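(* Let $T=\varphi\cdot\mathrm n$ be the Gauss mass transport sending $\mu=\rho_0\,dx$ on the compact convex set $A\subset\mathbb{R}^d$ to $\nu=\rho_1\,dx$ on $B_R$, and assume that $\rho_1(x)=\dfrac{C}{|x|^{d-1}}$ on $B_R$ for a constant $C$. Then for every $p>0$ there exists a constant $C_{p,R}>0$ such that $$ C_{p,R}\int_A|\nabla\varphi|^{p+1}\,d\mu\le\int_A\Big|\frac{\nabla\rho_0}{\rho_0}\Big|^{p+1}d\mu+\int_{\partial A}|\nabla\varphi|^p\rho_0\,d\mathcal H^{d-1} $$ and $$ C_{p,R}\int_A|\nabla\varphi|^{p+1}\,d\mu\le\int_A\Big|\frac{\nabla\rho_0}{\rho_0}\Big|^{p+1}d\mu+\int_{\partial A}K^{-p}\rho_0^{p+1}\,d\mathcal H^{d-1}, $$ where $K$ is the Gauss curvature of $\partial A$.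
   Context: Let $A\subset\mathbb{R}^d$ be a compact convex set of positive volume, $R>0$, $B_R=\{x\in\mathbb{R}^d:|x|\le R\}$. Let $\mu=\rho_0\,dx$ be a probability measure on $A$ equivalent to Lebesgue measure restricted to $A$, and $\nu=\rho_1\,dx$ a probability measure on $B_R$ equivalent to Lebesgue measure restricted to $B_R$. Gauss mass transport: it is known that there exist a Borel mapping $T:A\to B_R$ and a continuous function $\varphi:A\to[0,R]$ with convex sublevel sets $A_s=\{x\in A:\varphi(x)\le s\}$ such that $\nu=\mu\circ T^{-1}$ and $T(x)=\varphi(x)\,\mathrm n(x)$ for a.e. $x$, where $\mathrm n(x)$ is the unit outer normal to $A_{\varphi(x)}$ at $x$; $T$ is unique (a.e.). Put $H(r,\theta)=\sup_{x\in A_r}\langle\theta,x\rangle$ for $r\in[0,R]$, $\theta\in S^{d-1}$, regarded as a function on $B_R$ in polar coordinates. Standing regularity assumption: $H_r$, $H_\theta$, $H_{\theta\theta}$ (the $r$-derivative and the first and second spherical derivatives) are continuous and continuously differentiable in $r$ up to $\partial B_R$, except possibly at the origin, and $H$ satisfies $\rho_1r^{d-1}=\rho_0(T^{-1})\,H_r\det(H\cdot\mathrm{Id}+D_\theta^2H)$ up to $\partial B_R$, where $T^{-1}=H\cdot\mathrm n+D_\theta H$ with $\mathrm n=\theta$, $D_\theta$, $D^2_\theta$ are the gradient and Hessian on $S^{d-1}$, and $H_r=1/|\nabla\varphi(T^{-1})|$. The origin is placed (by translating $A$) so that $\varphi(0)=0$, $H\ge0$ and $H(0)=0$. The density $\rho_0$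 is regular enough for the expressions to make sense. The constant $C_{p,R}$ depends only on $p$ and $R$ (with the dimension $d$ fixed). $\mathcal H^{d-1}$ is the $(d-1)$-dimensional Hausdorff measure. *)

theory Defs
  imports "HOL-Analysis.Analysis" "HOL-Probability.Probability_Measure"
begin

section \<open>Gradients\<close>

text \<open>The gradient of \<open>f\<close> at \<open>x\<close> relative to \<open>S\<close>. On a convex set with nonempty interior it is unique
  at every point, so it also makes sense at boundary points (one-sided); at interior points it is
  the usual gradient.\<close>

definition grad_on :: "('a::euclidean_space \<Rightarrow> real) \<Rightarrow> 'a set \<Rightarrow> 'a \<Rightarrow> 'a" where
  "grad_on f S x = (THE g. (f has_derivative (\<lambda>h. inner g h)) (at x within S))"


section \<open>Calculus on the unit sphere\<close>

text \<open>A function \<open>f\<close> on the unit sphere is extended 0-homogeneously as \<open>x \<mapsto> f (sgn x) = f (x / |x|)\<close>; only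
  the values of \<open>f\<close> on the sphere enter below. The Euclidean gradient of the extension
  is tangential and equals the spherical gradient. The spherical Hessian is the
  covariant derivative of the gradient field, i.e. the tangential part of its derivative.\<close>

definition tangential :: "'a::euclidean_space \<Rightarrow> 'a \<Rightarrow> 'a" where
  "tangential \<theta> v = v - inner \<theta> v *\<^sub>R \<theta>"

definition sphere_grad :: "('a::euclidean_space \<Rightarrow> real) \<Rightarrow> 'a \<Rightarrow> 'a" where
  "sphere_grad f \<theta> = grad_on (\<lambda>x. f (sgn x)) UNIV \<theta>"

definition sphere_hess :: "('a::euclidean_space \<Rightarrow> real) \<Rightarrow> 'a \<Rightarrow> 'a \<Rightarrow> 'a" where
  "sphere_hess f \<theta> v = tangential \<theta> (frechet_derivative (\<lambda>x. sphere_grad f (sgn x)) (at \<theta>) v)"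

definition sphere_twice_differentiable :: "('a::euclidean_space \<Rightarrow> real) \<Rightarrow> bool" where
  "sphere_twice_differentiable f \<longleftrightarrow>
     (\<forall>\<theta>\<in>sphere 0 1. (\<lambda>x. f (sgn x)) differentiable (at \<theta>) \<and>
                     (\<lambda>x. sphere_grad f (sgn x)) differentiable (at \<theta>))"

text \<open>Determinant of an endomorphism \<open>L\<close> of the tangent space, the orthogonal complement of the unit
  vector \<open>\<theta>\<close>: the matrix below is block triangular, with blocks \<open>L\<close> and 1. In dimension one, where the
  tangent space is trivial, the value is 1.\<close>

definition tangent_det :: "real^'n \<Rightarrow> (real^'n \<Rightarrow> real^'n) \<Rightarrow> real" where
  "tangent_det \<theta> L = det (matrix (\<lambda>v. L (tangential \<theta> v) + inner \<theta> v *\<^sub>R \<theta>))"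


section \<open>Outer normals, Gauss curvature, Hausdorff measure\<close>

definition is_outer_unit_normal :: "'a::euclidean_space set \<Rightarrow> 'a \<Rightarrow> 'a \<Rightarrow> bool" where
  "is_outer_unit_normal S x n \<longleftrightarrow> norm n = 1 \<and> (\<forall>y\<in>S. inner n (y - x) \<le> 0)"

definition outer_unit_normal :: "'a::euclidean_space set \<Rightarrow> 'a \<Rightarrow> 'a" where
  "outer_unit_normal S x = (THE n. is_outer_unit_normal S x n)"

text \<open>Gauss curvature of the boundary of a convex body: the determinant of the differential of the
  Gauss map along the boundary. The derivative within the boundary is determined
  only on the tangent space, and this is the only part \<open>tangent_det\<close> uses.\<close>

definition gauss_curvature :: "(real^'n) set \<Rightarrow> real^'n \<Rightarrow> real" where
  "gauss_curvature S x =
     tangent_det (outer_unit_normal S x)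
       (frechet_derivative (outer_unit_normal S) (at x within frontier S))"

text \<open>The \<open>k\<close>-dimensional Hausdorff measure, normalised to agree with Lebesgue measure in dimension \<open>k\<close>.
  The empty set is treated separately because \<open>0 ^ 0 = 1\<close>; thus \<open>k = 0\<close> gives counting measure.
  Since \<open>hausdorff_outer k\<close> is a metric outer measure, it is countably additive on the Borel sets.\<close>

definition hausdorff_weight :: "nat \<Rightarrow> 'a::euclidean_space set \<Rightarrow> ennreal" where
  "hausdorff_weight k U =
     (if U = {} then 0 else ennreal (unit_ball_vol (real k) * (diameter U / 2) ^ k))"

definition hausdorff_outer :: "nat \<Rightarrow> 'a::euclidean_space set \<Rightarrow> ennreal" where
  "hausdorff_outer k X =
     (SUP \<delta>\<in>{0<..}. INF U\<in>{U :: nat \<Rightarrow> 'a set. X \<subseteq> (\<Union>i. U i) \<and> (\<forall>i. bounded (U i) \<and> diameter (U i) \<le> \<delta>)}.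
        (\<Sum>i. hausdorff_weight k (U i)))"

definition hausdorff_measure :: "nat \<Rightarrow> 'a::euclidean_space measure" where
  "hausdorff_measure k = measure_of UNIV (sets borel) (hausdorff_outer k)"


section \<open>Gauss mass transport\<close>

definition density_measure :: "'a::euclidean_space set \<Rightarrow> ('a \<Rightarrow> real) \<Rightarrow> 'a measure" where
  "density_measure S \<rho> = density (restrict_space lborel S) (\<lambda>x. ennreal (\<rho> x))"

definition probability_density_on :: "'a::euclidean_space set \<Rightarrow> ('a \<Rightarrow> real) \<Rightarrow> bool" where
  "probability_density_on S \<rho> \<longleftrightarrow>
     \<rho> \<in> borel_measurable (restrict_space borel S) \<and> (\<forall>x\<in>S. 0 \<le> \<rho> x) \<and>
     prob_space (density_measure S \<rho>) \<and>
     absolutely_continuous (restrict_space lborel S) (density_measure S \<rho>) \<and>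
     absolutely_continuous (density_measure S \<rho>) (restrict_space lborel S)"

definition sublevel :: "'a set \<Rightarrow> ('a \<Rightarrow> real) \<Rightarrow> real \<Rightarrow> 'a set" where
  "sublevel A \<phi> s = {x\<in>A. \<phi> x \<le> s}"

locale gauss_mass_transport =
  fixes A :: "(real^'n) set" and R :: real
    and \<rho>0 \<rho>1 :: "real^'n \<Rightarrow> real"
    and T :: "real^'n \<Rightarrow> real^'n" and \<phi> :: "real^'n \<Rightarrow> real"
  assumes compact_A: "compact A" and convex_A: "convex A"
    and volume_A: "emeasure lborel A > 0" and R_pos: "R > 0"
    and density0: "probability_density_on A \<rho>0"
    and density1: "probability_density_on (cball 0 R) \<rho>1"
    and T_borel: "T \<in> measurable (restrict_space borel A) (restrict_space borel (cball 0 R))"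
    and continuous_\<phi>: "continuous_on A \<phi>"
    and range_\<phi>: "\<phi> ` A \<subseteq> {0..R}"
    and convex_sublevel: "\<And>s. convex (sublevel A \<phi> s)"
    and push_forward: "distr (density_measure A \<rho>0) (restrict_space borel (cball 0 R)) T
                         = density_measure (cball 0 R) \<rho>1"
    and T_eq: "AE x in restrict_space lborel A.
                 (\<exists>!n. is_outer_unit_normal (sublevel A \<phi> (\<phi> x)) x n) \<and>
                 T x = \<phi> x *\<^sub>R outer_unit_normal (sublevel A \<phi> (\<phi> x)) x"


section \<open>The function H and the standing regularity assumption\<close>

definition level_support :: "'a::euclidean_space set \<Rightarrow> ('a \<Rightarrow> real) \<Rightarrow> real \<Rightarrow> 'a \<Rightarrow> real" where
  "level_support A \<phi> r \<theta> = (SUP x\<in>sublevel A \<phi> r. inner \<theta> x)"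

text \<open>Functions on the punctured ball of radius \<open>R\<close> are written in polar coordinates
  \<open>0 < r \<le> R\<close>, \<open>|\<theta>| = 1\<close>; derivatives in \<open>r\<close> are one-sided at \<open>r = R\<close>.\<close>

definition polar_C0 :: "real \<Rightarrow> (real \<Rightarrow> 'a::euclidean_space \<Rightarrow> 'b::real_normed_vector) \<Rightarrow> bool" where
  "polar_C0 R f \<longleftrightarrow> continuous_on ({0<..R} \<times> sphere 0 1) (\<lambda>(r, \<theta>). f r \<theta>)"

definition r_differentiable :: "real \<Rightarrow> (real \<Rightarrow> 'a::euclidean_space \<Rightarrow> 'b::real_normed_vector) \<Rightarrow> bool" where
  "r_differentiable R f \<longleftrightarrow>
     (\<forall>r\<in>{0<..R}. \<forall>\<theta>\<in>sphere 0 1. (\<lambda>s. f s \<theta>) differentiable (at r within {0<..R}))"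

definition r_deriv :: "real \<Rightarrow> (real \<Rightarrow> 'a::euclidean_space \<Rightarrow> 'b::real_normed_vector) \<Rightarrow> real \<Rightarrow> 'a \<Rightarrow> 'b" where
  "r_deriv R f r \<theta> = vector_derivative (\<lambda>s. f s \<theta>) (at r within {0<..R})"

definition C1_in_r :: "real \<Rightarrow> (real \<Rightarrow> 'a::euclidean_space \<Rightarrow> 'b::real_normed_vector) \<Rightarrow> bool" where
  "C1_in_r R f \<longleftrightarrow> polar_C0 R f \<and> r_differentiable R f \<and> polar_C0 R (r_deriv R f)"

definition inverse_transport :: "'a::euclidean_space set \<Rightarrow> ('a \<Rightarrow> real) \<Rightarrow> real \<Rightarrow> 'a \<Rightarrow> 'a" where
  "inverse_transport A \<phi> r \<theta> =
     level_support A \<phi> r \<theta> *\<^sub>R \<theta> + sphere_grad (level_support A \<phi> r) \<theta>"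

locale regular_gauss_mass_transport =
  gauss_mass_transport A R \<rho>0 \<rho>1 T \<phi>
  for A :: "(real^'n) set" and R :: real
    and \<rho>0 \<rho>1 :: "real^'n \<Rightarrow> real"
    and T :: "real^'n \<Rightarrow> real^'n" and \<phi> :: "real^'n \<Rightarrow> real" +
  assumes origin: "0 \<in> A" "\<phi> 0 = 0"
    and H_nonneg: "\<And>r \<theta>. \<lbrakk>r \<in> {0..R}; \<theta> \<in> sphere 0 1\<rbrakk> \<Longrightarrow> 0 \<le> level_support A \<phi> r \<theta>"
    and H_origin: "\<And>\<theta>. \<theta> \<in> sphere 0 1 \<Longrightarrow> level_support A \<phi> 0 \<theta> = 0"
    and H_r_exists: "r_differentiable R (level_support A \<phi>)"
    and H_\<theta>\<theta>_exists: "\<And>r. r \<in> {0<..R} \<Longrightarrow> sphere_twice_differentiable (level_support A \<phi> r)"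
    and H_r_C1: "C1_in_r R (r_deriv R (level_support A \<phi>))"
    and H_\<theta>_C1: "C1_in_r R (\<lambda>r. sphere_grad (level_support A \<phi> r))"
    and H_\<theta>\<theta>_C1: "\<And>v. C1_in_r R (\<lambda>r \<theta>. sphere_hess (level_support A \<phi> r) \<theta> v)"
    and change_of_variables: "\<And>r \<theta>. \<lbrakk>r \<in> {0<..R}; \<theta> \<in> sphere 0 1\<rbrakk> \<Longrightarrow>
          \<rho>1 (r *\<^sub>R \<theta>) * r ^ (CARD('n) - 1) =
            \<rho>0 (inverse_transport A \<phi> r \<theta>) * r_deriv R (level_support A \<phi>) r \<theta> *
            tangent_det \<theta> (\<lambda>v. level_support A \<phi> r \<theta> *\<^sub>R v + sphere_hess (level_support A \<phi> r) \<theta> v)"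
    and \<phi>_differentiable: "\<And>r \<theta>. \<lbrakk>r \<in> {0<..R}; \<theta> \<in> sphere 0 1\<rbrakk> \<Longrightarrow>
          \<phi> differentiable (at (inverse_transport A \<phi> r \<theta>) within A)"
    and H_r_eq: "\<And>r \<theta>. \<lbrakk>r \<in> {0<..R}; \<theta> \<in> sphere 0 1\<rbrakk> \<Longrightarrow>
          r_deriv R (level_support A \<phi>) r \<theta> = 1 / norm (grad_on \<phi> A (inverse_transport A \<phi> r \<theta>))"
    and \<rho>0_continuous: "continuous_on (A - {0}) \<rho>0"
    and \<rho>0_differentiable: "\<And>x. x \<in> interior A - {0} \<Longrightarrow> \<rho>0 differentiable (at x)"
    and \<rho>0_C1: "continuous_on (interior A - {0}) (grad_on \<rho>0 A)"

end

theory Submission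
  imports Defs
begin

text \<open>
  Let \<open>h = H\<^sub>r\<close>, so that \<open>h = 1 / |\<nabla>\<phi>|\<close> at \<open>T\<^sup>-\<^sup>1\<close>, and let \<open>\<psi>\<close> be a cutoff in the radius.  The field
  \<open>\<psi>(\<phi>) \<rho>\<^sub>0 |\<nabla>\<phi>|\<^sup>p n\<close> has integral divergence zero on \<open>A\<close>.  Convexity of the sublevel sets gives
  \<open>div n \<ge> 0\<close> and makes the tangential part of the derivative of \<open>h\<close> along \<open>n\<close> have a sign, so this
  derivative is at most \<open>h\<^sub>r / h\<close>.  The only uncontrolled integral contains \<open>h\<^sub>r\<close>; pushed forward to
  \<open>B\<^sub>R\<close>, where the density makes the measure \<open>C dr d\<theta>\<close>, it is a pure \<open>r\<close>-derivative and is integrated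
  by parts.  What remains is a \<open>\<nabla>\<rho>\<^sub>0 / \<rho>\<^sub>0\<close> term, absorbed by Young's inequality, and a strip at
  \<open>r = R\<close>.  The strip is compared with the Hausdorff integral over \<open>\<partial>A\<close> by a mass distribution
  argument.  At \<open>r = R\<close> the Monge-Ampere equation reads \<open>C K = \<rho>\<^sub>0 |\<nabla>\<phi>|\<^sup>-\<^sup>1\<close>, which exchanges the two
  boundary integrals, and \<open>C\<close> depends on \<open>R\<close> and \<open>d\<close> only because \<open>\<nu>\<close> has mass one.
\<close>


section \<open>Hausdorff measure and mass distribution\<close>

text \<open>The fields are differentiable only in the open set of points with radius strictly
  between 0 and \<open>R\<close>, so no divergence theorem with a boundary term is used. Every field
  is cut off in the radius, its total divergence vanishes by translation invariance, and the
  boundary reappears as the strip where the cutoff falls. There its slope is of order 1/\<delta>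
  while the strip has mass of order \<delta>, so the limit is finite.

  The exponents decide the outcome. The convexity estimate leaves \<open>p\<close> copies of the
  integral containing the r-derivative of \<open>H_r\<close>; the radial identity says that
  \<open>p + 1\<close> copies equal the integral containing the derivative of the cutoff. The
  surviving fraction 1/(p + 1) of the latter becomes the left-hand side.

  Integrals over the unit sphere are replaced by integrals of 0-homogeneous functions over balls.
  Only one direction of the comparison with Hausdorff measure is proved; it suffices and costs a
  dimensional factor, since covering sets are enlarged to balls.\<close>

lemma metric_outer_measure_closed_split:
  fixes f :: "'a::metric_space set \<Rightarrow> ennreal"
  assumes incr: "\<And>X Y. X \<subseteq> Y \<Longrightarrow> f X \<le> f Y"
    and subadd: "\<And>A. f (\<Union>i::nat. A i) \<le> (\<Sum>i. f (A i))"
    and metric: "\<And>X Y e. 0 < e \<Longrightarrow> (\<And>x y. x \<in> X \<Longrightarrow> y \<in> Y \<Longrightarrow> e \<le> dist x y) \<Longrightarrow> f X + f Y \<le> f (X \<union> Y)"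
    and empty: "f {} = 0"
    and F: "closed F"
  shows "f (F \<inter> X) + f (X - F) \<le> f X"
proof (cases "F = {} \<or> f X = \<infinity>")
  case True
  then show ?thesis using empty by auto
next
  case False
  then have Fne: "F \<noteq> {}" and fin: "f X < \<infinity>" by (auto simp: top.not_eq_extremum)
  have subadd2: "f (X \<union> Y) \<le> f X + f Y" for X Y
  proof -
    have "f (\<Union>i::nat. (if i = 0 then X else if i = 1 then Y else {})) \<le>
       (\<Sum>i::nat. f (if i = 0 then X else if i = 1 then Y else {}))" by (rule subadd)
    also have "\<dots> = (\<Sum>i\<in>{0,1::nat}. f (if i = 0 then X else if i = 1 then Y else {}))"
      by (rule suminf_finite) (auto simp: empty)
    also have "\<dots> = f X + f Y" by simp
    also have "(\<Union>i::nat. (if i = 0 then X else if i = 1 then Y else {})) = X \<union> Y"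
      by (auto split: if_splits intro: exI[of _ 0] exI[of _ 1])
    finally show ?thesis .
  qed
  \<comment> \<open>Caratheodory's criterion: the part \<open>D n\<close> of \<open>X\<close> has
    positive distance from \<open>F\<close>, so metric additivity applies to it. What it misses of
    \<open>X - F\<close> is a union of layers \<open>S m\<close>; their masses turn out to be
    summable, so the missing mass tends to zero.\<close>
  define D where "D n = {x\<in>X. inverse (real (Suc n)) \<le> infdist x F}" for n
  define S where "S m = D (Suc m) - D m" for m
  have D_mono: "D n \<subseteq> D (Suc n)" for n
  proof -
    have "inverse (real (Suc (Suc n))) \<le> inverse (real (Suc n))" by (intro le_imp_inverse_le) auto
    then show ?thesis unfolding D_def by (blast intro: order_trans)
  qed
  have D_sub: "D n \<subseteq> X - F" for n
    unfolding D_def by (auto simp: not_le)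
  have XF: "X - F \<subseteq> D n \<union> (\<Union>m. S (m + n))" for n
  proof
    fix x assume x: "x \<in> X - F"
    then have "infdist x F > 0"
      using F Fne by (metis DiffD2 in_closed_iff_infdist_zero infdist_nonneg less_eq_real_def)
    then obtain N where "inverse (real (Suc N)) < infdist x F"
      using reals_Archimedean by blast
    then have exN: "\<exists>m. x \<in> D m" using x unfolding D_def by (auto intro!: exI[of _ N])
    define M where "M = (LEAST m. x \<in> D m)"
    have xM: "x \<in> D M" unfolding M_def using exN by (rule LeastI_ex)
    show "x \<in> D n \<union> (\<Union>m. S (m + n))"
    proof (cases "M \<le> n")
      case True
      then have "D M \<subseteq> D n" by (rule lift_Suc_mono_le[of D, OF D_mono])
      then show ?thesis using xM by auto
    next
      case False
      then obtain j where j: "M = Suc (j + n)" by (metis add.commute less_natE not_le)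
      have "x \<notin> D (j + n)" using not_less_Least[of "j+n" "\<lambda>m. x \<in> D m"] j M_def by auto
      then show ?thesis using xM j unfolding S_def by auto
    qed
  qed
  have FD: "f (F \<inter> X) + f (D n) \<le> f X" for n
  proof -
    have "f (F \<inter> X) + f (D n) \<le> f ((F \<inter> X) \<union> D n)"
    proof (rule metric[of "inverse (real (Suc n))"])
      fix x y assume "x \<in> F \<inter> X" "y \<in> D n"
      then have "inverse (real (Suc n)) \<le> infdist y F" "infdist y F \<le> dist y x"
        unfolding D_def by (auto intro: infdist_le)
      then show "inverse (real (Suc n)) \<le> dist x y" by (simp add: dist_commute)
    qed simp
    also have "\<dots> \<le> f X" using D_sub by (intro incr) auto
    finally show ?thesis .
  qed
  \<comment> \<open>Consecutive layers may touch, but layers two indices apart are separated by the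
    gap between 1/N and 1/(N+1). Hence the step 2, with the offset \<open>j\<close> for the two
    parities.\<close>
  have sep: "f (\<Union>i<n. S (2 * i + j)) \<ge> (\<Sum>i<n. f (S (2 * i + j)))" for n j
  proof (induction n)
    case 0 then show ?case by (simp add: empty)
  next
    case (Suc n)
    have "(\<Sum>i<Suc n. f (S (2 * i + j))) \<le> f (\<Union>i<n. S (2 * i + j)) + f (S (2 * n + j))"
      using Suc by (auto intro: add_mono)
    also have "\<dots> \<le> f ((\<Union>i<n. S (2 * i + j)) \<union> S (2 * n + j))"
    proof (cases n)
      case 0 then show ?thesis by (simp add: empty)
    next
      case (Suc n')
      define N where "N = 2 * n + j"
      have N: "N \<ge> 2" using Suc N_def by simp
      define e where "e = inverse (real N) - inverse (real (Suc N))"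
      have "inverse (real (Suc N)) < inverse (real N)" using N by (intro less_imp_inverse_less) auto
      then have "e > 0" unfolding e_def by simp
      show ?thesis
      proof (rule metric[OF \<open>e > 0\<close>])
        fix x y assume x: "x \<in> (\<Union>i<n. S (2 * i + j))" and y: "y \<in> S (2 * n + j)"
        obtain i where i: "i < n" "x \<in> S (2 * i + j)" using x by auto
        have "x \<in> D (Suc (2 * i + j))" using i S_def by auto
        moreover have "D (Suc (2 * i + j)) \<subseteq> D (N - 1)"
          using i N_def by (intro lift_Suc_mono_le[of D, OF D_mono]) auto
        ultimately have "inverse (real N) \<le> infdist x F" using N unfolding D_def by auto
        moreover have "infdist y F < inverse (real (Suc N))"
          using y unfolding S_def D_def N_def by auto
        moreover have "infdist x F \<le> infdist y F + dist x y" by (rule infdist_triangle)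
        ultimately show "e \<le> dist x y" unfolding e_def by linarith
      qed
    qed
    also have "((\<Union>i<n. S (2 * i + j)) \<union> S (2 * n + j)) = (\<Union>i<Suc n. S (2 * i + j))"
      by (auto simp: lessThan_Suc)
    finally show ?case .
  qed
  \<comment> \<open>Even and odd layers contribute at most \<open>f X\<close> each, which gives the
    factor 2.\<close>
  have part: "(\<Sum>m<n. f (S m)) \<le> 2 * f X" for n
  proof -
    have "(\<Sum>m<n. f (S m)) \<le> (\<Sum>m<2*n. f (S m))"
      by (rule sum_mono2) auto
    also have "\<dots> = (\<Sum>i<n. f (S (2 * i + 0))) + (\<Sum>i<n. f (S (2 * i + 1)))"
      by (induction n) (auto simp: algebra_simps)
    also have "\<dots> \<le> f (\<Union>i<n. S (2 * i + 0)) + f (\<Union>i<n. S (2 * i + 1))"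
      by (intro add_mono sep)
    also have "\<dots> \<le> f X + f X"
      using D_sub unfolding S_def by (intro add_mono incr) fast+
    finally show ?thesis by (simp add: mult_2)
  qed
  define Z where "Z = (\<Sum>m. f (S m))"
  have "Z \<le> 2 * f X"
    unfolding Z_def using part by (intro suminf_le_const) auto
  then have Zfin: "Z < \<infinity>" using fin
    by (metis ennreal_mult_less_top ennreal_numeral_less_top infinity_ennreal_def order.strict_trans1)
  show ?thesis
  proof (rule ennreal_le_epsilon)
    fix e :: real assume "f X < top" and e: "e > 0"
    obtain n where n: "Z \<le> (\<Sum>m<n. f (S m)) + ennreal e"
    proof -
      have Zs: "Z = (SUP n. \<Sum>m<n. f (S m))" unfolding Z_def by (rule suminf_eq_SUP)
      show ?thesis
      proof (cases "Z = 0")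
        case True then show ?thesis by (intro that[of 0]) auto
      next
        case False
        have "Z - ennreal e < Z" using False Zfin e
          by (intro ennreal_between) (auto simp: zero_less_iff_neq_zero)
        then obtain n where "Z - ennreal e < (\<Sum>m<n. f (S m))"
          unfolding Zs less_SUP_iff by blast
        then show ?thesis by (intro that[of n]) (metis add.commute ennreal_minus_le_iff less_imp_le)
      qed
    qed
    have "Z = (\<Sum>m. f (S (m + n))) + (\<Sum>m<n. f (S m))"
      unfolding Z_def by (rule suminf_offset) auto
    then have "(\<Sum>m<n. f (S m)) + (\<Sum>m. f (S (m + n))) \<le> (\<Sum>m<n. f (S m)) + ennreal e"
      using n by (simp add: add.commute)
    moreover have "(\<Sum>m<n. f (S m)) \<le> Z" unfolding Z_def by (rule sum_le_suminf) auto
    then have "(\<Sum>m<n. f (S m)) \<noteq> \<infinity>" using Zfin by (metis leD)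
    ultimately have tail: "(\<Sum>m. f (S (m + n))) \<le> ennreal e"
      by (metis ennreal_add_left_cancel_le infinity_ennreal_def)
    have "f (X - F) \<le> f (D n \<union> (\<Union>m. S (m + n)))" by (rule incr[OF XF])
    also have "\<dots> \<le> f (D n) + f (\<Union>m. S (m + n))" by (rule subadd2)
    also have "\<dots> \<le> f (D n) + (\<Sum>m. f (S (m + n)))" by (intro add_left_mono subadd)
    also have "\<dots> \<le> f (D n) + ennreal e" by (intro add_left_mono tail)
    finally have "f (F \<inter> X) + f (X - F) \<le> (f (F \<inter> X) + f (D n)) + ennreal e"
      by (metis add.assoc add_left_mono)
    also have "\<dots> \<le> f X + ennreal e" by (intro add_right_mono FD)
    finally show "f (F \<inter> X) + f (X - F) \<le> f X + ennreal e" .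
  qed
qed

text \<open>The Caratheodory-measurable sets of an outer measure form a sigma-algebra on which it is
  countably additive. The splitting lemma puts all closed sets there, and these generate the Borel
  sets.\<close>

lemma metric_outer_measure_borel:
  fixes f :: "'a::metric_space set \<Rightarrow> ennreal"
  assumes incr: "\<And>X Y. X \<subseteq> Y \<Longrightarrow> f X \<le> f Y"
    and subadd: "\<And>A. f (\<Union>i::nat. A i) \<le> (\<Sum>i. f (A i))"
    and metric: "\<And>X Y e. 0 < e \<Longrightarrow> (\<And>x y. x \<in> X \<Longrightarrow> y \<in> Y \<Longrightarrow> e \<le> dist x y) \<Longrightarrow> f X + f Y \<le> f (X \<union> Y)"
    and empty: "f {} = 0"
  shows "measure_space UNIV (sets borel) f"
proof -
  define L where "L = lambda_system UNIV (Pow UNIV) f"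
  interpret P: sigma_algebra UNIV "Pow UNIV :: 'a set set" by (rule sigma_algebra_Pow)
  have "outer_measure_space (Pow UNIV) f"
    unfolding outer_measure_space_def positive_def increasing_def countably_subadditive_def
    using incr subadd empty by auto
  then have ms: "measure_space UNIV L f" unfolding L_def by (rule P.caratheodory_lemma)
  then have sa: "sigma_algebra UNIV L" unfolding measure_space_def by auto
  have "F \<in> L" if "closed F" for F
  proof -
    have "f (F \<inter> X) + f ((UNIV - F) \<inter> X) = f X" for X
    proof (rule antisym)
      have "(UNIV - F) \<inter> X = X - F" by auto
      then show "f (F \<inter> X) + f ((UNIV - F) \<inter> X) \<le> f X"
        using metric_outer_measure_closed_split[of f, OF incr subadd metric empty that] by simp
      have "f (\<Union>i::nat. (if i = 0 then F \<inter> X else if i = 1 then X - F else {})) \<le>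
         (\<Sum>i::nat. f (if i = 0 then F \<inter> X else if i = 1 then X - F else {}))" by (rule subadd)
      also have "\<dots> = (\<Sum>i\<in>{0,1::nat}. f (if i = 0 then F \<inter> X else if i = 1 then X - F else {}))"
        by (rule suminf_finite) (auto simp: empty)
      also have "\<dots> = f (F \<inter> X) + f (X - F)" by simp
      also have "(\<Union>i::nat. (if i = 0 then F \<inter> X else if i = 1 then X - F else {})) = X"
        by (auto split: if_splits intro: exI[of _ 0] exI[of _ 1])
      finally show "f X \<le> f (F \<inter> X) + f ((UNIV - F) \<inter> X)"
        using \<open>(UNIV - F) \<inter> X = X - F\<close> by simp
    qed
    then show ?thesis unfolding L_def lambda_system_def by auto
  qed
  then have "sigma_sets UNIV (Collect closed) \<subseteq> L"
    using sa by (intro sigma_algebra.sigma_sets_subset) auto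
  then have "sets (borel :: 'a measure) \<subseteq> L" by (simp add: borel_eq_closed)
  then show ?thesis
    using measure_down[OF ms, of "sets borel"] sets.sigma_algebra_axioms[of "borel :: 'a measure"] by simp
qed


section \<open>The Hausdorff outer measure as a metric outer measure\<close>

definition hausdorff_pre :: "nat \<Rightarrow> real \<Rightarrow> 'a::euclidean_space set \<Rightarrow> ennreal" where
  "hausdorff_pre k \<delta> X =
     (INF U\<in>{U :: nat \<Rightarrow> 'a set. X \<subseteq> (\<Union>i. U i) \<and> (\<forall>i. bounded (U i) \<and> diameter (U i) \<le> \<delta>)}.
        (\<Sum>i. hausdorff_weight k (U i)))"

lemma hausdorff_outer_eq_SUP: "hausdorff_outer k X = (SUP \<delta>\<in>{0<..}. hausdorff_pre k \<delta> X)"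
  unfolding hausdorff_outer_def hausdorff_pre_def ..

lemma hausdorff_pre_mono: "X \<subseteq> Y \<Longrightarrow> hausdorff_pre k \<delta> X \<le> hausdorff_pre k \<delta> Y"
  unfolding hausdorff_pre_def by (rule INF_superset_mono) auto

lemma hausdorff_pre_antimono: "\<delta> \<le> \<epsilon> \<Longrightarrow> hausdorff_pre k \<epsilon> X \<le> hausdorff_pre k \<delta> X"
  unfolding hausdorff_pre_def by (rule INF_superset_mono) (auto intro: order_trans)

lemma hausdorff_pre_le:
  "X \<subseteq> (\<Union>i. U i) \<Longrightarrow> (\<And>i. bounded (U i)) \<Longrightarrow> (\<And>i. diameter (U i) \<le> \<delta>) \<Longrightarrow>
     hausdorff_pre k \<delta> X \<le> (\<Sum>i. hausdorff_weight k (U i))"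
  unfolding hausdorff_pre_def by (rule INF_lower) auto

lemma hausdorff_pre_le_outer: "0 < \<delta> \<Longrightarrow> hausdorff_pre k \<delta> X \<le> hausdorff_outer k X"
  unfolding hausdorff_outer_eq_SUP by (rule SUP_upper) auto

lemma hausdorff_outer_mono: "X \<subseteq> Y \<Longrightarrow> hausdorff_outer k X \<le> hausdorff_outer k Y"
  unfolding hausdorff_outer_eq_SUP by (rule SUP_mono) (auto intro: hausdorff_pre_mono)

lemma hausdorff_outer_empty: "hausdorff_outer k {} = 0"
proof -
  have "hausdorff_pre k \<delta> ({} :: 'a set) = 0" if "\<delta> > 0" for \<delta>
  proof -
    have "hausdorff_pre k \<delta> ({} :: 'a set) \<le> (\<Sum>i. hausdorff_weight k ({} :: 'a set))"
      using that by (intro hausdorff_pre_le) auto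
    then show ?thesis by (simp add: hausdorff_weight_def)
  qed
  then show ?thesis unfolding hausdorff_outer_eq_SUP by (auto simp: SUP_eq_iff)
qed

text \<open>Nearly optimal covers of the sets \<open>A i\<close>, with excess e/2^(i+1), are merged
  into one sequence by \<open>prod_decode\<close>; the excesses sum to e.\<close>

lemma hausdorff_pre_subadditive:
  "hausdorff_pre k \<delta> (\<Union>i::nat. A i) \<le> (\<Sum>i. hausdorff_pre k \<delta> (A i))"
proof (rule ennreal_le_epsilon)
  fix e :: real assume fin: "(\<Sum>i. hausdorff_pre k \<delta> (A i)) < top" and e: "0 < e"
  have finA: "hausdorff_pre k \<delta> (A i) < top" for i
  proof -
    have "(\<Sum>i\<in>{i}. hausdorff_pre k \<delta> (A i)) \<le> (\<Sum>i. hausdorff_pre k \<delta> (A i))"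
      by (rule sum_le_suminf) auto
    then show ?thesis using fin by auto
  qed
  have "\<exists>U. A i \<subseteq> (\<Union>j. U j) \<and> (\<forall>j. bounded (U j) \<and> diameter (U j) \<le> \<delta>) \<and>
      (\<Sum>j::nat. hausdorff_weight k (U j)) \<le> hausdorff_pre k \<delta> (A i) + ennreal (e * (1/2) ^ Suc i)" for i
  proof -
    have "hausdorff_pre k \<delta> (A i) < hausdorff_pre k \<delta> (A i) + ennreal (e * (1/2) ^ Suc i)"
      using finA[of i] e ennreal_add_left_cancel_less[of "hausdorff_pre k \<delta> (A i)" 0 "ennreal (e * (1/2) ^ Suc i)"]
      by (simp add: top.not_eq_extremum)
    then show ?thesis
      unfolding hausdorff_pre_def INF_less_iff by (blast intro: less_imp_le)
  qed
  then obtain U where U: "\<And>i. A i \<subseteq> (\<Union>j. U i j)" "\<And>i j. bounded (U i j)" "\<And>i j. diameter (U i j) \<le> \<delta>"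
    "\<And>i. (\<Sum>j::nat. hausdorff_weight k (U i j)) \<le> hausdorff_pre k \<delta> (A i) + ennreal (e * (1/2) ^ Suc i)"
    by metis
  define V where "V n = (case prod_decode n of (i, j) \<Rightarrow> U i j)" for n
  have "hausdorff_pre k \<delta> (\<Union>i. A i) \<le> (\<Sum>n. hausdorff_weight k (V n))"
  proof (rule hausdorff_pre_le)
    show "(\<Union>i. A i) \<subseteq> (\<Union>n. V n)"
    proof
      fix x assume "x \<in> (\<Union>i. A i)"
      then obtain i j where "x \<in> U i j" using U(1) by blast
      then have "x \<in> V (prod_encode (i, j))" by (simp add: V_def)
      then show "x \<in> (\<Union>n. V n)" by blast
    qed
  qed (auto simp: V_def U split: prod.split)
  also have "\<dots> = (\<Sum>n. (\<lambda>(i, j). hausdorff_weight k (U i j)) (prod_decode n))"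
    by (simp add: V_def prod.case_distrib cong: suminf_cong)
  also have "\<dots> = (\<Sum>i. \<Sum>j. hausdorff_weight k (U i j))"
    by (rule suminf_ennreal_2dimen) simp
  also have "\<dots> \<le> (\<Sum>i. hausdorff_pre k \<delta> (A i) + ennreal (e * (1/2) ^ Suc i))"
    by (intro suminf_le U) auto
  also have "\<dots> = (\<Sum>i. hausdorff_pre k \<delta> (A i)) + (\<Sum>i. ennreal (e * (1/2) ^ Suc i))"
    by (rule suminf_add[symmetric]) auto
  also have "(\<Sum>i. ennreal (e * (1/2) ^ Suc i)) = ennreal e"
  proof (rule suminf_ennreal_eq)
    show "(\<lambda>i. e * (1/2) ^ Suc i) sums e"
      using sums_mult[OF power_half_series, of e] by simp
  qed (use e in auto)
  finally show "hausdorff_pre k \<delta> (\<Union>i. A i) \<le> (\<Sum>i. hausdorff_pre k \<delta> (A i)) + ennreal e" .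
qed

lemma hausdorff_outer_subadditive:
  "hausdorff_outer k (\<Union>i::nat. A i) \<le> (\<Sum>i. hausdorff_outer k (A i))"
proof -
  have "hausdorff_pre k \<delta> (\<Union>i::nat. A i) \<le> (\<Sum>i. hausdorff_outer k (A i))" if "\<delta> > 0" for \<delta>
  proof -
    have "(\<Sum>i. hausdorff_pre k \<delta> (A i)) \<le> (\<Sum>i. hausdorff_outer k (A i))"
      using that by (intro suminf_le hausdorff_pre_le_outer) auto
    then show ?thesis using hausdorff_pre_subadditive order_trans by blast
  qed
  then show ?thesis by (subst hausdorff_outer_eq_SUP) (auto intro: SUP_least)
qed

text \<open>A set of diameter at most \<delta> < e cannot meet both \<open>X\<close> and
  \<open>Y\<close>, so a cover of the union splits into a cover of \<open>X\<close> and a cover of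
  \<open>Y\<close> that use different members.\<close>

lemma hausdorff_pre_metric:
  assumes "\<delta> < e" "0 < \<delta>" and sep: "\<And>x y. x \<in> X \<Longrightarrow> y \<in> Y \<Longrightarrow> e \<le> dist x y"
  shows "hausdorff_pre k \<delta> X + hausdorff_pre k \<delta> Y \<le> hausdorff_pre k \<delta> (X \<union> Y)"
  unfolding hausdorff_pre_def[of k \<delta> "X \<union> Y"]
proof (rule INF_greatest, clarsimp)
  fix U :: "nat \<Rightarrow> 'a set"
  assume cov: "X \<subseteq> (\<Union>i. U i)" "Y \<subseteq> (\<Union>i. U i)" and U: "\<forall>i. bounded (U i) \<and> diameter (U i) \<le> \<delta>"
  \<comment> \<open>Members that miss \<open>X\<close> are replaced by the empty set, whose weight
    is 0 even for \<open>k = 0\<close>; this keeps them from being counted twice.\<close>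
  define V where "V i = (if U i \<inter> X = {} then {} else U i)" for i
  define W where "W i = (if U i \<inter> Y = {} then {} else U i)" for i
  have dj: "U i \<inter> X = {} \<or> U i \<inter> Y = {}" for i
  proof (rule ccontr)
    assume "\<not> ?thesis"
    then obtain x y where "x \<in> U i" "x \<in> X" "y \<in> U i" "y \<in> Y" by blast
    then have "e \<le> dist x y" "dist x y \<le> diameter (U i)"
      using sep U by (auto intro: diameter_bounded_bound)
    then show False using U assms(1) by (metis not_less order_trans)
  qed
  have "hausdorff_pre k \<delta> X \<le> (\<Sum>i. hausdorff_weight k (V i))"
    using cov U \<open>0 < \<delta>\<close> by (intro hausdorff_pre_le) (auto simp: V_def, blast)
  moreover have "hausdorff_pre k \<delta> Y \<le> (\<Sum>i. hausdorff_weight k (W i))"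
    using cov U \<open>0 < \<delta>\<close> by (intro hausdorff_pre_le) (auto simp: W_def, blast)
  ultimately have "hausdorff_pre k \<delta> X + hausdorff_pre k \<delta> Y \<le>
      (\<Sum>i. hausdorff_weight k (V i)) + (\<Sum>i. hausdorff_weight k (W i))"
    by (rule add_mono)
  also have "\<dots> = (\<Sum>i. hausdorff_weight k (V i) + hausdorff_weight k (W i))"
    by (rule suminf_add) auto
  also have "\<dots> \<le> (\<Sum>i. hausdorff_weight k (U i))"
  proof (rule suminf_le)
    fix i show "hausdorff_weight k (V i) + hausdorff_weight k (W i) \<le> hausdorff_weight k (U i)"
      using dj[of i] by (auto simp: V_def W_def hausdorff_weight_def)
  qed auto
  finally show "hausdorff_pre k \<delta> X + hausdorff_pre k \<delta> Y \<le> (\<Sum>i. hausdorff_weight k (U i))" .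
qed

text \<open>The two suprema run over independent mesh sizes. Their minimum, lowered below the
  separation, serves both, because the premeasure grows as the mesh shrinks.\<close>

lemma hausdorff_outer_metric:
  assumes "0 < e" and sep: "\<And>x y. x \<in> X \<Longrightarrow> y \<in> Y \<Longrightarrow> e \<le> dist x y"
  shows "hausdorff_outer k X + hausdorff_outer k Y \<le> hausdorff_outer k (X \<union> Y)"
proof -
  have *: "hausdorff_pre k \<delta>1 X + hausdorff_pre k \<delta>2 Y \<le> hausdorff_outer k (X \<union> Y)"
    if "\<delta>1 > 0" "\<delta>2 > 0" for \<delta>1 \<delta>2
  proof -
    define \<delta> where "\<delta> = min (min \<delta>1 \<delta>2) (e / 2)"
    have \<delta>: "0 < \<delta>" "\<delta> < e" "\<delta> \<le> \<delta>1" "\<delta> \<le> \<delta>2" using that assms(1) by (auto simp: \<delta>_def)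
    have "hausdorff_pre k \<delta>1 X + hausdorff_pre k \<delta>2 Y \<le> hausdorff_pre k \<delta> X + hausdorff_pre k \<delta> Y"
      using \<delta> by (intro add_mono hausdorff_pre_antimono)
    also have "\<dots> \<le> hausdorff_pre k \<delta> (X \<union> Y)"
      using \<delta> sep by (intro hausdorff_pre_metric)
    also have "\<dots> \<le> hausdorff_outer k (X \<union> Y)" using \<delta> by (intro hausdorff_pre_le_outer)
    finally show ?thesis .
  qed
  have "hausdorff_outer k X + hausdorff_pre k \<delta>2 Y \<le> hausdorff_outer k (X \<union> Y)" if "\<delta>2 > 0" for \<delta>2
  proof -
    have "hausdorff_outer k X + hausdorff_pre k \<delta>2 Y = (SUP \<delta>\<in>{0<..}. hausdorff_pre k \<delta> X + hausdorff_pre k \<delta>2 Y)"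
      unfolding hausdorff_outer_eq_SUP by (rule ennreal_SUP_add_left[symmetric]) auto
    then show ?thesis using *[OF _ that] by (auto intro: SUP_least)
  qed
  moreover have "hausdorff_outer k X + hausdorff_outer k Y = (SUP \<delta>\<in>{0<..}. hausdorff_outer k X + hausdorff_pre k \<delta> Y)"
    unfolding hausdorff_outer_eq_SUP[of k Y] add.commute[of "hausdorff_outer k X"]
    by (rule ennreal_SUP_add_left[symmetric]) auto
  ultimately show ?thesis by (auto intro: SUP_least)
qed

lemma measure_space_hausdorff:
  "measure_space UNIV (sets borel) (hausdorff_outer k :: 'a::euclidean_space set \<Rightarrow> ennreal)"
  by (rule metric_outer_measure_borel)
    (auto intro: hausdorff_outer_mono hausdorff_outer_subadditive hausdorff_outer_metric hausdorff_outer_empty)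

lemma sets_hausdorff [simp, measurable_cong]: "sets (hausdorff_measure k) = sets borel"
  unfolding hausdorff_measure_def by (metis sets.sigma_sets_eq sets_measure_of space_borel top_greatest Pow_UNIV subset_UNIV)

text \<open>\<open>measure_of\<close> falls back to the zero measure when the set function is not
  countably additive on the sigma-algebra; the metric property rules this out.\<close>

lemma emeasure_hausdorff:
  assumes "X \<in> sets borel"
  shows "emeasure (hausdorff_measure k) X = hausdorff_outer k X"
proof (rule emeasure_measure_of[OF hausdorff_measure_def])
  show "positive (sets (hausdorff_measure k)) (hausdorff_outer k)"
    "countably_additive (sets (hausdorff_measure k)) (hausdorff_outer k)"
    using measure_space_hausdorff[of k] unfolding measure_space_def by auto
qed (use assms in auto)

text \<open>Mass distribution principle: the part of \<open>E\<close> in a covering set lies in the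
  ball about one of its points, with the diameter as radius. Measured against the Hausdorff weight,
  which uses half the diameter, this costs \<open>2 ^ k / unit_ball_vol (real k)\<close>.\<close>

lemma mass_distribution_hausdorff:
  fixes m :: "'a::euclidean_space measure"
  assumes m: "sets m = sets borel" and E: "E \<in> sets borel" and c: "0 < c" and \<delta>0: "0 < \<delta>0"
    and bound: "\<And>x D. x \<in> E \<Longrightarrow> 0 < D \<Longrightarrow> D \<le> \<delta>0 \<Longrightarrow> emeasure m (cball x D) \<le> ennreal (c * D ^ k)"
  shows "emeasure m E \<le> ennreal (c * 2 ^ k / unit_ball_vol (real k)) * emeasure (hausdorff_measure k) E"
proof -
  note m[measurable_cong]
  define w where "w = unit_ball_vol (real k)"
  have w: "w > 0" by (simp add: w_def)
  \<comment> \<open>Covering sets may have diameter 0. The bound at radius 0 is the limit of those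
    at small radii; for \<open>k = 0\<close> it reads \<open>c\<close>, because
    \<open>0 ^ 0 = 1\<close>.\<close>
  have bound0: "emeasure m (cball x D) \<le> ennreal (c * D ^ k)" if "x \<in> E" "0 \<le> D" "D \<le> \<delta>0" for x D
  proof (cases "D = 0")
    case True
    have "(\<lambda>n. ennreal (c * (\<delta>0 / real (Suc n)) ^ k)) \<longlonglongrightarrow> ennreal (c * 0 ^ k)"
      by (intro tendsto_ennrealI tendsto_mult tendsto_const tendsto_power LIMSEQ_Suc[OF lim_const_over_n])
    moreover have "emeasure m (cball x D) \<le> ennreal (c * (\<delta>0 / real (Suc n)) ^ k)" for n
    proof -
      have "emeasure m (cball x D) \<le> emeasure m (cball x (\<delta>0 / real (Suc n)))"
        using True \<delta>0 m by (intro emeasure_mono) auto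
      also have "\<dots> \<le> ennreal (c * (\<delta>0 / real (Suc n)) ^ k)"
        using \<delta>0 that by (intro bound) (auto simp: field_simps)
      finally show ?thesis .
    qed
    ultimately have "emeasure m (cball x D) \<le> ennreal (c * 0 ^ k)"
      by (intro LIMSEQ_le_const) auto
    then show ?thesis using True by simp
  qed (use bound that in auto)
  have "emeasure m E \<le> ennreal (c * 2 ^ k / w) * hausdorff_pre k \<delta>0 E"
  proof -
    have "emeasure m E \<le> ennreal (c * 2 ^ k / w) * (\<Sum>i. hausdorff_weight k (U i))"
      if cov: "E \<subseteq> (\<Union>i. U i)" and U: "\<And>i. bounded (U i)" "\<And>i. diameter (U i) \<le> \<delta>0" for U :: "nat \<Rightarrow> 'a set"
    proof -
      define x where "x i = (SOME x. x \<in> U i \<inter> E)" for i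
      have x: "x i \<in> U i \<inter> E" if "U i \<inter> E \<noteq> {}" for i
        unfolding x_def using that by (metis ex_in_conv someI_ex)
      define V where "V i = (if U i \<inter> E = {} then {} else cball (x i) (diameter (U i)))" for i
      have "E \<subseteq> (\<Union>i. V i)"
      proof
        fix y assume y: "y \<in> E"
        then obtain i where i: "y \<in> U i" using cov by auto
        then have "y \<in> V i" using x[of i] y U(1) by (auto simp: V_def intro: diameter_bounded_bound)
        then show "y \<in> (\<Union>i. V i)" by auto
      qed
      moreover have Vm: "range V \<subseteq> sets m" unfolding m by (auto simp: V_def)
      ultimately have "emeasure m E \<le> emeasure m (\<Union>i. V i)"
        by (intro emeasure_mono) auto
      also have "\<dots> \<le> (\<Sum>i. emeasure m (V i))"
        by (rule emeasure_subadditive_countably[OF Vm])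
      also have "\<dots> \<le> (\<Sum>i. ennreal (c * 2 ^ k / w) * hausdorff_weight k (U i))"
      proof (rule suminf_le)
        fix i
        show "emeasure m (V i) \<le> ennreal (c * 2 ^ k / w) * hausdorff_weight k (U i)"
        proof (cases "U i \<inter> E = {}")
          case False
          have "emeasure m (V i) \<le> ennreal (c * diameter (U i) ^ k)"
            using False x[OF False] U unfolding V_def by (auto intro!: bound0 diameter_ge_0)
          also have "c * diameter (U i) ^ k = (c * 2 ^ k / w) * (w * (diameter (U i) / 2) ^ k)"
            using w by (simp add: field_simps)
          also have "ennreal \<dots> = ennreal (c * 2 ^ k / w) * hausdorff_weight k (U i)"
          proof -
            have "hausdorff_weight k (U i) = ennreal (w * (diameter (U i) / 2) ^ k)"
              using False by (auto simp: hausdorff_weight_def w_def)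
            then show ?thesis using c w U(1) by (simp only:) (intro ennreal_mult, auto intro!: mult_nonneg_nonneg zero_le_power divide_nonneg_nonneg diameter_ge_0)
          qed
          finally show ?thesis .
        qed (simp add: V_def)
      qed auto
      also have "\<dots> = ennreal (c * 2 ^ k / w) * (\<Sum>i. hausdorff_weight k (U i))"
        by (rule ennreal_suminf_cmult)
      finally show ?thesis .
    qed
    note * = this
    show ?thesis
    proof -
      have pos: "c * 2 ^ k / w > 0" using c w by auto
      have "emeasure m E / ennreal (c * 2 ^ k / w) \<le> hausdorff_pre k \<delta>0 E"
        unfolding hausdorff_pre_def
      proof (rule INF_greatest, clarsimp)
        fix U :: "nat \<Rightarrow> 'a set" assume "E \<subseteq> (\<Union>i. U i)" "\<forall>i. bounded (U i) \<and> diameter (U i) \<le> \<delta>0"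
        then have "emeasure m E \<le> ennreal (c * 2 ^ k / w) * (\<Sum>i. hausdorff_weight k (U i))"
          by (intro *) auto
        then show "emeasure m E / ennreal (c * 2 ^ k / w) \<le> (\<Sum>i. hausdorff_weight k (U i))"
          using pos by (subst divide_le_posI_ennreal) (auto simp: mult.commute)
      qed
      then have "ennreal (c * 2 ^ k / w) * (emeasure m E / ennreal (c * 2 ^ k / w)) \<le> ennreal (c * 2 ^ k / w) * hausdorff_pre k \<delta>0 E"
        by (rule mult_left_mono) simp
      moreover have "ennreal (c * 2 ^ k / w) * (emeasure m E / ennreal (c * 2 ^ k / w)) = emeasure m E"
        unfolding ennreal_times_divide using pos
        by (subst mult.commute, intro ennreal_mult_divide_eq) (simp_all only: ennreal_eq_0_iff not_le ennreal_neq_top, simp_all)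
      ultimately show ?thesis by simp
    qed
  qed
  also have "\<dots> \<le> ennreal (c * 2 ^ k / w) * hausdorff_outer k E"
    by (intro mult_left_mono hausdorff_pre_le_outer \<delta>0) simp
  finally show ?thesis by (simp add: emeasure_hausdorff[OF E] w_def)
qed

text \<open>A variable \<open>g\<close> is handled by cutting \<open>F\<close> into the dyadic bands
  \<open>P j\<close> of \<open>g\<close>. On a band the mass distribution bound uses the upper end,
  while the density of \<open>N\<close> keeps the lower end; their ratio is the extra 2 in
  \<open>2 ^ Suc k\<close>.\<close>

lemma nn_integral_le_hausdorff:
  fixes m :: "'a::euclidean_space measure" and g :: "'a \<Rightarrow> real" and f :: "'a \<Rightarrow> ennreal"
  assumes m: "sets m = sets borel" and F: "F \<in> sets borel" and null: "emeasure m (- F) = 0"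
    and g[measurable]: "g \<in> borel_measurable borel" and gpos: "\<And>x. x \<in> F \<Longrightarrow> 0 < g x" and \<delta>0: "0 < \<delta>0"
    and bound: "\<And>x D. x \<in> F \<Longrightarrow> 0 < D \<Longrightarrow> D \<le> \<delta>0 \<Longrightarrow> emeasure m (cball x D) \<le> ennreal (g x * D ^ k)"
    and f[measurable]: "f \<in> borel_measurable borel"
  shows "(\<integral>\<^sup>+x. f x \<partial>m) \<le> ennreal (2 ^ Suc k / unit_ball_vol (real k)) *
           (\<integral>\<^sup>+x\<in>F. ennreal (g x) * f x \<partial>hausdorff_measure k)"
proof -
  define a where "a = 2 ^ Suc k / unit_ball_vol (real k)"
  have a: "a > 0" by (simp add: a_def)
  define N :: "'a measure" where "N = density (hausdorff_measure k) (\<lambda>x. ennreal a * (ennreal (g x) * indicator F x))"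
  have Fm[measurable]: "F \<in> sets borel" by fact
  have [measurable]: "(\<lambda>x. ennreal a * (ennreal (g x) * indicator F x)) \<in> borel_measurable (hausdorff_measure k)" by measurable
  define P where "P j = {x\<in>F. 2 powr (real_of_int j) \<le> g x \<and> g x < 2 powr (real_of_int j + 1)}" for j :: int
  have P[measurable]: "P j \<in> sets borel" for j unfolding P_def by measurable
  have Pun: "F = (\<Union>j. P j)"
  proof
    show "F \<subseteq> (\<Union>j. P j)"
    proof
      fix x assume x: "x \<in> F"
      define j where "j = \<lfloor>log 2 (g x)\<rfloor>"
      have "2 powr (real_of_int j) \<le> g x" "g x < 2 powr (real_of_int j + 1)"
        using gpos[OF x] unfolding j_def by (auto simp: powr_le_iff less_powr_iff)
      then have "x \<in> P j" using x by (auto simp: P_def)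
      then show "x \<in> (\<Union>j. P j)" by auto
    qed
  qed (auto simp: P_def)
  have dis: "disjoint_family (\<lambda>j. E \<inter> P j)" for E
  proof -
    have "i \<le> j" if "x \<in> P i" "x \<in> P j" for i j x
    proof -
      have "2 powr real_of_int i < (2::real) powr (real_of_int j + 1)"
        using that unfolding P_def by (blast intro: le_less_trans)
      then show ?thesis by simp
    qed
    then show ?thesis unfolding disjoint_family_on_def by (meson IntD2 IntI antisym disjoint_iff)
  qed
  have P_bound: "emeasure m (E \<inter> P j) \<le> emeasure N (E \<inter> P j)" if E: "E \<in> sets borel" for E j
  proof -
    have Ej[measurable]: "E \<inter> P j \<in> sets borel" using E by auto
    have "emeasure m (E \<inter> P j) \<le> ennreal ((2 powr (real_of_int j + 1)) * 2 ^ k / unit_ball_vol (real k)) * emeasure (hausdorff_measure k) (E \<inter> P j)"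
    proof (rule mass_distribution_hausdorff[OF m _ _ \<delta>0])
      fix x D assume "x \<in> E \<inter> P j" "0 < D" "D \<le> \<delta>0"
      then show "emeasure m (cball x D) \<le> ennreal (2 powr (real_of_int j + 1) * D ^ k)"
        by (intro order_trans[OF bound] ennreal_leI mult_right_mono) (auto simp: P_def)
    qed (use E in auto)
    also have "(2 powr (real_of_int j + 1)) * 2 ^ k / unit_ball_vol (real k) = a * 2 powr real_of_int j"
      by (simp add: a_def powr_add)
    also have "ennreal (a * 2 powr real_of_int j) * emeasure (hausdorff_measure k) (E \<inter> P j) =
        (\<integral>\<^sup>+x. ennreal (a * 2 powr real_of_int j) * indicator (E \<inter> P j) x \<partial>hausdorff_measure k)"
      by (rule nn_integral_cmult_indicator[symmetric]) auto
    also have "\<dots> \<le> (\<integral>\<^sup>+x. ennreal a * (ennreal (g x) * indicator F x) * indicator (E \<inter> P j) x \<partial>hausdorff_measure k)"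
    proof (rule nn_integral_mono)
      fix x
      show "ennreal (a * 2 powr real_of_int j) * indicator (E \<inter> P j) x \<le> ennreal a * (ennreal (g x) * indicator F x) * indicator (E \<inter> P j) x"
        using a by (auto simp: indicator_def P_def ennreal_mult'[symmetric] intro!: ennreal_leI mult_left_mono)
    qed
    also have "\<dots> = emeasure N (E \<inter> P j)"
      unfolding N_def by (rule emeasure_density[symmetric]) auto
    finally show ?thesis .
  qed
  \<comment> \<open>Summation over the countably many bands compares the two measures on every Borel
    set, and an inequality of measures passes to the integrals of all \<open>f\<close> at
    once.\<close>
  have "emeasure m E \<le> emeasure N E" if E: "E \<in> sets borel" for E
  proof -
    have "AE x in m. x \<in> F" by (rule AE_I[of _ _ "- F"]) (use null F m in auto)
    then have "AE x in m. x \<in> E \<longleftrightarrow> x \<in> E \<inter> F" by eventually_elim auto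
    then have "emeasure m E = emeasure m (E \<inter> F)"
      by (rule emeasure_eq_AE) (use E m F in auto)
    also have "E \<inter> F = (\<Union>j. E \<inter> P j)" using Pun by auto
    also have "emeasure m (\<Union>j. E \<inter> P j) = (\<integral>\<^sup>+j. emeasure m (E \<inter> P j) \<partial>count_space UNIV)"
      using E m dis by (intro emeasure_UN_countable) auto
    also have "\<dots> \<le> (\<integral>\<^sup>+j. emeasure N (E \<inter> P j) \<partial>count_space UNIV)"
      by (intro nn_integral_mono P_bound E)
    also have "\<dots> = emeasure N (\<Union>j. E \<inter> P j)"
      using E dis by (intro emeasure_UN_countable[symmetric]) (auto simp: N_def)
    also have "\<dots> \<le> emeasure N E" using E by (intro emeasure_mono) (auto simp: N_def)
    finally show ?thesis .
  qed
  then have "m \<le> N" using m by (subst le_measure) (auto simp: N_def)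
  then have "(\<integral>\<^sup>+x. f x \<partial>m) \<le> (\<integral>\<^sup>+x. f x \<partial>N)"
    using m by (intro nn_integral_mono_measure) (auto simp: N_def)
  also have "\<dots> = (\<integral>\<^sup>+x. ennreal a * (ennreal (g x) * indicator F x) * f x \<partial>hausdorff_measure k)"
    unfolding N_def by (rule nn_integral_density) auto
  also have "\<dots> = (\<integral>\<^sup>+x. ennreal a * (ennreal (g x) * f x * indicator F x) \<partial>hausdorff_measure k)"
    by (simp add: mult_ac)
  also have "\<dots> = ennreal a * (\<integral>\<^sup>+x\<in>F. ennreal (g x) * f x \<partial>hausdorff_measure k)"
    by (rule nn_integral_cmult) measurable
  finally show ?thesis unfolding a_def .
qed


section \<open>Divergence of compactly supported fields; volume of slabs\<close>

lemma lborel_integral_translation: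
  fixes f :: "'a::euclidean_space \<Rightarrow> real"
  assumes "integrable lborel f"
  shows "integrable lborel (\<lambda>x. f (x + c))" "(\<integral>x. f (x + c) \<partial>lborel) = (\<integral>x. f x \<partial>lborel)"
proof -
  have f: "f \<in> borel_measurable borel" using assms by auto
  have "integrable (distr lborel borel ((+) c)) f" using assms by (simp add: lborel_distr_plus)
  then show "integrable lborel (\<lambda>x. f (x + c))"
    using f by (subst (asm) integrable_distr_eq) (auto simp: add.commute)
  have "(\<integral>x. f x \<partial>lborel) = (\<integral>x. f x \<partial>distr lborel borel ((+) c))" by (simp add: lborel_distr_plus)
  also have "\<dots> = (\<integral>x. f (c + x) \<partial>lborel)" using f by (subst integral_distr) auto
  finally show "(\<integral>x. f (x + c) \<partial>lborel) = (\<integral>x. f x \<partial>lborel)" by (simp add: add.commute)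
qed

text \<open>The difference quotients of \<open>f\<close> along \<open>b\<close> have integral zero
  by translation invariance, and they converge dominatedly to the derivative.\<close>

lemma integral_directional_derivative_zero:
  fixes f :: "'a::euclidean_space \<Rightarrow> real"
  assumes \<Omega>: "open \<Omega>" and K: "compact K" "K \<subseteq> \<Omega>" and zero: "\<And>x. x \<notin> K \<Longrightarrow> f x = 0"
    and der: "\<And>x. x \<in> \<Omega> \<Longrightarrow> ((\<lambda>t. f (x + t *\<^sub>R b)) has_real_derivative f' x) (at 0)"
    and contf: "continuous_on \<Omega> f" and cont: "continuous_on \<Omega> f'"
  shows "integrable lborel (\<lambda>x. if x \<in> \<Omega> then f' x else 0)"
    and "(\<integral>x. (if x \<in> \<Omega> then f' x else 0) \<partial>lborel) = 0"
proof -
  define g where "g x = (if x \<in> \<Omega> then f' x else 0)" for x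
  have oK: "open (- K)" using K by (simp add: compact_imp_closed open_Compl)
  \<comment> \<open>\<open>f\<close> vanishes on the open set \<open>- K\<close>, so the derivative
    does too. This glues \<open>f'\<close> on \<Omega> with zero to a continuous function on the
    whole space.\<close>
  have derK: "((\<lambda>t. f (x + t *\<^sub>R b)) has_real_derivative 0) (at 0)" if "x \<notin> K" for x
  proof -
    have "((\<lambda>t. x + t *\<^sub>R b) \<longlongrightarrow> x + 0 *\<^sub>R b) (nhds 0)"
      by (intro tendsto_intros filterlim_ident)
    then have "eventually (\<lambda>t. x + t *\<^sub>R b \<in> - K) (nhds 0)"
      using that oK by (auto dest!: topological_tendstoD)
    then have "eventually (\<lambda>t. f (x + t *\<^sub>R b) = 0) (nhds 0)"
      by eventually_elim (auto simp: zero)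
    then show ?thesis by (subst DERIV_cong_ev[OF refl _ refl]) auto
  qed
  have gK: "g x = 0" if "x \<notin> K" for x
    using derK[OF that] der[of x] by (auto simp: g_def intro: DERIV_unique)
  have derg: "((\<lambda>t. f (x + t *\<^sub>R b)) has_real_derivative g x) (at 0)" for x
    using derK[of x] der[of x] gK[of x] K by (cases "x \<in> \<Omega>") (auto simp: g_def)
  have derg': "((\<lambda>t. f (x + t *\<^sub>R b)) has_real_derivative g (x + s *\<^sub>R b)) (at s)" for x s
  proof -
    have "((\<lambda>t. f ((x + s *\<^sub>R b) + (t - s) *\<^sub>R b)) has_real_derivative g (x + s *\<^sub>R b) * 1) (at s)"
      by (rule DERIV_chain2[where g = "\<lambda>t. t - s" and f = "\<lambda>t. f ((x + s *\<^sub>R b) + t *\<^sub>R b)"])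
         (use derg in \<open>auto intro!: derivative_eq_intros\<close>)
    then show ?thesis by (simp add: algebra_simps)
  qed
  have un: "\<Omega> \<union> - K = UNIV" using K by auto
  have contg: "continuous_on UNIV g"
  proof -
    have "continuous_on \<Omega> g" using cont by (rule continuous_on_eq) (auto simp: g_def)
    moreover have "continuous_on (- K) g"
      by (rule continuous_on_eq[of _ "\<lambda>x. 0"]) (auto simp: gK)
    ultimately show ?thesis using continuous_on_open_Un[OF \<Omega> oK] un by metis
  qed
  have contf': "continuous_on UNIV f"
  proof -
    have "continuous_on (- K) f"
      by (rule continuous_on_eq[of _ "\<lambda>x. 0"]) (auto simp: zero)
    then show ?thesis using continuous_on_open_Un[OF \<Omega> oK contf] un by metis
  qed
  have int: "integrable lborel u" if "continuous_on UNIV u" "\<And>x. x \<notin> K \<Longrightarrow> u x = 0" for u :: "'a \<Rightarrow> real"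
  proof -
    have "integrable lborel (\<lambda>x. indicator K x *\<^sub>R u x)"
      using that K(1) by (intro borel_integrable_compact) (auto intro: continuous_on_subset)
    also have "(\<lambda>x. indicator K x *\<^sub>R u x) = u"
      using that(2) by (auto simp: fun_eq_iff indicator_def split: split_of_bool)
    finally show ?thesis .
  qed
  have fint: "integrable lborel f" and gint: "integrable lborel g"
    using int contf' contg zero gK by auto
  obtain B where B: "B > 0" "\<And>x. \<bar>g x\<bar> \<le> B"
  proof -
    have "compact (g ` K)" using K contg by (intro compact_continuous_image) (auto intro: continuous_on_subset)
    then obtain B where "B > 0" "\<forall>y\<in>g ` K. norm y \<le> B" using compact_imp_bounded bounded_pos by metis
    then show ?thesis using gK by (intro that[of B]) (metis abs_zero imageI less_eq_real_def real_norm_def)+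
  qed
  obtain \<rho> where \<rho>: "\<And>x. x \<in> K \<Longrightarrow> norm x \<le> \<rho>"
    using compact_imp_bounded[OF K(1)] bounded_pos by metis
  define s where "s n = 1 / real (Suc n)" for n
  have s: "0 < s n" "s n \<le> 1" for n by (auto simp: s_def)
  define q where "q n x = (f (x + s n *\<^sub>R b) - f x) / s n" for n x
  have q0: "(\<integral>x. q n x \<partial>lborel) = 0" for n
    unfolding q_def using lborel_integral_translation[OF fint, of "s n *\<^sub>R b"] fint by simp
  have fm[measurable]: "f \<in> borel_measurable borel" using fint by auto
  \<comment> \<open>The steps \<open>s n\<close> are at most 1, so all quotients vanish outside the
    ball that exceeds the support by \<open>norm b\<close>. Inside it the mean value theorem bounds
    them by the maximum of the derivative.\<close>
  have "(\<lambda>n. (\<integral>x. q n x \<partial>lborel)) \<longlonglongrightarrow> (\<integral>x. g x \<partial>lborel)"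
  proof (rule integral_dominated_convergence[where w = "\<lambda>x. B * indicator (cball 0 (\<rho> + norm b)) x"])
    show "g \<in> borel_measurable lborel" using gint by auto
    show "q n \<in> borel_measurable lborel" for n unfolding q_def by measurable
    show "integrable lborel (\<lambda>x. B * indicator (cball (0::'a) (\<rho> + norm b)) x)"
      by (intro integrable_mult_right integrable_real_indicator) (auto intro!: emeasure_bounded_finite[unfolded infinity_ennreal_def])
    show "AE x in lborel. (\<lambda>n. q n x) \<longlonglongrightarrow> g x"
    proof (rule AE_I2)
      fix x
      have "((\<lambda>h. (f (x + h *\<^sub>R b) - f x) / h) \<longlongrightarrow> g x) (at 0)"
        using derg[of x] by (simp add: has_field_derivative_iff)
      moreover have "filterlim s (at 0) sequentially"
        unfolding filterlim_at using s by (auto simp: s_def[abs_def] simp del: of_nat_Suc intro!: LIMSEQ_Suc[OF lim_1_over_n] always_eventually)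
      ultimately show "(\<lambda>n. q n x) \<longlonglongrightarrow> g x" unfolding q_def by (rule filterlim_compose)
    qed
    show "AE x in lborel. norm (q n x) \<le> B * indicator (cball 0 (\<rho> + norm b)) x" for n
    proof (rule AE_I2)
      fix x
      show "norm (q n x) \<le> B * indicator (cball 0 (\<rho> + norm b)) x"
      proof (cases "x \<in> cball 0 (\<rho> + norm b)")
        case True
        obtain z where "0 < z" "z < s n" "f (x + s n *\<^sub>R b) - f (x + 0 *\<^sub>R b) = (s n - 0) * g (x + z *\<^sub>R b)"
          using MVT2[of 0 "s n" "\<lambda>t. f (x + t *\<^sub>R b)" "\<lambda>t. g (x + t *\<^sub>R b)"] s derg' by blast
        then have "q n x = g (x + z *\<^sub>R b)" using s[of n] by (simp add: q_def)
        then show ?thesis using True B by auto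
      next
        case False
        have "norm x \<le> norm (x + s n *\<^sub>R b) + norm (s n *\<^sub>R b)" by (metis add_diff_cancel norm_triangle_ineq4)
        also have "norm (s n *\<^sub>R b) \<le> norm b" using s[of n] by (simp add: mult_left_le_one_le)
        finally have "x + s n *\<^sub>R b \<notin> K" "x \<notin> K" using \<rho>[of "x + s n *\<^sub>R b"] \<rho>[of x] False norm_ge_zero[of b] by (auto, linarith)
        then show ?thesis using False zero by (simp add: q_def)
      qed
    qed
  qed
  then have "(\<integral>x. g x \<partial>lborel) = 0" unfolding q0 using LIMSEQ_unique by blast
  then show "(\<integral>x. (if x \<in> \<Omega> then f' x else 0) \<partial>lborel) = 0"
    "integrable lborel (\<lambda>x. if x \<in> \<Omega> then f' x else 0)"
    using gint unfolding g_def[abs_def] by auto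
qed

text \<open>The trace of the derivative is a sum of directional derivatives of components, each of
  which integrates to zero.\<close>

lemma divergence_compact_support:
  fixes W :: "'a::euclidean_space \<Rightarrow> 'a"
  assumes \<Omega>: "open \<Omega>" and K: "compact K" "K \<subseteq> \<Omega>" and zero: "\<And>x. x \<notin> K \<Longrightarrow> W x = 0"
    and der: "\<And>x. x \<in> \<Omega> \<Longrightarrow> (W has_derivative W' x) (at x)"
    and cont: "\<And>b. b \<in> Basis \<Longrightarrow> continuous_on \<Omega> (\<lambda>x. W' x b)"
  shows "integrable lborel (\<lambda>x. if x \<in> \<Omega> then \<Sum>b\<in>Basis. W' x b \<bullet> b else 0)"
    and "(\<integral>x. (if x \<in> \<Omega> then \<Sum>b\<in>Basis. W' x b \<bullet> b else 0) \<partial>lborel) = 0"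
proof -
  have contW: "continuous_on \<Omega> W"
    using der by (intro has_derivative_continuous_on) (auto intro: has_derivative_at_withinI)
  have *: "integrable lborel (\<lambda>x. if x \<in> \<Omega> then W' x b \<bullet> b else 0)"
    "(\<integral>x. (if x \<in> \<Omega> then W' x b \<bullet> b else 0) \<partial>lborel) = 0" if b: "b \<in> Basis" for b
  proof -
    have "((\<lambda>t. W (x + t *\<^sub>R b) \<bullet> b) has_real_derivative W' x b \<bullet> b) (at 0)" if "x \<in> \<Omega>" for x
    proof -
      have "((\<lambda>t. W (x + t *\<^sub>R b) \<bullet> b) has_derivative (\<lambda>t. W' x (t *\<^sub>R b) \<bullet> b)) (at 0)"
        using der[OF that]
        by (intro has_derivative_inner_left has_derivative_compose[of "\<lambda>t. x + t *\<^sub>R b" _ _ _ W])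
           (auto intro!: derivative_eq_intros)
      moreover have "W' x (t *\<^sub>R b) = t *\<^sub>R W' x b" for t
        using der[OF that] by (intro linear_cmul has_derivative_linear)
      then have "(\<lambda>t. W' x (t *\<^sub>R b) \<bullet> b) = (*) (W' x b \<bullet> b)" by (auto simp: fun_eq_iff)
      ultimately show ?thesis by (simp add: has_field_derivative_def)
    qed
    moreover have "continuous_on \<Omega> (\<lambda>x. W x \<bullet> b)" "continuous_on \<Omega> (\<lambda>x. W' x b \<bullet> b)"
      using contW cont[OF b] by (auto intro!: continuous_intros)
    ultimately show "integrable lborel (\<lambda>x. if x \<in> \<Omega> then W' x b \<bullet> b else 0)"
    "(\<integral>x. (if x \<in> \<Omega> then W' x b \<bullet> b else 0) \<partial>lborel) = 0"
      using integral_directional_derivative_zero[OF \<Omega> K, of "\<lambda>x. W x \<bullet> b" b "\<lambda>x. W' x b \<bullet> b"] zero by auto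
  qed
  have eq: "(if x \<in> \<Omega> then \<Sum>b\<in>Basis. W' x b \<bullet> b else 0) = (\<Sum>b\<in>Basis. if x \<in> \<Omega> then W' x b \<bullet> b else 0)" for x
    by simp
  show "integrable lborel (\<lambda>x. if x \<in> \<Omega> then \<Sum>b\<in>Basis. W' x b \<bullet> b else 0)"
    "(\<integral>x. (if x \<in> \<Omega> then \<Sum>b\<in>Basis. W' x b \<bullet> b else 0) \<partial>lborel) = 0"
    unfolding eq using * by (auto intro: Bochner_Integration.integrable_sum simp: Bochner_Integration.integral_sum)
qed

text \<open>The piece is translated along one coordinate axis in steps that move
  \<open>\<theta> \<bullet> x\<close> by exactly the width \<open>w\<close>. The copies are
  disjoint, and \<open>K\<close> of them fit into a box with one side \<open>2 * D + K * t\<close>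
  and the others \<open>2 * D\<close>. Dividing by \<open>K\<close> and letting \<open>K\<close>
  grow leaves the cross-section times \<open>t\<close>.\<close>

lemma emeasure_slab_le:
  fixes x0 \<theta> :: "'a::euclidean_space" and D w a :: real
  assumes "0 \<le> D" "0 < w" "norm \<theta> = 1"
  shows "emeasure lborel {x \<in> cball x0 D. a \<le> \<theta> \<bullet> x \<and> \<theta> \<bullet> x < a + w}
           \<le> ennreal ((2 * D) ^ (DIM('a) - 1) * (DIM('a) * w))"
proof -
  define S where "S = {x \<in> cball x0 D. a \<le> \<theta> \<bullet> x \<and> \<theta> \<bullet> x < a + w}"
  have Sm[measurable]: "S \<in> sets borel" unfolding S_def by measurable
  \<comment> \<open>The l1-norm of a unit vector is at least 1, so some coordinate has modulus at
    least 1/d. This is the origin of the factor \<open>DIM('a)\<close>.\<close>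
  obtain j where j: "j \<in> Basis" "\<bar>\<theta> \<bullet> j\<bar> \<ge> 1 / DIM('a)"
  proof (rule ccontr)
    assume "\<not> thesis"
    then have "\<forall>b\<in>Basis. \<not> \<bar>\<theta> \<bullet> b\<bar> \<ge> 1 / DIM('a)" using that by blast
    then have "(\<Sum>b\<in>Basis. \<bar>\<theta> \<bullet> b\<bar>) < (\<Sum>b\<in>(Basis::'a set). 1 / DIM('a))"
      by (intro sum_strict_mono) auto
    then show False using norm_le_l1[of \<theta>] assms by simp
  qed
  define t where "t = w / \<bar>\<theta> \<bullet> j\<bar>"
  have j0: "\<bar>\<theta> \<bullet> j\<bar> > 0" using j by (metis DIM_positive divide_pos_pos less_le_trans of_nat_0_less_iff zero_less_one)
  have t: "0 < t" "t \<le> DIM('a) * w"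
    using j j0 assms by (auto simp: t_def field_simps)
  define V where "V i = (\<lambda>x. (- (real i * t)) *\<^sub>R j + x) -` S" for i :: nat
  have Vm[measurable]: "V i \<in> sets borel" for i
    using measurable_sets[of "\<lambda>x. (- (real i * t)) *\<^sub>R j + x" borel borel S] by (simp add: V_def)
  have eV: "emeasure lborel (V i) = emeasure lborel S" for i
  proof -
    have "emeasure lborel S = emeasure (distr lborel borel ((+) ((- (real i * t)) *\<^sub>R j))) S"
      by (simp add: lborel_distr_plus)
    also have "\<dots> = emeasure lborel (V i)" by (subst emeasure_distr) (auto simp: V_def vimage_def)
    finally show ?thesis by simp
  qed
  have tj: "t * (\<theta> \<bullet> j) = sgn (\<theta> \<bullet> j) * w" using j0 by (auto simp: t_def sgn_if)
  have sgnc: "sgn (\<theta> \<bullet> j) = 1 \<or> sgn (\<theta> \<bullet> j) = -1" using j0 by (auto simp: sgn_if)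
  have dis: "disjoint_family V"
  proof -
    have "i = i'" if "x \<in> V i" "x \<in> V i'" for i i' x
    proof -
      have A: "a \<le> \<theta> \<bullet> x - real i * (sgn (\<theta> \<bullet> j) * w)" "\<theta> \<bullet> x - real i * (sgn (\<theta> \<bullet> j) * w) < a + w"
        "a \<le> \<theta> \<bullet> x - real i' * (sgn (\<theta> \<bullet> j) * w)" "\<theta> \<bullet> x - real i' * (sgn (\<theta> \<bullet> j) * w) < a + w"
        using that unfolding V_def S_def tj[symmetric] by (auto simp: inner_simps algebra_simps)
      have "real i * w - real i' * w < w" "real i' * w - real i * w < w"
        using A sgnc by (elim disjE; simp)+
      then have "(real i - real i') * w < 1 * w" "(real i' - real i) * w < 1 * w"
        by (simp_all add: left_diff_distrib)
      then have "real i - real i' < 1" "real i' - real i < 1"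
        using assms(2) by (simp_all only: mult_less_cancel_right_pos)
      then show ?thesis by linarith
    qed
    then show ?thesis unfolding disjoint_family_on_def by blast
  qed
  have main: "real K * measure lborel S \<le> (2 * D) ^ (DIM('a) - 1) * (2 * D + real K * t)"
    and fin: "emeasure lborel S = ennreal (measure lborel S)" for K :: nat
  proof -
    define l where "l = x0 - (\<Sum>b\<in>Basis. D *\<^sub>R b)"
    define u where "u = x0 + (\<Sum>b\<in>Basis. D *\<^sub>R b) + (real K * t) *\<^sub>R j"
    have ul: "(u - l) \<bullet> b = (if b = j then 2 * D + real K * t else 2 * D)" if "b \<in> Basis" for b
      using that j by (auto simp: u_def l_def inner_simps inner_sum_left inner_Basis if_distrib cong: if_cong)
    have sub: "(\<Union>i<K. V i) \<subseteq> cbox l u"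
    proof clarify
      fix x i assume i: "i < K" "x \<in> V i"
      then have "norm (x - (real i * t) *\<^sub>R j - x0) \<le> D"
        by (auto simp: V_def S_def dist_norm norm_minus_commute algebra_simps)
      then have *: "\<bar>(x - (real i * t) *\<^sub>R j - x0) \<bullet> b\<bar> \<le> D" if "b \<in> Basis" for b
        using Basis_le_norm[OF that] order_trans by blast
      have it: "0 \<le> real i * t" "real i * t \<le> real K * t" using i t by auto
      show "x \<in> cbox l u"
        unfolding mem_box
      proof
        fix b :: 'a assume b: "b \<in> Basis"
        show "l \<bullet> b \<le> x \<bullet> b \<and> x \<bullet> b \<le> u \<bullet> b"
          using *[OF b] it b j by (cases "b = j")
            (auto simp: u_def l_def inner_simps inner_sum_left inner_Basis abs_le_iff if_distrib cong: if_cong)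
      qed
    qed
    have "S \<subseteq> cball x0 D" by (auto simp: S_def)
    then have "bounded S" using bounded_cball bounded_subset by blast
    then have "emeasure lborel S \<noteq> \<infinity>" using emeasure_bounded_finite[of S] by auto
    then show fin: "emeasure lborel S = ennreal (measure lborel S)"
      by (simp add: emeasure_eq_ennreal_measure)
    have "ennreal (real K * measure lborel S) = (\<Sum>i<K. emeasure lborel (V i))"
      by (simp add: eV fin ennreal_mult ennreal_of_nat_eq_real_of_nat)
    also have "\<dots> = emeasure lborel (\<Union>i<K. V i)"
      using dis by (intro sum_emeasure) (auto intro: disjoint_family_on_mono)
    also have "\<dots> \<le> emeasure lborel (cbox l u)" using sub by (intro emeasure_mono) auto
    also have "\<dots> = ennreal (\<Prod>b\<in>Basis. (u - l) \<bullet> b)"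
    proof (rule emeasure_lborel_cbox)
      fix b :: 'a assume b: "b \<in> Basis"
      have "0 \<le> real K * t" using t by simp
      then have "0 \<le> (u - l) \<bullet> b" using ul[OF b] assms by simp
      then show "l \<bullet> b \<le> u \<bullet> b" by (simp add: inner_diff_left)
    qed
    also have "(\<Prod>b\<in>Basis. (u - l) \<bullet> b) = (2 * D) ^ (DIM('a) - 1) * (2 * D + real K * t)"
      using j by (subst prod.remove[of _ j]) (auto simp: ul card_Diff_singleton)
    finally show "real K * measure lborel S \<le> (2 * D) ^ (DIM('a) - 1) * (2 * D + real K * t)"
      using assms t by (subst (asm) ennreal_le_iff) auto
  qed
  have "measure lborel S \<le> (2 * D) ^ (DIM('a) - 1) * t"
  proof (rule LIMSEQ_le_const)
    have "(\<lambda>n. (2 * D) ^ (DIM('a) - 1) * (2 * D / real (Suc n) + t)) \<longlonglongrightarrow> (2 * D) ^ (DIM('a) - 1) * (0 + t)"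
      by (intro tendsto_mult tendsto_add tendsto_const LIMSEQ_Suc[OF lim_const_over_n])
    then show "(\<lambda>n. (2 * D) ^ (DIM('a) - 1) * (2 * D / real (Suc n) + t)) \<longlonglongrightarrow> (2 * D) ^ (DIM('a) - 1) * t"
      by simp
    have "measure lborel S \<le> (2 * D) ^ (DIM('a) - 1) * (2 * D / real (Suc n) + t)" for n
      using main[of "Suc n"] by (simp add: field_simps)
    then show "\<exists>N. \<forall>n\<ge>N. measure lborel S \<le> (2 * D) ^ (DIM('a) - 1) * (2 * D / real (Suc n) + t)"
      by blast
  qed
  also have "\<dots> \<le> (2 * D) ^ (DIM('a) - 1) * (DIM('a) * w)"
    using t assms by (intro mult_left_mono) auto
  finally show ?thesis using fin unfolding S_def[symmetric] by (simp add: ennreal_leI)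
qed


section \<open>Calculus on the sphere and in polar coordinates\<close>

lemma grad_on_UNIV_eqI:
  assumes "(f has_derivative (\<lambda>h. inner g h)) (at x)"
  shows "grad_on f UNIV x = g"
  unfolding grad_on_def
proof (rule the_equality)
  fix g' assume "(f has_derivative inner g') (at x within UNIV)"
  then have "inner g' = inner g" using assms has_derivative_unique by blast
  then have "inner g' (g' - g) = inner g (g' - g)" by (rule fun_cong)
  then have "inner (g' - g) (g' - g) = 0" by (simp add: inner_diff_left)
  then show "g' = g" by simp
qed (use assms in simp)

lemma grad_on_UNIV_works:
  fixes f :: "'a::euclidean_space \<Rightarrow> real"
  assumes "f differentiable (at x)"
  shows "(f has_derivative (\<lambda>h. inner (grad_on f UNIV x) h)) (at x)"
proof -
  obtain f' where f': "(f has_derivative f') (at x)" using assms unfolding differentiable_def by blast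
  have lin: "linear f'" using f' by (rule has_derivative_linear)
  define g where "g = adjoint f' 1"
  have eq: "f' = inner g"
  proof
    fix h
    have "f' h = h \<bullet> g" using adjoint_works[OF lin, of h 1] by (simp add: g_def)
    then show "f' h = inner g h" by (simp only: inner_commute)
  qed
  have g: "(f has_derivative inner g) (at x)" using f' unfolding eq .
  show ?thesis unfolding grad_on_UNIV_eqI[OF g] by (rule g)
qed

lemma grad_on_interior: "x \<in> interior S \<Longrightarrow> grad_on f S x = grad_on f UNIV x"
  unfolding grad_on_def by (simp only: at_within_interior)

lemma tangential_simps [simp]:
  "tangential \<theta> 0 = 0"
  "tangential \<theta> (u + v) = tangential \<theta> u + tangential \<theta> v"
  "tangential \<theta> (c *\<^sub>R v) = c *\<^sub>R tangential \<theta> v"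
  by (simp_all add: tangential_def inner_right_distrib scaleR_add_left scaleR_diff_right)

lemma inner_tangential: "norm \<theta> = 1 \<Longrightarrow> \<theta> \<bullet> tangential \<theta> v = 0"
  by (simp add: tangential_def inner_simps dot_square_norm)

lemma tangential_idem: "\<theta> \<bullet> v = 0 \<Longrightarrow> tangential \<theta> v = v"
  by (simp add: tangential_def)

lemma has_derivative_sgn:
  fixes x :: "'a::euclidean_space"
  assumes "x \<noteq> 0"
  shows "(sgn has_derivative (\<lambda>v. tangential (sgn x) v /\<^sub>R norm x)) (at x)"
proof -
  have n: "(norm has_derivative (\<lambda>v. sgn x \<bullet> v)) (at x)"
    using has_derivative_norm[OF assms] by (simp only: inner_commute)
  have "((\<lambda>y. inverse (norm y)) has_derivative (\<lambda>v. - (inverse (norm x) * (sgn x \<bullet> v) * inverse (norm x)))) (at x)"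
    by (rule Deriv.has_derivative_inverse[OF _ n]) (use assms in simp)
  from has_derivative_scaleR[OF this has_derivative_ident]
  have "((\<lambda>y. inverse (norm y) *\<^sub>R y) has_derivative (\<lambda>v. inverse (norm x) *\<^sub>R v + (- (inverse (norm x) * (sgn x \<bullet> v) * inverse (norm x))) *\<^sub>R x)) (at x)" .
  moreover have "(\<lambda>y. inverse (norm y) *\<^sub>R y) = (sgn :: 'a \<Rightarrow> 'a)" by (auto simp: sgn_div_norm fun_eq_iff)
  moreover have "inverse (norm x) *\<^sub>R v + (- (inverse (norm x) * (sgn x \<bullet> v) * inverse (norm x))) *\<^sub>R x = tangential (sgn x) v /\<^sub>R norm x" for v
    by (simp add: tangential_def scaleR_diff_right sgn_div_norm)
  ultimately show ?thesis by (simp only:)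
qed

text \<open>A function constant on rays has a derivative that is homogeneous of degree -1, so
  differentiability on the sphere extends to all nonzero points.\<close>

lemma has_derivative_comp_sgn_scale:
  fixes f :: "'a::euclidean_space \<Rightarrow> 'b::real_normed_vector"
  assumes "((\<lambda>x. f (sgn x)) has_derivative F') (at (sgn z))" "z \<noteq> 0"
  shows "((\<lambda>x. f (sgn x)) has_derivative (\<lambda>v. F' v /\<^sub>R norm z)) (at z)"
proof -
  have "((\<lambda>x. f (sgn (x /\<^sub>R norm z))) has_derivative (\<lambda>v. F' (v /\<^sub>R norm z))) (at z)"
    using assms
    by (intro has_derivative_compose[of "\<lambda>x. x /\<^sub>R norm z" _ _ _ "\<lambda>x. f (sgn x)"])
       (auto intro!: derivative_eq_intros simp: sgn_div_norm)
  moreover have "sgn (x /\<^sub>R norm z) = sgn x" for x :: 'a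
    using assms(2) by (simp add: sgn_scaleR[of "inverse (norm z)" x])
  moreover have "F' (v /\<^sub>R norm z) = F' v /\<^sub>R norm z" for v
    using assms(1) by (intro linear_cmul has_derivative_linear)
  ultimately show ?thesis by simp
qed

lemma has_derivative_comp_sgn_radial:
  fixes f :: "'a::euclidean_space \<Rightarrow> 'b::real_normed_vector"
  assumes "((\<lambda>x. f (sgn x)) has_derivative F') (at \<theta>)"
  shows "F' \<theta> = 0"
proof -
  have "((\<lambda>t. f (sgn (t *\<^sub>R \<theta>))) has_derivative (\<lambda>s. F' (s *\<^sub>R \<theta>))) (at (1::real))"
    using assms
    by (intro has_derivative_compose[of "\<lambda>t. t *\<^sub>R \<theta>" _ _ _ "\<lambda>x. f (sgn x)"]) (auto intro!: derivative_eq_intros)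
  moreover have "((\<lambda>t. f (sgn (t *\<^sub>R \<theta>))) has_derivative (\<lambda>s. 0)) (at (1::real))"
    by (rule has_derivative_transform_within_open[of "\<lambda>t. f (sgn \<theta>)" _ _ _ "{0<..}"])
       (auto simp: sgn_scaleR)
  ultimately have "(\<lambda>s::real. F' (s *\<^sub>R \<theta>)) = (\<lambda>s. 0)" by (rule has_derivative_unique)
  then show ?thesis by (metis scaleR_one)
qed

lemma sphere_grad_works:
  assumes "(\<lambda>x. f (sgn x)) differentiable (at \<theta>)"
  shows "((\<lambda>x. f (sgn x)) has_derivative (\<lambda>h. sphere_grad f \<theta> \<bullet> h)) (at \<theta>)"
    "sphere_grad f \<theta> \<bullet> \<theta> = 0"
proof -
  show *: "((\<lambda>x. f (sgn x)) has_derivative (\<lambda>h. sphere_grad f \<theta> \<bullet> h)) (at \<theta>)"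
    unfolding sphere_grad_def by (rule grad_on_UNIV_works[OF assms])
  show "sphere_grad f \<theta> \<bullet> \<theta> = 0" using has_derivative_comp_sgn_radial[OF *] .
qed

text \<open>The last claim identifies the matrix of the Monge-Ampere equation with the derivative of
  the inverse Gauss map. Differentiating the factor \<open>f\<close> creates a normal part, and
  exactly this part is cancelled by the one which \<open>sphere_hess\<close> projects away.\<close>

lemma sphere_hess_works:
  fixes f :: "'a::euclidean_space \<Rightarrow> real"
  assumes f: "sphere_twice_differentiable f" and \<theta>: "\<theta> \<in> sphere 0 1"
  shows "linear (sphere_hess f \<theta>)" "sphere_hess f \<theta> (tangential \<theta> v) = sphere_hess f \<theta> v"
    "\<theta> \<bullet> sphere_hess f \<theta> v = 0"
    "((\<lambda>x. f (sgn x) *\<^sub>R sgn x + sphere_grad f (sgn x)) has_derivative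
       (\<lambda>v. f \<theta> *\<^sub>R tangential \<theta> v + sphere_hess f \<theta> v)) (at \<theta>)"
proof -
  have n: "norm \<theta> = 1" "\<theta> \<noteq> 0" and s: "sgn \<theta> = \<theta>" using \<theta> by (auto simp: sgn_div_norm)
  define D where "D = frechet_derivative (\<lambda>x. sphere_grad f (sgn x)) (at \<theta>)"
  have D: "((\<lambda>x. sphere_grad f (sgn x)) has_derivative D) (at \<theta>)"
    using f \<theta> unfolding sphere_twice_differentiable_def D_def by (metis frechet_derivative_works)
  have lD: "linear D" using D by (rule has_derivative_linear)
  have D\<theta>: "D \<theta> = 0" using has_derivative_comp_sgn_radial[OF D] .
  have h: "sphere_hess f \<theta> v = tangential \<theta> (D v)" for v
    by (simp add: sphere_hess_def D_def)
  show "linear (sphere_hess f \<theta>)"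
    unfolding h by (rule linearI) (auto simp: linear_add[OF lD] linear_cmul[OF lD])
  have "D (tangential \<theta> v) = D v" for v
    by (simp add: tangential_def linear_diff[OF lD] linear_cmul[OF lD] D\<theta>)
  then show "sphere_hess f \<theta> (tangential \<theta> v) = sphere_hess f \<theta> v" by (simp add: h)
  show "\<theta> \<bullet> sphere_hess f \<theta> v = 0" using n by (simp add: h inner_tangential)
  have g: "((\<lambda>x. f (sgn x)) has_derivative (\<lambda>h. sphere_grad f \<theta> \<bullet> h)) (at \<theta>)"
    and g0: "\<theta>' \<in> sphere 0 1 \<Longrightarrow> sphere_grad f \<theta>' \<bullet> \<theta>' = 0" for \<theta>'
    using f \<theta> unfolding sphere_twice_differentiable_def by (auto intro: sphere_grad_works)
  have sg: "(sgn has_derivative (\<lambda>v. tangential \<theta> v)) (at \<theta>)"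
    using has_derivative_sgn[of \<theta>] n s by simp
  \<comment> \<open>Differentiating the orthogonality of gradient and position cancels the normal part of \<open>D\<close>.\<close>
  have "((\<lambda>x. sgn x \<bullet> sphere_grad f (sgn x)) has_derivative (\<lambda>v. \<theta> \<bullet> D v + tangential \<theta> v \<bullet> sphere_grad f \<theta>)) (at \<theta>)"
    using has_derivative_inner[OF sg D] s by simp
  moreover have "((\<lambda>x. sgn x \<bullet> sphere_grad f (sgn x)) has_derivative (\<lambda>v. 0)) (at \<theta>)"
  proof (rule has_derivative_transform_within_open[of "\<lambda>x. 0"])
    fix x :: 'a assume "x \<in> - {0}"
    then have "sgn x \<in> sphere 0 1" by (simp add: norm_sgn)
    then show "0 = sgn x \<bullet> sphere_grad f (sgn x)" using g0[of "sgn x"] by (metis inner_commute)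
  qed (use n in auto)
  ultimately have "(\<lambda>v. \<theta> \<bullet> D v + tangential \<theta> v \<bullet> sphere_grad f \<theta>) = (\<lambda>v. 0)"
    by (rule has_derivative_unique)
  then have "\<theta> \<bullet> D v + tangential \<theta> v \<bullet> sphere_grad f \<theta> = 0" for v by (rule fun_cong)
  moreover have "tangential \<theta> v \<bullet> sphere_grad f \<theta> = sphere_grad f \<theta> \<bullet> v" for v
    using g0[OF \<theta>] by (simp add: tangential_def inner_simps inner_commute)
  ultimately have nD: "\<theta> \<bullet> D v = - (sphere_grad f \<theta> \<bullet> v)" for v by (simp add: add_eq_0_iff)
  have "((\<lambda>x. f (sgn x) *\<^sub>R sgn x + sphere_grad f (sgn x)) has_derivative
       (\<lambda>v. (f \<theta> *\<^sub>R tangential \<theta> v + (sphere_grad f \<theta> \<bullet> v) *\<^sub>R \<theta>) + D v)) (at \<theta>)"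
    using has_derivative_add[OF has_derivative_scaleR[OF g sg] D] s by simp
  then show "((\<lambda>x. f (sgn x) *\<^sub>R sgn x + sphere_grad f (sgn x)) has_derivative
       (\<lambda>v. f \<theta> *\<^sub>R tangential \<theta> v + sphere_hess f \<theta> v)) (at \<theta>)"
    by (simp add: h tangential_def[of \<theta> "D _"] nD algebra_simps)
qed

text \<open>The 1-homogeneous extension of \<open>f\<close> minus the linear function given by
  \<open>x\<close> is nonnegative and vanishes at \<theta>. Its gradient there,
  \<open>f \<theta> *\<^sub>R \<theta> + sphere_grad f \<theta> - x\<close>, is therefore
  zero.\<close>

lemma support_point_eq_gradient:
  fixes K :: "'a::euclidean_space set"
  assumes K: "\<And>\<theta> y. \<theta> \<in> sphere 0 1 \<Longrightarrow> y \<in> K \<Longrightarrow> \<theta> \<bullet> y \<le> f \<theta>"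
    and x: "x \<in> K" "\<theta> \<bullet> x = f \<theta>" and \<theta>: "\<theta> \<in> sphere 0 1"
    and diff: "(\<lambda>z. f (sgn z)) differentiable (at \<theta>)"
  shows "x = f \<theta> *\<^sub>R \<theta> + sphere_grad f \<theta>"
proof -
  have n: "norm \<theta> = 1" "\<theta> \<noteq> 0" and s: "sgn \<theta> = \<theta>" using \<theta> by (auto simp: sgn_div_norm)
  define q where "q z = norm z * f (sgn z) - x \<bullet> z" for z
  have dn: "(norm has_derivative (\<lambda>h. h \<bullet> \<theta>)) (at \<theta>)" using has_derivative_norm[OF n(2)] s by simp
  have "(q has_derivative (\<lambda>h. (norm \<theta> * (sphere_grad f \<theta> \<bullet> h) + (h \<bullet> \<theta>) * f (sgn \<theta>)) - x \<bullet> h)) (at \<theta>)"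
    unfolding q_def
    using sphere_grad_works(1)[OF diff]
    by (intro has_derivative_diff has_derivative_mult has_derivative_inner_right has_derivative_ident dn)
  then have dq: "(q has_derivative (\<lambda>h. (f \<theta> *\<^sub>R \<theta> + sphere_grad f \<theta> - x) \<bullet> h)) (at \<theta>)"
    using n s by (simp add: inner_simps algebra_simps inner_commute)
  have "\<forall>z\<in>- {0}. q \<theta> \<le> q z"
  proof
    fix z :: 'a assume z: "z \<in> - {0}"
    then have "sgn z \<bullet> x \<le> f (sgn z)" using x K by (auto simp: norm_sgn)
    then have "norm z * (sgn z \<bullet> x) \<le> norm z * f (sgn z)" by (rule mult_left_mono) simp
    moreover have "norm z * (sgn z \<bullet> x) = x \<bullet> z" using z by (simp add: sgn_div_norm inner_commute)
    ultimately have "0 \<le> q z" by (simp add: q_def)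
    moreover have "q \<theta> = 0" using x n s by (simp add: q_def inner_commute)
    ultimately show "q \<theta> \<le> q z" by simp
  qed
  then have "(\<lambda>h. (f \<theta> *\<^sub>R \<theta> + sphere_grad f \<theta> - x) \<bullet> h) = (\<lambda>v. 0)"
    using dq n by (intro differential_zero_maxmin[of \<theta> "- {0}" q]) auto
  then have "(f \<theta> *\<^sub>R \<theta> + sphere_grad f \<theta> - x) \<bullet> (f \<theta> *\<^sub>R \<theta> + sphere_grad f \<theta> - x) = 0" by metis
  then show ?thesis by simp
qed

text \<open>Cramer's rule writes the solution as quotients of determinants with continuous entries.
  This yields the continuity of the derivative of the inverse map.\<close>

lemma continuous_on_linear_solve:
  fixes L :: "'a::topological_space \<Rightarrow> real^'n \<Rightarrow> real^'n"
  assumes lin: "\<And>x. x \<in> S \<Longrightarrow> linear (L x)"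
    and inj: "\<And>x v. x \<in> S \<Longrightarrow> L x v = 0 \<Longrightarrow> v = 0"
    and cont: "\<And>v. continuous_on S (\<lambda>x. L x v)"
    and u: "\<And>x. x \<in> S \<Longrightarrow> L x (u x) = w x" and w: "continuous_on S w"
  shows "continuous_on S u"
proof -
  have det0: "det (matrix (L x)) \<noteq> 0" if "x \<in> S" for x
  proof -
    have "inj (L x)" using lin[OF that] inj[OF that] by (simp add: linear_injective_0)
    then show ?thesis using det_nz_iff_inj[OF lin[OF that]] by simp
  qed
  have contdet: "continuous_on S (\<lambda>x. det (A x))"
    if "\<And>i j. continuous_on S (\<lambda>x. A x $ i $ j)" for A :: "'a \<Rightarrow> real^'n^'n"
    unfolding det_def by (intro continuous_on_sum continuous_on_mult continuous_on_const continuous_on_prod that)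
  have entry: "continuous_on S (\<lambda>x. matrix (L x) $ i $ j)" for i j
    using cont[of "axis j 1"] by (simp add: matrix_def continuous_on_component)
  have eq: "u x = (\<chi> k. det (\<chi> i j. if j = k then w x $ i else matrix (L x) $ i $ j) / det (matrix (L x)))"
    if "x \<in> S" for x
    using cramer[OF det0[OF that], of "u x" "w x"] u[OF that] lin[OF that] by (simp add: matrix_works)
  have "continuous_on S (\<lambda>x. \<chi> k. det (\<chi> i j. if j = k then w x $ i else matrix (L x) $ i $ j) / det (matrix (L x)))"
  proof (intro continuous_on_vec_lambda continuous_on_divide contdet entry)
    fix k i j
    show "continuous_on S (\<lambda>x. (\<chi> i j. if j = k then w x $ i else matrix (L x) $ i $ j) $ i $ j)"
      using entry w by (cases "j = k") (simp_all add: continuous_on_component)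
  qed (use det0 in auto)
  then show ?thesis by (rule continuous_on_eq) (simp add: eq)
qed


section \<open>Differentiation in polar coordinates\<close>

lemma continuous_on_polar:
  assumes "polar_C0 R f"
  shows "continuous_on (cball 0 R - {0}) (\<lambda>y. f (norm y) (sgn y))"
proof -
  have "continuous_on (cball 0 R - {0}) (\<lambda>y. (\<lambda>(r, \<theta>). f r \<theta>) (norm y, sgn y))"
    using assms unfolding polar_C0_def
    by (rule continuous_on_compose2) (auto intro!: continuous_intros simp: norm_sgn)
  then show ?thesis by simp
qed

lemma r_deriv_works:
  assumes "r_differentiable R f" "r \<in> {0<..R}" "\<theta> \<in> sphere 0 1"
  shows "((\<lambda>s. f s \<theta>) has_vector_derivative r_deriv R f r \<theta>) (at r within {0<..R})"
  using assms unfolding r_differentiable_def r_deriv_def vector_derivative_works by blast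

lemma r_deriv_works_at:
  assumes "r_differentiable R f" "r \<in> {0<..<R}" "\<theta> \<in> sphere 0 1"
  shows "((\<lambda>s. f s \<theta>) has_vector_derivative r_deriv R f r \<theta>) (at r)"
proof -
  have "((\<lambda>s. f s \<theta>) has_vector_derivative r_deriv R f r \<theta>) (at r within {0<..R})"
    using assms by (intro r_deriv_works) auto
  then have "((\<lambda>s. f s \<theta>) has_vector_derivative r_deriv R f r \<theta>) (at r within {0<..<R})"
    by (rule has_vector_derivative_within_subset) auto
  moreover have "at r within {0<..<R} = at r" using assms by (intro at_within_open) auto
  ultimately show ?thesis by (simp only:)
qed

text \<open>Joint continuity of the radial derivative suffices for total differentiability, so the
  angular derivative enters only at the radius \<open>norm y\<close>. Working within the closed ball
  keeps the case \<open>norm y = R\<close>, where the radial derivative is one-sided.\<close>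

lemma polar_has_derivative:
  fixes f :: "real \<Rightarrow> 'a::euclidean_space \<Rightarrow> 'b::real_normed_vector"
  assumes f: "\<And>r \<theta>. r \<in> {0<..R} \<Longrightarrow> \<theta> \<in> sphere 0 1 \<Longrightarrow> ((\<lambda>s. f s \<theta>) has_vector_derivative f' r \<theta>) (at r within {0<..R})"
      "polar_C0 R f'" and y: "y \<in> cball 0 R - {0}"
    and D: "((\<lambda>z. f (norm y) (sgn z)) has_derivative D) (at y)"
  shows "((\<lambda>z. f (norm z) (sgn z)) has_derivative (\<lambda>v. D v + (sgn y \<bullet> v) *\<^sub>R f' (norm y) (sgn y)))
           (at y within cball 0 R - {0})"
proof -
  define U where "U = - {0::'a}"
  define I where "I = {0<..R}"
  have yU: "y \<in> U" "norm y \<in> I" using y by (auto simp: U_def I_def)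
  have "continuous_on (U \<times> I) (\<lambda>p. (\<lambda>(r, \<theta>). f' r \<theta>) (snd p, sgn (fst p)))"
    using f(2) unfolding polar_C0_def
    by (rule continuous_on_compose2) (auto intro!: continuous_intros simp: norm_sgn U_def I_def)
  then have "continuous_on (U \<times> I) (\<lambda>p. blinfun_scaleR_left (f' (snd p) (sgn (fst p))))"
    by (intro bounded_linear.continuous_on[OF bounded_linear_blinfun_scaleR_left]) simp
  then have "continuous (at (y, norm y) within U \<times> I) (\<lambda>p. blinfun_scaleR_left (f' (snd p) (sgn (fst p))))"
    using yU by (auto simp: continuous_on_eq_continuous_within)
  then have cont: "continuous (at (y, norm y) within U \<times> I) (\<lambda>(z, s). blinfun_scaleR_left (f' s (sgn z)))"
    by (simp add: case_prod_beta')
  have "((\<lambda>(z, s). f s (sgn z)) has_derivative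
     (\<lambda>(tz, ts). D tz + blinfun_apply (blinfun_scaleR_left (f' (norm y) (sgn y))) ts)) (at (y, norm y) within U \<times> I)"
  proof (rule has_derivative_partialsI[where fy = "\<lambda>z s. blinfun_scaleR_left (f' s (sgn z))"])
    show "((\<lambda>z. f (norm y) (sgn z)) has_derivative D) (at y within U)"
      using D by (rule has_derivative_at_withinI)
    show "((\<lambda>s. f s (sgn z)) has_derivative blinfun_apply (blinfun_scaleR_left (f' s (sgn z)))) (at s within I)"
      if "z \<in> U" "s \<in> I" for z s
    proof -
      have "s \<in> {0<..R}" "sgn z \<in> sphere 0 1" using that by (auto simp: U_def I_def norm_sgn)
      from f(1)[OF this] show ?thesis
        unfolding has_vector_derivative_def I_def blinfun_scaleR_left.rep_eq .
    qed
  qed (use yU cont in \<open>auto simp: I_def\<close>)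
  then have *: "((\<lambda>(z, s). f s (sgn z)) has_derivative
     (\<lambda>(tz, ts). D tz + ts *\<^sub>R f' (norm y) (sgn y))) (at (y, norm y) within U \<times> I)"
    by (simp only: blinfun_scaleR_left.rep_eq)
  have n: "((\<lambda>z. (z, norm z)) has_derivative (\<lambda>v. (v, sgn y \<bullet> v))) (at y within cball 0 R - {0})"
  proof (rule has_derivative_at_withinI, intro has_derivative_Pair has_derivative_ident)
    show "(norm has_derivative (\<lambda>v. sgn y \<bullet> v)) (at y)"
    proof -
      have "y \<noteq> 0" using y by auto
      then show ?thesis using has_derivative_norm[OF \<open>y \<noteq> 0\<close>] by (simp only: inner_commute)
    qed
  qed
  have "((\<lambda>z. (\<lambda>(z, s). f s (sgn z)) (z, norm z)) has_derivative
     (\<lambda>v. (\<lambda>(tz, ts). D tz + ts *\<^sub>R f' (norm y) (sgn y)) (v, sgn y \<bullet> v))) (at y within cball 0 R - {0})"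
    by (rule has_derivative_in_compose[OF n has_derivative_subset[OF *]]) (auto simp: U_def I_def)
  then show ?thesis by (simp only: prod.case)
qed

lemma polar_has_derivative_at:
  fixes f :: "real \<Rightarrow> 'a::euclidean_space \<Rightarrow> 'b::real_normed_vector"
  assumes f: "\<And>r \<theta>. r \<in> {0<..R} \<Longrightarrow> \<theta> \<in> sphere 0 1 \<Longrightarrow> ((\<lambda>s. f s \<theta>) has_vector_derivative f' r \<theta>) (at r within {0<..R})"
      "polar_C0 R f'" and y: "y \<in> ball 0 R - {0}"
    and D: "((\<lambda>z. f (norm y) (sgn z)) has_derivative D) (at y)"
  shows "((\<lambda>z. f (norm z) (sgn z)) has_derivative (\<lambda>v. D v + (sgn y \<bullet> v) *\<^sub>R f' (norm y) (sgn y))) (at y)"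
proof -
  have "((\<lambda>z. f (norm z) (sgn z)) has_derivative (\<lambda>v. D v + (sgn y \<bullet> v) *\<^sub>R f' (norm y) (sgn y))) (at y within cball 0 R - {0})"
    using f y D by (intro polar_has_derivative) auto
  then have "((\<lambda>z. f (norm z) (sgn z)) has_derivative (\<lambda>v. D v + (sgn y \<bullet> v) *\<^sub>R f' (norm y) (sgn y))) (at y within ball 0 R - {0})"
    by (rule has_derivative_subset) auto
  moreover have "at y within ball 0 R - {0} = at y" using y by (intro at_within_open) auto
  ultimately show ?thesis by (simp only:)
qed

text \<open>If the gradients of \<open>g r\<close> are differentiable in \<open>r\<close>, then the \<open>r\<close>-derivative of \<open>g\<close> is differentiable in
  the angle: the mean value theorem in the angle is applied to difference quotients in \<open>r\<close>.\<close>

lemma has_derivative_r_deriv_comp_sgn: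
  fixes f :: "real \<Rightarrow> 'a::euclidean_space \<Rightarrow> real"
  assumes f: "r_differentiable R f" 
    and g: "\<And>r. r \<in> {0<..R} \<Longrightarrow> \<forall>\<theta>\<in>sphere 0 1. (\<lambda>x. f r (sgn x)) differentiable (at \<theta>)"
    and g1: "C1_in_r R (\<lambda>r. sphere_grad (f r))"
    and r: "r \<in> {0<..<R}" and z0: "z0 \<in> sphere 0 1"
  shows "((\<lambda>z. r_deriv R f r (sgn z)) has_derivative
           (\<lambda>v. r_deriv R (\<lambda>r. sphere_grad (f r)) r z0 \<bullet> v)) (at z0)"
proof -
  define k where "k = r_deriv R (\<lambda>r. sphere_grad (f r))"
  \<comment> \<open>\<open>G\<close> and \<open>\<kappa>\<close> belong to the 0-homogeneous
    extensions. They live off the origin, because the segments used in the mean value theorem leave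
    the sphere.\<close>
  define G where "G s z = sphere_grad (f s) (sgn z) /\<^sub>R norm z" for s z
  define \<kappa> where "\<kappa> s z = k s (sgn z) /\<^sub>R norm z" for s z
  have n0: "norm z0 = 1" "z0 \<noteq> 0" "sgn z0 = z0" using z0 by (auto simp: sgn_div_norm)
  have fG: "((\<lambda>z. f s (sgn z)) has_derivative (\<lambda>v. G s z \<bullet> v)) (at z)" if "s \<in> {0<..R}" "z \<noteq> 0" for s z
  proof -
    have "((\<lambda>x. f s (sgn x)) has_derivative (\<lambda>v. (sphere_grad (f s) (sgn z) \<bullet> v) /\<^sub>R norm z)) (at z)"
      using that g[OF that(1)] by (intro has_derivative_comp_sgn_scale sphere_grad_works) (auto simp: norm_sgn)
    moreover have "(sphere_grad (f s) (sgn z) \<bullet> v) /\<^sub>R norm z = G s z \<bullet> v" for v by (simp add: G_def)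
    ultimately show ?thesis by (simp only:)
  qed
  have Gk: "((\<lambda>s. G s z) has_vector_derivative \<kappa> s z) (at s within {0<..R})" if "s \<in> {0<..R}" "z \<noteq> 0" for s z
  proof -
    have "((\<lambda>s. sphere_grad (f s) (sgn z)) has_vector_derivative k s (sgn z)) (at s within {0<..R})"
      unfolding k_def using g1 that by (intro r_deriv_works) (auto simp: C1_in_r_def norm_sgn)
    then show ?thesis unfolding G_def \<kappa>_def by (rule bounded_linear.has_vector_derivative[OF bounded_linear_scaleR_right])
  qed
  have contk: "continuous_on ({0<..<R} \<times> (- {0})) (\<lambda>p. \<kappa> (fst p) (snd p))"
  proof -
    have "continuous_on ({0<..R} \<times> sphere 0 1) (\<lambda>(r, \<theta>). k r \<theta>)"
      using g1 unfolding polar_C0_def C1_in_r_def k_def by blast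
    then have "continuous_on ({0<..<R} \<times> (- {0})) (\<lambda>p. (\<lambda>(r, \<theta>). k r \<theta>) (fst p, sgn (snd p)))"
      by (rule continuous_on_compose2) (auto intro!: continuous_intros simp: norm_sgn)
    then show ?thesis unfolding \<kappa>_def by (auto intro!: continuous_intros)
  qed
  have "((\<lambda>z. r_deriv R f r (sgn z)) has_derivative (\<lambda>v. \<kappa> r z0 \<bullet> v)) (at z0)"
    unfolding has_derivative_at_alt
  proof (intro conjI allI impI)
    show "bounded_linear (\<lambda>v. \<kappa> r z0 \<bullet> v)" by (rule bounded_linear_inner_right)
    fix e :: real assume e: "0 < e"
    have "open ({0<..<R} \<times> (- {0::'a}))" by (intro open_Times) auto
    then have "isCont (\<lambda>p. \<kappa> (fst p) (snd p)) (r, z0)"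
      using contk r n0 by (auto simp: continuous_on_eq_continuous_at)
    then obtain d where d: "d > 0" "\<And>p. dist p (r, z0) < d \<Longrightarrow> dist (\<kappa> (fst p) (snd p)) (\<kappa> r z0) < e"
      using e unfolding continuous_at_eps_delta by (metis fst_conv snd_conv)
    \<comment> \<open>This radius keeps \<open>s\<close> between 0 and \<open>R\<close> and, being
      at most 1, keeps \<open>z\<close> away from the origin.\<close>
    define d' where "d' = Min {d / 2, r, R - r, 1}"
    have d': "0 < d'" "d' \<le> d / 2" "d' \<le> r" "d' \<le> R - r" "d' \<le> 1" using d(1) r unfolding d'_def by (auto simp: min_def)
    have near: "norm (\<kappa> s z - \<kappa> r z0) \<le> e" if "\<bar>s - r\<bar> < d'" "norm (z - z0) < d'" for s z
    proof -
      have "dist (s, z) (r, z0) \<le> dist s r + dist z z0" by (rule dist_Pair_Pair[THEN eq_refl, THEN order_trans]) (rule sqrt_sum_squares_le_sum; simp)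
      also have "\<dots> < d" using that d' by (simp add: dist_norm)
      finally show ?thesis using d(2)[of "(s, z)"] by (simp add: dist_norm)
    qed
    show "\<exists>d>0. \<forall>y. norm (y - z0) < d \<longrightarrow>
       norm (r_deriv R f r (sgn y) - r_deriv R f r (sgn z0) - \<kappa> r z0 \<bullet> (y - z0)) \<le> e * norm (y - z0)"
    proof (intro exI[of _ d'] conjI allI impI)
      fix z assume z: "norm (z - z0) < d'"
      have nz: "w \<noteq> 0" if "w \<in> ball z0 d'" for w
        using that n0 d' by (auto simp: dist_norm)
      have zb: "z \<in> ball z0 d'" using z by (simp add: dist_norm norm_minus_commute)
      \<comment> \<open>The derivative of \<open>q\<close> at \<open>r\<close> is the error to be
        estimated. A bound of its increments by \<open>e * norm (z - z0)\<close> times the increment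
        of \<open>s\<close> passes to that derivative.\<close>
      define q where "q s = (f s (sgn z) - f s (sgn z0)) - s * (\<kappa> r z0 \<bullet> (z - z0))" for s
      have q: "\<bar>q s - q r\<bar> \<le> \<bar>s - r\<bar> * (e * norm (z - z0))" if s: "\<bar>s - r\<bar> < d'" for s
      proof -
        have sI: "t \<in> {0<..<R}" if "\<bar>t - r\<bar> < d'" for t using that d' by auto
        have r': "\<bar>r - r\<bar> < d'" using d' by simp
        define m where "m w = f s (sgn w) - f r (sgn w) - (s - r) * (\<kappa> r z0 \<bullet> w)" for w
        have dm: "(m has_derivative (\<lambda>v. (G s w - G r w - (s - r) *\<^sub>R \<kappa> r z0) \<bullet> v)) (at w within ball z0 d')"
          if "w \<in> ball z0 d'" for w
        proof (rule has_derivative_at_withinI)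
          have "(m has_derivative (\<lambda>v. G s w \<bullet> v - G r w \<bullet> v - (s - r) * (\<kappa> r z0 \<bullet> v))) (at w)"
            unfolding m_def using fG[of s w] fG[of r w] sI[OF s] sI[OF r'] nz[OF that]
            by (intro has_derivative_diff has_derivative_mult_right has_derivative_inner_right has_derivative_ident) auto
          moreover have "G s w \<bullet> v - G r w \<bullet> v - (s - r) * (\<kappa> r z0 \<bullet> v) = (G s w - G r w - (s - r) *\<^sub>R \<kappa> r z0) \<bullet> v" for v
            by (simp add: inner_simps)
          ultimately show "(m has_derivative (\<lambda>v. (G s w - G r w - (s - r) *\<^sub>R \<kappa> r z0) \<bullet> v)) (at w)" by (simp only:)
        qed
        have bnd: "onorm (\<lambda>v. (G s w - G r w - (s - r) *\<^sub>R \<kappa> r z0) \<bullet> v) \<le> \<bar>s - r\<bar> * e" if w: "w \<in> ball z0 d'" for w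
        proof -
          have "norm ((G s w - s *\<^sub>R \<kappa> r z0) - (G r w - r *\<^sub>R \<kappa> r z0)) \<le> e * norm (s - r)"
          proof (rule differentiable_bound[of "{t. \<bar>t - r\<bar> < d'}" "\<lambda>t. G t w - t *\<^sub>R \<kappa> r z0" "\<lambda>t h. h *\<^sub>R (\<kappa> t w - \<kappa> r z0)"])
            show "convex {t. \<bar>t - r\<bar> < d'}"
            proof -
              have "{t. \<bar>t - r\<bar> < d'} = {r - d'<..<r + d'}" by auto
              then show ?thesis by simp
            qed
            fix t assume t: "t \<in> {t. \<bar>t - r\<bar> < d'}"
            have "((\<lambda>t. G t w - t *\<^sub>R \<kappa> r z0) has_vector_derivative \<kappa> t w - \<kappa> r z0) (at t within {0<..R})"
              using Gk[of t w] sI[of t] t nz[OF w] by (auto intro!: derivative_eq_intros)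
            then have "((\<lambda>t. G t w - t *\<^sub>R \<kappa> r z0) has_vector_derivative \<kappa> t w - \<kappa> r z0) (at t within {t. \<bar>t - r\<bar> < d'})"
              by (rule has_vector_derivative_within_subset) (use sI in force)
            then show "((\<lambda>t. G t w - t *\<^sub>R \<kappa> r z0) has_derivative (\<lambda>h. h *\<^sub>R (\<kappa> t w - \<kappa> r z0))) (at t within {t. \<bar>t - r\<bar> < d'})"
              by (simp only: has_vector_derivative_def)
            show "onorm (\<lambda>h. h *\<^sub>R (\<kappa> t w - \<kappa> r z0)) \<le> e"
              using near[of t w] t w e
              by (intro onorm_le) (auto simp: dist_norm norm_minus_commute mult.commute[of e] intro!: mult_left_mono)
          qed (use s r' in auto)
          then have "norm (G s w - G r w - (s - r) *\<^sub>R \<kappa> r z0) \<le> \<bar>s - r\<bar> * e"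
            by (simp add: algebra_simps)
          then show ?thesis
            by (intro onorm_le) (auto intro!: order_trans[OF Cauchy_Schwarz_ineq2] mult_right_mono)
        qed
        have "norm (m z - m z0) \<le> \<bar>s - r\<bar> * e * norm (z - z0)"
          using zb d' by (intro differentiable_bound[OF convex_ball[of z0 d'] dm bnd]) auto
        moreover have "m z - m z0 = q s - q r" by (simp add: m_def q_def inner_simps algebra_simps)
        ultimately show ?thesis by (simp add: mult.assoc)
      qed
      define L where "L = r_deriv R f r (sgn z) - r_deriv R f r (sgn z0) - \<kappa> r z0 \<bullet> (z - z0)"
      have der: "(q has_real_derivative L) (at r)"
      proof -
        have "((\<lambda>s. f s (sgn w)) has_real_derivative r_deriv R f r (sgn w)) (at r)" if "w \<in> ball z0 d'" for w
          unfolding has_real_derivative_iff_has_vector_derivative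
          using nz[OF that] by (intro r_deriv_works_at[OF f r]) (simp add: norm_sgn)
        from this[OF zb] this[of z0] show ?thesis
          unfolding q_def L_def using d' by (auto intro!: derivative_eq_intros)
      qed
      then have "((\<lambda>s. \<bar>(q s - q r) / (s - r)\<bar>) \<longlongrightarrow> \<bar>L\<bar>) (at r)"
        by (intro tendsto_rabs) (simp add: has_field_derivative_iff DERIV_def LIM_offset_zero_iff)
      moreover have "eventually (\<lambda>s. \<bar>(q s - q r) / (s - r)\<bar> \<le> e * norm (z - z0)) (at r)"
        unfolding eventually_at
      proof (intro exI[of _ d'] conjI ballI impI)
        fix s assume "s \<noteq> r \<and> dist s r < d'"
        then show "\<bar>(q s - q r) / (s - r)\<bar> \<le> e * norm (z - z0)"
          using q[of s] by (simp add: dist_real_def field_simps)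
      qed (use d' in auto)
      ultimately have "\<bar>L\<bar> \<le> e * norm (z - z0)" by (rule tendsto_upperbound) simp
      then show "norm (r_deriv R f r (sgn z) - r_deriv R f r (sgn z0) - \<kappa> r z0 \<bullet> (z - z0)) \<le> e * norm (z - z0)"
        by (simp add: L_def)
    qed (use d' in auto)
  qed
  moreover have "\<kappa> r z0 = r_deriv R (\<lambda>r. sphere_grad (f r)) r z0" using n0 by (simp add: \<kappa>_def k_def)
  ultimately show ?thesis by (simp only:)
qed


section \<open>Parametrisation by the inverse transport\<close>

lemma density_measure_simps:
  assumes "S \<in> sets borel"
  shows "sets (density_measure S \<rho>) = sets (restrict_space borel S)" "space (density_measure S \<rho>) = S"
  using assms by (auto simp: density_measure_def space_restrict_space sets_restrict_space)

lemma nn_integral_density_measure: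
  assumes S: "S \<in> sets borel" and \<rho>: "\<rho> \<in> borel_measurable (restrict_space borel S)"
    and f: "f \<in> borel_measurable (restrict_space borel S)"
  shows "(\<integral>\<^sup>+x. f x \<partial>density_measure S \<rho>) = (\<integral>\<^sup>+x\<in>S. ennreal (\<rho> x) * f x \<partial>lborel)"
proof -
  have "(\<lambda>x. ennreal (\<rho> x)) \<in> borel_measurable (restrict_space lborel S)"
  proof -
    have "borel_measurable (restrict_space lborel S) = (borel_measurable (restrict_space borel S) :: ('a \<Rightarrow> real) set)"
      by (intro measurable_cong_sets) (auto simp: sets_restrict_space)
    then show ?thesis using \<rho> by (intro measurable_compose[OF _ measurable_ennreal]) simp
  qed
  moreover have "f \<in> borel_measurable (restrict_space lborel S)"
  proof -
    have "borel_measurable (restrict_space lborel S) = (borel_measurable (restrict_space borel S) :: ('a \<Rightarrow> ennreal) set)"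
      by (intro measurable_cong_sets) (auto simp: sets_restrict_space)
    then show ?thesis using f by simp
  qed
  ultimately have "(\<integral>\<^sup>+x. f x \<partial>density_measure S \<rho>) = (\<integral>\<^sup>+x. ennreal (\<rho> x) * f x \<partial>restrict_space lborel S)"
    unfolding density_measure_def by (rule nn_integral_density)
  also have "\<dots> = (\<integral>\<^sup>+x\<in>S. ennreal (\<rho> x) * f x \<partial>lborel)"
    using S by (intro nn_integral_restrict_space) simp
  finally show ?thesis .
qed

text \<open>The density is prescribed off the origin, which is a null set. The constant
  \<open>C\<close> is a parameter here; its value is later forced by the total mass.\<close>

locale radial_target_transport =
  regular_gauss_mass_transport A R \<rho>0 \<rho>1 T \<phi>
  for A :: "(real^'n) set" and R :: real
    and \<rho>0 \<rho>1 :: "real^'n \<Rightarrow> real"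
    and T :: "real^'n \<Rightarrow> real^'n" and \<phi> :: "real^'n \<Rightarrow> real" +
  fixes C :: real
  assumes target_density: "x \<in> cball 0 R - {0} \<Longrightarrow> \<rho>1 x = C / norm x ^ (CARD('n) - 1)"
begin

abbreviation "H \<equiv> level_support A \<phi>"
abbreviation "h \<equiv> r_deriv R H"
abbreviation "X \<equiv> inverse_transport A \<phi>"
abbreviation "k \<equiv> r_deriv R (\<lambda>r. sphere_grad (H r))"
abbreviation "Q r \<equiv> sphere_hess (H r)"

section \<open>Sublevel sets, their support functions and their contact points\<close>

lemma sublevel_compact: "compact (sublevel A \<phi> r)"
proof -
  have "sublevel A \<phi> r = A \<inter> \<phi> -` {..r}" by (auto simp: sublevel_def)
  moreover have "closed (A \<inter> \<phi> -` {..r})"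
    using compact_imp_closed[OF compact_A] by (intro continuous_closed_preimage continuous_\<phi>) auto
  ultimately have "closed (sublevel A \<phi> r)" by simp
  moreover have "sublevel A \<phi> r = A \<inter> sublevel A \<phi> r" by (auto simp: sublevel_def)
  ultimately show ?thesis by (metis compact_A compact_Int_closed)
qed

lemma zero_in_sublevel: "0 \<le> r \<Longrightarrow> 0 \<in> sublevel A \<phi> r"
  using origin by (auto simp: sublevel_def)

lemma sublevel_mono: "r \<le> s \<Longrightarrow> sublevel A \<phi> r \<subseteq> sublevel A \<phi> s"
  by (auto simp: sublevel_def)

lemma sublevel_R: "sublevel A \<phi> R = A"
  using range_\<phi> by (auto simp: sublevel_def)

lemma inner_le_H: "x \<in> sublevel A \<phi> r \<Longrightarrow> \<theta> \<bullet> x \<le> H r \<theta>"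
  unfolding level_support_def
proof (rule cSUP_upper)
  have "compact ((\<lambda>x. \<theta> \<bullet> x) ` sublevel A \<phi> r)"
    by (intro compact_continuous_image sublevel_compact continuous_intros)
  then show "bdd_above ((\<lambda>x. \<theta> \<bullet> x) ` sublevel A \<phi> r)"
    by (intro bounded_imp_bdd_above compact_imp_bounded)
qed

lemma H_le: "0 \<le> r \<Longrightarrow> (\<And>x. x \<in> sublevel A \<phi> r \<Longrightarrow> \<theta> \<bullet> x \<le> c) \<Longrightarrow> H r \<theta> \<le> c"
  unfolding level_support_def using zero_in_sublevel by (intro cSUP_least) auto

lemma H_mono: "0 \<le> r \<Longrightarrow> r \<le> s \<Longrightarrow> H r \<theta> \<le> H s \<theta>"
  using inner_le_H sublevel_mono by (intro H_le) blast+

text \<open>Differentiability of the support function leaves only one contact point per direction.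
  Points given by a normal, in \<open>A\<close> or on its frontier, are later identified with values
  of \<open>X\<close> in this way.\<close>

lemma X_unique:
  assumes "r \<in> {0<..R}" "\<theta> \<in> sphere 0 1" "x \<in> sublevel A \<phi> r" "\<theta> \<bullet> x \<ge> H r \<theta>"
  shows "x = X r \<theta>"
  unfolding inverse_transport_def
proof (rule support_point_eq_gradient)
  show "(\<lambda>z. H r (sgn z)) differentiable (at \<theta>)"
    using H_\<theta>\<theta>_exists[OF assms(1)] assms(2) by (simp add: sphere_twice_differentiable_def)
  show "\<theta> \<bullet> x = H r \<theta>" using assms inner_le_H by (intro antisym) auto
qed (use assms inner_le_H in auto)

lemma X_in: 
  assumes "r \<in> {0<..R}" "\<theta> \<in> sphere 0 1"
  shows "X r \<theta> \<in> sublevel A \<phi> r" "\<theta> \<bullet> X r \<theta> = H r \<theta>" "X r \<theta> \<in> A"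
proof -
  have r: "0 \<le> r" using assms by auto
  obtain x where x: "x \<in> sublevel A \<phi> r" "\<And>y. y \<in> sublevel A \<phi> r \<Longrightarrow> \<theta> \<bullet> y \<le> \<theta> \<bullet> x"
  proof -
    have "continuous_on (sublevel A \<phi> r) (\<lambda>x. \<theta> \<bullet> x)" by (intro continuous_intros)
    then have "\<exists>x\<in>sublevel A \<phi> r. \<forall>y\<in>sublevel A \<phi> r. \<theta> \<bullet> y \<le> \<theta> \<bullet> x"
      using continuous_attains_sup[OF sublevel_compact] zero_in_sublevel[OF r] by blast
    then show ?thesis using that by blast
  qed
  have "H r \<theta> \<le> \<theta> \<bullet> x" using r x(2) by (rule H_le)
  then show "X r \<theta> \<in> sublevel A \<phi> r" "\<theta> \<bullet> X r \<theta> = H r \<theta>"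
    using X_unique[OF assms x(1)] x inner_le_H[OF x(1), of \<theta>] by auto
  then show "X r \<theta> \<in> A" by (auto simp: sublevel_def)
qed

lemma exists_unit: "\<exists>\<theta>::real^'n. \<theta> \<in> sphere 0 1"
  using vector_choose_size[of 1] by auto

lemma A_borel [measurable]: "A \<in> sets borel"
  using compact_A by (intro borel_closed compact_imp_closed)

text \<open>Nonnegativity is read off at a boundary point of the ball; with \<open>C = 0\<close> the
  target measure would have no mass.\<close>

lemma C_pos: "C > 0"
proof -
  obtain \<theta> :: "real^'n" where \<theta>: "\<theta> \<in> sphere 0 1" using exists_unit by blast
  have "0 \<le> \<rho>1 (R *\<^sub>R \<theta>)" using density1 \<theta> R_pos by (auto simp: probability_density_on_def)
  moreover have "R *\<^sub>R \<theta> \<in> cball 0 R - {0}" "norm (R *\<^sub>R \<theta>) = R" using \<theta> R_pos by auto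
  ultimately have "0 \<le> C / R ^ (CARD('n) - 1)" using target_density by metis
  then have "0 \<le> C / R ^ (CARD('n) - 1) * R ^ (CARD('n) - 1)" using R_pos by (intro mult_nonneg_nonneg) auto
  then have "0 \<le> C" using R_pos by simp
  moreover have "C \<noteq> 0"
  proof
    assume C0: "C = 0"
    have ps: "prob_space (density_measure (cball 0 R) \<rho>1)" and m: "\<rho>1 \<in> borel_measurable (restrict_space borel (cball 0 R))"
      using density1 by (auto simp: probability_density_on_def)
    have "1 = emeasure (density_measure (cball 0 R) \<rho>1) (space (density_measure (cball 0 R) \<rho>1))"
      using ps by (simp add: prob_space.emeasure_space_1)
    also have "\<dots> = (\<integral>\<^sup>+x. 1 \<partial>density_measure (cball 0 R) \<rho>1)" by simp
    also have "\<dots> = (\<integral>\<^sup>+x\<in>cball 0 R. ennreal (\<rho>1 x) * 1 \<partial>lborel)"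
      by (rule nn_integral_density_measure) (use m in auto)
    also have "\<dots> = (\<integral>\<^sup>+(x::real^'n). 0 \<partial>lborel)"
    proof (rule nn_integral_cong_AE)
      have "AE x in lborel. x \<noteq> (0::real^'n)" by (rule AE_lborel_singleton)
      then show "AE x in lborel. ennreal (\<rho>1 x) * 1 * indicator (cball 0 R) x = 0"
        by eventually_elim (use target_density C0 in \<open>auto simp: indicator_def\<close>)
    qed
    finally show False by simp
  qed
  ultimately show ?thesis by simp
qed

lemma cov:
  assumes "r \<in> {0<..R}" "\<theta> \<in> sphere 0 1"
  shows "C = \<rho>0 (X r \<theta>) * h r \<theta> * tangent_det \<theta> (\<lambda>v. H r \<theta> *\<^sub>R v + Q r \<theta> v)"
proof -
  have "r *\<^sub>R \<theta> \<in> cball 0 R - {0}" "norm (r *\<^sub>R \<theta>) = r" using assms by auto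
  then have "\<rho>1 (r *\<^sub>R \<theta>) * r ^ (CARD('n) - 1) = C" using target_density assms by auto
  then show ?thesis using change_of_variables[OF assms] by simp
qed

text \<open>The product in the Monge-Ampere equation is \<open>C > 0\<close> and its first two
  factors are nonnegative, so all three are positive. In particular \<open>1 / norm\<close> in the
  equation for \<open>H_r\<close> is never the default value 0: the gradient of \<phi> does not
  vanish at these points.\<close>

lemma positivity:
  assumes "r \<in> {0<..R}" "\<theta> \<in> sphere 0 1"
  shows "0 < h r \<theta>" "0 < \<rho>0 (X r \<theta>)" "0 < tangent_det \<theta> (\<lambda>v. H r \<theta> *\<^sub>R v + Q r \<theta> v)"
proof -
  have "0 \<le> h r \<theta>" "0 \<le> \<rho>0 (X r \<theta>)"
    using density0 X_in[OF assms] H_r_eq[OF assms] by (auto simp: probability_density_on_def)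
  moreover have "h r \<theta> \<noteq> 0" "\<rho>0 (X r \<theta>) \<noteq> 0" using cov[OF assms] C_pos by auto
  ultimately show *: "0 < h r \<theta>" "0 < \<rho>0 (X r \<theta>)" by auto
  have "0 < (\<rho>0 (X r \<theta>) * h r \<theta>) * tangent_det \<theta> (\<lambda>v. H r \<theta> *\<^sub>R v + Q r \<theta> v)"
    using cov[OF assms] C_pos by simp
  then show "0 < tangent_det \<theta> (\<lambda>v. H r \<theta> *\<^sub>R v + Q r \<theta> v)"
    using * by (metis mult_pos_pos zero_less_mult_pos)
qed


lemma H_strict:
  assumes "0 \<le> s" "s < r" "r \<le> R" "\<theta> \<in> sphere 0 1"
  shows "H s \<theta> < H r \<theta>"
proof -
  \<comment> \<open>At \<open>s = 0\<close> no derivative is available and at \<open>r = R\<close>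
    only a one-sided one. The middle third avoids both ends, and monotonicity covers the
    rest.\<close>
  define t where "t = s + (r - s) / 3"
  define u where "u = s + 2 * (r - s) / 3"
  have t: "0 < t" "s < t" "t < u" "u < r" using assms by (auto simp: t_def u_def field_simps)
  have "\<exists>z>t. z < u \<and> H u \<theta> - H t \<theta> = (u - t) * h z \<theta>"
  proof (rule MVT2[OF t(3)])
    fix x assume x: "t \<le> x" "x \<le> u"
    show "((\<lambda>s. H s \<theta>) has_real_derivative h x \<theta>) (at x)"
      unfolding has_real_derivative_iff_has_vector_derivative
      by (rule r_deriv_works_at[OF H_r_exists]) (use x t assms in auto)
  qed
  then obtain z where z: "t < z" "z < u" "H u \<theta> - H t \<theta> = (u - t) * h z \<theta>" by blast
  have "h z \<theta> > 0" using z t assms by (intro positivity) auto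
  then have "H t \<theta> < H u \<theta>" using z(3) t by (metis diff_gt_0_iff_gt mult_pos_pos)
  moreover have "H s \<theta> \<le> H t \<theta>" "H u \<theta> \<le> H r \<theta>" using t assms by (auto intro!: H_mono)
  ultimately show ?thesis by simp
qed

lemma H_pos: "r \<in> {0<..R} \<Longrightarrow> \<theta> \<in> sphere 0 1 \<Longrightarrow> 0 < H r \<theta>"
  using H_strict[of 0 r \<theta>] H_origin[of \<theta>] by auto

text \<open>Otherwise a smaller sublevel set would already attain the support value
  \<open>H r \<theta>\<close>, against strict monotonicity in the radius.\<close>

lemma \<phi>_X:
  assumes "r \<in> {0<..R}" "\<theta> \<in> sphere 0 1"
  shows "\<phi> (X r \<theta>) = r"
proof (rule ccontr)
  assume ne: "\<phi> (X r \<theta>) \<noteq> r"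
  define s where "s = \<phi> (X r \<theta>)"
  have s: "0 \<le> s" "s < r" using X_in[OF assms] ne range_\<phi> by (auto simp: s_def sublevel_def)
  have "X r \<theta> \<in> sublevel A \<phi> s" using X_in[OF assms] by (auto simp: s_def sublevel_def)
  then have "H r \<theta> \<le> H s \<theta>" using inner_le_H X_in(2)[OF assms] by metis
  then show False using H_strict[of s r \<theta>] s assms by auto
qed

text \<open>The derivative of \<open>X r\<close> along the sphere, extended by zero in the direction
  \<theta>.\<close>

definition L :: "real \<Rightarrow> real^'n \<Rightarrow> real^'n \<Rightarrow> real^'n" where
  "L r \<theta> v = H r \<theta> *\<^sub>R tangential \<theta> v + Q r \<theta> v"

lemma
  assumes "r \<in> {0<..R}" "\<theta> \<in> sphere 0 1"
  shows linear_L: "linear (L r \<theta>)" 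
    and L_tangential: "L r \<theta> (tangential \<theta> v) = L r \<theta> v"
    and inner_L: "\<theta> \<bullet> L r \<theta> v = 0"
    and L_eq_0: "L r \<theta> v = 0 \<Longrightarrow> tangential \<theta> v = 0"
    and X_has_derivative: "((\<lambda>z. X r (sgn z)) has_derivative L r \<theta>) (at \<theta>)"
proof -
  note hw = sphere_hess_works[OF H_\<theta>\<theta>_exists[OF assms(1)] assms(2)]
  have n: "norm \<theta> = 1" using assms by simp
  show lin: "linear (L r \<theta>)"
    unfolding L_def by (rule linearI) (auto simp: linear_add[OF hw(1)] linear_cmul[OF hw(1)] algebra_simps)
  have tt: "tangential \<theta> (tangential \<theta> v) = tangential \<theta> v" for v
    by (rule tangential_idem) (rule inner_tangential[OF n])
  show Lt: "L r \<theta> (tangential \<theta> v) = L r \<theta> v" for v by (simp add: L_def hw(2) tt)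
  show iL: "\<theta> \<bullet> L r \<theta> v = 0" for v
    using hw(3) n by (simp add: L_def inner_right_distrib inner_tangential)
  show "((\<lambda>z. X r (sgn z)) has_derivative L r \<theta>) (at \<theta>)"
    unfolding inverse_transport_def L_def[abs_def] by (rule hw(4))
  assume L0: "L r \<theta> v = 0"
  \<comment> \<open>The endomorphism inside \<open>tangent_det\<close>: it agrees with
    \<open>L r \<theta>\<close> on the tangent space and fixes \<theta>, so a nonzero determinant
    makes \<open>L r \<theta>\<close> injective on tangent vectors.\<close>
  define M where "M v = (H r \<theta> *\<^sub>R tangential \<theta> v + Q r \<theta> (tangential \<theta> v)) + (\<theta> \<bullet> v) *\<^sub>R \<theta>" for v
  have M_eq: "M v = L r \<theta> v + (\<theta> \<bullet> v) *\<^sub>R \<theta>" for v by (simp add: M_def L_def hw(2))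
  have linM: "linear M"
    unfolding M_eq by (rule linearI) (auto simp: linear_add[OF lin] linear_cmul[OF lin] algebra_simps inner_simps)
  have "det (matrix M) \<noteq> 0"
    using positivity(3)[OF assms] unfolding tangent_det_def M_def by simp
  then have "inj M" using det_nz_iff_inj[OF linM] by simp
  moreover have "M (tangential \<theta> v) = 0"
    using L0 Lt n by (simp add: M_eq inner_tangential)
  ultimately show "tangential \<theta> v = 0" using linM by (simp add: linear_injective_0)
qed

text \<open>If a point had two normals, every direction between them would be a normal there as
  well. Then \<open>X r\<close> would be constant on an arc and its derivative would annihilate a
  nonzero tangent vector, against the positive determinant.\<close>

lemma X_inj:
  assumes r: "r \<in> {0<..R}" and \<theta>: "\<theta>1 \<in> sphere 0 1" "\<theta>2 \<in> sphere 0 1" and eq: "X r \<theta>1 = X r \<theta>2"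
  shows "\<theta>1 = \<theta>2"
proof (rule ccontr)
  assume ne: "\<theta>1 \<noteq> \<theta>2"
  define x where "x = X r \<theta>1"
  have x: "x \<in> sublevel A \<phi> r" "\<theta>1 \<bullet> x = H r \<theta>1" "\<theta>2 \<bullet> x = H r \<theta>2"
    using X_in[OF r \<theta>(1)] X_in[OF r \<theta>(2)] eq by (auto simp: x_def)
  \<comment> \<open>Opposite normals are excluded because the support function is positive. This
    keeps the segment between the two normals away from the origin.\<close>
  have nopp: "\<theta>2 \<noteq> - \<theta>1"
    using H_pos[OF r \<theta>(1)] H_pos[OF r \<theta>(2)] x by auto
  have n: "norm \<theta>1 = 1" "norm \<theta>2 = 1" using \<theta> by auto
  have tg: "tangential \<theta>1 (\<theta>2 - \<theta>1) \<noteq> 0"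
  proof
    assume "tangential \<theta>1 (\<theta>2 - \<theta>1) = 0"
    then have e: "\<theta>2 = (\<theta>1 \<bullet> \<theta>2) *\<^sub>R \<theta>1" using n by (simp add: tangential_def inner_simps dot_square_norm algebra_simps)
    then have "\<bar>\<theta>1 \<bullet> \<theta>2\<bar> = 1" using n by (metis mult.right_neutral norm_scaleR)
    then have "\<theta>1 \<bullet> \<theta>2 = 1 \<or> \<theta>1 \<bullet> \<theta>2 = -1" by linarith
    then show False using e ne nopp by (metis scaleR_one scaleR_minus1_left)
  qed
  define \<gamma> where "\<gamma> t = \<theta>1 + t *\<^sub>R (\<theta>2 - \<theta>1)" for t
  have \<gamma>0: "\<gamma> t \<noteq> 0" if "t \<in> {0..1}" for t
  proof
    assume g0: "\<gamma> t = 0"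
    have "(1 - t) *\<^sub>R \<theta>1 + t *\<^sub>R \<theta>2 = \<gamma> t" by (simp add: \<gamma>_def algebra_simps)
    then have e: "(1 - t) *\<^sub>R \<theta>1 = - (t *\<^sub>R \<theta>2)" using g0 by (simp add: add_eq_0_iff2)
    have "norm ((1 - t) *\<^sub>R \<theta>1) = norm (t *\<^sub>R \<theta>2)" unfolding e by simp
    then have "1 - t = t" using that n by simp
    then have t: "t = 1/2" by simp
    have "(1/2) *\<^sub>R \<theta>1 = (1/2) *\<^sub>R (- \<theta>2)" using e unfolding t by simp
    then have "\<theta>1 = - \<theta>2" unfolding scaleR_cancel_left by simp
    then show False using nopp by simp
  qed
  have const: "X r (sgn (\<gamma> t)) = x" if t: "t \<in> {0..1}" for t
  proof (rule X_unique[symmetric, OF r])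
    show s: "sgn (\<gamma> t) \<in> sphere 0 1" using \<gamma>0[OF t] by (simp add: norm_sgn)
    show "x \<in> sublevel A \<phi> r" by (fact x)
    show "H r (sgn (\<gamma> t)) \<le> sgn (\<gamma> t) \<bullet> x"
    proof (rule H_le)
      fix y assume y: "y \<in> sublevel A \<phi> r"
      have "\<theta>1 \<bullet> y \<le> \<theta>1 \<bullet> x" "\<theta>2 \<bullet> y \<le> \<theta>2 \<bullet> x" using inner_le_H[OF y] x by auto
      then have "(1 - t) * (\<theta>1 \<bullet> y) + t * (\<theta>2 \<bullet> y) \<le> (1 - t) * (\<theta>1 \<bullet> x) + t * (\<theta>2 \<bullet> x)"
        using t by (intro add_mono mult_left_mono) auto
      then have "\<gamma> t \<bullet> y \<le> \<gamma> t \<bullet> x" by (simp add: \<gamma>_def inner_simps algebra_simps)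
      then show "sgn (\<gamma> t) \<bullet> y \<le> sgn (\<gamma> t) \<bullet> x"
        by (simp add: sgn_div_norm mult_left_mono)
    qed (use r in auto)
  qed
  have g1: "(\<gamma> has_derivative (\<lambda>t. t *\<^sub>R (\<theta>2 - \<theta>1))) (at 0)"
    unfolding \<gamma>_def by (auto intro!: derivative_eq_intros)
  have g2: "((\<lambda>z. X r (sgn z)) has_derivative L r \<theta>1) (at (\<gamma> 0))"
    using X_has_derivative[OF r \<theta>(1)] by (simp only: \<gamma>_def scaleR_zero_left add_0_right)
  have "((\<lambda>t. X r (sgn (\<gamma> t))) has_derivative (\<lambda>t. L r \<theta>1 (t *\<^sub>R (\<theta>2 - \<theta>1)))) (at 0)"
    by (rule has_derivative_compose[OF g1 g2])
  then have d1: "((\<lambda>t. X r (sgn (\<gamma> t))) has_vector_derivative L r \<theta>1 (\<theta>2 - \<theta>1)) (at 0 within cbox 0 1)"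
    unfolding has_vector_derivative_def linear_cmul[OF linear_L[OF r \<theta>(1)]]
    by (rule has_derivative_at_withinI)
  \<comment> \<open>Constancy is known for \<open>t\<close> in [0,1] only, so the two derivatives at
    0 are compared from one side.\<close>
  have d2: "((\<lambda>t. X r (sgn (\<gamma> t))) has_vector_derivative 0) (at 0 within cbox 0 (1::real))"
    by (rule has_vector_derivative_transform[of _ _ _ "\<lambda>t. x"]) (use const in auto)
  have "L r \<theta>1 (\<theta>2 - \<theta>1) = 0"
    by (rule vector_derivative_unique_within_closed_interval[OF _ _ d1 d2]) auto
  then show False using L_eq_0[OF r \<theta>(1)] tg by blast
qed

end


lemma tendsto_difference_quotient:
  assumes "(f has_vector_derivative D) (at 0)"
  shows "((\<lambda>t. (f t - f 0) /\<^sub>R t) \<longlongrightarrow> D) (at 0)"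
proof -
  have "((\<lambda>t. norm (f t - f 0 - t *\<^sub>R D) / norm t) \<longlongrightarrow> 0) (at 0)"
    using assms unfolding has_vector_derivative_def has_derivative_at by simp
  moreover have "eventually (\<lambda>t. norm (f t - f 0 - t *\<^sub>R D) / norm t = norm ((f t - f 0) /\<^sub>R t - D)) (at (0::real))"
    unfolding eventually_at
  proof (intro exI[of _ 1] conjI ballI impI)
    fix t :: real assume "t \<noteq> 0 \<and> dist t 0 < 1"
    then have "(f t - f 0) /\<^sub>R t - D = (f t - f 0 - t *\<^sub>R D) /\<^sub>R t" by (simp add: scaleR_diff_right)
    then show "norm (f t - f 0 - t *\<^sub>R D) / norm t = norm ((f t - f 0) /\<^sub>R t - D)"
      by (simp add: divide_inverse mult.commute)
  qed simp
  ultimately have "((\<lambda>t. norm ((f t - f 0) /\<^sub>R t - D)) \<longlongrightarrow> 0) (at 0)"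
    by (rule Lim_transform_eventually)
  then have "((\<lambda>t. (f t - f 0) /\<^sub>R t - D) \<longlongrightarrow> 0) (at 0)" by (rule tendsto_norm_zero_cancel)
  then show ?thesis by (simp add: LIM_zero_cancel)
qed

section \<open>The map \<open>Xy\<close> from the punctured ball into \<open>A\<close> and its
  inverse \<open>N\<close>\<close>

context radial_target_transport
begin

abbreviation "PB \<equiv> cball (0::real^'n) R - {0}"
abbreviation "hr \<equiv> r_deriv R h"

lemma polar_PB: "y \<in> PB \<Longrightarrow> norm y \<in> {0<..R}" "y \<in> PB \<Longrightarrow> sgn y \<in> sphere 0 1"
  "y \<in> ball 0 R - {0} \<Longrightarrow> norm y \<in> {0<..<R}" "y \<in> ball 0 R - {0} \<Longrightarrow> sgn y \<in> sphere 0 1"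
  "y \<in> ball 0 R - {0} \<Longrightarrow> norm y \<in> {0<..R}"
  by (auto simp: norm_sgn)

lemma polar_scaleR: "r \<in> {0<..R} \<Longrightarrow> \<theta> \<in> sphere 0 1 \<Longrightarrow> r *\<^sub>R \<theta> \<in> PB \<and> norm (r *\<^sub>R \<theta>) = r \<and> sgn (r *\<^sub>R \<theta>) = \<theta>"
  by (auto simp: sgn_div_norm)

lemma h_C0: "polar_C0 R h" and hr_C0: "polar_C0 R hr" and grad_C0: "polar_C0 R (\<lambda>r. sphere_grad (H r))"
  and k_C0: "polar_C0 R k" and Q_C0: "polar_C0 R (\<lambda>r \<theta>. Q r \<theta> v)"
  using H_r_C1 H_\<theta>_C1 H_\<theta>\<theta>_C1[of v] by (auto simp: C1_in_r_def)

lemma H_has_derivative_angle: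
  assumes "r \<in> {0<..R}" "z \<noteq> 0"
  shows "((\<lambda>z. H r (sgn z)) has_derivative (\<lambda>v. (sphere_grad (H r) (sgn z) \<bullet> v) /\<^sub>R norm z)) (at z)"
proof (rule has_derivative_comp_sgn_scale[OF sphere_grad_works(1) assms(2)])
  show "(\<lambda>z. H r (sgn z)) differentiable at (sgn z)"
    using H_\<theta>\<theta>_exists[OF assms(1)] assms(2) by (auto simp: sphere_twice_differentiable_def norm_sgn)
qed

lemma continuous_H: "continuous_on PB (\<lambda>y. H (norm y) (sgn y))"
  unfolding continuous_on_eq_continuous_within
proof
  fix y assume y: "y \<in> PB"
  then have "norm y \<in> {0<..R}" "y \<noteq> 0" using polar_PB by auto
  from polar_has_derivative[OF r_deriv_works[OF H_r_exists] h_C0 y H_has_derivative_angle[OF this]]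
  show "continuous (at y within PB) (\<lambda>y. H (norm y) (sgn y))" by (rule has_derivative_continuous)
qed

lemma continuous_X: "continuous_on PB (\<lambda>y. X (norm y) (sgn y))"
  unfolding inverse_transport_def
  by (intro continuous_intros continuous_H continuous_on_polar[OF grad_C0]) auto

definition Xy :: "real^'n \<Rightarrow> real^'n" where
  "Xy y = X (norm y) (sgn y)"

text \<open>The angular part is divided by \<open>norm y\<close> because \<open>X r\<close> is
  extended 0-homogeneously; the radial part is the r-derivative of \<open>X\<close>.\<close>

definition DX :: "real^'n \<Rightarrow> real^'n \<Rightarrow> real^'n" where
  "DX y v = L (norm y) (sgn y) v /\<^sub>R norm y +
     (sgn y \<bullet> v) *\<^sub>R (h (norm y) (sgn y) *\<^sub>R sgn y + k (norm y) (sgn y))"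

lemma X_r_derivative:
  assumes "r \<in> {0<..R}" "\<theta> \<in> sphere 0 1"
  shows "((\<lambda>s. X s \<theta>) has_vector_derivative h r \<theta> *\<^sub>R \<theta> + k r \<theta>) (at r within {0<..R})"
proof -
  have 1: "((\<lambda>s. H s \<theta>) has_vector_derivative h r \<theta>) (at r within {0<..R})"
    by (rule r_deriv_works[OF H_r_exists assms])
  have 2: "((\<lambda>s. sphere_grad (H s) \<theta>) has_vector_derivative k r \<theta>) (at r within {0<..R})"
    using H_\<theta>_C1 by (intro r_deriv_works assms) (simp add: C1_in_r_def)
  have 3: "((\<lambda>s. H s \<theta> *\<^sub>R \<theta>) has_vector_derivative h r \<theta> *\<^sub>R \<theta>) (at r within {0<..R})"
    by (rule bounded_linear.has_vector_derivative[OF bounded_linear_scaleR_left 1])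
  show ?thesis
    unfolding inverse_transport_def by (rule has_vector_derivative_add[OF 3 2])
qed

lemma X_r_C0: "polar_C0 R (\<lambda>r \<theta>. h r \<theta> *\<^sub>R \<theta> + k r \<theta>)"
  using h_C0 k_C0 unfolding polar_C0_def by (auto simp: case_prod_beta' intro!: continuous_intros)

lemma Xy_has_derivative:
  assumes y: "y \<in> ball 0 R - {0}"
  shows "(Xy has_derivative DX y) (at y)"
proof -
  have yP: "y \<in> PB" using y by auto
  have y0: "y \<noteq> 0" using y by auto
  have "((\<lambda>z. X (norm y) (sgn z)) has_derivative (\<lambda>v. L (norm y) (sgn y) v /\<^sub>R norm y)) (at y)"
    by (rule has_derivative_comp_sgn_scale[OF X_has_derivative[OF polar_PB(1,2)[OF yP]] y0])
  from polar_has_derivative_at[OF X_r_derivative X_r_C0 y this]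
  show ?thesis unfolding Xy_def[abs_def] DX_def[abs_def] .
qed

text \<open>Spherical gradients are orthogonal to \<theta> at every radius, and a linear relation
  survives differentiation in the radius.\<close>

lemma inner_k:
  assumes r: "r \<in> {0<..<R}" and \<theta>: "\<theta> \<in> sphere 0 1"
  shows "\<theta> \<bullet> k r \<theta> = 0"
proof -
  have "((\<lambda>s. sphere_grad (H s) \<theta>) has_vector_derivative k r \<theta>) (at r)"
    using H_\<theta>_C1 by (intro r_deriv_works_at r \<theta>) (simp add: C1_in_r_def)
  then have "((\<lambda>s. \<theta> \<bullet> sphere_grad (H s) \<theta>) has_vector_derivative \<theta> \<bullet> k r \<theta>) (at r)"
    by (rule bounded_linear.has_vector_derivative[OF bounded_linear_inner_right])
  moreover have "((\<lambda>s. \<theta> \<bullet> sphere_grad (H s) \<theta>) has_vector_derivative 0) (at r)"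
  proof (rule has_vector_derivative_transform_within_open[of "\<lambda>s. 0" _ _ "{0<..<R}"])
    fix s assume "s \<in> {0<..<R}"
    then have "sphere_grad (H s) \<theta> \<bullet> \<theta> = 0"
      using H_\<theta>\<theta>_exists[of s] \<theta> by (intro sphere_grad_works(2)) (auto simp: sphere_twice_differentiable_def)
    then show "0 = \<theta> \<bullet> sphere_grad (H s) \<theta>" by (simp add: inner_commute)
  qed (use r in auto)
  ultimately show ?thesis by (rule vector_derivative_unique_at)
qed

lemma linear_DX:
  assumes "y \<in> PB" shows "linear (DX y)"
  unfolding DX_def
  by (rule linearI)
     (simp_all add: linear_add[OF linear_L[OF polar_PB(1,2)[OF assms]]] linear_cmul[OF linear_L[OF polar_PB(1,2)[OF assms]]]
       inner_simps algebra_simps)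

lemma inner_DX:
  assumes "y \<in> ball 0 R - {0}"
  shows "sgn y \<bullet> DX y v = (sgn y \<bullet> v) * h (norm y) (sgn y)"
  using inner_k[OF polar_PB(3,4)[OF assms]] inner_L[OF polar_PB(5,4)[OF assms]] assms
  by (simp add: DX_def inner_simps dot_square_norm norm_sgn)

text \<open>\<open>DX y\<close> is block triangular: the radial component is multiplied by
  \<open>h\<close>, and on vectors without radial component it acts as a multiple of
  \<open>L\<close>. Both blocks are injective.\<close>

lemma DX_eq_0:
  assumes "y \<in> ball 0 R - {0}" "DX y v = 0"
  shows "v = 0"
proof -
  note p = polar_PB(5,4)[OF assms(1)]
  have "(sgn y \<bullet> v) * h (norm y) (sgn y) = 0" using inner_DX[OF assms(1), of v] assms(2) by simp
  then have 0: "sgn y \<bullet> v = 0" using positivity(1)[OF p] by simp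
  then have "L (norm y) (sgn y) v = 0" using assms by (simp add: DX_def)
  then have "tangential (sgn y) v = 0" by (rule L_eq_0[OF p])
  then show ?thesis using 0 by (simp add: tangential_def)
qed

lemma continuous_DX: "continuous_on PB (\<lambda>y. DX y v)"
proof -
  have "continuous_on PB (\<lambda>y. L (norm y) (sgn y) v)"
    unfolding L_def tangential_def
    by (intro continuous_intros continuous_H continuous_on_polar[OF Q_C0]) auto
  then show ?thesis
    unfolding DX_def
    by (intro continuous_intros continuous_on_polar[OF h_C0] continuous_on_polar[OF k_C0]) auto
qed

lemma continuous_Xy: "continuous_on PB Xy"
  using continuous_X by (simp add: Xy_def[abs_def])

lemma Xy_inj: "inj_on Xy PB"
proof (rule inj_onI)
  fix y z assume y: "y \<in> PB" and z: "z \<in> PB" and eq: "Xy y = Xy z"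
  note py = polar_PB(1,2)[OF y] and pz = polar_PB(1,2)[OF z]
  have n: "norm y = norm z" using \<phi>_X[OF py] \<phi>_X[OF pz] eq by (simp add: Xy_def)
  have "sgn y = sgn z" using X_inj[OF py(1) py(2) pz(2)] eq n by (simp add: Xy_def)
  then have "norm y *\<^sub>R sgn y = norm z *\<^sub>R sgn z" using n by simp
  then show "y = z" using y z by (simp add: sgn_div_norm)
qed

definition \<Omega> :: "(real^'n) set" where "\<Omega> = Xy ` (ball 0 R - {0})"

text \<open>A representative of the transport: it agrees with \<open>T\<close> almost everywhere on
  \<Omega> and is differentiable at every point of \<Omega>.\<close>

definition N :: "real^'n \<Rightarrow> real^'n" where "N = the_inv_into PB Xy"

lemma N_Xy: "y \<in> PB \<Longrightarrow> N (Xy y) = y"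
  unfolding N_def by (rule the_inv_into_f_f[OF Xy_inj])

text \<open>Invariance of domain asks for continuity and injectivity alone, so \<Omega> is known to
  be open before \<open>N\<close> is shown to be differentiable.\<close>

lemma open_\<Omega>: "open \<Omega>"
  unfolding \<Omega>_def
  by (rule invariance_of_domain)
     (auto intro: continuous_on_subset[OF continuous_Xy] inj_on_subset[OF Xy_inj])

lemma Xy_in_A: "y \<in> PB \<Longrightarrow> Xy y \<in> A"
  unfolding Xy_def using X_in(3) polar_PB by blast

lemma \<phi>_Xy: "y \<in> PB \<Longrightarrow> \<phi> (Xy y) = norm y"
  unfolding Xy_def using \<phi>_X polar_PB by blast

lemma \<Omega>_N: 
  assumes "x \<in> \<Omega>"
  shows "N x \<in> ball 0 R - {0}" "N x \<in> PB" "Xy (N x) = x" "\<phi> x = norm (N x)"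
proof -
  obtain y where y: "y \<in> ball 0 R - {0}" "x = Xy y" using assms unfolding \<Omega>_def by blast
  then have "y \<in> PB" by auto
  then show "N x \<in> ball 0 R - {0}" "N x \<in> PB" "Xy (N x) = x" "\<phi> x = norm (N x)"
    using y by (simp_all add: N_Xy \<phi>_Xy)
qed

lemma \<Omega>_interior: "\<Omega> \<subseteq> interior A - {0}"
proof
  fix x assume x: "x \<in> \<Omega>"
  have "ball 0 R - {0} \<subseteq> PB" by auto
  then have "\<Omega> \<subseteq> A" unfolding \<Omega>_def using Xy_in_A by blast
  then have "x \<in> interior A" using x open_\<Omega> by (meson interiorI)
  moreover have "x \<noteq> 0" using \<Omega>_N(1,4)[OF x] origin by auto
  ultimately show "x \<in> interior A - {0}" by auto
qed

lemma continuous_N: "continuous_on \<Omega> N"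
proof -
  have "continuous_on (ball 0 R - {0}) Xy" "inj_on Xy (ball 0 R - {0})"
    by (auto intro: continuous_on_subset[OF continuous_Xy] inj_on_subset[OF Xy_inj])
  then obtain g where g: "homeomorphism (ball 0 R - {0}) (Xy ` (ball 0 R - {0})) Xy g"
    using invariance_of_domain_homeomorphism[of "ball 0 R - {0}" Xy] by auto
  then have contg: "continuous_on \<Omega> g" and g: "\<And>x. x \<in> \<Omega> \<Longrightarrow> Xy (g x) = x \<and> g x \<in> ball 0 R - {0}"
    unfolding homeomorphism_def \<Omega>_def by auto
  have "g x = N x" if "x \<in> \<Omega>" for x
  proof -
    have "g x \<in> PB" using g[OF that] by auto
    then show ?thesis using N_Xy g[OF that] by metis
  qed
  with contg show ?thesis by (metis continuous_on_eq)
qed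

definition DN :: "real^'n \<Rightarrow> real^'n \<Rightarrow> real^'n" where
  "DN x = (SOME g. linear g \<and> g \<circ> DX (N x) = id)"

lemma DN_works:
  assumes "x \<in> \<Omega>"
  shows "linear (DN x)" "DN x (DX (N x) v) = v" "DX (N x) (DN x w) = w"
proof -
  note y = \<Omega>_N(1,2)[OF assms]
  have lin: "linear (DX (N x))" by (rule linear_DX[OF y(2)])
  have "inj (DX (N x))" using lin DX_eq_0[OF y(1)] by (simp add: linear_injective_0)
  then have "\<exists>g. linear g \<and> g \<circ> DX (N x) = id" using linear_injective_left_inverse[OF lin] by blast
  then have *: "linear (DN x) \<and> DN x \<circ> DX (N x) = id" unfolding DN_def by (rule someI_ex)
  then show "linear (DN x)" "DN x (DX (N x) v) = v" by (auto simp: fun_eq_iff)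
  have "DX (N x) \<circ> DN x = id" using * lin linear_inverse_left by blast
  then show "DX (N x) (DN x w) = w" by (auto simp: fun_eq_iff)
qed

text \<open>A continuous inverse of a differentiable map is differentiable where the derivative is
  invertible; the continuity of \<open>N\<close> comes from invariance of domain.\<close>

lemma N_has_derivative:
  assumes "x \<in> \<Omega>"
  shows "(N has_derivative DN x) (at x)"
proof (rule has_derivative_inverse_basic[where T = \<Omega>])
  show "(Xy has_derivative DX (N x)) (at (N x))" by (rule Xy_has_derivative[OF \<Omega>_N(1)[OF assms]])
  show "bounded_linear (DN x)" using DN_works(1)[OF assms] by (simp add: linear_conv_bounded_linear)
  show "DN x \<circ> DX (N x) = id" using DN_works(2)[OF assms] by auto
  show "continuous (at x) N" using continuous_N open_\<Omega> assms by (simp add: continuous_on_eq_continuous_at)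
qed (use open_\<Omega> assms \<Omega>_N in auto)

lemma continuous_on_comp_N: "continuous_on PB f \<Longrightarrow> continuous_on \<Omega> (\<lambda>x. f (N x))"
  by (rule continuous_on_compose2[OF _ continuous_N]) (use \<Omega>_N(2) in auto)

lemma continuous_DN: "continuous_on \<Omega> (\<lambda>x. DN x w)"
proof (rule continuous_on_linear_solve[where L = "\<lambda>x. DX (N x)" and w = "\<lambda>x. w"])
  show "continuous_on \<Omega> (\<lambda>x. DX (N x) v)" for v by (rule continuous_on_comp_N[OF continuous_DX])
  show "v = 0" if "x \<in> \<Omega>" "DX (N x) v = 0" for x v
    by (rule DX_eq_0[OF \<Omega>_N(1)[OF that(1)] that(2)])
  show "linear (DX (N x))" if "x \<in> \<Omega>" for x by (rule linear_DX[OF \<Omega>_N(2)[OF that]])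
qed (use DN_works(3) in auto)

text \<open>Contact points are monotone in the normal: the increments of \<theta> and of
  \<open>X r \<theta>\<close> have nonnegative inner product. Dividing by the square of the
  parameter and passing to the limit gives the quadratic form of \<open>L\<close>.\<close>

lemma L_nonneg:
  assumes r: "r \<in> {0<..R}" and \<theta>: "\<theta> \<in> sphere 0 1" and \<sigma>: "\<theta> \<bullet> \<sigma> = 0"
  shows "0 \<le> \<sigma> \<bullet> L r \<theta> \<sigma>"
proof -
  have n: "norm \<theta> = 1" "\<theta> \<noteq> 0" and sg: "sgn \<theta> = \<theta>" using \<theta> by (auto simp: sgn_div_norm)
  define \<gamma> where "\<gamma> t = \<theta> + t *\<^sub>R \<sigma>" for t
  have \<gamma>0: "\<gamma> t \<noteq> 0" for t
  proof
    assume "\<gamma> t = 0"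
    then have "\<theta> \<bullet> \<gamma> t = 0" by simp
    then show False using n \<sigma> by (simp add: \<gamma>_def inner_simps dot_square_norm)
  qed
  have s: "sgn (\<gamma> t) \<in> sphere 0 1" for t using \<gamma>0 by (simp add: norm_sgn)
  have g1: "(\<gamma> has_derivative (\<lambda>t. t *\<^sub>R \<sigma>)) (at 0)"
    unfolding \<gamma>_def by (auto intro!: derivative_eq_intros)
  have g0: "\<gamma> 0 = \<theta>" by (simp add: \<gamma>_def)
  have g2: "((\<lambda>z. X r (sgn z)) has_derivative L r \<theta>) (at (\<gamma> 0))"
    unfolding g0 by (rule X_has_derivative[OF r \<theta>])
  have "((\<lambda>t. X r (sgn (\<gamma> t))) has_derivative (\<lambda>t. L r \<theta> (t *\<^sub>R \<sigma>))) (at 0)"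
    by (rule has_derivative_compose[OF g1 g2])
  then have "((\<lambda>t. X r (sgn (\<gamma> t))) has_vector_derivative L r \<theta> \<sigma>) (at 0)"
    unfolding has_vector_derivative_def linear_cmul[OF linear_L[OF r \<theta>]] .
  then have q1: "((\<lambda>t. (X r (sgn (\<gamma> t)) - X r (sgn (\<gamma> 0))) /\<^sub>R t) \<longlongrightarrow> L r \<theta> \<sigma>) (at 0)"
    by (rule tendsto_difference_quotient)
  have g3: "(sgn has_derivative (\<lambda>v. tangential (sgn \<theta>) v /\<^sub>R norm \<theta>)) (at (\<gamma> 0))"
    unfolding g0 by (rule has_derivative_sgn[OF n(2)])
  have "((\<lambda>t. sgn (\<gamma> t)) has_derivative (\<lambda>t. tangential (sgn \<theta>) (t *\<^sub>R \<sigma>) /\<^sub>R norm \<theta>)) (at 0)"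
    by (rule has_derivative_compose[OF g1 g3])
  moreover have "tangential (sgn \<theta>) (t *\<^sub>R \<sigma>) /\<^sub>R norm \<theta> = t *\<^sub>R \<sigma>" for t
    using n sg \<sigma> by (simp add: tangential_idem)
  ultimately have "((\<lambda>t. sgn (\<gamma> t)) has_vector_derivative \<sigma>) (at 0)"
    unfolding has_vector_derivative_def by (simp only:)
  then have q2: "((\<lambda>t. (sgn (\<gamma> t) - sgn (\<gamma> 0)) /\<^sub>R t) \<longlongrightarrow> \<sigma>) (at 0)"
    by (rule tendsto_difference_quotient)
  have "((\<lambda>t. ((sgn (\<gamma> t) - sgn (\<gamma> 0)) /\<^sub>R t) \<bullet> ((X r (sgn (\<gamma> t)) - X r (sgn (\<gamma> 0))) /\<^sub>R t)) \<longlongrightarrow> \<sigma> \<bullet> L r \<theta> \<sigma>) (at 0)"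
    by (rule tendsto_inner[OF q2 q1])
  moreover have "0 \<le> ((sgn (\<gamma> t) - sgn (\<gamma> 0)) /\<^sub>R t) \<bullet> ((X r (sgn (\<gamma> t)) - X r (sgn (\<gamma> 0))) /\<^sub>R t)" for t
  proof -
    have "sgn (\<gamma> t) \<bullet> X r (sgn (\<gamma> 0)) \<le> sgn (\<gamma> t) \<bullet> X r (sgn (\<gamma> t))"
      "sgn (\<gamma> 0) \<bullet> X r (sgn (\<gamma> t)) \<le> sgn (\<gamma> 0) \<bullet> X r (sgn (\<gamma> 0))"
      using X_in[OF r s] inner_le_H by metis+
    then have "0 \<le> (sgn (\<gamma> t) - sgn (\<gamma> 0)) \<bullet> (X r (sgn (\<gamma> t)) - X r (sgn (\<gamma> 0)))"
      by (simp add: inner_simps)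
    then have "0 \<le> (inverse t * inverse t) * ((sgn (\<gamma> t) - sgn (\<gamma> 0)) \<bullet> (X r (sgn (\<gamma> t)) - X r (sgn (\<gamma> 0))))"
      by (intro mult_nonneg_nonneg zero_le_square)
    then show ?thesis by simp
  qed
  ultimately show ?thesis by (intro tendsto_lowerbound[of _ _ "at (0::real)"]) auto
qed

end


section \<open>The interior inequality\<close>

text \<open>Projecting the basis vectors to the hyperplane orthogonal to \<open>n\<close> changes
  the sum only by multiples of \<open>n \<bullet> B n = 0\<close>, and the projected sum is
  nonnegative term by term.\<close>

lemma trace_nonneg:
  fixes B :: "'a::euclidean_space \<Rightarrow> 'a"
  assumes B: "linear B" and n: "norm n = 1" "n \<bullet> B n = 0"
    and nonneg: "\<And>\<tau>. n \<bullet> \<tau> = 0 \<Longrightarrow> 0 \<le> B \<tau> \<bullet> \<tau>"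
  shows "0 \<le> (\<Sum>b\<in>Basis. B b \<bullet> b)"
proof -
  have "0 \<le> (\<Sum>b\<in>Basis. B (tangential n b) \<bullet> tangential n b)"
    by (intro sum_nonneg nonneg inner_tangential n)
  also have "\<dots> = (\<Sum>b\<in>Basis. B b \<bullet> b - (n \<bullet> b) * (B b \<bullet> n) - (n \<bullet> b) * (B n \<bullet> b))"
    by (rule sum.cong)
       (auto simp: tangential_def linear_diff[OF B] linear_cmul[OF B] inner_simps n inner_commute[of "B n" n])
  also have "\<dots> = (\<Sum>b\<in>Basis. B b \<bullet> b) - (\<Sum>b\<in>Basis. (n \<bullet> b) * (B b \<bullet> n)) - (\<Sum>b\<in>Basis. (n \<bullet> b) * (B n \<bullet> b))"
    by (simp add: sum_subtractf)
  also have "(\<Sum>b\<in>Basis. (n \<bullet> b) * (B n \<bullet> b)) = n \<bullet> B n"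
    by (rule euclidean_inner[symmetric])
  also have "(\<Sum>b\<in>Basis. (n \<bullet> b) * (B b \<bullet> n)) = (\<Sum>b\<in>Basis. (n \<bullet> b) *\<^sub>R B b) \<bullet> n"
    by (simp add: inner_sum_left)
  also have "(\<Sum>b\<in>Basis. (n \<bullet> b) *\<^sub>R B b) = B (\<Sum>b\<in>Basis. (n \<bullet> b) *\<^sub>R b)"
    by (simp add: linear_sum[OF B] linear_cmul[OF B])
  also have "\<dots> = B n" by (simp add: euclidean_representation)
  finally show ?thesis using n by (simp add: inner_commute)
qed

lemma sum_inner_basis_scaleR:
  assumes "linear f"
  shows "(\<Sum>b\<in>Basis. f b *\<^sub>R (u::'a::euclidean_space) \<bullet> b) = (f u :: real)"
proof -
  have "(\<Sum>b\<in>Basis. f b *\<^sub>R u \<bullet> b) = (\<Sum>b\<in>Basis. f ((u \<bullet> b) *\<^sub>R b))"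
    by (simp add: linear_cmul[OF assms] mult.commute)
  also have "\<dots> = f (\<Sum>b\<in>Basis. (u \<bullet> b) *\<^sub>R b)" by (rule linear_sum[OF assms, symmetric])
  finally show ?thesis by (simp add: euclidean_representation)
qed

lemma has_derivative_real_compose:
  assumes "(u has_derivative u') (at x)" "(f has_real_derivative D) (at (u x))"
  shows "((\<lambda>x. f (u x)) has_derivative (\<lambda>v. D * u' v)) (at x)"
  using has_derivative_compose[OF assms(1) assms(2)[unfolded has_field_derivative_def]] .

lemma integrable_compact_support:
  fixes f :: "'a::euclidean_space \<Rightarrow> real"
  assumes "continuous_on S f" "compact K" "K \<subseteq> S" "\<And>x. x \<in> S - K \<Longrightarrow> f x = 0"
  shows "integrable lborel (\<lambda>x. if x \<in> S then f x else 0)"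
proof -
  have "integrable lborel (\<lambda>x. indicator K x *\<^sub>R f x)"
    using assms by (intro borel_integrable_compact) (auto intro: continuous_on_subset)
  also have "(\<lambda>x. indicator K x *\<^sub>R f x) = (\<lambda>x. if x \<in> S then f x else 0)"
    using assms(3,4) by (auto simp: fun_eq_iff indicator_def split: split_of_bool)
  finally show ?thesis .
qed

section \<open>Derivatives of the radius, the normal and \<open>H_r\<close> as functions on
  \<Omega>\<close>

context radial_target_transport
begin

abbreviation "nN x \<equiv> sgn (N x)"
abbreviation "rN x \<equiv> norm (N x)"
abbreviation "hN x \<equiv> h (norm (N x)) (sgn (N x))"

definition Dn :: "real^'n \<Rightarrow> real^'n \<Rightarrow> real^'n" where
  "Dn x v = tangential (nN x) (DN x v) /\<^sub>R rN x"

text \<open>The angular gradient of \<open>h\<close> is \<open>k\<close>, because the r-derivative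
  and the spherical gradient of \<open>H\<close> commute.\<close>

definition Dh :: "real^'n \<Rightarrow> real^'n \<Rightarrow> real" where
  "Dh y v = (k (norm y) (sgn y) \<bullet> v) /\<^sub>R norm y + (sgn y \<bullet> v) * hr (norm y) (sgn y)"

lemma polar_N:
  assumes "x \<in> \<Omega>"
  shows "rN x \<in> {0<..<R}" "rN x \<in> {0<..R}" "nN x \<in> sphere 0 1" "norm (nN x) = 1" "N x \<noteq> 0" "0 < rN x" "0 < hN x"
proof -
  note y = \<Omega>_N(1)[OF assms]
  show "rN x \<in> {0<..<R}" "rN x \<in> {0<..R}" "nN x \<in> sphere 0 1"
    using polar_PB(3)[OF y] polar_PB(5)[OF y] polar_PB(4)[OF y] by blast+
  then show "norm (nN x) = 1" "N x \<noteq> 0" "0 < rN x" "0 < hN x" using positivity(1) by auto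
qed

lemma h_has_derivative:
  assumes y: "y \<in> ball 0 R - {0}"
  shows "((\<lambda>y. h (norm y) (sgn y)) has_derivative Dh y) (at y)"
proof -
  note p = polar_PB(3,4)[OF y]
  have y0: "y \<noteq> 0" using y by auto
  have "((\<lambda>z. h (norm y) (sgn z)) has_derivative (\<lambda>v. k (norm y) (sgn y) \<bullet> v)) (at (sgn y))"
    using H_\<theta>\<theta>_exists
    by (intro has_derivative_r_deriv_comp_sgn H_r_exists H_\<theta>_C1 p) (auto simp: sphere_twice_differentiable_def)
  from has_derivative_comp_sgn_scale[OF this y0]
  have D: "((\<lambda>z. h (norm y) (sgn z)) has_derivative (\<lambda>v. (k (norm y) (sgn y) \<bullet> v) /\<^sub>R norm y)) (at y)" .
  have hd: "r_differentiable R h" using H_r_C1 by (simp add: C1_in_r_def)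
  have "((\<lambda>z. h (norm z) (sgn z)) has_derivative
      (\<lambda>v. (k (norm y) (sgn y) \<bullet> v) /\<^sub>R norm y + (sgn y \<bullet> v) *\<^sub>R hr (norm y) (sgn y))) (at y)"
    by (rule polar_has_derivative_at[OF r_deriv_works[OF hd] hr_C0 y D])
  then show ?thesis unfolding Dh_def[abs_def] real_scaleR_def .
qed

lemma rN_has_derivative: "x \<in> \<Omega> \<Longrightarrow> (rN has_derivative (\<lambda>v. nN x \<bullet> DN x v)) (at x)"
proof -
  assume x: "x \<in> \<Omega>"
  have "(norm has_derivative (\<lambda>v. nN x \<bullet> v)) (at (N x))"
    using has_derivative_norm[OF polar_N(5)[OF x]] by (simp only: inner_commute)
  from has_derivative_compose[OF N_has_derivative[OF x] this] show ?thesis .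
qed

lemma nN_has_derivative: "x \<in> \<Omega> \<Longrightarrow> (nN has_derivative Dn x) (at x)"
proof -
  assume x: "x \<in> \<Omega>"
  from has_derivative_compose[OF N_has_derivative[OF x] has_derivative_sgn[OF polar_N(5)[OF x]]]
  show ?thesis unfolding Dn_def[abs_def] .
qed

lemma hN_has_derivative: "x \<in> \<Omega> \<Longrightarrow> (hN has_derivative (\<lambda>v. Dh (N x) (DN x v))) (at x)"
proof -
  assume x: "x \<in> \<Omega>"
  from has_derivative_compose[OF N_has_derivative[OF x] h_has_derivative[OF \<Omega>_N(1)[OF x]]] show ?thesis .
qed

text \<open>The radial component is scaled by the nonzero factor \<open>hN\<close>, so vectors
  tangent to a level set of \<phi> correspond to vectors tangent to the sphere. On these,
  \<open>DN\<close> inverts the nonnegative form \<open>L\<close> up to the factor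
  \<open>rN\<close>.\<close>

lemma DN_tangent:
  assumes x: "x \<in> \<Omega>" and \<tau>: "nN x \<bullet> \<tau> = 0"
  shows "nN x \<bullet> DN x \<tau> = 0" "\<tau> = L (rN x) (nN x) (DN x \<tau>) /\<^sub>R rN x" "0 \<le> DN x \<tau> \<bullet> \<tau>"
proof -
  note y = \<Omega>_N(1)[OF x]
  have "(nN x \<bullet> DN x \<tau>) * hN x = 0" using inner_DX[OF y, of "DN x \<tau>"] DN_works(3)[OF x, of \<tau>] \<tau> by simp
  then show 0: "nN x \<bullet> DN x \<tau> = 0" using polar_N(7)[OF x] by simp
  have "\<tau> = DX (N x) (DN x \<tau>)" using DN_works(3)[OF x] by simp
  then show *: "\<tau> = L (rN x) (nN x) (DN x \<tau>) /\<^sub>R rN x" using 0 by (simp add: DX_def)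
  have "0 \<le> DN x \<tau> \<bullet> L (rN x) (nN x) (DN x \<tau>)"
    using L_nonneg[OF polar_N(2,3)[OF x] 0] .
  then have "0 \<le> (DN x \<tau> \<bullet> L (rN x) (nN x) (DN x \<tau>)) / rN x" by simp
  also have "\<dots> = DN x \<tau> \<bullet> (L (rN x) (nN x) (DN x \<tau>) /\<^sub>R rN x)" by (simp add: divide_inverse mult.commute)
  also have "\<dots> = DN x \<tau> \<bullet> \<tau>" using * by simp
  finally show "0 \<le> DN x \<tau> \<bullet> \<tau>" .
qed

text \<open>The trace is the sum of the principal curvatures of a level set bounding a convex set.
  There is no diagonal entry along the normal, since the derivative of a unit field is
  tangential.\<close>

lemma div_normal_nonneg:
  assumes x: "x \<in> \<Omega>"
  shows "0 \<le> (\<Sum>b\<in>Basis. Dn x b \<bullet> b)"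
proof (rule trace_nonneg)
  note n = polar_N(4)[OF x]
  show "linear (Dn x)" unfolding Dn_def
    by (rule linearI) (auto simp: linear_add[OF DN_works(1)[OF x]] linear_cmul[OF DN_works(1)[OF x]] scaleR_add_right)
  show "nN x \<bullet> Dn x (nN x) = 0" by (simp add: Dn_def inner_tangential[OF n])
  show "norm (nN x) = 1" by (rule n)
  fix \<tau> assume \<tau>: "nN x \<bullet> \<tau> = 0"
  have "Dn x \<tau> \<bullet> \<tau> = (DN x \<tau> \<bullet> \<tau>) / rN x"
    by (simp add: Dn_def tangential_idem[OF DN_tangent(1)[OF x \<tau>]] divide_inverse mult.commute)
  then show "0 \<le> Dn x \<tau> \<bullet> \<tau>" using DN_tangent(3)[OF x \<tau>] by simp
qed

text \<open>\<open>DX\<close> sends the normal \<open>n\<close> to \<open>h n + \<kappa>\<close>,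
  hence \<open>DN x n = (n - DN x \<kappa>) / h\<close>. In the derivative of \<open>h\<close> the
  first part contributes \<open>hr\<close>; the second contributes a negative multiple of
  \<open>\<kappa> \<bullet> DN x \<kappa>\<close>, which is nonnegative by convexity, and is
  dropped.\<close>

lemma normal_derivatives:
  assumes x: "x \<in> \<Omega>"
  shows "nN x \<bullet> DN x (nN x) = 1 / hN x" "Dh (N x) (DN x (nN x)) \<le> hr (rN x) (nN x) / hN x"
proof -
  note n = polar_N(4)[OF x] and p = polar_N(2,3)[OF x] and hpos = polar_N(7)[OF x]
  define \<kappa> where "\<kappa> = k (rN x) (nN x)"
  have n\<kappa>: "nN x \<bullet> \<kappa> = 0" unfolding \<kappa>_def by (rule inner_k[OF polar_N(1,3)[OF x]])
  have nn: "nN x \<bullet> nN x = 1" using n by (simp add: dot_square_norm)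
  have "L (rN x) (nN x) (nN x) = L (rN x) (nN x) (tangential (nN x) (nN x))"
    by (rule L_tangential[OF p, symmetric])
  also have "tangential (nN x) (nN x) = 0" by (simp add: tangential_def nn)
  also have "L (rN x) (nN x) 0 = 0" by (rule linear_0[OF linear_L[OF p]])
  finally have "DX (N x) (nN x) = hN x *\<^sub>R nN x + \<kappa>" by (simp add: DX_def nn \<kappa>_def)
  then have "DN x (hN x *\<^sub>R nN x + \<kappa>) = nN x" using DN_works(2)[OF x, of "nN x"] by simp
  then have e: "hN x *\<^sub>R DN x (nN x) = nN x - DN x \<kappa>"
    by (simp add: linear_add[OF DN_works(1)[OF x]] linear_cmul[OF DN_works(1)[OF x]] algebra_simps)
  have "DN x (nN x) = (hN x *\<^sub>R DN x (nN x)) /\<^sub>R hN x" using hpos by simp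
  then have e': "DN x (nN x) = (nN x - DN x \<kappa>) /\<^sub>R hN x" unfolding e .
  show "nN x \<bullet> DN x (nN x) = 1 / hN x"
    unfolding e' by (simp add: inner_diff_right nn DN_tangent(1)[OF x n\<kappa>] divide_inverse)
  have lin: "Dh (N x) (a *\<^sub>R (u - v)) = a * (Dh (N x) u - Dh (N x) v)" for a u v
    by (simp add: Dh_def inner_diff_right algebra_simps)
  have "Dh (N x) (nN x) = hr (rN x) (nN x)"
    using n\<kappa> by (simp add: Dh_def nn \<kappa>_def[symmetric] inner_commute)
  moreover have "Dh (N x) (DN x \<kappa>) \<ge> 0"
    using DN_tangent(1,3)[OF x n\<kappa>] polar_N(6)[OF x] by (simp add: Dh_def \<kappa>_def[symmetric] inner_commute)
  ultimately have "Dh (N x) (DN x (nN x)) \<le> inverse (hN x) * hr (rN x) (nN x)"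
    unfolding e' lin using hpos by (intro mult_left_mono) auto
  then show "Dh (N x) (DN x (nN x)) \<le> hr (rN x) (nN x) / hN x" by (simp add: divide_inverse mult.commute)
qed

end


text \<open>C^1 is the regularity that the divergence argument uses, so that piecewise quadratic
  cutoffs are admissible.\<close>

locale cutoff =
  fixes \<psi> \<psi>' :: "real \<Rightarrow> real" and \<epsilon> R' :: real
  assumes \<psi>_deriv: "\<And>r. (\<psi> has_real_derivative \<psi>' r) (at r)" and \<psi>'_cont: "continuous_on UNIV \<psi>'"
    and \<psi>_nonneg: "\<And>r. 0 \<le> \<psi> r" and \<epsilon>_pos: "0 < \<epsilon>"
    and \<psi>_outside: "\<And>r. r < \<epsilon> \<or> R' < r \<Longrightarrow> \<psi> r = 0" and \<psi>'_outside: "\<And>r. r < \<epsilon> \<or> R' < r \<Longrightarrow> \<psi>' r = 0"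
begin

lemma \<psi>_cont: "continuous_on UNIV \<psi>"
  using \<psi>_deriv by (meson DERIV_isCont continuous_at_imp_continuous_on)

end

section \<open>The divergence inequality on \<open>A\<close> and the divergence identity on the
  ball\<close>

context radial_target_transport
begin

abbreviation "grad\<rho> x \<equiv> grad_on \<rho>0 A x"

lemma \<rho>0_has_derivative:
  assumes "x \<in> \<Omega>"
  shows "(\<rho>0 has_derivative (\<lambda>v. grad\<rho> x \<bullet> v)) (at x)"
proof -
  have x: "x \<in> interior A - {0}" using assms \<Omega>_interior by blast
  then have "x \<in> interior A" by simp
  show ?thesis
    unfolding grad_on_interior[OF \<open>x \<in> interior A\<close>]
    by (rule grad_on_UNIV_works[OF \<rho>0_differentiable[OF x]])
qed

lemma \<Omega>_sub_A: "\<Omega> \<subseteq> A - {0}"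
  using \<Omega>_interior interior_subset by blast

lemma continuous_on_\<Omega>:
  "continuous_on \<Omega> \<rho>0" "continuous_on \<Omega> (\<lambda>x. grad\<rho> x)" "continuous_on \<Omega> rN" "continuous_on \<Omega> nN" "continuous_on \<Omega> hN"
  "continuous_on \<Omega> (\<lambda>x. hr (rN x) (nN x))" "continuous_on \<Omega> (\<lambda>x. k (rN x) (nN x))"
  "continuous_on \<Omega> (\<lambda>x. hN x powr s)"
proof -
  show "continuous_on \<Omega> \<rho>0" by (rule continuous_on_subset[OF \<rho>0_continuous \<Omega>_sub_A])
  show "continuous_on \<Omega> (\<lambda>x. grad\<rho> x)" by (rule continuous_on_subset[OF \<rho>0_C1 \<Omega>_interior])
  show "continuous_on \<Omega> rN" by (intro continuous_on_norm continuous_N)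
  show "continuous_on \<Omega> nN" using polar_N(5) by (intro continuous_on_sgn continuous_N) auto
  show hN: "continuous_on \<Omega> hN" by (rule continuous_on_comp_N[OF continuous_on_polar[OF h_C0]])
  show "continuous_on \<Omega> (\<lambda>x. hr (rN x) (nN x))" by (rule continuous_on_comp_N[OF continuous_on_polar[OF hr_C0]])
  show "continuous_on \<Omega> (\<lambda>x. k (rN x) (nN x))" by (rule continuous_on_comp_N[OF continuous_on_polar[OF k_C0]])
  show "continuous_on \<Omega> (\<lambda>x. hN x powr s)"
    using polar_N(7) by (intro continuous_on_powr hN continuous_on_const) fastforce
qed

lemma continuous_Dn: "continuous_on \<Omega> (\<lambda>x. Dn x v)"
  unfolding Dn_def tangential_def
  by (intro continuous_intros continuous_on_\<Omega> continuous_DN) (use polar_N in auto)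

lemma continuous_Dh_DN: "continuous_on \<Omega> (\<lambda>x. Dh (N x) (DN x v))"
  unfolding Dh_def
  by (intro continuous_intros continuous_on_\<Omega> continuous_DN) (use polar_N in auto)

definition annulus_image :: "real \<Rightarrow> real \<Rightarrow> (real^'n) set" where
  "annulus_image \<epsilon> R' = Xy ` (cball 0 R' - ball 0 \<epsilon>)"

lemma compact_annulus: "compact (cball (0::real^'n) b - ball 0 a)"
  by (intro compact_diff) auto

lemma annulus_sub: 
  assumes "0 < \<epsilon>" "R' < R"
  shows "cball (0::real^'n) R' - ball 0 \<epsilon> \<subseteq> ball 0 R - {0}"
  using assms by auto

lemma annulus_image:
  assumes "0 < \<epsilon>" "R' < R"
  shows "compact (annulus_image \<epsilon> R')" "annulus_image \<epsilon> R' \<subseteq> \<Omega>"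
    "\<And>x. x \<in> \<Omega> \<Longrightarrow> x \<notin> annulus_image \<epsilon> R' \<Longrightarrow> rN x < \<epsilon> \<or> R' < rN x"
proof -
  have "ball 0 R - {0} \<subseteq> PB" by auto
  then have sub: "cball (0::real^'n) R' - ball 0 \<epsilon> \<subseteq> PB" using annulus_sub[OF assms] by blast
  show "compact (annulus_image \<epsilon> R')"
    unfolding annulus_image_def
    by (intro compact_continuous_image continuous_on_subset[OF continuous_Xy sub] compact_annulus)
  show "annulus_image \<epsilon> R' \<subseteq> \<Omega>"
    unfolding annulus_image_def \<Omega>_def by (rule image_mono[OF annulus_sub[OF assms]])
  fix x assume x: "x \<in> \<Omega>" "x \<notin> annulus_image \<epsilon> R'"
  then have "N x \<notin> cball 0 R' - ball 0 \<epsilon>" using \<Omega>_N(3)[OF x(1)] unfolding annulus_image_def by force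
  then show "rN x < \<epsilon> \<or> R' < rN x" by auto
qed

text \<open>\<open>low\<close> bounds the divergence of \<open>W\<close> from below: the divergence
  of the normal is discarded, and the normal derivative of \<open>hN\<close>, which enters with the
  negative factor \<open>-p\<close>, is replaced by its upper bound \<open>hr / hN\<close>.\<close>

lemma divergence_inequality:
  fixes p :: real
  assumes "cutoff \<psi> \<psi>' \<epsilon> R'" "R' < R"
  defines "low \<equiv> \<lambda>x. \<rho>0 x * \<psi>' (rN x) * hN x powr (-p-1) + \<psi> (rN x) * hN x powr (-p) * (grad\<rho> x \<bullet> nN x)
      - p * (\<rho>0 x * \<psi> (rN x) * hN x powr (-p-2) * hr (rN x) (nN x))"
  assumes p: "0 < p"
  shows "(\<integral>x. (if x \<in> \<Omega> then low x else 0) \<partial>lborel) \<le> 0"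
proof -
  interpret cutoff \<psi> \<psi>' \<epsilon> R' by fact
  note ann = annulus_image[OF \<epsilon>_pos \<open>R' < R\<close>]
  define K where "K = annulus_image \<epsilon> R'"
  have out: "\<psi> (rN x) = 0" "\<psi>' (rN x) = 0" if "x \<in> \<Omega> - K" for x
    using that ann(3)[of x] \<psi>_outside[of "rN x"] \<psi>'_outside[of "rN x"] by (auto simp: K_def)
  define G where "G x = \<rho>0 x * hN x powr (-p)" for x
  define G' where "G' x v = \<rho>0 x * ((-p * hN x powr (-p-1)) * Dh (N x) (DN x v)) + (grad\<rho> x \<bullet> v) * hN x powr (-p)" for x v
  define g where "g x = \<psi> (rN x) * G x" for x
  define g' where "g' x v = \<psi> (rN x) * G' x v + (\<psi>' (rN x) * (nN x \<bullet> DN x v)) * G x" for x v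
  define W where "W x = (if x \<in> \<Omega> then g x *\<^sub>R nN x else 0)" for x
  define W' where "W' x v = g x *\<^sub>R Dn x v + g' x v *\<^sub>R nN x" for x v
  have cont\<psi>: "continuous_on \<Omega> (\<lambda>x. \<psi> (rN x))" "continuous_on \<Omega> (\<lambda>x. \<psi>' (rN x))"
    by (rule continuous_on_compose2[OF \<psi>_cont continuous_on_\<Omega>(3)], simp)
       (rule continuous_on_compose2[OF \<psi>'_cont continuous_on_\<Omega>(3)], simp)
  have dG: "(G has_derivative G' x) (at x)" if x: "x \<in> \<Omega>" for x
  proof -
    have "((\<lambda>z. z powr (-p)) has_real_derivative -p * hN x powr (-p-1)) (at (hN x))"
      using polar_N(7)[OF x] by (rule has_real_derivative_powr)
    from has_derivative_real_compose[OF hN_has_derivative[OF x] this]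
    have "((\<lambda>x. hN x powr (-p)) has_derivative (\<lambda>v. (-p * hN x powr (-p-1)) * Dh (N x) (DN x v))) (at x)" .
    from has_derivative_mult[OF \<rho>0_has_derivative[OF x] this]
    show ?thesis unfolding G_def[abs_def] G'_def[abs_def] .
  qed
  have dg: "(g has_derivative g' x) (at x)" if x: "x \<in> \<Omega>" for x
    using has_derivative_mult[OF has_derivative_real_compose[OF rN_has_derivative[OF x] \<psi>_deriv] dG[OF x]]
    unfolding g_def[abs_def] g'_def[abs_def] .
  have dW: "(W has_derivative W' x) (at x)" if x: "x \<in> \<Omega>" for x
  proof (rule has_derivative_transform_within_open[OF _ open_\<Omega> x])
    show "((\<lambda>x. g x *\<^sub>R nN x) has_derivative W' x) (at x)"
      using has_derivative_scaleR[OF dg[OF x] nN_has_derivative[OF x]] unfolding W'_def[abs_def] .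
  qed (simp add: W_def)
  have contW': "continuous_on \<Omega> (\<lambda>x. W' x v)" for v
  proof -
    have cG: "continuous_on \<Omega> G" unfolding G_def by (intro continuous_on_mult continuous_on_\<Omega>)
    have cG': "continuous_on \<Omega> (\<lambda>x. G' x v)" unfolding G'_def
      by (intro continuous_on_add continuous_on_mult continuous_on_inner continuous_on_const continuous_on_\<Omega> continuous_Dh_DN)
    have "continuous_on \<Omega> g" unfolding g_def by (intro continuous_on_mult cont\<psi> cG)
    moreover have "continuous_on \<Omega> (\<lambda>x. g' x v)" unfolding g'_def
      by (intro continuous_on_add continuous_on_mult continuous_on_inner cont\<psi> cG cG' continuous_on_\<Omega> continuous_DN)
    ultimately show ?thesis unfolding W'_def
      by (intro continuous_on_add continuous_on_scaleR continuous_Dn continuous_on_\<Omega>)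
  qed
  have "(\<integral>x. (if x \<in> \<Omega> then \<Sum>b\<in>Basis. W' x b \<bullet> b else 0) \<partial>lborel) = 0"
    and int: "integrable lborel (\<lambda>x. if x \<in> \<Omega> then \<Sum>b\<in>Basis. W' x b \<bullet> b else 0)"
    using divergence_compact_support[OF open_\<Omega>, of K W W'] ann dW contW' out
    by (auto simp: K_def W_def g_def)
  moreover have "(\<integral>x. (if x \<in> \<Omega> then low x else 0) \<partial>lborel) \<le> (\<integral>x. (if x \<in> \<Omega> then \<Sum>b\<in>Basis. W' x b \<bullet> b else 0) \<partial>lborel)"
  proof (rule integral_mono[OF _ int])
    have "continuous_on \<Omega> low"
      unfolding low_def
      by (intro continuous_on_add continuous_on_diff continuous_on_mult continuous_on_inner continuous_on_const cont\<psi> continuous_on_\<Omega>)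
    then show "integrable lborel (\<lambda>x. if x \<in> \<Omega> then low x else 0)"
      by (rule integrable_compact_support[where K = K]) (use ann out in \<open>auto simp: K_def low_def\<close>)
    fix x
    show "(if x \<in> \<Omega> then low x else 0) \<le> (if x \<in> \<Omega> then \<Sum>b\<in>Basis. W' x b \<bullet> b else 0)"
    proof (cases "x \<in> \<Omega>")
      case x: True
      have \<rho>: "0 \<le> \<rho>0 x" using density0 x \<Omega>_sub_A by (auto simp: probability_density_on_def)
      have hpos: "0 < hN x" by (rule polar_N(7)[OF x])
      have lin: "linear (g' x)" using dg[OF x] by (rule has_derivative_linear)
      have "low x \<le> g' x (nN x)"
      proof -
        have h1: "hN x powr (-p-2) = hN x powr (-p-1) / hN x" "hN x powr (-p-1) = hN x powr (-p) / hN x"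
          using hpos by (simp_all add: powr_diff powr_numeral power2_eq_square)
        have "p * (\<rho>0 x * \<psi> (rN x) * hN x powr (-p-1)) * Dh (N x) (DN x (nN x))
            \<le> p * (\<rho>0 x * \<psi> (rN x) * hN x powr (-p-1)) * (hr (rN x) (nN x) / hN x)"
          using p \<rho> \<psi>_nonneg by (intro mult_left_mono normal_derivatives(2)[OF x] mult_nonneg_nonneg) auto
        then have "p * (\<rho>0 x * \<psi> (rN x) * hN x powr (-p-1)) * Dh (N x) (DN x (nN x))
            \<le> p * (\<rho>0 x * \<psi> (rN x) * hN x powr (-p-2) * hr (rN x) (nN x))"
          by (simp add: h1)
        moreover have "g' x (nN x) = \<rho>0 x * \<psi>' (rN x) * hN x powr (-p-1) + \<psi> (rN x) * hN x powr (-p) * (grad\<rho> x \<bullet> nN x)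
           - p * (\<rho>0 x * \<psi> (rN x) * hN x powr (-p-1)) * Dh (N x) (DN x (nN x))"
          unfolding g'_def G'_def G_def normal_derivatives(1)[OF x] h1(2) by (simp add: algebra_simps)
        ultimately show ?thesis unfolding low_def by linarith
      qed
      also have "\<dots> \<le> g' x (nN x) + g x * (\<Sum>b\<in>Basis. Dn x b \<bullet> b)"
        using div_normal_nonneg[OF x] \<psi>_nonneg \<rho> by (simp add: g_def G_def)
      also have "\<dots> = (\<Sum>b\<in>Basis. W' x b \<bullet> b)"
        unfolding W'_def by (simp add: inner_add_left sum.distrib sum_distrib_left sum_inner_basis_scaleR[OF lin, simplified])
      finally show ?thesis using x by simp
    qed simp
  qed
  ultimately show ?thesis by simp
qed

text \<open>The field is \<open>y\<close> times \<open>\<psi> h^(-p-1) / norm y ^ d\<close>. Its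
  divergence is the r-derivative of \<open>\<psi> h^(-p-1)\<close> divided by
  \<open>norm y ^ (d - 1)\<close>, the weight of the target density; this stands for an integration
  by parts along every ray.\<close>

lemma polar_divergence:
  assumes "cutoff \<psi> \<psi>' \<epsilon> R'" "R' < R"
  shows "(\<integral>y. (if y \<in> ball 0 R - {0} then (\<psi>' (norm y) * h (norm y) (sgn y) powr (-p-1)
      - (p + 1) * (\<psi> (norm y) * h (norm y) (sgn y) powr (-p-2) * hr (norm y) (sgn y))) / norm y ^ (CARD('n) - 1) else 0) \<partial>lborel) = 0"
proof -
  interpret cutoff \<psi> \<psi>' \<epsilon> R' by fact
  define S where "S = ball (0::real^'n) R - {0}"
  define K where "K = cball (0::real^'n) R' - ball 0 \<epsilon>"
  have oS: "open S" unfolding S_def by auto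
  have SPB: "S \<subseteq> PB" unfolding S_def by auto
  have K: "compact K" "K \<subseteq> S"
    unfolding K_def S_def by (rule compact_annulus) (rule annulus_sub[OF \<epsilon>_pos assms(2)])
  have out: "\<psi> (norm y) = 0" "\<psi>' (norm y) = 0" if "y \<notin> K" for y
    using that \<psi>_outside[of "norm y"] \<psi>'_outside[of "norm y"] by (auto simp: K_def)
  define d where "d = CARD('n)"
  have d: "d > 0" "DIM(real^'n) = d" by (auto simp: d_def)
  define hy where "hy y = h (norm y) (sgn y)" for y
  have S1: "hy y > 0" "norm y > 0" "y \<noteq> 0" if "y \<in> S" for y
    using that positivity(1)[OF polar_PB(1,2)] SPB by (auto simp: S_def hy_def)
  define q where "q s = \<psi> s / s ^ d" for s
  define q' where "q' s = \<psi>' s / s ^ d - d * \<psi> s / s ^ (d + 1)" for s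
  have dq: "(q has_real_derivative q' s) (at s)" if "s > 0" for s
  proof -
    have "(q has_real_derivative (\<psi>' s * s ^ d - \<psi> s * (real d * s ^ (d - Suc 0))) / (s ^ d * s ^ d)) (at s)"
      unfolding q_def using that \<psi>_deriv by (auto intro!: derivative_eq_intros)
    moreover have "(\<psi>' s * s ^ d - \<psi> s * (real d * s ^ (d - Suc 0))) / (s ^ d * s ^ d) = q' s"
    proof -
      obtain m where m: "d = Suc m" using d gr0_implies_Suc by blast
      show ?thesis using that unfolding q'_def m by (simp add: field_simps)
    qed
    ultimately show ?thesis by simp
  qed
  define f' where "f' y v = ((-p-1) * hy y powr (-p-2)) * Dh y v" for y v
  define c where "c y = q (norm y) * hy y powr (-p-1)" for y
  define c' where "c' y v = q (norm y) * f' y v + (q' (norm y) * (sgn y \<bullet> v)) * hy y powr (-p-1)" for y v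
  define W where "W y = (if y \<in> S then c y *\<^sub>R y else 0)" for y
  define W' where "W' y v = c y *\<^sub>R v + c' y v *\<^sub>R y" for y v
  have dc: "(c has_derivative c' y) (at y)" if y: "y \<in> S" for y
  proof -
    have "((\<lambda>z. z powr (-p-1)) has_real_derivative (-p-1) * hy y powr (-p-1-1)) (at (hy y))"
      using S1(1)[OF y] by (rule has_real_derivative_powr)
    moreover have "-p-1-1 = -p-2" by simp
    ultimately have "((\<lambda>z. z powr (-p-1)) has_real_derivative (-p-1) * hy y powr (-p-2)) (at (hy y))" by (simp only:)
    moreover have "(hy has_derivative Dh y) (at y)"
      using h_has_derivative[of y] y unfolding hy_def[abs_def] S_def by blast
    ultimately have f: "((\<lambda>y. hy y powr (-p-1)) has_derivative f' y) (at y)"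
      unfolding f'_def[abs_def] by (intro has_derivative_real_compose)
    have "(norm has_derivative (\<lambda>v. sgn y \<bullet> v)) (at y)"
      using has_derivative_norm[OF S1(3)[OF y]] by (simp only: inner_commute)
    from has_derivative_mult[OF has_derivative_real_compose[OF this dq[OF S1(2)[OF y]]] f]
    show ?thesis unfolding c_def[abs_def] c'_def[abs_def] .
  qed
  have dW: "(W has_derivative W' y) (at y)" if y: "y \<in> S" for y
  proof (rule has_derivative_transform_within_open[OF _ oS y])
    show "((\<lambda>y. c y *\<^sub>R y) has_derivative W' y) (at y)"
      using has_derivative_scaleR[OF dc[OF y] has_derivative_ident] unfolding W'_def[abs_def] .
  qed (simp add: W_def)
  have conts: "continuous_on S hy" "continuous_on S (\<lambda>y. hr (norm y) (sgn y))" "continuous_on S (\<lambda>y. k (norm y) (sgn y))"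
    using continuous_on_subset[OF continuous_on_polar[OF h_C0] SPB] continuous_on_subset[OF continuous_on_polar[OF hr_C0] SPB]
      continuous_on_subset[OF continuous_on_polar[OF k_C0] SPB] by (auto simp: hy_def[abs_def])
  have cont\<psi>: "continuous_on S (\<lambda>x. \<psi> (norm x))" "continuous_on S (\<lambda>x. \<psi>' (norm x))"
    by (rule continuous_on_compose2[OF \<psi>_cont], auto intro: continuous_intros)
       (rule continuous_on_compose2[OF \<psi>'_cont], auto intro: continuous_intros)
  have S2: "\<And>y. y \<in> S \<Longrightarrow> hy y \<noteq> 0" "\<And>y. y \<in> S \<Longrightarrow> norm y \<noteq> 0" using S1 by fastforce+
  have contW': "continuous_on S (\<lambda>x. W' x v)" for v
    unfolding W'_def c'_def c_def q_def q'_def f'_def Dh_def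
    by (intro continuous_intros conts cont\<psi> ballI power_not_zero) (use S2 in auto)
  have "(\<integral>x. (if x \<in> S then \<Sum>b\<in>Basis. W' x b \<bullet> b else 0) \<partial>lborel) = 0"
    using divergence_compact_support(2)[OF oS K, of W W'] dW contW' out
    by (auto simp: W_def c_def q_def)
  moreover have "(\<Sum>b\<in>Basis. W' y b \<bullet> b) = (\<psi>' (norm y) * hy y powr (-p-1)
      - (p + 1) * (\<psi> (norm y) * hy y powr (-p-2) * hr (norm y) (sgn y))) / norm y ^ (d - 1)" if y: "y \<in> S" for y
  proof -
    have yS: "y \<in> ball 0 R - {0}" using y S_def by blast
    have yP: "norm y > 0" "y \<noteq> 0" using S1[OF y] by auto
    have lin: "linear (c' y)" using dc[OF y] by (rule has_derivative_linear)
    have "(\<Sum>b\<in>Basis. W' y b \<bullet> b) = c y * d + c' y y"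
      unfolding W'_def
      by (simp add: inner_add_left sum.distrib sum_inner_basis_scaleR[OF lin, simplified] d_def)
    moreover have "sgn y \<bullet> y = norm y" using yP by (simp add: sgn_div_norm dot_square_norm power2_eq_square)
    \<comment> \<open>\<open>k\<close> is orthogonal to the ray, so only the radial part of the
      derivative of \<open>h\<close> is left.\<close>
    moreover have "k (norm y) (sgn y) \<bullet> y = 0"
    proof -
      have "sgn y \<bullet> k (norm y) (sgn y) = 0" by (rule inner_k[OF polar_PB(3,4)[OF yS]])
      then show ?thesis using yP by (simp add: sgn_div_norm inner_commute)
    qed
    ultimately have "(\<Sum>b\<in>Basis. W' y b \<bullet> b) = q (norm y) * hy y powr (-p-1) * d +
       (q (norm y) * (((-p-1) * hy y powr (-p-2)) * (norm y * hr (norm y) (sgn y))) + (q' (norm y) * norm y) * hy y powr (-p-1))"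
      by (simp add: c_def c'_def f'_def Dh_def)
    also have "\<dots> = (q (norm y) * d + q' (norm y) * norm y) * hy y powr (-p-1)
       - (p + 1) * (q (norm y) * norm y) * (hy y powr (-p-2) * hr (norm y) (sgn y))"
      by (simp add: algebra_simps)
    also have "q (norm y) * d + q' (norm y) * norm y = \<psi>' (norm y) / norm y ^ (d - 1)"
    proof -
      obtain m where m: "d = Suc m" using d gr0_implies_Suc by blast
      show ?thesis using yP unfolding q_def q'_def m by (simp add: field_simps)
    qed
    also have "q (norm y) * norm y = \<psi> (norm y) / norm y ^ (d - 1)"
    proof -
      obtain m where m: "d = Suc m" using d gr0_implies_Suc by blast
      show ?thesis using yP unfolding q_def m by (simp add: field_simps)
    qed
    finally show ?thesis by (simp add: diff_divide_distrib)
  qed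
  ultimately show ?thesis unfolding S_def hy_def d_def by (simp cong: if_cong)
qed

end


section \<open>Transfer of integrals along the transport\<close>

context radial_target_transport
begin

abbreviation "B0 \<equiv> ball (0::real^'n) R - {0}"

text \<open>At almost every point the outer normal \<open>n\<close> of the sublevel set attains its
  support function there. Uniqueness of contact points gives \<open>x = X (\<phi> x) n\<close>, and
  \<open>T x\<close> is the matching point of the ball.\<close>

lemma T_eq_N: "AE x in lborel. x \<in> A \<longrightarrow> norm (T x) = \<phi> x \<and> (0 < \<phi> x \<longrightarrow> \<phi> x < R \<longrightarrow> x \<in> \<Omega> \<and> N x = T x)"
proof -
  have m: "A \<inter> space lborel \<in> sets lborel" using A_borel by simp
  have "AE x in lborel. x \<in> A \<longrightarrow> (\<exists>!n. is_outer_unit_normal (sublevel A \<phi> (\<phi> x)) x n) \<and>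
                 T x = \<phi> x *\<^sub>R outer_unit_normal (sublevel A \<phi> (\<phi> x)) x"
    using T_eq unfolding AE_restrict_space_iff[OF m] .
  then show ?thesis
  proof eventually_elim
    fix x
    assume asm: "x \<in> A \<longrightarrow> (\<exists>!n. is_outer_unit_normal (sublevel A \<phi> (\<phi> x)) x n) \<and>
                 T x = \<phi> x *\<^sub>R outer_unit_normal (sublevel A \<phi> (\<phi> x)) x"
    show "x \<in> A \<longrightarrow> norm (T x) = \<phi> x \<and> (0 < \<phi> x \<longrightarrow> \<phi> x < R \<longrightarrow> x \<in> \<Omega> \<and> N x = T x)"
    proof (intro impI)
      assume x: "x \<in> A"
      define n where "n = outer_unit_normal (sublevel A \<phi> (\<phi> x)) x"
      have n: "is_outer_unit_normal (sublevel A \<phi> (\<phi> x)) x n"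
        unfolding n_def outer_unit_normal_def by (rule theI') (use asm x in blast)
      have Tx: "T x = \<phi> x *\<^sub>R n" using asm x n_def by blast
      have \<phi>x: "0 \<le> \<phi> x" "x \<in> sublevel A \<phi> (\<phi> x)" using x range_\<phi> by (auto simp: sublevel_def)
      have n1: "norm n = 1" using n by (simp add: is_outer_unit_normal_def)
      show "norm (T x) = \<phi> x \<and> (0 < \<phi> x \<longrightarrow> \<phi> x < R \<longrightarrow> x \<in> \<Omega> \<and> N x = T x)"
      proof (intro conjI impI)
        show "norm (T x) = \<phi> x" using Tx n1 \<phi>x by simp
        assume r: "0 < \<phi> x" "\<phi> x < R"
        then have r': "\<phi> x \<in> {0<..R}" and n2: "n \<in> sphere 0 1" using n1 by auto
        have "x = X (\<phi> x) n"
        proof (rule X_unique[OF r' n2 \<phi>x(2)])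
          show "H (\<phi> x) n \<le> n \<bullet> x"
            using n r by (intro H_le) (auto simp: is_outer_unit_normal_def inner_diff_right)
        qed
        then have xT: "x = Xy (T x)" using polar_scaleR[OF r' n2] Tx by (simp add: Xy_def)
        have "T x \<in> PB" "norm (T x) = \<phi> x" using polar_scaleR[OF r' n2] Tx by auto
        then have "T x \<in> B0" "T x \<in> PB" using r by auto
        then show "x \<in> \<Omega>" "N x = T x" using xT N_Xy[of "T x"] unfolding \<Omega>_def by (blast, simp)
      qed
    qed
  qed
qed

lemma nn_integral_target:
  assumes f: "f \<in> borel_measurable borel"
  shows "(\<integral>\<^sup>+x\<in>A. ennreal (\<rho>0 x) * f (T x) \<partial>lborel) = (\<integral>\<^sup>+y\<in>cball 0 R. ennreal (\<rho>1 y) * f y \<partial>lborel)"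
proof -
  have m: "f \<in> borel_measurable (restrict_space borel (cball 0 R))"
    using f by (rule measurable_restrict_space1)
  have \<rho>: "\<rho>0 \<in> borel_measurable (restrict_space borel A)" "\<rho>1 \<in> borel_measurable (restrict_space borel (cball 0 R))"
    using density0 density1 by (auto simp: probability_density_on_def)
  have T: "T \<in> measurable (density_measure A \<rho>0) (restrict_space borel (cball 0 R))"
    using T_borel by (subst measurable_cong_sets[OF density_measure_simps(1)[OF A_borel] refl])
  have "(\<integral>\<^sup>+y\<in>cball 0 R. ennreal (\<rho>1 y) * f y \<partial>lborel) = (\<integral>\<^sup>+y. f y \<partial>density_measure (cball 0 R) \<rho>1)"
    by (rule nn_integral_density_measure[symmetric]) (use \<rho> m in auto)
  also have "\<dots> = (\<integral>\<^sup>+y. f y \<partial>distr (density_measure A \<rho>0) (restrict_space borel (cball 0 R)) T)"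
    by (simp only: push_forward)
  also have "\<dots> = (\<integral>\<^sup>+x. f (T x) \<partial>density_measure A \<rho>0)"
    by (rule nn_integral_distr[OF T]) (use m in simp)
  also have "\<dots> = (\<integral>\<^sup>+x\<in>A. ennreal (\<rho>0 x) * f (T x) \<partial>lborel)"
    by (rule nn_integral_density_measure[OF A_borel \<rho>(1)]) (rule measurable_compose[OF T_borel m])
  finally show ?thesis by simp
qed

lemma nn_integral_push:
  assumes f: "f \<in> borel_measurable borel"
  shows "(\<integral>\<^sup>+x\<in>\<Omega>. ennreal (\<rho>0 x) * f (N x) \<partial>lborel) = (\<integral>\<^sup>+y\<in>B0. ennreal (C / norm y ^ (CARD('n) - 1)) * f y \<partial>lborel)"
proof -
  \<comment> \<open>Cutting \<open>f\<close> down to \<open>B0\<close> makes \<open>T\<close> and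
    \<open>N\<close> interchangeable: almost every point of \<open>A\<close> outside \<Omega> is
    sent to the origin or to the bounding sphere.\<close>
  define f1 where "f1 y = f y * indicator B0 y" for y
  have B0: "B0 \<in> sets borel" by auto
  have f1: "f1 \<in> borel_measurable borel" unfolding f1_def using f B0 by measurable
  have "(\<integral>\<^sup>+x\<in>\<Omega>. ennreal (\<rho>0 x) * f (N x) \<partial>lborel) = (\<integral>\<^sup>+x\<in>A. ennreal (\<rho>0 x) * f1 (T x) \<partial>lborel)"
  proof (rule nn_integral_cong_AE)
    show "AE x in lborel. ennreal (\<rho>0 x) * f (N x) * indicator \<Omega> x = ennreal (\<rho>0 x) * f1 (T x) * indicator A x"
      using T_eq_N
    proof eventually_elim
      fix x assume a: "x \<in> A \<longrightarrow> norm (T x) = \<phi> x \<and> (0 < \<phi> x \<longrightarrow> \<phi> x < R \<longrightarrow> x \<in> \<Omega> \<and> N x = T x)"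
      show "ennreal (\<rho>0 x) * f (N x) * indicator \<Omega> x = ennreal (\<rho>0 x) * f1 (T x) * indicator A x"
      proof (cases "x \<in> \<Omega>")
        case True
        then have xA: "x \<in> A" using \<Omega>_sub_A by blast
        have "0 < \<phi> x" "\<phi> x < R" using \<Omega>_N(1,4)[OF True] by auto
        then have "N x = T x" using a xA by blast
        then have "T x \<in> B0" using \<Omega>_N(1)[OF True] by simp
        then show ?thesis using True xA \<open>N x = T x\<close> by (simp add: f1_def)
      next
        case False
        have "T x \<notin> B0" if xA: "x \<in> A"
        proof
          assume "T x \<in> B0"
          then have "0 < norm (T x)" "norm (T x) < R" by auto
          then show False using a xA False by metis
        qed
        then have "f1 (T x) * indicator A x = 0" by (auto simp: f1_def indicator_def)
        then show ?thesis using False by (simp add: mult.assoc)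
      qed
    qed
  qed
  also have "\<dots> = (\<integral>\<^sup>+y\<in>cball 0 R. ennreal (\<rho>1 y) * f1 y \<partial>lborel)" by (rule nn_integral_target[OF f1])
  also have "\<dots> = (\<integral>\<^sup>+y\<in>B0. ennreal (C / norm y ^ (CARD('n) - 1)) * f y \<partial>lborel)"
  proof (rule nn_integral_cong)
    fix y
    show "ennreal (\<rho>1 y) * f1 y * indicator (cball 0 R) y = ennreal (C / norm y ^ (CARD('n) - 1)) * f y * indicator B0 y"
    proof (cases "y \<in> B0")
      case True
      then have "y \<in> PB" by auto
      then have "\<rho>1 y = C / norm y ^ (CARD('n) - 1)" by (rule target_density)
      then show ?thesis using True \<open>y \<in> PB\<close> by (simp add: f1_def)
    next
      case False
      then have "f1 y = 0" unfolding f1_def by (simp add: indicator_def)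
      then show ?thesis using False by simp
    qed
  qed
  finally show ?thesis .
qed

text \<open>The target measure does not charge the origin and the sphere of radius \<open>R\<close>,
  so almost no point of positive density is sent there.\<close>

lemma AE_in_\<Omega>: "AE x in lborel. x \<in> A \<longrightarrow> 0 < \<rho>0 x \<longrightarrow> x \<in> \<Omega>"
proof -
  define S where "S = insert 0 (sphere (0::real^'n) R)"
  have "closed S" unfolding S_def by (intro closed_insert closed_sphere)
  then have Sm: "S \<in> sets borel" by (rule borel_closed)
  have "negligible S" unfolding S_def by (simp only: negligible_insert negligible_sphere)
  then have "S \<in> null_sets lebesgue" by (simp only: negligible_iff_null_sets)
  then have null: "S \<in> null_sets lborel" using Sm null_sets_completion_iff[of S lborel] by (simp only: sets_lborel)
  have \<rho>: "\<rho>0 \<in> borel_measurable (restrict_space borel A)" using density0 by (simp add: probability_density_on_def)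
  have "(\<integral>\<^sup>+x\<in>A. ennreal (\<rho>0 x) * indicator S (T x) \<partial>lborel) = (\<integral>\<^sup>+y\<in>cball 0 R. ennreal (\<rho>1 y) * indicator S y \<partial>lborel)"
    using Sm by (intro nn_integral_target) auto
  also have "\<dots> = (\<integral>\<^sup>+(y::real^'n). 0 \<partial>lborel)"
    by (rule nn_integral_cong_AE) (use AE_not_in[OF null] in \<open>eventually_elim; simp\<close>)
  finally have 0: "(\<integral>\<^sup>+x. ennreal (\<rho>0 x) * indicator S (T x) * indicator A x \<partial>lborel) = 0" by simp
  have "(\<lambda>x. ennreal (\<rho>0 x) * indicator S (T x)) \<in> borel_measurable (restrict_space borel A)"
  proof (rule borel_measurable_times_ennreal)
    show "(\<lambda>x. ennreal (\<rho>0 x)) \<in> borel_measurable (restrict_space borel A)" using \<rho> by measurable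
    have "indicator S \<in> borel_measurable (restrict_space borel (cball (0::real^'n) R))"
      using Sm by (intro measurable_restrict_space1) auto
    from measurable_compose[OF T_borel this]
    show "(\<lambda>x. indicator S (T x) :: ennreal) \<in> borel_measurable (restrict_space borel A)" .
  qed
  then have "(\<lambda>x. ennreal (\<rho>0 x) * indicator S (T x) * indicator A x) \<in> borel_measurable lborel"
    by (subst (asm) borel_measurable_restrict_space_iff_ennreal) auto
  then have "AE x in lborel. ennreal (\<rho>0 x) * indicator S (T x) * indicator A x = 0"
    using 0 by (subst (asm) nn_integral_0_iff_AE) auto
  then show ?thesis using T_eq_N
  proof eventually_elim
    fix x assume z: "ennreal (\<rho>0 x) * indicator S (T x) * indicator A x = 0"
      and a: "x \<in> A \<longrightarrow> norm (T x) = \<phi> x \<and> (0 < \<phi> x \<longrightarrow> \<phi> x < R \<longrightarrow> x \<in> \<Omega> \<and> N x = T x)"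
    show "x \<in> A \<longrightarrow> 0 < \<rho>0 x \<longrightarrow> x \<in> \<Omega>"
    proof (intro impI)
      assume x: "x \<in> A" "0 < \<rho>0 x"
      then have "T x \<notin> S" using z by (auto simp: indicator_def split: if_splits)
      then have "\<phi> x \<noteq> 0" "\<phi> x \<noteq> R" using a x by (auto simp: S_def)
      moreover have "0 \<le> \<phi> x" "\<phi> x \<le> R" using range_\<phi> x by auto
      ultimately show "x \<in> \<Omega>" using a x by auto
    qed
  qed
qed

text \<open>The image under \<open>N\<close> of the source measure on \<Omega> is identified as a
  measure. This carries over signed integrands, such as the one containing \<open>hr\<close>,
  without splitting them.\<close>

lemma integral_push:
  fixes f :: "real^'n \<Rightarrow> real"
  assumes f: "f \<in> borel_measurable borel"
  shows "(\<integral>x. (if x \<in> \<Omega> then \<rho>0 x * f (N x) else 0) \<partial>lborel) =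
    (\<integral>y. (if y \<in> B0 then C / norm y ^ (CARD('n) - 1) * f y else 0) \<partial>lborel)"
proof -
  have \<Omega>m: "\<Omega> \<in> sets borel" using open_\<Omega> by auto
  have B0: "B0 \<in> sets borel" by auto
  define w0 where "w0 x = indicator \<Omega> x * \<rho>0 x" for x
  define w1 where "w1 y = indicator B0 y * (C / norm y ^ (CARD('n) - 1))" for y :: "real^'n"
  define N1 where "N1 x = indicator \<Omega> x *\<^sub>R N x" for x
  have w0: "w0 \<in> borel_measurable borel" "0 \<le> w0 x" for x
  proof -
    show "w0 \<in> borel_measurable borel"
      using borel_measurable_continuous_on_indicator[OF \<Omega>m continuous_on_\<Omega>(1)] by (simp add: w0_def[abs_def])
    show "0 \<le> w0 x" using density0 \<Omega>_sub_A by (auto simp: w0_def indicator_def probability_density_on_def)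
  qed
  have w1: "w1 \<in> borel_measurable borel" "0 \<le> w1 y" for y
    unfolding w1_def using B0 C_pos by (measurable, auto)
  have N1: "N1 \<in> borel_measurable borel"
    unfolding N1_def using borel_measurable_continuous_on_indicator[OF \<Omega>m continuous_N] .
  have "distr (density lborel (\<lambda>x. ennreal (w0 x))) borel N1 = density lborel (\<lambda>y. ennreal (w1 y))"
  proof (rule measure_eqI)
    fix D assume "D \<in> sets (distr (density lborel (\<lambda>x. ennreal (w0 x))) borel N1)"
    then have D: "D \<in> sets borel" by simp
    have "emeasure (distr (density lborel (\<lambda>x. ennreal (w0 x))) borel N1) D
        = (\<integral>\<^sup>+x. indicator D x \<partial>distr (density lborel (\<lambda>x. ennreal (w0 x))) borel N1)"
      using D by simp
    also have "\<dots> = (\<integral>\<^sup>+x. indicator D (N1 x) \<partial>density lborel (\<lambda>x. ennreal (w0 x)))"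
      using D N1 by (intro nn_integral_distr) auto
    also have "\<dots> = (\<integral>\<^sup>+x. ennreal (w0 x) * indicator D (N1 x) \<partial>lborel)"
      using w0 N1 D by (intro nn_integral_density) auto
    also have "\<dots> = (\<integral>\<^sup>+x\<in>\<Omega>. ennreal (\<rho>0 x) * indicator D (N x) \<partial>lborel)"
      by (rule nn_integral_cong) (auto simp: w0_def N1_def indicator_def)
    also have "\<dots> = (\<integral>\<^sup>+y\<in>B0. ennreal (C / norm y ^ (CARD('n) - 1)) * indicator D y \<partial>lborel)"
      using D by (intro nn_integral_push) auto
    also have "\<dots> = (\<integral>\<^sup>+y. ennreal (w1 y) * indicator D y \<partial>lborel)"
    proof (rule nn_integral_cong)
      fix y show "ennreal (C / norm y ^ (CARD('n) - 1)) * indicator D y * indicator B0 y = ennreal (w1 y) * indicator D y"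
        unfolding w1_def by (cases "y \<in> B0") (simp_all del: Diff_iff)
    qed
    also have "\<dots> = emeasure (density lborel (\<lambda>y. ennreal (w1 y))) D"
      using w1 D by (intro emeasure_density[symmetric]) auto
    finally show "emeasure (distr (density lborel (\<lambda>x. ennreal (w0 x))) borel N1) D = emeasure (density lborel (\<lambda>y. ennreal (w1 y))) D" .
  qed simp
  note eq = this
  have "(\<integral>x. (if x \<in> \<Omega> then \<rho>0 x * f (N x) else 0) \<partial>lborel) = (\<integral>x. w0 x *\<^sub>R f (N1 x) \<partial>lborel)"
    by (rule Bochner_Integration.integral_cong) (auto simp: w0_def N1_def)
  also have "\<dots> = (\<integral>x. f (N1 x) \<partial>density lborel (\<lambda>x. ennreal (w0 x)))"
    using w0 N1 f by (intro integral_density[symmetric]) auto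
  also have "\<dots> = (\<integral>y. f y \<partial>distr (density lborel (\<lambda>x. ennreal (w0 x))) borel N1)"
    using N1 f by (intro integral_distr[symmetric]) auto
  also have "\<dots> = (\<integral>y. f y \<partial>density lborel (\<lambda>y. ennreal (w1 y)))" by (simp only: eq)
  also have "\<dots> = (\<integral>y. w1 y *\<^sub>R f y \<partial>lborel)"
    using w1 f by (intro integral_density) auto
  also have "\<dots> = (\<integral>y. (if y \<in> B0 then C / norm y ^ (CARD('n) - 1) * f y else 0) \<partial>lborel)"
  proof (rule Bochner_Integration.integral_cong)
    fix y show "w1 y *\<^sub>R f y = (if y \<in> B0 then C / norm y ^ (CARD('n) - 1) * f y else 0)"
      unfolding w1_def by (cases "y \<in> B0") (simp_all del: Diff_iff)
  qed simp
  finally show ?thesis .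
qed

text \<open>Divergence on \<open>A\<close> gives \<open>I f1 + I f2 - p * I f3 \<le> 0\<close>, the
  identity on the ball gives \<open>I f1 = (p + 1) * I f3\<close>. Eliminating the uncontrolled
  \<open>I f3\<close> leaves \<open>I f1 / (p + 1) \<le> - I f2\<close>, and Cauchy-Schwarz turns
  the right-hand side into \<open>I f4\<close>.\<close>

lemma interior_inequality:
  fixes p :: real
  assumes cut: "cutoff \<psi> \<psi>' \<epsilon> R'" and R': "R' < R" and p: "0 < p"
  shows "(\<integral>x. (if x \<in> \<Omega> then \<rho>0 x * (\<psi>' (rN x) * hN x powr (-p-1)) else 0) \<partial>lborel)
    \<le> (p + 1) * (\<integral>x. (if x \<in> \<Omega> then \<psi> (rN x) * hN x powr (-p) * norm (grad\<rho> x) else 0) \<partial>lborel)"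
proof -
  interpret cutoff \<psi> \<psi>' \<epsilon> R' by fact
  note ann = annulus_image[OF \<epsilon>_pos R']
  define K where "K = annulus_image \<epsilon> R'"
  have out: "\<psi> (rN x) = 0" "\<psi>' (rN x) = 0" if "x \<in> \<Omega> - K" for x
    using that ann(3)[of x] \<psi>_outside[of "rN x"] \<psi>'_outside[of "rN x"] by (auto simp: K_def)
  have K: "compact K" "K \<subseteq> \<Omega>" using ann by (auto simp: K_def)
  have cont\<psi>: "continuous_on \<Omega> (\<lambda>x. \<psi> (rN x))" "continuous_on \<Omega> (\<lambda>x. \<psi>' (rN x))"
    by (rule continuous_on_compose2[OF \<psi>_cont continuous_on_\<Omega>(3)], simp)
       (rule continuous_on_compose2[OF \<psi>'_cont continuous_on_\<Omega>(3)], simp)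
  define f1 where "f1 x = \<rho>0 x * (\<psi>' (rN x) * hN x powr (-p-1))" for x
  define f2 where "f2 x = \<psi> (rN x) * hN x powr (-p) * (grad\<rho> x \<bullet> nN x)" for x
  define f3 where "f3 x = \<rho>0 x * (\<psi> (rN x) * hN x powr (-p-2) * hr (rN x) (nN x))" for x
  define f4 where "f4 x = \<psi> (rN x) * hN x powr (-p) * norm (grad\<rho> x)" for x
  define I where "I f = (\<integral>x. (if x \<in> \<Omega> then f x else 0) \<partial>lborel)" for f :: "real^'n \<Rightarrow> real"
  have c1: "continuous_on \<Omega> f1" unfolding f1_def[abs_def] by (intro continuous_on_mult cont\<psi> continuous_on_\<Omega>)
  have int1: "integrable lborel (\<lambda>x. if x \<in> \<Omega> then f1 x else 0)"
  proof (rule integrable_compact_support[OF c1 K])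
    fix x assume "x \<in> \<Omega> - K"
    from out[OF this] show "f1 x = 0" by (simp add: f1_def)
  qed
  have c2: "continuous_on \<Omega> f2" unfolding f2_def[abs_def] by (intro continuous_on_mult continuous_on_inner cont\<psi> continuous_on_\<Omega>)
  have int2: "integrable lborel (\<lambda>x. if x \<in> \<Omega> then f2 x else 0)"
  proof (rule integrable_compact_support[OF c2 K])
    fix x assume "x \<in> \<Omega> - K"
    from out[OF this] show "f2 x = 0" by (simp add: f2_def)
  qed
  have c3: "continuous_on \<Omega> f3" unfolding f3_def[abs_def] by (intro continuous_on_mult cont\<psi> continuous_on_\<Omega>)
  have int3: "integrable lborel (\<lambda>x. if x \<in> \<Omega> then f3 x else 0)"
  proof (rule integrable_compact_support[OF c3 K])
    fix x assume "x \<in> \<Omega> - K"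
    from out[OF this] show "f3 x = 0" by (simp add: f3_def)
  qed
  have c4: "continuous_on \<Omega> f4" unfolding f4_def[abs_def] by (intro continuous_on_mult continuous_on_norm cont\<psi> continuous_on_\<Omega>)
  have int4: "integrable lborel (\<lambda>x. if x \<in> \<Omega> then f4 x else 0)"
  proof (rule integrable_compact_support[OF c4 K])
    fix x assume "x \<in> \<Omega> - K"
    from out[OF this] show "f4 x = 0" by (simp add: f4_def)
  qed
  have A: "I f1 + I f2 - p * I f3 \<le> 0"
  proof -
    have "I f1 + I f2 - p * I f3 = (\<integral>x. (if x \<in> \<Omega> then f1 x else 0) + (if x \<in> \<Omega> then f2 x else 0) - p * (if x \<in> \<Omega> then f3 x else 0) \<partial>lborel)"
      unfolding I_def using int1 int2 int3 by simp
    also have "\<dots> = (\<integral>x. (if x \<in> \<Omega> then \<rho>0 x * \<psi>' (rN x) * hN x powr (-p-1) + \<psi> (rN x) * hN x powr (-p) * (grad\<rho> x \<bullet> nN x)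
      - p * (\<rho>0 x * \<psi> (rN x) * hN x powr (-p-2) * hr (rN x) (nN x)) else 0) \<partial>lborel)"
      by (rule Bochner_Integration.integral_cong) (auto simp: f1_def f2_def f3_def)
    also have "\<dots> \<le> 0" by (rule divergence_inequality[OF cut R' p])
    finally show ?thesis .
  qed
  \<comment> \<open>After the transfer the integrand is \<open>C\<close> times a divergence on the
    ball, because the target density has the weight \<open>norm y ^ (d - 1)\<close> in its
    denominator.\<close>
  have B: "I f1 - (p + 1) * I f3 = 0"
  proof -
    define q where "q y = indicator B0 y *\<^sub>R (\<psi>' (norm y) * h (norm y) (sgn y) powr (-p-1)
        - (p + 1) * (\<psi> (norm y) * h (norm y) (sgn y) powr (-p-2) * hr (norm y) (sgn y)))" for y
    have B0PB: "B0 \<subseteq> PB" by auto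
    have q: "q \<in> borel_measurable borel"
      unfolding q_def
    proof (rule borel_measurable_continuous_on_indicator)
      have c: "continuous_on B0 (\<lambda>y. h (norm y) (sgn y))" "continuous_on B0 (\<lambda>y. hr (norm y) (sgn y))"
        using continuous_on_subset[OF continuous_on_polar[OF h_C0] B0PB] continuous_on_subset[OF continuous_on_polar[OF hr_C0] B0PB] .
      have c2: "continuous_on B0 (\<lambda>y. h (norm y) (sgn y) powr s)" for s
      proof (rule continuous_on_powr[OF c(1) continuous_on_const])
        show "\<forall>y\<in>B0. h (norm y) (sgn y) \<noteq> 0"
          using positivity(1)[OF polar_PB(5,4)] by (metis less_irrefl)
      qed
      have c3: "continuous_on B0 (\<lambda>x. \<psi> (norm x))" "continuous_on B0 (\<lambda>x. \<psi>' (norm x))"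
        by (rule continuous_on_compose2[OF \<psi>_cont], auto intro: continuous_intros)
           (rule continuous_on_compose2[OF \<psi>'_cont], auto intro: continuous_intros)
      show "continuous_on B0 (\<lambda>y. \<psi>' (norm y) * h (norm y) (sgn y) powr (-p-1)
        - (p + 1) * (\<psi> (norm y) * h (norm y) (sgn y) powr (-p-2) * hr (norm y) (sgn y)))"
        by (intro continuous_on_diff continuous_on_mult continuous_on_const c c2 c3)
    qed auto
    have "I f1 - (p + 1) * I f3 = (\<integral>x. (if x \<in> \<Omega> then f1 x else 0) - (p + 1) * (if x \<in> \<Omega> then f3 x else 0) \<partial>lborel)"
      unfolding I_def using int1 int3 by simp
    also have "\<dots> = (\<integral>x. (if x \<in> \<Omega> then \<rho>0 x * q (N x) else 0) \<partial>lborel)"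
    proof (rule Bochner_Integration.integral_cong)
      fix x show "(if x \<in> \<Omega> then f1 x else 0) - (p + 1) * (if x \<in> \<Omega> then f3 x else 0) = (if x \<in> \<Omega> then \<rho>0 x * q (N x) else 0)"
        using \<Omega>_N(1)[of x] unfolding f1_def f3_def q_def by (auto simp: algebra_simps)
    qed simp
    also have "\<dots> = (\<integral>y. (if y \<in> B0 then C / norm y ^ (CARD('n) - 1) * q y else 0) \<partial>lborel)" by (rule integral_push[OF q])
    also have "\<dots> = (\<integral>y. C * (if y \<in> B0 then (\<psi>' (norm y) * h (norm y) (sgn y) powr (-p-1)
        - (p + 1) * (\<psi> (norm y) * h (norm y) (sgn y) powr (-p-2) * hr (norm y) (sgn y))) / norm y ^ (CARD('n) - 1) else 0) \<partial>lborel)"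
    proof (rule Bochner_Integration.integral_cong)
      fix y show "(if y \<in> B0 then C / norm y ^ (CARD('n) - 1) * q y else 0) = C * (if y \<in> B0 then (\<psi>' (norm y) * h (norm y) (sgn y) powr (-p-1)
        - (p + 1) * (\<psi> (norm y) * h (norm y) (sgn y) powr (-p-2) * hr (norm y) (sgn y))) / norm y ^ (CARD('n) - 1) else 0)"
        unfolding q_def by (cases "y \<in> B0") (simp_all del: Diff_iff)
    qed simp
    also have "\<dots> = 0" using polar_divergence[OF cut R', of p] by simp
    finally show ?thesis .
  qed
  have "- I f2 \<le> I f4"
  proof -
    have "- I f2 = (\<integral>x. - (if x \<in> \<Omega> then f2 x else 0) \<partial>lborel)" unfolding I_def by simp
    also have "\<dots> \<le> I f4"
      unfolding I_def
    proof (rule integral_mono)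
      show "integrable lborel (\<lambda>x. - (if x \<in> \<Omega> then f2 x else 0))" using int2 by simp
      fix x
      have "- (grad\<rho> x \<bullet> nN x) \<le> norm (grad\<rho> x)" if "x \<in> \<Omega>"
        using Cauchy_Schwarz_ineq2[of "grad\<rho> x" "nN x"] polar_N(4)[OF that] by (simp add: abs_le_iff)
      then show "- (if x \<in> \<Omega> then f2 x else 0) \<le> (if x \<in> \<Omega> then f4 x else 0)"
        using \<psi>_nonneg mult_left_mono[of "- (grad\<rho> x \<bullet> nN x)" "norm (grad\<rho> x)" "\<psi> (rN x) * hN x powr (-p)"]
        by (auto simp: f2_def f4_def)
    qed (rule int4)
    finally show ?thesis .
  qed
  moreover have "I f1 \<le> (p + 1) * (- I f2)"
  proof -
    have "(p + 1) * (I f1 + I f2 - p * I f3) \<le> 0" using A p by (simp add: mult_le_0_iff)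
    moreover have "(p + 1) * (I f1 + I f2 - p * I f3) = (p + 1) * I f1 + (p + 1) * I f2 - p * ((p + 1) * I f3)" by (simp add: algebra_simps)
    moreover have "(p + 1) * I f3 = I f1" using B by simp
    ultimately have "(p + 1) * I f1 + (p + 1) * I f2 - p * I f1 \<le> 0" by simp
    then show ?thesis by (simp add: algebra_simps)
  qed
  ultimately have "I f1 \<le> (p + 1) * I f4" using p by (meson mult_left_mono order_trans add_nonneg_nonneg less_imp_le zero_le_one)
  then show ?thesis unfolding I_def f1_def f4_def .
qed

end


section \<open>The boundary strip\<close>

text \<open>Integrals of 0-homogeneous functions over balls stand for integrals over the sphere;
  dilation produces the power of the radius.\<close>

lemma nn_integral_cone:
  fixes f :: "'a::euclidean_space \<Rightarrow> ennreal"
  assumes f: "(\<lambda>y. f (sgn y)) \<in> borel_measurable borel" and b: "0 < b"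
  shows "(\<integral>\<^sup>+y\<in>ball 0 b - {0}. f (sgn y) \<partial>lborel) = ennreal (b ^ DIM('a)) * (\<integral>\<^sup>+y\<in>ball 0 1 - {0}. f (sgn y) \<partial>lborel)"
proof -
  define g where "g y = f (sgn y) * indicator (ball 0 b - {0}) y" for y :: 'a
  have B: "ball 0 b - {0::'a} \<in> sets borel" and B1: "ball 0 1 - {0::'a} \<in> sets borel" by auto
  have g: "g \<in> borel_measurable borel" unfolding g_def using f B by measurable
  have "lborel = density (distr lborel borel (\<lambda>x::'a. 0 + b *\<^sub>R x)) (\<lambda>_. ennreal (\<bar>b\<bar> ^ DIM('a)))"
    using b lborel_affine[of b "0::'a"] by (simp add: ennreal_power)
  then have "(\<integral>\<^sup>+y. g y \<partial>lborel) = (\<integral>\<^sup>+y. g y \<partial>density (distr lborel borel (\<lambda>x::'a. 0 + b *\<^sub>R x)) (\<lambda>_. ennreal (\<bar>b\<bar> ^ DIM('a))))"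
    by (rule arg_cong)
  also have "\<dots> = (\<integral>\<^sup>+y. ennreal (\<bar>b\<bar> ^ DIM('a)) * g y \<partial>distr lborel borel (\<lambda>x::'a. 0 + b *\<^sub>R x))"
    using g by (intro nn_integral_density) auto
  also have "\<dots> = (\<integral>\<^sup>+x. ennreal (\<bar>b\<bar> ^ DIM('a)) * g (0 + b *\<^sub>R x) \<partial>lborel)"
    using g by (intro nn_integral_distr) auto
  also have "\<dots> = (\<integral>\<^sup>+x. ennreal (\<bar>b\<bar> ^ DIM('a)) * (f (sgn x) * indicator (ball 0 1 - {0}) x) \<partial>lborel)"
  proof (rule nn_integral_cong)
    fix x :: 'a
    have "sgn (b *\<^sub>R x) = sgn x" using b by (simp add: sgn_scaleR)
    moreover have "indicator (ball 0 b - {0}) (b *\<^sub>R x) = (indicator (ball 0 1 - {0}) x :: ennreal)"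
      using b by (auto simp: indicator_def)
    ultimately show "ennreal (\<bar>b\<bar> ^ DIM('a)) * g (0 + b *\<^sub>R x) = ennreal (\<bar>b\<bar> ^ DIM('a)) * (f (sgn x) * indicator (ball 0 1 - {0}) x)"
      by (simp only: g_def add_0_left)
  qed
  also have "\<dots> = ennreal (\<bar>b\<bar> ^ DIM('a)) * (\<integral>\<^sup>+x. f (sgn x) * indicator (ball 0 1 - {0}) x \<partial>lborel)"
    by (intro nn_integral_cmult borel_measurable_times_ennreal borel_measurable_indicator) (use f B1 in auto)
  finally show ?thesis using b by (simp add: g_def)
qed

text \<open>A shell is the difference of two balls. Finiteness is what allows the inner ball to be
  cancelled in \<open>ennreal\<close>.\<close>

lemma nn_integral_cone_shell:
  fixes f :: "'a::euclidean_space \<Rightarrow> ennreal"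
  assumes f: "(\<lambda>y. f (sgn y)) \<in> borel_measurable borel" and a: "0 < a" "a < b"
    and fin: "(\<integral>\<^sup>+y\<in>ball 0 1 - {0}. f (sgn y) \<partial>lborel) < \<infinity>"
  shows "(\<integral>\<^sup>+y\<in>ball 0 b - ball 0 a. f (sgn y) \<partial>lborel)
           = ennreal (b ^ DIM('a) - a ^ DIM('a)) * (\<integral>\<^sup>+y\<in>ball 0 1 - {0}. f (sgn y) \<partial>lborel)"
proof -
  define J where "J = (\<integral>\<^sup>+y\<in>ball 0 1 - {0}. f (sgn y) \<partial>lborel)"
  have J: "J = ennreal (enn2real J)" using fin by (simp add: J_def)
  have Bm: "ball 0 b - {0::'a} \<in> sets borel" "ball 0 a - {0::'a} \<in> sets borel" "ball 0 b - ball 0 a \<in> sets (borel :: 'a measure)" by auto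
  have "ennreal (b ^ DIM('a)) * J = (\<integral>\<^sup>+y\<in>ball 0 b - {0}. f (sgn y) \<partial>lborel)"
    unfolding J_def using f a by (intro nn_integral_cone[symmetric]) auto
  also have "\<dots> = (\<integral>\<^sup>+y. f (sgn y) * indicator (ball 0 a - {0}) y + f (sgn y) * indicator (ball 0 b - ball 0 a) y \<partial>lborel)"
    by (rule nn_integral_cong) (use a in \<open>auto simp: indicator_def\<close>)
  also have "\<dots> = (\<integral>\<^sup>+y\<in>ball 0 a - {0}. f (sgn y) \<partial>lborel) + (\<integral>\<^sup>+y\<in>ball 0 b - ball 0 a. f (sgn y) \<partial>lborel)"
    by (rule nn_integral_add) (use f Bm in measurable)
  also have "(\<integral>\<^sup>+y\<in>ball 0 a - {0}. f (sgn y) \<partial>lborel) = ennreal (a ^ DIM('a)) * J"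
    unfolding J_def using f a by (intro nn_integral_cone) auto
  finally have e: "ennreal (b ^ DIM('a)) * J = ennreal (a ^ DIM('a)) * J + (\<integral>\<^sup>+y\<in>ball 0 b - ball 0 a. f (sgn y) \<partial>lborel)" .
  have le: "a ^ DIM('a) \<le> b ^ DIM('a)" using a by (intro power_mono) auto
  have "ennreal (b ^ DIM('a)) = ennreal (a ^ DIM('a)) + ennreal (b ^ DIM('a) - a ^ DIM('a))"
    using a le by (subst ennreal_plus[symmetric]) auto
  then have "ennreal (a ^ DIM('a)) * J + ennreal (b ^ DIM('a) - a ^ DIM('a)) * J
      = ennreal (a ^ DIM('a)) * J + (\<integral>\<^sup>+y\<in>ball 0 b - ball 0 a. f (sgn y) \<partial>lborel)"
    using e by (simp add: distrib_right)
  moreover have "ennreal (a ^ DIM('a)) * J \<noteq> \<infinity>"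
    using J by (metis ennreal_mult_eq_top_iff ennreal_neq_top infinity_ennreal_def)
  ultimately show ?thesis unfolding J_def[symmetric] by (metis ennreal_add_left_cancel infinity_ennreal_def)
qed

section \<open>Normals at the frontier and the cone measure\<close>

context radial_target_transport
begin

lemma R_in: "R \<in> {0<..R}"
  using R_pos by simp

lemma \<Omega>_nonempty: "\<Omega> \<noteq> {}"
proof -
  obtain \<theta> :: "real^'n" where "\<theta> \<in> sphere 0 1" using exists_unit by blast
  then have "(R / 2) *\<^sub>R \<theta> \<in> B0" using R_pos by auto
  then show ?thesis unfolding \<Omega>_def by blast
qed

lemma X_frontier: "\<theta> \<in> sphere 0 1 \<Longrightarrow> X R \<theta> \<in> frontier A"
proof -
  assume \<theta>: "\<theta> \<in> sphere 0 1"
  have xA: "X R \<theta> \<in> A" by (rule X_in(3)[OF R_in \<theta>])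
  have "X R \<theta> \<notin> interior A"
  proof
    assume "X R \<theta> \<in> interior A"
    then obtain e where e: "e > 0" "cball (X R \<theta>) e \<subseteq> A" using mem_interior_cball by blast
    have "X R \<theta> + e *\<^sub>R \<theta> \<in> cball (X R \<theta>) e" using e(1) \<theta> by (simp add: dist_norm)
    then have "X R \<theta> + e *\<^sub>R \<theta> \<in> sublevel A \<phi> R" unfolding sublevel_R using e(2) by blast
    then have "\<theta> \<bullet> (X R \<theta> + e *\<^sub>R \<theta>) \<le> H R \<theta>" by (rule inner_le_H)
    then show False using X_in(2)[OF R_in \<theta>] e(1) \<theta> by (simp add: inner_add_right dot_square_norm)
  qed
  then show ?thesis using xA compact_imp_closed[OF compact_A] by (simp add: frontier_def)
qed

lemma frontier_normal:
  assumes x: "x \<in> frontier A"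
  obtains \<theta> where "\<theta> \<in> sphere 0 1" "x = X R \<theta>"
proof -
  have cl: "closed A" by (rule compact_imp_closed[OF compact_A])
  have xA: "x \<in> A" "x \<notin> interior A" using x cl by (auto simp: frontier_def)
  have "interior A \<noteq> {}" using \<Omega>_interior \<Omega>_nonempty by blast
  then have "rel_interior A = interior A" by (rule rel_interior_nonempty_interior)
  then have "x \<notin> rel_interior A" using xA by simp
  then obtain a where a: "a \<noteq> 0" "\<And>y. y \<in> A \<Longrightarrow> a \<bullet> x \<le> a \<bullet> y"
    using supporting_hyperplane_rel_boundary[OF convex_A xA(1)] by metis
  \<comment> \<open>The supporting functional \<open>a\<close> is minimal at \<open>x\<close>, so
    the outer normal is opposite to it.\<close>
  define \<theta> where "\<theta> = - sgn a"
  have \<theta>: "\<theta> \<in> sphere 0 1" using a by (simp add: \<theta>_def norm_sgn)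
  have "x = X R \<theta>"
  proof (rule X_unique[OF R_in \<theta>])
    show "x \<in> sublevel A \<phi> R" using xA sublevel_R by simp
    show "H R \<theta> \<le> \<theta> \<bullet> x"
      using R_pos a(2) by (intro H_le) (auto simp: sublevel_R \<theta>_def sgn_div_norm intro!: mult_left_mono)
  qed
  then show ?thesis using that \<theta> by blast
qed

text \<open>The Gauss map of the frontier, encoded as the inverse of \<open>X R\<close> on the
  sphere so that its continuity follows from compactness.\<close>

definition \<nu> :: "real^'n \<Rightarrow> real^'n" where "\<nu> = the_inv_into (sphere 0 1) (X R)"

lemma inj_X_R: "inj_on (X R) (sphere 0 1)"
  by (rule inj_onI) (rule X_inj[OF R_in])

lemma \<nu>_X: "\<theta> \<in> sphere 0 1 \<Longrightarrow> \<nu> (X R \<theta>) = \<theta>"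
  unfolding \<nu>_def by (rule the_inv_into_f_f[OF inj_X_R])

lemma \<nu>_frontier: "x \<in> frontier A \<Longrightarrow> \<nu> x \<in> sphere 0 1" "x \<in> frontier A \<Longrightarrow> X R (\<nu> x) = x"
  using frontier_normal \<nu>_X by metis+

lemma continuous_X_R: "continuous_on (- {0}) (\<lambda>z. X R (sgn z))"
proof -
  have "continuous_on (- {0}) (\<lambda>z. (\<lambda>y. X (norm y) (sgn y)) (R *\<^sub>R sgn z))"
    by (rule continuous_on_compose2[OF continuous_X]) (use R_pos in \<open>auto intro!: continuous_intros simp: norm_sgn sgn_zero_iff\<close>)
  moreover have "(\<lambda>y. X (norm y) (sgn y)) (R *\<^sub>R sgn z) = X R (sgn z)" if "z \<in> - {0}" for z
    using R_pos that by (simp add: norm_sgn sgn_scaleR sgn_div_norm[of "sgn z"])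
  ultimately show ?thesis by (rule continuous_on_eq)
qed

lemma continuous_X_sphere: "continuous_on (sphere 0 1) (X R)"
proof -
  have "continuous_on (sphere 0 1) (\<lambda>z. X R (sgn z))"
    by (rule continuous_on_subset[OF continuous_X_R]) auto
  then show ?thesis by (rule continuous_on_eq) (simp add: sgn_div_norm)
qed

lemma frontier_eq: "frontier A = X R ` sphere 0 1"
  using X_frontier frontier_normal by blast

lemma continuous_\<nu>: "continuous_on (frontier A) \<nu>"
  unfolding frontier_eq \<nu>_def
  by (rule continuous_on_inv_into) (auto intro: continuous_X_sphere inj_X_R)

lemma frontier_sub: "frontier A \<subseteq> A - {0}"
proof
  fix x assume x: "x \<in> frontier A"
  then obtain \<theta> where \<theta>: "\<theta> \<in> sphere 0 1" "x = X R \<theta>" by (rule frontier_normal)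
  have "x \<in> A" using X_in(3)[OF R_in \<theta>(1)] \<theta>(2) by simp
  moreover have "x \<noteq> 0" using \<phi>_X[OF R_in \<theta>(1)] \<theta>(2) origin R_pos by auto
  ultimately show "x \<in> A - {0}" by simp
qed

lemma continuous_h_frontier: "continuous_on (frontier A) (\<lambda>x. h R (\<nu> x))"
proof -
  have "continuous_on (frontier A) (\<lambda>x. (\<lambda>y. h (norm y) (sgn y)) (R *\<^sub>R \<nu> x))"
    by (rule continuous_on_compose2[OF continuous_on_polar[OF h_C0]])
       (use R_pos \<nu>_frontier(1) in \<open>force intro!: continuous_intros continuous_\<nu>\<close>)+
  then show ?thesis
    by (rule continuous_on_eq) (use polar_scaleR[OF R_in \<nu>_frontier(1)] in auto)
qed

text \<open>Up to the factor 1/d this measures a part of the frontier by the spherical area of its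
  normals: it is the Gauss curvature measure. The indicator avoids the value of \<open>X R\<close>
  at \<open>sgn 0\<close>.\<close>

definition cone_measure :: "(real^'n) measure" where
  "cone_measure = distr (density lborel (indicator (ball 0 1 - {0}))) borel (\<lambda>y. indicator (- {0}) y *\<^sub>R X R (sgn y))"

lemma sets_cone_measure [simp, measurable_cong]: "sets cone_measure = sets borel"
  by (simp add: cone_measure_def)

lemma measurable_X_R: "(\<lambda>y. indicator (- {0}) y *\<^sub>R X R (sgn y)) \<in> borel_measurable borel"
  by (rule borel_measurable_continuous_on_indicator[OF _ continuous_X_R]) auto

lemma nn_integral_cone_measure:
  assumes f: "f \<in> borel_measurable borel"
  shows "(\<integral>\<^sup>+x. f x \<partial>cone_measure) = (\<integral>\<^sup>+y\<in>ball 0 1 - {0}. f (X R (sgn y)) \<partial>lborel)"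
proof -
  have B: "ball 0 1 - {0::real^'n} \<in> sets borel" by auto
  have "(\<integral>\<^sup>+x. f x \<partial>cone_measure) = (\<integral>\<^sup>+y. f (indicator (- {0}) y *\<^sub>R X R (sgn y)) \<partial>density lborel (indicator (ball 0 1 - {0})))"
    unfolding cone_measure_def using measurable_X_R f by (intro nn_integral_distr) auto
  also have "\<dots> = (\<integral>\<^sup>+y. indicator (ball 0 1 - {0}) y * f (indicator (- {0}) y *\<^sub>R X R (sgn y)) \<partial>lborel)"
    by (rule nn_integral_density) (use B measurable_compose[OF measurable_X_R f] in \<open>auto intro!: borel_measurable_indicator\<close>)
  also have "\<dots> = (\<integral>\<^sup>+y\<in>ball 0 1 - {0}. f (X R (sgn y)) \<partial>lborel)"
    by (rule nn_integral_cong) (auto simp: indicator_def)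
  finally show ?thesis .
qed

lemma uniform_near_boundary:
  fixes f :: "real^'n \<Rightarrow> real"
  assumes f: "continuous_on PB f" and e: "0 < e"
  shows "\<exists>\<kappa>>0. \<kappa> \<le> R / 2 \<and> (\<forall>y\<in>PB. \<forall>\<theta>\<in>sphere 0 1. norm (y - R *\<^sub>R \<theta>) < \<kappa> \<longrightarrow> \<bar>f y - f (R *\<^sub>R \<theta>)\<bar> < e)"
proof -
  define Q where "Q = cball (0::real^'n) R - ball 0 (R / 2)"
  have "compact Q" unfolding Q_def by (rule compact_annulus)
  moreover have "continuous_on Q f" by (rule continuous_on_subset[OF f]) (use R_pos in \<open>auto simp: Q_def\<close>)
  ultimately have "uniformly_continuous_on Q f" by (rule compact_uniformly_continuous[rotated])
  then obtain d where d: "d > 0" "\<And>x x'. x \<in> Q \<Longrightarrow> x' \<in> Q \<Longrightarrow> dist x' x < d \<Longrightarrow> dist (f x') (f x) < e"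
    using e unfolding uniformly_continuous_on_def by metis
  show ?thesis
  proof (intro exI[of _ "min d (R / 2)"] conjI ballI impI)
    fix y \<theta> :: "real^'n" assume y: "y \<in> PB" and \<theta>: "\<theta> \<in> sphere 0 1" and n: "norm (y - R *\<^sub>R \<theta>) < min d (R / 2)"
    have "norm (R *\<^sub>R \<theta>) \<le> norm y + norm (y - R *\<^sub>R \<theta>)" by (metis norm_minus_commute norm_triangle_sub)
    then have "R / 2 \<le> norm y" using n \<theta> R_pos by simp
    then have "y \<in> Q" "R *\<^sub>R \<theta> \<in> Q" using y \<theta> R_pos by (auto simp: Q_def)
    then show "\<bar>f y - f (R *\<^sub>R \<theta>)\<bar> < e" using d(2)[of "R *\<^sub>R \<theta>" y] n by (simp add: dist_norm)
  qed (use d R_pos in auto)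
qed

end


text \<open>Assembled from the slab comparison: 2 for the density near \<open>x0\<close>, 6 for the
  thickness of the slab, and \<open>d * 4 ^ (d - 1)\<close> from the volume bound for a slab in a
  ball of radius \<open>2 * D\<close>.\<close>

definition cone_factor :: "nat \<Rightarrow> real" where
  "cone_factor d = 12 * real d * 4 ^ (d - 1)"

section \<open>The mass of small balls under the cone measure\<close>

context radial_target_transport
begin

lemma measurable_sphere_function:
  fixes f :: "real^'n \<Rightarrow> 'b::real_normed_vector"
  assumes "continuous_on (- {0::real^'n}) f" 
  shows "f \<in> borel_measurable (borel :: (real^'n) measure)"
proof (rule measurable_discrete_difference[of "\<lambda>y. indicator (- {0}) y *\<^sub>R f y" _ _ "{0}"])
  show "(\<lambda>y. indicator (- {0}) y *\<^sub>R f y) \<in> borel_measurable borel"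
    by (rule borel_measurable_continuous_on_indicator[OF _ assms]) auto
qed auto

lemma X_R_measurable: "(\<lambda>y. X R (sgn y)) \<in> borel_measurable borel"
  by (rule measurable_sphere_function[OF continuous_X_R])

lemma continuous_h_R: "continuous_on (- {0}) (\<lambda>z. h R (sgn z))"
proof -
  have "continuous_on (- {0}) (\<lambda>z. (\<lambda>y. h (norm y) (sgn y)) (R *\<^sub>R sgn z))"
    by (rule continuous_on_compose2[OF continuous_on_polar[OF h_C0]])
      (use R_pos in \<open>auto intro!: continuous_intros simp: norm_sgn sgn_zero_iff\<close>)
  moreover have "(\<lambda>y. h (norm y) (sgn y)) (R *\<^sub>R sgn z) = h R (sgn z)" if "z \<in> - {0}" for z
    using R_pos that by (simp add: norm_sgn sgn_scaleR sgn_div_norm[of "sgn z"])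
  ultimately show ?thesis by (rule continuous_on_eq)
qed

lemma sphere_min:
  fixes f :: "real^'n \<Rightarrow> real"
  assumes f: "continuous_on PB f" and pos: "\<And>y. y \<in> PB \<Longrightarrow> 0 < f y"
  obtains m where "0 < m" "\<And>\<theta>. \<theta> \<in> sphere 0 1 \<Longrightarrow> m \<le> f (R *\<^sub>R \<theta>)"
proof -
  have sub: "sphere (0::real^'n) R \<subseteq> PB" using R_pos by auto
  obtain \<theta> :: "real^'n" where "\<theta> \<in> sphere 0 1" using exists_unit by blast
  then have "R *\<^sub>R \<theta> \<in> sphere 0 R" using R_pos by simp
  then obtain z where z: "z \<in> sphere 0 R" "\<And>y. y \<in> sphere 0 R \<Longrightarrow> f z \<le> f y"
    using continuous_attains_inf[OF compact_sphere _ continuous_on_subset[OF f sub]] by blast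
  show ?thesis
  proof (rule that)
    show "0 < f z" using pos z(1) sub by blast
    show "f z \<le> f (R *\<^sub>R \<theta>)" if "\<theta> \<in> sphere 0 1" for \<theta>
      using that R_pos by (intro z(2)) simp
  qed
qed

text \<open>The transport carries the part of a thin shell at the boundary of the ball whose directions are normals at
  points near \<open>x0\<close> into a slab orthogonal to the normal at \<open>x0\<close>. Comparing masses bounds the measure of these normals.\<close>

lemma cone_measure_cball_le:
  "\<exists>\<delta>0>0. \<forall>x0\<in>frontier A. \<forall>D. 0 < D \<longrightarrow> D \<le> \<delta>0 \<longrightarrow>
     emeasure cone_measure (cball x0 D) \<le> ennreal (cone_factor CARD('n) * \<rho>0 x0 * h R (\<nu> x0) / C * D ^ (CARD('n) - 1))"
proof -
  define d where "d = CARD('n)"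
  have d: "d > 0" "DIM(real^'n) = d" by (auto simp: d_def)
  define hy where "hy y = h (norm y) (sgn y)" for y
  define ry where "ry y = \<rho>0 (Xy y)" for y
  define ky where "ky y = h (norm y) (sgn y) *\<^sub>R sgn y + k (norm y) (sgn y)" for y
  have conth: "continuous_on PB hy" unfolding hy_def[abs_def] by (rule continuous_on_polar[OF h_C0])
  have contr: "continuous_on PB ry"
    unfolding ry_def
  proof (rule continuous_on_compose2[OF \<rho>0_continuous continuous_Xy])
    show "Xy ` PB \<subseteq> A - {0}"
    proof
      fix x assume "x \<in> Xy ` PB"
      then obtain y where y: "y \<in> PB" "x = Xy y" by blast
      have "x \<in> A" using Xy_in_A[OF y(1)] y(2) by simp
      moreover have "\<phi> x = norm y" using \<phi>_Xy[OF y(1)] y(2) by simp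
      then have "x \<noteq> 0" using origin y(1) by auto
      ultimately show "x \<in> A - {0}" by simp
    qed
  qed
  have contk: "continuous_on PB ky" unfolding ky_def[abs_def] by (rule continuous_on_polar[OF X_r_C0])
  have hpos: "0 < hy y" and rpos: "0 < ry y" if "y \<in> PB" for y
    using positivity(1,2)[OF polar_PB(1,2)[OF that]] by (auto simp: hy_def ry_def Xy_def)
  \<comment> \<open>With positive lower bounds on the sphere, oscillations below
    \<open>m0 / 2\<close> and \<open>m1\<close> become multiplicative errors, so that the final
    constant does not involve the transport.\<close>
  obtain m0 where m0: "0 < m0" "\<And>\<theta>. \<theta> \<in> sphere 0 1 \<Longrightarrow> m0 \<le> hy (R *\<^sub>R \<theta>)" using sphere_min[OF conth hpos] by blast
  obtain m1 where m1: "0 < m1" "\<And>\<theta>. \<theta> \<in> sphere 0 1 \<Longrightarrow> m1 \<le> ry (R *\<^sub>R \<theta>)" using sphere_min[OF contr rpos] by blast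
  obtain \<kappa>1 where \<kappa>1: "\<kappa>1 > 0" "\<kappa>1 \<le> R / 2"
    "\<And>y \<theta>. y \<in> PB \<Longrightarrow> \<theta> \<in> sphere 0 1 \<Longrightarrow> norm (y - R *\<^sub>R \<theta>) < \<kappa>1 \<Longrightarrow> \<bar>hy y - hy (R *\<^sub>R \<theta>)\<bar> < m0 / 2"
    using uniform_near_boundary[OF conth, of "m0 / 2"] m0(1) by auto
  obtain \<kappa>2 where \<kappa>2: "\<kappa>2 > 0" "\<kappa>2 \<le> R / 2"
    "\<And>y \<theta>. y \<in> PB \<Longrightarrow> \<theta> \<in> sphere 0 1 \<Longrightarrow> norm (y - R *\<^sub>R \<theta>) < \<kappa>2 \<Longrightarrow> \<bar>ry y - ry (R *\<^sub>R \<theta>)\<bar> < m1"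
    using uniform_near_boundary[OF contr, of "m1"] m1(1) by auto
  \<comment> \<open>\<open>Lc\<close> bounds the speed of \<open>X s \<theta>\<close> along a ray in
    the outer half of the ball.\<close>
  obtain Lc where Lc: "1 \<le> Lc" "\<And>y. y \<in> cball 0 R - ball 0 (R/2) \<Longrightarrow> norm (ky y) \<le> Lc"
  proof -
    have "compact (ky ` (cball 0 R - ball 0 (R/2)))"
      by (intro compact_continuous_image compact_annulus continuous_on_subset[OF contk]) (use R_pos in auto)
    then obtain B where "\<forall>z\<in>ky ` (cball 0 R - ball 0 (R/2)). norm z \<le> B" using compact_imp_bounded bounded_pos by metis
    then show ?thesis by (intro that[of "max 1 B"]) (auto intro: order_trans[of _ B])
  qed
  define \<kappa> where "\<kappa> = min \<kappa>1 \<kappa>2"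
  have \<kappa>: "0 < \<kappa>" "\<kappa> \<le> R / 2" "\<kappa> \<le> \<kappa>1" "\<kappa> \<le> \<kappa>2" using \<kappa>1 \<kappa>2 by (auto simp: \<kappa>_def)
  \<comment> \<open>The first bound keeps the relevant part of the shell within \<kappa> of
    \<open>R *\<^sub>R \<theta>0\<close>; the second lets a tilt of the normal by \<omega> change
    the slope along a ray by at most \<open>m0 / 2\<close>.\<close>
  define \<omega> where "\<omega> = min (\<kappa> / (4 * R)) (m0 / (2 * Lc))"
  have \<omega>: "0 < \<omega>" "R * \<omega> \<le> \<kappa> / 4" "Lc * \<omega> \<le> m0 / 2"
  proof -
    show "0 < \<omega>" using \<kappa> R_pos m0 Lc by (auto simp: \<omega>_def)
    have "\<omega> \<le> \<kappa> / (4 * R)" "\<omega> \<le> m0 / (2 * Lc)" by (auto simp: \<omega>_def)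
    then show "R * \<omega> \<le> \<kappa> / 4" "Lc * \<omega> \<le> m0 / 2" using R_pos Lc by (auto simp: field_simps)
  qed
  have "compact (frontier A)" by (rule compact_frontier[OF compact_A])
  then have "uniformly_continuous_on (frontier A) \<nu>" by (rule compact_uniformly_continuous[OF continuous_\<nu>])
  then obtain \<delta>\<omega> where \<delta>\<omega>: "\<delta>\<omega> > 0"
    "\<And>x x'. x \<in> frontier A \<Longrightarrow> x' \<in> frontier A \<Longrightarrow> dist x' x < \<delta>\<omega> \<Longrightarrow> dist (\<nu> x') (\<nu> x) < \<omega>"
    using \<omega>(1) unfolding uniformly_continuous_on_def by metis
  define \<delta>0 where "\<delta>0 = min (\<kappa> / 4) (\<delta>\<omega> / 2)"
  show ?thesis
  proof (intro exI[of _ \<delta>0] conjI ballI allI impI)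
    show "0 < \<delta>0" using \<kappa> \<delta>\<omega> by (simp add: \<delta>0_def)
    fix x0 D assume x0: "x0 \<in> frontier A" and D: "0 < D" "D \<le> \<delta>0"
    define \<theta>0 where "\<theta>0 = \<nu> x0"
    have \<theta>0: "\<theta>0 \<in> sphere 0 1" "X R \<theta>0 = x0" using \<nu>_frontier[OF x0] by (auto simp: \<theta>0_def)
    have n0: "norm \<theta>0 = 1" using \<theta>0 by simp
    define h0 where "h0 = h R \<theta>0"
    define r0 where "r0 = \<rho>0 x0"
    have pR: "R *\<^sub>R \<theta> \<in> PB" "norm (R *\<^sub>R \<theta>) = R" "sgn (R *\<^sub>R \<theta>) = \<theta>" if "\<theta> \<in> sphere 0 1" for \<theta>
      using polar_scaleR[OF R_in that] by blast+
    have hR: "hy (R *\<^sub>R \<theta>0) = h0" "ry (R *\<^sub>R \<theta>0) = r0"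
      using pR[OF \<theta>0(1)] \<theta>0(2) by (auto simp: hy_def ry_def h0_def r0_def Xy_def)
    have h0: "m0 \<le> h0" "0 < h0" and r0: "m1 \<le> r0" "0 < r0" using m0 m1 \<theta>0 hR by force+
    \<comment> \<open>In a shell of this thickness points move by at most \<open>D\<close> along a
      ray. The value of \<tau> cancels at the end: the lower bound for the mass of the shell and the
      thickness of the slab are both proportional to it.\<close>
    define \<tau> where "\<tau> = D / Lc"
    have \<tau>: "0 < \<tau>" "Lc * \<tau> = D" "\<tau> \<le> D" "\<tau> \<le> \<kappa> / 4" "\<tau> < R / 2" "D < \<delta>\<omega>"
    proof -
      show "0 < \<tau>" "Lc * \<tau> = D" using D Lc by (auto simp: \<tau>_def)
      show *: "\<tau> \<le> D" using D Lc by (simp add: \<tau>_def field_simps)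
      have "D \<le> \<kappa> / 4" "D \<le> \<delta>\<omega> / 2" using D by (auto simp: \<delta>0_def)
      then show "\<tau> \<le> \<kappa> / 4" "\<tau> < R / 2" "D < \<delta>\<omega>" using * \<kappa> \<delta>\<omega> by auto
    qed
    \<comment> \<open>The lower end allows for a deviation \<open>h0 * \<tau>\<close> of
      \<open>X R \<theta>\<close> from the supporting plane at \<open>x0\<close> and a descent
      \<open>2 * h0 * \<tau>\<close> along the ray. The upper end lies beyond that plane because the
      slab is half-open.\<close>
    define slab where "slab = {x \<in> cball x0 (2 * D). \<theta>0 \<bullet> x0 - 3 * h0 * \<tau> \<le> \<theta>0 \<bullet> x \<and> \<theta>0 \<bullet> x < (\<theta>0 \<bullet> x0 - 3 * h0 * \<tau>) + 6 * h0 * \<tau>}"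
    have slab: "emeasure lborel slab \<le> ennreal ((4 * D) ^ (d - 1) * (d * (6 * h0 * \<tau>)))"
    proof -
      have "emeasure lborel slab \<le> ennreal ((2 * (2 * D)) ^ (DIM(real^'n) - 1) * (DIM(real^'n) * (6 * h0 * \<tau>)))"
        unfolding slab_def using D h0 \<tau> n0 by (intro emeasure_slab_le) auto
      then show ?thesis using d(2) by (simp add: mult.assoc[symmetric])
    qed
    have key: "Xy y \<in> slab \<and> \<rho>0 (Xy y) \<le> 2 * r0"
      if y: "y \<in> B0" "R - \<tau> \<le> norm y" "X R (sgn y) \<in> cball x0 D" for y
    proof -
      define r where "r = norm y"
      define \<theta> where "\<theta> = sgn y"
      have yPB: "y \<in> PB" using y(1) by auto
      have \<theta>: "\<theta> \<in> sphere 0 1" and r: "r \<in> {0<..<R}" "r \<in> {0<..R}" "R - \<tau> \<le> r"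
        using polar_PB(3,4,5)[OF y(1)] y(2) by (auto simp: \<theta>_def r_def)
      have n1: "norm \<theta> = 1" using \<theta> by simp
      have Xf: "X R \<theta> \<in> frontier A" by (rule X_frontier[OF \<theta>])
      have dx: "norm (X R \<theta> - x0) \<le> D" using y(3) by (simp add: \<theta>_def dist_norm norm_minus_commute)
      then have "dist (\<nu> (X R \<theta>)) (\<nu> x0) < \<omega>" using \<tau>(6) by (intro \<delta>\<omega>(2)[OF x0 Xf]) (simp add: dist_norm)
      then have d\<theta>: "norm (\<theta> - \<theta>0) < \<omega>" using \<nu>_X[OF \<theta>] by (simp add: \<theta>0_def dist_norm)
      have near: "norm (s *\<^sub>R \<theta> - R *\<^sub>R \<theta>0) < \<kappa>" if "R - \<tau> \<le> s" "s \<le> R" for s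
      proof -
        have "s *\<^sub>R \<theta> - R *\<^sub>R \<theta>0 = (s - R) *\<^sub>R \<theta> + R *\<^sub>R (\<theta> - \<theta>0)" by (simp add: algebra_simps)
        then have "norm (s *\<^sub>R \<theta> - R *\<^sub>R \<theta>0) \<le> \<bar>s - R\<bar> + R * norm (\<theta> - \<theta>0)"
          using norm_triangle_ineq[of "(s - R) *\<^sub>R \<theta>" "R *\<^sub>R (\<theta> - \<theta>0)"] n1 R_pos by simp
        also have "\<dots> \<le> \<tau> + R * \<omega>" using that d\<theta> R_pos by (intro add_mono mult_left_mono) auto
        also have "\<dots> < \<kappa>" using \<tau>(4) \<omega>(2) \<kappa>(1) by linarith
        finally show ?thesis .
      qed
      have polar: "s *\<^sub>R \<theta> \<in> PB" "norm (s *\<^sub>R \<theta>) = s" "sgn (s *\<^sub>R \<theta>) = \<theta>" if "s \<in> {0<..R}" for s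
        using polar_scaleR[OF that \<theta>] by blast+
      have yr: "y = r *\<^sub>R \<theta>" using y(1) by (auto simp: r_def \<theta>_def sgn_div_norm)
      have dX: "((\<lambda>s. X s \<theta>) has_vector_derivative ky (s *\<^sub>R \<theta>)) (at s within {r..R})" if "s \<in> {r..R}" for s
      proof -
        have s: "s \<in> {0<..R}" using that r by auto
        have "((\<lambda>s. X s \<theta>) has_vector_derivative h s \<theta> *\<^sub>R \<theta> + k s \<theta>) (at s within {r..R})"
          by (rule has_vector_derivative_within_subset[OF X_r_derivative[OF s \<theta>]]) (use r in auto)
        then show ?thesis using polar[OF s] by (simp only: ky_def)
      qed
      have kyb: "norm (ky (s *\<^sub>R \<theta>)) \<le> Lc" if "s \<in> {r..R}" for s
        using that r \<tau>(5) n1 by (intro Lc(2)) auto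
      have Xdiff: "norm (X R \<theta> - X r \<theta>) \<le> D"
      proof -
        have "norm (X R \<theta> - X r \<theta>) \<le> Lc * norm (R - r)"
        proof (rule differentiable_bound[of "{r..R}" "\<lambda>s. X s \<theta>" "\<lambda>s t. t *\<^sub>R ky (s *\<^sub>R \<theta>)"])
          fix s assume s: "s \<in> {r..R}"
          show "((\<lambda>s. X s \<theta>) has_derivative (\<lambda>t. t *\<^sub>R ky (s *\<^sub>R \<theta>))) (at s within {r..R})"
            using dX[OF s] by (simp only: has_vector_derivative_def)
          show "onorm (\<lambda>t. t *\<^sub>R ky (s *\<^sub>R \<theta>)) \<le> Lc"
            using kyb[OF s] by (intro onorm_le) (auto simp: mult.commute[of Lc] intro!: mult_left_mono)
        qed (use r in auto)
        also have "\<dots> \<le> Lc * \<tau>" using r Lc by (intro mult_left_mono) auto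
        finally show ?thesis using \<tau>(2) by simp
      qed
      have slope: "\<theta>0 \<bullet> (X R \<theta> - X r \<theta>) \<le> 2 * h0 * \<tau>"
      proof -
        have "\<exists>s\<in>{r..R}. \<theta>0 \<bullet> X R \<theta> - \<theta>0 \<bullet> X r \<theta> = (\<lambda>s t. \<theta>0 \<bullet> (t *\<^sub>R ky (s *\<^sub>R \<theta>))) s (R - r)"
        proof (rule mvt_very_simple[of r R "\<lambda>s. \<theta>0 \<bullet> X s \<theta>"])
          show "r \<le> R" using r by auto
          fix s assume "r \<le> s" "s \<le> R"
          then have "s \<in> {r..R}" by simp
          from has_derivative_inner_right[OF dX[OF this, unfolded has_vector_derivative_def], of \<theta>0]
          show "((\<lambda>s. \<theta>0 \<bullet> X s \<theta>) has_derivative (\<lambda>t. \<theta>0 \<bullet> (t *\<^sub>R ky (s *\<^sub>R \<theta>)))) (at s within {r..R})" .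
        qed
        then obtain s where s: "s \<in> {r..R}" "\<theta>0 \<bullet> X R \<theta> - \<theta>0 \<bullet> X r \<theta> = (R - r) * (\<theta>0 \<bullet> ky (s *\<^sub>R \<theta>))" by auto
        have s2: "s \<in> {0<..R}" using s(1) r by auto
        \<comment> \<open>Orthogonality of \<open>k\<close> was derived from two-sided derivatives;
          at \<open>s = R\<close> it follows by continuity.\<close>
        have nk: "\<theta> \<bullet> ky (s *\<^sub>R \<theta>) = h s \<theta>"
        proof (cases "s < R")
          case True
          then have "s \<in> {0<..<R}" using s2 by simp
          then show ?thesis using inner_k[of s \<theta>] \<theta> n1 polar(2,3)[OF s2] by (simp add: ky_def inner_add_right dot_square_norm)
        next
          case False
          then have sR: "s = R" using s(1) by simp
          have "continuous_on PB (\<lambda>y. sgn y \<bullet> k (norm y) (sgn y))"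
            by (intro continuous_intros continuous_on_polar[OF k_C0]) auto
          then have "continuous_on {0<..R} (\<lambda>s. sgn (s *\<^sub>R \<theta>) \<bullet> k (norm (s *\<^sub>R \<theta>)) (sgn (s *\<^sub>R \<theta>)))"
            by (rule continuous_on_compose2[where f = "\<lambda>s. s *\<^sub>R \<theta>"]) (use polar(1) in \<open>auto intro!: continuous_intros\<close>)
          then have c: "continuous_on {0<..R} (\<lambda>s. \<theta> \<bullet> k s \<theta>)"
            by (rule continuous_on_eq) (use polar in auto)
          have cl: "closure {0<..<R} = {0..R}" using R_pos by simp
          have "\<theta> \<bullet> k R \<theta> = 0"
          proof (rule tendsto_unique)
            show "((\<lambda>s. \<theta> \<bullet> k s \<theta>) \<longlongrightarrow> \<theta> \<bullet> k R \<theta>) (at R within {0<..R})"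
              using c R_pos by (auto simp: continuous_on_def)
            have "eventually (\<lambda>s. 0 = \<theta> \<bullet> k s \<theta>) (at R within {0<..R})"
              unfolding eventually_at using inner_k[OF _ \<theta>] by (intro exI[of _ 1]) auto
            then show "((\<lambda>s. \<theta> \<bullet> k s \<theta>) \<longlongrightarrow> 0) (at R within {0<..R})"
              by (rule Lim_transform_eventually[OF tendsto_const])
            show "at R within {0<..R} \<noteq> bot"
              using R_pos by (simp add: trivial_limit_within islimpt_in_closure[symmetric] cl)
          qed
          then show ?thesis using n1 polar(2,3)[OF s2] sR by (simp add: ky_def inner_add_right dot_square_norm)
        qed
        have "\<theta>0 \<bullet> ky (s *\<^sub>R \<theta>) = h s \<theta> + (\<theta>0 - \<theta>) \<bullet> ky (s *\<^sub>R \<theta>)" using nk by (simp add: inner_diff_left)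
        also have "(\<theta>0 - \<theta>) \<bullet> ky (s *\<^sub>R \<theta>) \<le> norm (\<theta>0 - \<theta>) * norm (ky (s *\<^sub>R \<theta>))" by (rule norm_cauchy_schwarz)
        also have "\<dots> \<le> \<omega> * Lc" using d\<theta> kyb[OF s(1)] \<omega>(1) by (intro mult_mono) (auto simp: norm_minus_commute)
        also have "\<dots> \<le> m0 / 2" using \<omega>(3) by (simp add: mult.commute)
        also have "h s \<theta> \<le> h0 + m0 / 2"
        proof -
          have "\<bar>hy (s *\<^sub>R \<theta>) - hy (R *\<^sub>R \<theta>0)\<bar> < m0 / 2"
            using near[of s] s(1) r \<kappa>(3) by (intro \<kappa>1(3) polar(1)[OF s2] \<theta>0(1)) auto
          moreover have "hy (s *\<^sub>R \<theta>) = h s \<theta>" using polar(2,3)[OF s2] by (simp only: hy_def)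
          ultimately show ?thesis unfolding hR(1) by linarith
        qed
        finally have "\<theta>0 \<bullet> ky (s *\<^sub>R \<theta>) \<le> 2 * h0" using h0(1) by simp
        then have "(R - r) * (\<theta>0 \<bullet> ky (s *\<^sub>R \<theta>)) \<le> (R - r) * (2 * h0)" using r by (intro mult_left_mono) auto
        also have "\<dots> \<le> \<tau> * (2 * h0)" using r h0 by (intro mult_right_mono) auto
        finally show ?thesis using s(2) by (simp add: inner_diff_right mult.commute mult.left_commute)
      qed
      \<comment> \<open>\<open>x0\<close> lies below the supporting plane at
        \<open>X R \<theta>\<close>. Hence \<open>X R \<theta>\<close> can fall below the plane at
        \<open>x0\<close> only through the tilt between the normals, by at most \<omega> times the
        distance \<open>D\<close>.\<close>
      have low: "- (h0 * \<tau>) \<le> \<theta>0 \<bullet> (X R \<theta> - x0)"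
      proof -
        have "x0 \<in> sublevel A \<phi> R" using frontier_sub x0 by (auto simp: sublevel_R)
        then have "0 \<le> \<theta> \<bullet> (X R \<theta> - x0)" using inner_le_H X_in(2)[OF R_in \<theta>] by (simp add: inner_diff_right)
        then have "(\<theta>0 - \<theta>) \<bullet> (X R \<theta> - x0) \<le> \<theta>0 \<bullet> (X R \<theta> - x0)" by (simp add: inner_diff_left)
        moreover have "\<bar>(\<theta>0 - \<theta>) \<bullet> (X R \<theta> - x0)\<bar> \<le> norm (\<theta>0 - \<theta>) * norm (X R \<theta> - x0)" by (rule Cauchy_Schwarz_ineq2)
        moreover have "norm (\<theta>0 - \<theta>) * norm (X R \<theta> - x0) \<le> \<omega> * D"
          using d\<theta> dx \<omega>(1) by (intro mult_mono) (auto simp: norm_minus_commute)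
        moreover have "\<omega> * D \<le> h0 * \<tau>"
        proof -
          have "\<omega> * D = (Lc * \<omega>) * \<tau>" using \<tau>(2) by (simp add: mult_ac)
          also have "\<dots> \<le> h0 * \<tau>" using \<omega>(3) h0 m0 \<tau>(1) by (intro mult_right_mono) auto
          finally show ?thesis .
        qed
        ultimately show ?thesis by linarith
      qed
      have up: "\<theta>0 \<bullet> X r \<theta> \<le> \<theta>0 \<bullet> x0"
      proof -
        have "X r \<theta> \<in> sublevel A \<phi> R" using X_in(3)[OF r(2) \<theta>] by (simp add: sublevel_R)
        then show ?thesis using inner_le_H[of "X r \<theta>" R \<theta>0] X_in(2)[OF R_in \<theta>0(1)] \<theta>0(2) by simp
      qed
      have Xyr: "Xy y = X r \<theta>" by (simp add: Xy_def r_def \<theta>_def)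
      have "norm (X r \<theta> - x0) \<le> norm (X R \<theta> - X r \<theta>) + norm (X R \<theta> - x0)"
        using norm_triangle_ineq4[of "X R \<theta> - x0" "X R \<theta> - X r \<theta>"] by (simp add: algebra_simps)
      then have "Xy y \<in> cball x0 (2 * D)" using Xdiff dx unfolding Xyr by (simp add: dist_norm norm_minus_commute)
      moreover have "\<theta>0 \<bullet> x0 - 3 * h0 * \<tau> \<le> \<theta>0 \<bullet> Xy y" using low slope unfolding Xyr by (simp add: inner_diff_right)
      moreover have "0 < h0 * \<tau>" using h0 \<tau> by simp
      then have "\<theta>0 \<bullet> Xy y < (\<theta>0 \<bullet> x0 - 3 * h0 * \<tau>) + 6 * h0 * \<tau>" using up unfolding Xyr by linarith
      ultimately have "Xy y \<in> slab" by (simp add: slab_def)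
      moreover have "\<bar>ry y - ry (R *\<^sub>R \<theta>0)\<bar> < m1"
        using near[of r] r \<kappa>(4) yr by (intro \<kappa>2(3) yPB \<theta>0(1)) auto
      then have "\<rho>0 (Xy y) \<le> 2 * r0" using hR(2) r0(1) by (simp add: ry_def)
      ultimately show ?thesis by simp
    qed
    have XR: "(\<lambda>y. X R (sgn y)) \<in> borel_measurable borel" by (rule X_R_measurable)
    have cb: "(indicator (cball x0 D) :: _ \<Rightarrow> ennreal) \<in> borel_measurable borel"
      by (rule borel_measurable_indicator) simp
    define \<sigma> where "\<sigma> = emeasure cone_measure (cball x0 D)"
    have \<sigma>: "\<sigma> = (\<integral>\<^sup>+y\<in>ball 0 1 - {0}. indicator (cball x0 D) (X R (sgn y)) \<partial>lborel)"
      unfolding \<sigma>_def using nn_integral_cone_measure[OF cb] by simp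
    have \<sigma>fin: "\<sigma> < \<infinity>"
    proof -
      have "\<sigma> \<le> (\<integral>\<^sup>+y. indicator (ball (0::real^'n) 1) y \<partial>lborel)"
        unfolding \<sigma> by (intro nn_integral_mono) (auto simp: indicator_def)
      also have "\<dots> < \<infinity>" by (simp add: emeasure_bounded_finite[unfolded infinity_ennreal_def])
      finally show ?thesis .
    qed
    define s where "s = enn2real \<sigma>"
    have s: "\<sigma> = ennreal s" "0 \<le> s" using \<sigma>fin by (auto simp: s_def)
    have XRc: "(\<lambda>y. indicator (cball x0 D) (X R (sgn y)) :: ennreal) \<in> borel_measurable borel"
      by (rule measurable_compose[OF XR cb])
    define E where "E = ball (0::real^'n) R - ball 0 (R - \<tau>)"
    have Em: "E \<in> sets borel" unfolding E_def by auto
    define f where "f y = indicator E y * (indicator (cball x0 D) (X R (sgn y)) :: ennreal)" for y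
    have f: "f \<in> borel_measurable borel" unfolding f_def using Em XRc by measurable
    \<comment> \<open>Lower bound for the mass of the selected part of the shell: the target density
      is at least \<open>C / R ^ (d - 1)\<close>, and the volume is at least \<sigma> times
      \<open>\<tau> * R ^ (d - 1)\<close>.\<close>
    have "ennreal (C * \<tau>) * \<sigma> \<le> ennreal (C / R ^ (d - 1)) * (ennreal (R ^ d - (R - \<tau>) ^ d) * \<sigma>)"
    proof -
      obtain m where m: "d = Suc m" using d gr0_implies_Suc by blast
      have "(R - \<tau>) * (R - \<tau>) ^ m \<le> (R - \<tau>) * R ^ m"
        using \<tau>(1,5) R_pos by (intro mult_left_mono power_mono) auto
      then have "\<tau> * R ^ m \<le> R ^ d - (R - \<tau>) ^ d" by (simp add: m algebra_simps)
      then have "C / R ^ m * (\<tau> * R ^ m) \<le> C / R ^ m * (R ^ d - (R - \<tau>) ^ d)"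
        using C_pos R_pos by (intro mult_left_mono) auto
      then have le: "C * \<tau> \<le> C / R ^ m * (R ^ d - (R - \<tau>) ^ d)" using R_pos by simp
      have "ennreal (C * \<tau>) * \<sigma> \<le> ennreal (C / R ^ m * (R ^ d - (R - \<tau>) ^ d)) * \<sigma>"
        by (intro mult_right_mono ennreal_leI le) simp
      also have "\<dots> = ennreal (C / R ^ m) * (ennreal (R ^ d - (R - \<tau>) ^ d) * \<sigma>)"
      proof -
        have "ennreal (C / R ^ m * (R ^ d - (R - \<tau>) ^ d)) = ennreal (C / R ^ m) * ennreal (R ^ d - (R - \<tau>) ^ d)"
          by (rule ennreal_mult') (use C_pos R_pos in simp)
        then show ?thesis by (simp only: mult.assoc)
      qed
      finally show ?thesis by (simp add: m)
    qed
    also have "ennreal (R ^ d - (R - \<tau>) ^ d) * \<sigma> = (\<integral>\<^sup>+y\<in>E. indicator (cball x0 D) (X R (sgn y)) \<partial>lborel)"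
      using nn_integral_cone_shell[of "\<lambda>\<theta>. indicator (cball x0 D) (X R \<theta>)" "R - \<tau>" R] XRc \<tau>(1,5) R_pos \<sigma>fin
      unfolding \<sigma> E_def d(2)[symmetric] by simp
    also have "ennreal (C / R ^ (d - 1)) * \<dots> = (\<integral>\<^sup>+y. ennreal (C / R ^ (d - 1)) * (indicator (cball x0 D) (X R (sgn y)) * indicator E y) \<partial>lborel)"
      by (rule nn_integral_cmult[symmetric]) (use XRc Em in measurable)
    also have "\<dots> \<le> (\<integral>\<^sup>+y\<in>B0. ennreal (C / norm y ^ (CARD('n) - 1)) * f y \<partial>lborel)"
    proof (rule nn_integral_mono)
      fix y :: "real^'n"
      show "ennreal (C / R ^ (d - 1)) * (indicator (cball x0 D) (X R (sgn y)) * indicator E y)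
          \<le> ennreal (C / norm y ^ (CARD('n) - 1)) * f y * indicator B0 y"
      proof (cases "y \<in> E")
        case True
        then have y: "0 < norm y" "norm y \<le> R" "y \<in> B0" using \<tau>(5) R_pos by (auto simp: E_def)
        have "C / R ^ (d - 1) \<le> C / norm y ^ (d - 1)"
          using y C_pos R_pos by (intro divide_left_mono power_mono mult_pos_pos) auto
        then have "ennreal (C / R ^ (d - 1)) \<le> ennreal (C / norm y ^ (d - 1))" by (rule ennreal_leI)
        then show ?thesis using y(3) True by (simp add: f_def d_def mult_right_mono del: Diff_iff)
      qed (simp add: f_def)
    qed
    also have "\<dots> = (\<integral>\<^sup>+x\<in>\<Omega>. ennreal (\<rho>0 x) * f (N x) \<partial>lborel)" by (rule nn_integral_push[OF f, symmetric])
    also have "\<dots> \<le> (\<integral>\<^sup>+x. ennreal (2 * r0) * indicator slab x \<partial>lborel)"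
    proof (rule nn_integral_mono)
      fix x
      show "ennreal (\<rho>0 x) * f (N x) * indicator \<Omega> x \<le> ennreal (2 * r0) * indicator slab x"
      proof (cases "x \<in> \<Omega> \<and> N x \<in> E \<and> X R (sgn (N x)) \<in> cball x0 D")
        case True
        then have x: "x \<in> \<Omega>" by simp
        have "R - \<tau> \<le> norm (N x)" using True by (auto simp: E_def)
        from key[OF \<Omega>_N(1)[OF x] this] True have "x \<in> slab" "\<rho>0 x \<le> 2 * r0" using \<Omega>_N(3)[OF x] by auto
        then show ?thesis using True by (simp add: f_def ennreal_leI del: mem_cball)
      next
        case False
        then have "f (N x) * indicator \<Omega> x = 0" by (auto simp: f_def indicator_def)
        then show ?thesis by (simp only: mult.assoc mult_zero_right zero_le)
      qed
    qed
    also have "\<dots> = ennreal (2 * r0) * emeasure lborel slab"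
      unfolding slab_def by (rule nn_integral_cmult_indicator) measurable
    also have "\<dots> \<le> ennreal (2 * r0) * ennreal ((4 * D) ^ (d - 1) * (d * (6 * h0 * \<tau>)))"
      by (intro mult_left_mono slab) simp
    finally have "ennreal (C * \<tau>) * ennreal s \<le> ennreal (2 * r0) * ennreal ((4 * D) ^ (d - 1) * (d * (6 * h0 * \<tau>)))"
      unfolding s(1) .
    then have "ennreal ((C * \<tau>) * s) \<le> ennreal ((2 * r0) * ((4 * D) ^ (d - 1) * (d * (6 * h0 * \<tau>))))"
      using C_pos \<tau>(1) r0 by (simp only: ennreal_mult'[symmetric] mult_nonneg_nonneg less_imp_le)
    then have "(C * \<tau>) * s \<le> (2 * r0) * ((4 * D) ^ (d - 1) * (d * (6 * h0 * \<tau>)))"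
      using r0 h0 \<tau> D by (subst (asm) ennreal_le_iff) auto
    also have "\<dots> = (C * \<tau>) * (cone_factor CARD('n) * r0 * h0 / C * D ^ (d - 1))"
      using C_pos unfolding cone_factor_def d_def[symmetric] by (simp add: power_mult_distrib field_simps)
    finally have "(C * \<tau>) * s \<le> (C * \<tau>) * (cone_factor CARD('n) * r0 * h0 / C * D ^ (d - 1))" .
    moreover have "0 < C * \<tau>" using C_pos \<tau>(1) by simp
    ultimately have "s \<le> cone_factor CARD('n) * r0 * h0 / C * D ^ (d - 1)" by (simp only: mult_le_cancel_left_pos)
    then show "emeasure cone_measure (cball x0 D) \<le> ennreal (cone_factor CARD('n) * \<rho>0 x0 * h R (\<nu> x0) / C * D ^ (CARD('n) - 1))"
      using s(1) unfolding \<sigma>_def r0_def h0_def \<theta>0_def d_def by (simp add: ennreal_leI)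
  qed
qed

end


lemma power_diff_le:
  fixes a b :: real
  assumes "0 \<le> a" "a \<le> b" "0 < b"
  shows "b ^ n - a ^ n \<le> real n * (b - a) * b ^ (n - 1)"
proof (cases n)
  case (Suc m)
  have "1 + real n * ((a - b) / b) \<le> (1 + (a - b) / b) ^ n"
    using assms by (intro Bernoulli_inequality) (simp add: field_simps)
  also have "1 + (a - b) / b = a / b" using assms by (simp add: field_simps)
  finally have "b ^ n * (1 + real n * ((a - b) / b)) \<le> b ^ n * (a / b) ^ n" using assms by (intro mult_left_mono) auto
  also have "b ^ n * (a / b) ^ n = a ^ n" using assms by (simp add: power_divide)
  also have "b ^ n * (1 + real n * ((a - b) / b)) = b ^ n + real n * (a - b) * b ^ (n - 1)"
    using assms by (simp add: Suc field_simps)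
  finally show ?thesis by (simp add: algebra_simps)
qed simp

text \<open>The factor \<open>2 ^ (d + 1) * d\<close> comes from the strip: its thickness
  \<open>2 * \<delta>\<close>, the Bernoulli bound for its volume, the target density at radius at
  least \<open>R / 2\<close>, and a doubling of the integrand. The other factors come from
  \<open>nn_integral_le_hausdorff\<close> and the ball estimate; the constant \<open>C\<close>
  cancels between the two.\<close>

definition boundary_factor :: "nat \<Rightarrow> real" where
  "boundary_factor d = 2 ^ (d + 1) * real d * (2 ^ d / unit_ball_vol (real (d - 1))) * cone_factor d"

lemma boundary_factor_pos: "0 < d \<Longrightarrow> 0 < boundary_factor d"
  by (simp add: boundary_factor_def cone_factor_def)

section \<open>From the sphere to the Hausdorff integral, and the mass of the strip\<close>

context radial_target_transport
begin

text \<open>The ball estimate holds with a multiple of \<open>\<rho>0 h / C\<close>. Multiplying the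
  integrand \<open>h powr (-p-1)\<close> by it uses up one power of \<open>h\<close> and leaves the
  boundary integrand \<open>h powr (-p) * \<rho>0\<close>.\<close>

lemma nn_integral_sphere_le:
  fixes p :: real
  shows "(\<integral>\<^sup>+y\<in>ball 0 1 - {0}. ennreal (h R (sgn y) powr (-p-1)) \<partial>lborel)
    \<le> ennreal (2 ^ CARD('n) / unit_ball_vol (real (CARD('n) - 1)) * (cone_factor CARD('n) / C)) *
       (\<integral>\<^sup>+x\<in>frontier A. ennreal (h R (\<nu> x) powr (-p) * \<rho>0 x) \<partial>hausdorff_measure (CARD('n) - 1))"
proof -
  define d where "d = CARD('n)"
  have d: "Suc (d - 1) = d" by (simp add: d_def)
  have Fc: "compact (frontier A)" by (rule compact_frontier[OF compact_A])
  have Fm: "frontier A \<in> sets borel" using Fc by (intro borel_closed compact_imp_closed)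
  define g where "g x = indicator (frontier A) x *\<^sub>R (cone_factor CARD('n) * \<rho>0 x * h R (\<nu> x) / C)" for x
  define q where "q x = indicator (frontier A) x *\<^sub>R (h R (\<nu> x) powr (-p-1))" for x
  have hpos: "0 < h R (\<nu> x)" and rpos: "0 < \<rho>0 x" if "x \<in> frontier A" for x
    using positivity(1,2)[OF R_in \<nu>_frontier(1)[OF that]] \<nu>_frontier(2)[OF that] by auto
  have contr: "continuous_on (frontier A) \<rho>0" by (rule continuous_on_subset[OF \<rho>0_continuous frontier_sub])
  have g: "g \<in> borel_measurable borel"
    unfolding g_def
    by (rule borel_measurable_continuous_on_indicator[OF Fm])
       (use C_pos in \<open>intro continuous_on_divide continuous_on_mult continuous_on_const contr continuous_h_frontier; simp\<close>)
  have q: "q \<in> borel_measurable borel"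
    unfolding q_def
    by (rule borel_measurable_continuous_on_indicator[OF Fm])
       (use hpos in \<open>intro continuous_on_powr continuous_on_const continuous_h_frontier; force\<close>)
  obtain \<delta>0 where \<delta>0: "\<delta>0 > 0" "\<And>x D. x \<in> frontier A \<Longrightarrow> 0 < D \<Longrightarrow> D \<le> \<delta>0 \<Longrightarrow>
     emeasure cone_measure (cball x D) \<le> ennreal (cone_factor CARD('n) * \<rho>0 x * h R (\<nu> x) / C * D ^ (d - 1))"
    using cone_measure_cball_le unfolding d_def by blast
  have null: "emeasure cone_measure (- frontier A) = 0"
  proof -
    have m: "indicator (- frontier A) \<in> borel_measurable borel" using Fm by (intro borel_measurable_indicator) auto
    have "emeasure cone_measure (- frontier A) = (\<integral>\<^sup>+x. indicator (- frontier A) x \<partial>cone_measure)"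
      using Fm by (intro nn_integral_indicator[symmetric]) auto
    also have "\<dots> = (\<integral>\<^sup>+y\<in>ball 0 1 - {0}. indicator (- frontier A) (X R (sgn y)) \<partial>lborel)"
      by (rule nn_integral_cone_measure[OF m])
    also have "\<dots> = (\<integral>\<^sup>+(y::real^'n). 0 \<partial>lborel)"
      by (rule nn_integral_cong) (use X_frontier in \<open>auto simp: indicator_def norm_sgn\<close>)
    finally show ?thesis by simp
  qed
  have "(\<integral>\<^sup>+y\<in>ball 0 1 - {0}. ennreal (h R (sgn y) powr (-p-1)) \<partial>lborel) = (\<integral>\<^sup>+y\<in>ball 0 1 - {0}. ennreal (q (X R (sgn y))) \<partial>lborel)"
    by (rule nn_integral_cong) (auto simp: q_def indicator_def norm_sgn X_frontier \<nu>_X)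
  also have "\<dots> = (\<integral>\<^sup>+x. ennreal (q x) \<partial>cone_measure)"
    by (rule nn_integral_cone_measure[symmetric]) (use q in measurable)
  also have "\<dots> \<le> ennreal (2 ^ Suc (d - 1) / unit_ball_vol (real (d - 1))) * (\<integral>\<^sup>+x\<in>frontier A. ennreal (g x) * ennreal (q x) \<partial>hausdorff_measure (d - 1))"
  proof (rule nn_integral_le_hausdorff[OF sets_cone_measure Fm null g _ \<delta>0(1)])
    show "0 < g x" if "x \<in> frontier A" for x
      using that hpos rpos C_pos by (simp add: g_def cone_factor_def)
    show "emeasure cone_measure (cball x D) \<le> ennreal (g x * D ^ (d - 1))" if "x \<in> frontier A" "0 < D" "D \<le> \<delta>0" for x D
      using \<delta>0(2)[OF that] that by (simp add: g_def)
  qed (use q in measurable)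
  also have "(\<integral>\<^sup>+x\<in>frontier A. ennreal (g x) * ennreal (q x) \<partial>hausdorff_measure (d - 1))
    = (\<integral>\<^sup>+x. ennreal (cone_factor CARD('n) / C) * (ennreal (h R (\<nu> x) powr (-p) * \<rho>0 x) * indicator (frontier A) x) \<partial>hausdorff_measure (d - 1))"
  proof (rule nn_integral_cong)
    fix x
    show "ennreal (g x) * ennreal (q x) * indicator (frontier A) x = ennreal (cone_factor CARD('n) / C) * (ennreal (h R (\<nu> x) powr (-p) * \<rho>0 x) * indicator (frontier A) x)"
    proof (cases "x \<in> frontier A")
      case True
      have "h R (\<nu> x) powr (-p-1) = h R (\<nu> x) powr (-p) / h R (\<nu> x)"
        using hpos[OF True] by (simp add: powr_diff)
      then have "g x * q x = cone_factor CARD('n) / C * (h R (\<nu> x) powr (-p) * \<rho>0 x)"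
        using True hpos[OF True] by (simp add: g_def q_def)
      moreover have "0 \<le> g x" "0 \<le> q x" "0 \<le> cone_factor CARD('n) / C"
        using True hpos rpos C_pos by (auto simp: g_def q_def cone_factor_def less_imp_le)
      ultimately show ?thesis using True by (simp add: ennreal_mult'[symmetric])
    qed simp
  qed
  also have "\<dots> = ennreal (cone_factor CARD('n) / C) * (\<integral>\<^sup>+x\<in>frontier A. ennreal (h R (\<nu> x) powr (-p) * \<rho>0 x) \<partial>hausdorff_measure (d - 1))"
  proof (rule nn_integral_cmult)
    have "(\<lambda>x. indicator (frontier A) x *\<^sub>R (h R (\<nu> x) powr (-p) * \<rho>0 x)) \<in> borel_measurable borel"
      by (rule borel_measurable_continuous_on_indicator[OF Fm])
       (use hpos in \<open>intro continuous_on_mult contr continuous_on_powr continuous_on_const continuous_h_frontier; force\<close>)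
    then have "(\<lambda>x. ennreal (indicator (frontier A) x *\<^sub>R (h R (\<nu> x) powr (-p) * \<rho>0 x))) \<in> borel_measurable borel" by measurable
    moreover have "ennreal (indicator (frontier A) x *\<^sub>R (h R (\<nu> x) powr (-p) * \<rho>0 x)) = ennreal (h R (\<nu> x) powr (-p) * \<rho>0 x) * indicator (frontier A) x" for x
      by (simp add: indicator_def)
    ultimately show "(\<lambda>x. ennreal (h R (\<nu> x) powr (-p) * \<rho>0 x) * indicator (frontier A) x) \<in> borel_measurable (hausdorff_measure (d - 1))"
      by (simp add: measurable_cong_sets[OF sets_hausdorff refl])
  qed
  finally have "(\<integral>\<^sup>+y\<in>ball 0 1 - {0}. ennreal (h R (sgn y) powr (-p-1)) \<partial>lborel)
    \<le> ennreal (2 ^ d / unit_ball_vol (real (d - 1))) * (ennreal (cone_factor CARD('n) / C) * (\<integral>\<^sup>+x\<in>frontier A. ennreal (h R (\<nu> x) powr (-p) * \<rho>0 x) \<partial>hausdorff_measure (d - 1)))"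
    by (simp only: d)
  also have "\<dots> = ennreal (2 ^ d / unit_ball_vol (real (d - 1)) * (cone_factor CARD('n) / C)) * (\<integral>\<^sup>+x\<in>frontier A. ennreal (h R (\<nu> x) powr (-p) * \<rho>0 x) \<partial>hausdorff_measure (d - 1))"
  proof -
    have "ennreal (2 ^ d / unit_ball_vol (real (d - 1)) * (cone_factor CARD('n) / C)) = ennreal (2 ^ d / unit_ball_vol (real (d - 1))) * ennreal (cone_factor CARD('n) / C)"
      by (rule ennreal_mult') simp
    then show ?thesis by (simp only: mult.assoc)
  qed
  finally show ?thesis by (simp only: d_def)
qed

text \<open>The threshold \<open>\<delta>1\<close> depends on the transport through a modulus of
  continuity, the constant does not. Since \<delta> later tends to 0, the threshold leaves no trace
  in the estimate.\<close>

lemma boundary_strip_le: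
  fixes p :: real
  shows "\<exists>\<delta>1>0. \<delta>1 \<le> R / 4 \<and> (\<forall>\<delta>. 0 < \<delta> \<longrightarrow> \<delta> \<le> \<delta>1 \<longrightarrow>
     (\<integral>\<^sup>+x\<in>\<Omega>. ennreal (\<rho>0 x) * (ennreal (hN x powr (-p-1)) * indicator {R - 2 * \<delta>..} (rN x)) \<partial>lborel)
      \<le> ennreal (boundary_factor CARD('n) * \<delta>) * (\<integral>\<^sup>+x\<in>frontier A. ennreal (h R (\<nu> x) powr (-p) * \<rho>0 x) \<partial>hausdorff_measure (CARD('n) - 1)))"
proof -
  define d where "d = CARD('n)"
  have d: "d > 0" "DIM(real^'n) = d" by (auto simp: d_def)
  define fy where "fy y = h (norm y) (sgn y) powr (-p-1)" for y
  have contf: "continuous_on PB fy"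
    unfolding fy_def
    by (intro continuous_on_powr continuous_on_polar[OF h_C0] continuous_on_const)
       (use positivity(1)[OF polar_PB(1,2)] in force)
  have fpos: "0 < fy y" if "y \<in> PB" for y using positivity(1)[OF polar_PB(1,2)[OF that]] by (simp add: fy_def)
  obtain m where m: "0 < m" "\<And>\<theta>. \<theta> \<in> sphere 0 1 \<Longrightarrow> m \<le> fy (R *\<^sub>R \<theta>)" using sphere_min[OF contf fpos] by blast
  obtain \<kappa> where \<kappa>: "\<kappa> > 0" "\<kappa> \<le> R / 2"
    "\<And>y \<theta>. y \<in> PB \<Longrightarrow> \<theta> \<in> sphere 0 1 \<Longrightarrow> norm (y - R *\<^sub>R \<theta>) < \<kappa> \<Longrightarrow> \<bar>fy y - fy (R *\<^sub>R \<theta>)\<bar> < m"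
    using uniform_near_boundary[OF contf m(1)] by auto
  have fyR: "fy (R *\<^sub>R \<theta>) = h R \<theta> powr (-p-1)" if "\<theta> \<in> sphere 0 1" for \<theta>
    using polar_scaleR[OF R_in that] by (simp add: fy_def)
  define J where "J = (\<integral>\<^sup>+x\<in>frontier A. ennreal (h R (\<nu> x) powr (-p) * \<rho>0 x) \<partial>hausdorff_measure (d - 1))"
  define I where "I = (\<integral>\<^sup>+y\<in>ball 0 1 - {0}. ennreal (h R (sgn y) powr (-p-1)) \<partial>lborel)"
  have hm: "(\<lambda>y. ennreal (h R (sgn y) powr (-p-1))) \<in> borel_measurable borel"
  proof -
    have "continuous_on (- {0::real^'n}) (\<lambda>y. h R (sgn y) powr (-p-1))"
    proof (intro continuous_on_powr continuous_h_R continuous_on_const ballI)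
      fix y :: "real^'n" assume "y \<in> - {0}"
      then show "h R (sgn y) \<noteq> 0" using positivity(1)[OF R_in, of "sgn y"] by (simp add: norm_sgn)
    qed
    from measurable_sphere_function[OF this] show ?thesis by measurable
  qed
  have Ifin: "I < \<infinity>"
  proof -
    have "compact (fy ` sphere 0 R)"
      by (intro compact_continuous_image compact_sphere continuous_on_subset[OF contf]) (use R_pos in auto)
    then obtain B where B: "\<forall>z\<in>fy ` sphere 0 R. norm z \<le> B" using compact_imp_bounded bounded_pos by metis
    have "I \<le> (\<integral>\<^sup>+y. ennreal B * indicator (ball (0::real^'n) 1) y \<partial>lborel)"
      unfolding I_def
    proof (rule nn_integral_mono)
      fix y :: "real^'n"
      show "ennreal (h R (sgn y) powr (-p-1)) * indicator (ball 0 1 - {0}) y \<le> ennreal B * indicator (ball 0 1) y"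
      proof (cases "y \<in> ball 0 1 - {0}")
        case True
        then have s: "sgn y \<in> sphere 0 1" by (auto simp: norm_sgn)
        then have "R *\<^sub>R sgn y \<in> sphere 0 R" using R_pos by simp
        then have "norm (fy (R *\<^sub>R sgn y)) \<le> B" using B by blast
        then have "h R (sgn y) powr (-p-1) \<le> B" using fyR[OF s] by simp
        then show ?thesis using True by (auto simp: indicator_def ennreal_leI)
      qed (simp add: indicator_def)
    qed
    also have "\<dots> = ennreal B * emeasure lborel (ball (0::real^'n) 1)" by (rule nn_integral_cmult_indicator) auto
    also have "\<dots> < \<infinity>"
      by (simp add: ennreal_mult_less_top emeasure_bounded_finite[unfolded infinity_ennreal_def])
    finally show ?thesis .
  qed
  define \<delta>1 where "\<delta>1 = min (\<kappa> / 4) (R / 4)"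
  show ?thesis
  proof (intro exI[of _ \<delta>1] conjI allI impI)
    show "0 < \<delta>1" "\<delta>1 \<le> R / 4" using \<kappa> R_pos by (auto simp: \<delta>1_def)
    fix \<delta> assume \<delta>: "0 < \<delta>" "\<delta> \<le> \<delta>1"
    have \<delta>2: "2 * \<delta> < \<kappa>" "2 * \<delta> \<le> R / 2" using \<delta> \<kappa> R_pos by (auto simp: \<delta>1_def)
    define f where "f y = ennreal (indicator B0 y *\<^sub>R fy y) * (indicator {R - 2 * \<delta>..} (norm y) :: ennreal)" for y
    have f: "f \<in> borel_measurable borel"
    proof -
      have "B0 \<subseteq> PB" by auto
      then have "(\<lambda>y. indicator B0 y *\<^sub>R fy y) \<in> borel_measurable borel"
        by (intro borel_measurable_continuous_on_indicator continuous_on_subset[OF contf]) auto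
      then show ?thesis unfolding f_def by measurable
    qed
    have "(\<integral>\<^sup>+x\<in>\<Omega>. ennreal (\<rho>0 x) * (ennreal (hN x powr (-p-1)) * indicator {R - 2 * \<delta>..} (rN x)) \<partial>lborel)
      = (\<integral>\<^sup>+x\<in>\<Omega>. ennreal (\<rho>0 x) * f (N x) \<partial>lborel)"
    proof (rule nn_integral_cong)
      fix x
      show "ennreal (\<rho>0 x) * (ennreal (hN x powr (-p-1)) * indicator {R - 2 * \<delta>..} (rN x)) * indicator \<Omega> x = ennreal (\<rho>0 x) * f (N x) * indicator \<Omega> x"
        using \<Omega>_N(1)[of x] by (cases "x \<in> \<Omega>") (simp_all add: f_def fy_def del: Diff_iff)
    qed
    also have "\<dots> = (\<integral>\<^sup>+y\<in>B0. ennreal (C / norm y ^ (CARD('n) - 1)) * f y \<partial>lborel)" by (rule nn_integral_push[OF f])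
    also have "\<dots> \<le> (\<integral>\<^sup>+y. ennreal (C * (2 / R) ^ (d - 1) * 2) * (ennreal (h R (sgn y) powr (-p-1)) * indicator (ball 0 R - ball 0 (R - 2 * \<delta>)) y) \<partial>lborel)"
    proof (rule nn_integral_mono)
      fix y :: "real^'n"
      show "ennreal (C / norm y ^ (CARD('n) - 1)) * f y * indicator B0 y \<le>
        ennreal (C * (2 / R) ^ (d - 1) * 2) * (ennreal (h R (sgn y) powr (-p-1)) * indicator (ball 0 R - ball 0 (R - 2 * \<delta>)) y)"
      proof (cases "y \<in> B0 \<and> R - 2 * \<delta> \<le> norm y")
        case True
        then have yB: "y \<in> B0" and yR: "R - 2 * \<delta> \<le> norm y" "norm y < R" by auto
        have yPB: "y \<in> PB" using yB by auto
        have s: "sgn y \<in> sphere 0 1" by (rule polar_PB(4)[OF yB])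
        have "y = norm y *\<^sub>R sgn y" using yB by (auto simp: sgn_div_norm)
        then have "y - R *\<^sub>R sgn y = (norm y - R) *\<^sub>R sgn y" by (metis scaleR_diff_left)
        then have "norm (y - R *\<^sub>R sgn y) = R - norm y" using s yR by simp
        then have "\<bar>fy y - fy (R *\<^sub>R sgn y)\<bar> < m" using yR \<delta>2 by (intro \<kappa>(3)[OF yPB s]) simp
        then have le1: "fy y \<le> 2 * (h R (sgn y) powr (-p-1))" using m(2)[OF s] fyR[OF s] by simp
        have "R / 2 \<le> norm y" using yR \<delta>2 by simp
        then have "C / norm y ^ (d - 1) \<le> C / (R / 2) ^ (d - 1)"
          using C_pos R_pos by (intro divide_left_mono power_mono mult_pos_pos zero_less_power) auto
        also have "\<dots> = C * (2 / R) ^ (d - 1)" by (simp add: power_divide)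
        finally have le2: "C / norm y ^ (d - 1) \<le> C * (2 / R) ^ (d - 1)" .
        have "C / norm y ^ (d - 1) * fy y \<le> C * (2 / R) ^ (d - 1) * (2 * (h R (sgn y) powr (-p-1)))"
          using le1 le2 C_pos R_pos fpos[OF yPB] by (intro mult_mono) auto
        then have "ennreal (C / norm y ^ (d - 1) * fy y) \<le> ennreal ((C * (2 / R) ^ (d - 1) * 2) * (h R (sgn y) powr (-p-1)))"
          by (intro ennreal_leI) (simp add: mult_ac)
        moreover have "indicator (ball 0 R - ball 0 (R - 2 * \<delta>)) y = (1::ennreal)" using yR by simp
        ultimately show ?thesis
          using yB yR C_pos R_pos by (simp add: f_def d_def[symmetric] ennreal_mult'[symmetric] del: Diff_iff)
      next
        case False
        then have "f y * indicator B0 y = 0" by (auto simp: f_def indicator_def)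
        then show ?thesis by (simp only: mult.assoc mult_zero_right zero_le)
      qed
    qed
    also have "\<dots> = ennreal (C * (2 / R) ^ (d - 1) * 2) * (\<integral>\<^sup>+y\<in>ball 0 R - ball 0 (R - 2 * \<delta>). ennreal (h R (sgn y) powr (-p-1)) \<partial>lborel)"
      by (intro nn_integral_cmult borel_measurable_times_ennreal borel_measurable_indicator) (use hm in auto)
    also have "(\<integral>\<^sup>+y\<in>ball 0 R - ball 0 (R - 2 * \<delta>). ennreal (h R (sgn y) powr (-p-1)) \<partial>lborel) = ennreal (R ^ d - (R - 2 * \<delta>) ^ d) * I"
      using nn_integral_cone_shell[of "\<lambda>\<theta>. ennreal (h R \<theta> powr (-p-1))" "R - 2 * \<delta>" R] hm \<delta> \<delta>2 R_pos Ifin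
      unfolding I_def d(2)[symmetric] by simp
    also have "ennreal (C * (2 / R) ^ (d - 1) * 2) * (ennreal (R ^ d - (R - 2 * \<delta>) ^ d) * I)
       \<le> ennreal (C * (2 / R) ^ (d - 1) * 2) * (ennreal (real d * (2 * \<delta>) * R ^ (d - 1)) * I)"
    proof (intro mult_left_mono mult_right_mono ennreal_leI)
      show "R ^ d - (R - 2 * \<delta>) ^ d \<le> real d * (2 * \<delta>) * R ^ (d - 1)"
        using power_diff_le[of "R - 2 * \<delta>" R d] \<delta> \<delta>2 R_pos by simp
    qed auto
    also have "\<dots> = ennreal (2 ^ (d + 1) * d * C * \<delta>) * I"
    proof -
      obtain n where n: "d = Suc n" using d gr0_implies_Suc by blast
      have "(C * (2 / R) ^ (d - 1) * 2) * (real d * (2 * \<delta>) * R ^ (d - 1)) = 2 ^ (d + 1) * d * C * \<delta>"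
        using R_pos by (simp add: n power_divide field_simps)
      moreover have "0 \<le> C * (2 / R) ^ (d - 1) * 2" using C_pos R_pos by simp
      ultimately show ?thesis by (metis ennreal_mult' mult.assoc)
    qed
    also have "\<dots> \<le> ennreal (2 ^ (d + 1) * d * C * \<delta>) * (ennreal (2 ^ d / unit_ball_vol (real (d - 1)) * (cone_factor CARD('n) / C)) * J)"
      unfolding I_def J_def d_def by (intro mult_left_mono nn_integral_sphere_le) simp
    also have "\<dots> = ennreal (boundary_factor CARD('n) * \<delta>) * J"
    proof -
      have "(2 ^ (d + 1) * d * C * \<delta>) * (2 ^ d / unit_ball_vol (real (d - 1)) * (cone_factor CARD('n) / C)) = boundary_factor CARD('n) * \<delta>"
        using C_pos unfolding boundary_factor_def d_def[symmetric] by (simp add: field_simps)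
      moreover have "0 \<le> 2 ^ (d + 1) * d * C * \<delta>" using C_pos \<delta> by simp
      ultimately show ?thesis by (metis ennreal_mult' mult.assoc)
    qed
    finally show "(\<integral>\<^sup>+x\<in>\<Omega>. ennreal (\<rho>0 x) * (ennreal (hN x powr (-p-1)) * indicator {R - 2 * \<delta>..} (rN x)) \<partial>lborel)
      \<le> ennreal (boundary_factor CARD('n) * \<delta>) * (\<integral>\<^sup>+x\<in>frontier A. ennreal (h R (\<nu> x) powr (-p) * \<rho>0 x) \<partial>hausdorff_measure (CARD('n) - 1))"
      unfolding J_def d_def .
  qed
qed

end


section \<open>Cutoffs and absorption\<close>

text \<open>The truncated square, a C^1 function; both parts of the cutoff are linear combinations
  of its affine rescalings.\<close>

definition sqpos :: "real \<Rightarrow> real" where "sqpos t = (max 0 t)\<^sup>2"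

lemma sqpos_deriv: "(sqpos has_real_derivative 2 * max 0 t) (at t)"
proof (cases "t = 0")
  case True
  have "((\<lambda>h. (sqpos (0 + h) - sqpos 0) / h) \<longlongrightarrow> 0) (at 0)"
  proof (rule Lim_null_comparison)
    show "eventually (\<lambda>h. norm ((sqpos (0 + h) - sqpos 0) / h) \<le> \<bar>h\<bar>) (at 0)"
      by (rule always_eventually) (auto simp: sqpos_def max_def power2_eq_square abs_mult)
    show "((\<lambda>h::real. \<bar>h\<bar>) \<longlongrightarrow> 0) (at 0)" by (auto intro!: tendsto_eq_intros)
  qed
  then show ?thesis using True by (simp add: DERIV_def)
next
  case False
  then consider "t > 0" | "t < 0" by linarith
  then show ?thesis
  proof cases
    case 1
    have "((\<lambda>t. t\<^sup>2) has_real_derivative 2 * max 0 t) (at t)" using 1 by (auto intro!: derivative_eq_intros)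
    then show ?thesis
      by (rule has_field_derivative_transform_within_open[where S = "{0<..}"]) (use 1 in \<open>auto simp: sqpos_def\<close>)
  next
    case 2
    have "((\<lambda>t. 0) has_real_derivative 2 * max 0 t) (at t)" using 2 by (auto intro!: derivative_eq_intros)
    then show ?thesis
      by (rule has_field_derivative_transform_within_open[where S = "{..<0}"]) (use 2 in \<open>auto simp: sqpos_def\<close>)
  qed
qed

lemma sqpos_shift_deriv: "((\<lambda>r. sqpos (a * r - b)) has_real_derivative 2 * max 0 (a * r - b) * a) (at r)"
  by (rule DERIV_chain2[OF sqpos_deriv, where g = "\<lambda>r. a * r - b"]) (auto intro!: derivative_eq_intros)

text \<open>The cutoff is the product of a ramp of slope \<open>1\<close> starting at \<open>\<epsilon>\<close> and a smooth step
  descending from \<open>1\<close> to \<open>0\<close> on \<open>[R - 2 \<delta>, R - \<delta>]\<close>; \<open>w\<close> is the part of its derivative due to the ramp.\<close>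

lemma cutoff_exists:
  fixes R \<epsilon> \<delta> :: real
  assumes "0 < \<epsilon>" "0 < \<delta>" "0 < R"
  obtains \<psi> \<psi>' w where "cutoff \<psi> \<psi>' \<epsilon> (R - \<delta>)" "continuous_on UNIV w"
    "\<And>r. r < \<epsilon> \<or> R - \<delta> < r \<Longrightarrow> w r = 0"
    "\<And>r. 0 \<le> w r" "\<And>r. w r \<le> 1" "\<And>r. 2 * \<epsilon> \<le> r \<Longrightarrow> r \<le> R - 2 * \<delta> \<Longrightarrow> w r = 1"
    "\<And>r. r \<le> R \<Longrightarrow> \<psi> r \<le> R * w r"
    "\<And>r. r \<le> R \<Longrightarrow> w r - \<psi>' r \<le> (if R - 2 * \<delta> \<le> r \<and> r \<le> R - \<delta> \<and> \<epsilon> \<le> r then 2 * R / \<delta> else 0)"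
proof -
  \<comment> \<open>The derivative of \<alpha> rises linearly from 0 at \<epsilon> to 1 at
    2\<epsilon> and stays there.\<close>
  define \<alpha> where "\<alpha> r = (sqpos (1 * r - \<epsilon>) - sqpos (1 * r - 2 * \<epsilon>)) / (2 * \<epsilon>)" for r
  define \<alpha>' where "\<alpha>' r = (max 0 (r - \<epsilon>) - max 0 (r - 2 * \<epsilon>)) / \<epsilon>" for r
  define u where "u r = (R - \<delta> - r) / \<delta>" for r
  \<comment> \<open>As a function of \<open>u\<close> this is the quadratic step 2u^2 up to 1/2 and
    1 - 2(1 - u)^2 from there to 1. The arguments are spelled out as affine functions of
    \<open>r\<close> to fit \<open>sqpos_shift_deriv\<close>.\<close>
  define \<beta> where "\<beta> r = 2 * sqpos ((-1/\<delta>) * r - (- (R - \<delta>) / \<delta>)) - 4 * sqpos ((-1/\<delta>) * r - (1/2 - (R - \<delta>) / \<delta>)) + 2 * sqpos ((-1/\<delta>) * r - (1 - (R - \<delta>) / \<delta>))" for r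
  define \<beta>' where "\<beta>' r = - ((max 0 (u r) - 2 * max 0 (u r - 1/2) + max 0 (u r - 1)) * (4 / \<delta>))" for r
  have args: "(-1/\<delta>) * r - (- (R - \<delta>) / \<delta>) = u r" "(-1/\<delta>) * r - (1/2 - (R - \<delta>) / \<delta>) = u r - 1/2" "(-1/\<delta>) * r - (1 - (R - \<delta>) / \<delta>) = u r - 1" for r
    by (simp_all add: u_def diff_divide_distrib)
  have \<beta>u: "\<beta> r = 2 * sqpos (u r) - 4 * sqpos (u r - 1/2) + 2 * sqpos (u r - 1)" for r
    unfolding \<beta>_def args ..
  have d\<alpha>: "(\<alpha> has_real_derivative \<alpha>' r) (at r)" for r
  proof -
    have "(\<alpha> has_real_derivative (2 * max 0 (1 * r - \<epsilon>) * 1 - 2 * max 0 (1 * r - 2 * \<epsilon>) * 1) / (2 * \<epsilon>)) (at r)"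
      unfolding \<alpha>_def by (intro DERIV_cdivide DERIV_diff sqpos_shift_deriv)
    moreover have "(2 * max 0 (1 * r - \<epsilon>) * 1 - 2 * max 0 (1 * r - 2 * \<epsilon>) * 1) / (2 * \<epsilon>) = \<alpha>' r"
      by (simp add: \<alpha>'_def diff_divide_distrib)
    ultimately show ?thesis by (simp only:)
  qed
  have d\<beta>: "(\<beta> has_real_derivative \<beta>' r) (at r)" for r
  proof -
    have "(\<beta> has_real_derivative (2 * (2 * max 0 ((-1/\<delta>) * r - (- (R - \<delta>) / \<delta>)) * (-1/\<delta>))
        - 4 * (2 * max 0 ((-1/\<delta>) * r - (1/2 - (R - \<delta>) / \<delta>)) * (-1/\<delta>))
        + 2 * (2 * max 0 ((-1/\<delta>) * r - (1 - (R - \<delta>) / \<delta>)) * (-1/\<delta>)))) (at r)"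
      unfolding \<beta>_def by (intro DERIV_add DERIV_diff DERIV_cmult sqpos_shift_deriv)
    then have "(\<beta> has_real_derivative (2 * (2 * max 0 (u r) * (-1/\<delta>)) - 4 * (2 * max 0 (u r - 1/2) * (-1/\<delta>)) + 2 * (2 * max 0 (u r - 1) * (-1/\<delta>)))) (at r)"
      unfolding args .
    moreover have "2 * (2 * max 0 (u r) * (-1/\<delta>)) - 4 * (2 * max 0 (u r - 1/2) * (-1/\<delta>)) + 2 * (2 * max 0 (u r - 1) * (-1/\<delta>)) = \<beta>' r"
      using assms by (simp add: \<beta>'_def field_simps)
    ultimately show ?thesis by (simp only:)
  qed
  have \<alpha>0: "0 \<le> \<alpha> r" "0 \<le> \<alpha>' r" "\<alpha>' r \<le> 1" "2 * \<epsilon> \<le> r \<Longrightarrow> \<alpha>' r = 1" "r < \<epsilon> \<Longrightarrow> \<alpha> r = 0" "r < \<epsilon> \<Longrightarrow> \<alpha>' r = 0" 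
    "r \<le> R \<Longrightarrow> \<alpha> r \<le> R * \<alpha>' r" "r \<le> R \<Longrightarrow> \<alpha> r \<le> R" for r
  proof -
    consider "r < \<epsilon>" | "\<epsilon> \<le> r" "r < 2 * \<epsilon>" | "2 * \<epsilon> \<le> r" by linarith
    then have "0 \<le> \<alpha> r \<and> 0 \<le> \<alpha>' r \<and> \<alpha>' r \<le> 1 \<and> (2 * \<epsilon> \<le> r \<longrightarrow> \<alpha>' r = 1) \<and> (r < \<epsilon> \<longrightarrow> \<alpha> r = 0 \<and> \<alpha>' r = 0) \<and>
      (r \<le> R \<longrightarrow> \<alpha> r \<le> R * \<alpha>' r \<and> \<alpha> r \<le> R)"
    proof cases
      case 1
      then show ?thesis using assms by (simp add: \<alpha>_def \<alpha>'_def sqpos_def)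
    next
      case 2
      then have e: "\<alpha> r = (r - \<epsilon>)\<^sup>2 / (2 * \<epsilon>)" "\<alpha>' r = (r - \<epsilon>) / \<epsilon>" by (simp_all add: \<alpha>_def \<alpha>'_def sqpos_def)
      \<comment> \<open>On the starting part of the ramp \<alpha> is a small multiple of its own
        derivative. The resulting \<open>\<alpha> \<le> R * \<alpha>'\<close> is what lets the
        gradient term be absorbed later.\<close>
      have e2: "\<alpha> r = (r - \<epsilon>) / 2 * \<alpha>' r" using assms unfolding e by (simp add: power2_eq_square)
      have a': "0 \<le> \<alpha>' r" "\<alpha>' r \<le> 1" using 2 assms unfolding e by auto
      have a1: "\<alpha> r \<le> R * \<alpha>' r" if "r \<le> R" unfolding e2 using that a' assms by (intro mult_right_mono) auto
      have "R * \<alpha>' r \<le> R" using a' assms by (simp add: mult_left_le)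
      then have "\<alpha> r \<le> R" if "r \<le> R" using a1[OF that] by simp
      moreover have "0 \<le> \<alpha> r" unfolding e using assms by simp
      ultimately show ?thesis using 2 a' a1 by auto
    next
      case 3
      have "\<alpha> r = ((r - \<epsilon>)\<^sup>2 - (r - 2 * \<epsilon>)\<^sup>2) / (2 * \<epsilon>)" "\<alpha>' r = 1"
        using 3 assms by (simp_all add: \<alpha>_def \<alpha>'_def sqpos_def)
      moreover have "((r - \<epsilon>)\<^sup>2 - (r - 2 * \<epsilon>)\<^sup>2) / (2 * \<epsilon>) = r - 3 / 2 * \<epsilon>"
        using assms by (simp add: power2_eq_square field_simps)
      ultimately show ?thesis using 3 assms by simp
    qed
    then show "0 \<le> \<alpha> r" "0 \<le> \<alpha>' r" "\<alpha>' r \<le> 1" "2 * \<epsilon> \<le> r \<Longrightarrow> \<alpha>' r = 1" "r < \<epsilon> \<Longrightarrow> \<alpha> r = 0" "r < \<epsilon> \<Longrightarrow> \<alpha>' r = 0" 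
    "r \<le> R \<Longrightarrow> \<alpha> r \<le> R * \<alpha>' r" "r \<le> R \<Longrightarrow> \<alpha> r \<le> R" by blast+
  qed
  have step: "0 \<le> 2 * sqpos v - 4 * sqpos (v - 1/2) + 2 * sqpos (v - 1)" "2 * sqpos v - 4 * sqpos (v - 1/2) + 2 * sqpos (v - 1) \<le> 1"
    "v < 0 \<Longrightarrow> 2 * sqpos v - 4 * sqpos (v - 1/2) + 2 * sqpos (v - 1) = 0" "1 \<le> v \<Longrightarrow> 2 * sqpos v - 4 * sqpos (v - 1/2) + 2 * sqpos (v - 1) = 1" for v
  proof -
    consider "v < 0" | "0 \<le> v" "v < 1/2" | "1/2 \<le> v" "v < 1" | "1 \<le> v" by linarith
    then have "0 \<le> 2 * sqpos v - 4 * sqpos (v - 1/2) + 2 * sqpos (v - 1) \<and> 2 * sqpos v - 4 * sqpos (v - 1/2) + 2 * sqpos (v - 1) \<le> 1 \<and>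
      (v < 0 \<longrightarrow> 2 * sqpos v - 4 * sqpos (v - 1/2) + 2 * sqpos (v - 1) = 0) \<and> (1 \<le> v \<longrightarrow> 2 * sqpos v - 4 * sqpos (v - 1/2) + 2 * sqpos (v - 1) = 1)"
    proof cases
      case 2
      have "2 * v\<^sup>2 \<le> 1" using power_mono[of v "1/2" 2] 2 by (simp add: power2_eq_square)
      then show ?thesis using 2 by (simp add: sqpos_def)
    next
      case 3
      have e: "2 * sqpos v - 4 * sqpos (v - 1/2) + 2 * sqpos (v - 1) = 1 - 2 * (1 - v)\<^sup>2"
        using 3 by (simp add: sqpos_def power2_eq_square algebra_simps)
      have "(1 - v)\<^sup>2 \<le> (1/2)\<^sup>2" using 3 by (intro power_mono) auto
      then show ?thesis unfolding e using 3 by (simp add: power2_eq_square)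
    next
      case 4
      then show ?thesis by (simp add: sqpos_def power2_eq_square algebra_simps)
    qed (simp add: sqpos_def)
    then show "0 \<le> 2 * sqpos v - 4 * sqpos (v - 1/2) + 2 * sqpos (v - 1)" "2 * sqpos v - 4 * sqpos (v - 1/2) + 2 * sqpos (v - 1) \<le> 1"
    "v < 0 \<Longrightarrow> 2 * sqpos v - 4 * sqpos (v - 1/2) + 2 * sqpos (v - 1) = 0" "1 \<le> v \<Longrightarrow> 2 * sqpos v - 4 * sqpos (v - 1/2) + 2 * sqpos (v - 1) = 1" by blast+
  qed
  have u: "u r < 0 \<longleftrightarrow> R - \<delta> < r" "1 \<le> u r \<longleftrightarrow> r \<le> R - 2 * \<delta>" for r
    using assms by (auto simp: u_def field_simps)
  have \<beta>0: "0 \<le> \<beta> r" "\<beta> r \<le> 1" "R - \<delta> < r \<Longrightarrow> \<beta> r = 0" "r \<le> R - 2 * \<delta> \<Longrightarrow> \<beta> r = 1" for r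
    using step[of "u r"] u[of r] unfolding \<beta>u by auto
  have \<beta>'0: "- \<beta>' r \<le> (if R - 2 * \<delta> \<le> r \<and> r \<le> R - \<delta> then 2 / \<delta> else 0)" "R - \<delta> < r \<Longrightarrow> \<beta>' r = 0" for r
  proof -
    \<comment> \<open>The step is steepest in its middle, where the slope is 1/2 times
      \<open>4 / \<delta>\<close>.\<close>
    have m: "max 0 v - 2 * max 0 (v - 1/2) + max 0 (v - 1) \<le> 1/2" "v < 0 \<or> 1 < v \<Longrightarrow> max 0 v - 2 * max 0 (v - 1/2) + max 0 (v - 1) = 0" for v :: real
      by (auto simp: max_def)
    have "- \<beta>' r = (max 0 (u r) - 2 * max 0 (u r - 1/2) + max 0 (u r - 1)) * (4 / \<delta>)" by (simp add: \<beta>'_def)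
    moreover have "(max 0 (u r) - 2 * max 0 (u r - 1/2) + max 0 (u r - 1)) * (4 / \<delta>) \<le> 1/2 * (4 / \<delta>)"
      using m(1)[of "u r"] assms by (intro mult_right_mono) auto
    moreover have "u r < 0 \<or> 1 < u r" if "\<not> (R - 2 * \<delta> \<le> r \<and> r \<le> R - \<delta>)" using that assms by (auto simp: u_def field_simps)
    ultimately show "- \<beta>' r \<le> (if R - 2 * \<delta> \<le> r \<and> r \<le> R - \<delta> then 2 / \<delta> else 0)" using m(2)[of "u r"] by auto
    show "R - \<delta> < r \<Longrightarrow> \<beta>' r = 0" using m(2)[of "u r"] u(1)[of r] by (simp add: \<beta>'_def)
  qed
  have c\<alpha>: "continuous_on UNIV \<alpha>" "continuous_on UNIV \<beta>"
    using d\<alpha> d\<beta> by (meson DERIV_isCont continuous_at_imp_continuous_on)+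
  have c\<alpha>': "continuous_on UNIV \<alpha>'" "continuous_on UNIV \<beta>'"
    unfolding \<alpha>'_def[abs_def] \<beta>'_def[abs_def] u_def using assms by (intro continuous_intros; simp)+
  show ?thesis
  proof (rule that[of "\<lambda>r. \<alpha> r * \<beta> r" "\<lambda>r. \<alpha>' r * \<beta> r + \<beta>' r * \<alpha> r" "\<lambda>r. \<alpha>' r * \<beta> r"])
    show "cutoff (\<lambda>r. \<alpha> r * \<beta> r) (\<lambda>r. \<alpha>' r * \<beta> r + \<beta>' r * \<alpha> r) \<epsilon> (R - \<delta>)"
    proof
      show "((\<lambda>r. \<alpha> r * \<beta> r) has_real_derivative \<alpha>' r * \<beta> r + \<beta>' r * \<alpha> r) (at r)" for r
        by (rule DERIV_mult[OF d\<alpha> d\<beta>])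
      show "continuous_on UNIV (\<lambda>r. \<alpha>' r * \<beta> r + \<beta>' r * \<alpha> r)"
        by (intro continuous_on_add continuous_on_mult c\<alpha> c\<alpha>')
    qed (use assms \<alpha>0 \<beta>0 \<beta>'0 in auto)
    show "continuous_on UNIV (\<lambda>r. \<alpha>' r * \<beta> r)" by (intro continuous_on_mult c\<alpha> c\<alpha>')
    show "\<alpha>' r * \<beta> r = 0" if "r < \<epsilon> \<or> R - \<delta> < r" for r using that \<alpha>0(6) \<beta>0(3) by auto
    show "0 \<le> \<alpha>' r * \<beta> r" "\<alpha>' r * \<beta> r \<le> 1" for r using \<alpha>0(2,3)[of r] \<beta>0(1,2)[of r] by (auto intro: mult_le_one)
    show "\<alpha>' r * \<beta> r = 1" if "2 * \<epsilon> \<le> r" "r \<le> R - 2 * \<delta>" for r using that \<alpha>0(4) \<beta>0(4) by simp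
    show "\<alpha> r * \<beta> r \<le> R * (\<alpha>' r * \<beta> r)" if "r \<le> R" for r
      using mult_right_mono[OF \<alpha>0(7)[OF that] \<beta>0(1)[of r]] by (simp add: mult.assoc)
    show "\<alpha>' r * \<beta> r - (\<alpha>' r * \<beta> r + \<beta>' r * \<alpha> r) \<le> (if R - 2 * \<delta> \<le> r \<and> r \<le> R - \<delta> \<and> \<epsilon> \<le> r then 2 * R / \<delta> else 0)" if r: "r \<le> R" for r
    proof (cases "R - 2 * \<delta> \<le> r \<and> r \<le> R - \<delta> \<and> \<epsilon> \<le> r")
      case True
      have "(- \<beta>' r) * \<alpha> r \<le> 2 / \<delta> * \<alpha> r" using \<beta>'0(1)[of r] True \<alpha>0(1)[of r] by (intro mult_right_mono) auto
      also have "\<dots> \<le> 2 / \<delta> * R" using \<alpha>0(8)[OF r] assms by (intro mult_left_mono) auto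
      finally show ?thesis using True by simp
    next
      case False
      then have "\<alpha> r = 0 \<or> - \<beta>' r \<le> 0" using \<beta>'0(1)[of r] \<alpha>0(5)[of r] by (auto split: if_splits)
      then have "(- \<beta>' r) * \<alpha> r \<le> 0" using \<alpha>0(1)[of r] by (auto intro: mult_nonpos_nonneg)
      then show ?thesis unfolding if_not_P[OF False] by simp
    qed
  qed
qed

lemma powr_one_divide: "0 < t \<Longrightarrow> (1 / t) powr q = t powr (- q)" for t q :: real
  by (simp add: powr_divide powr_minus_divide)

lemma ennreal_lincomb:
  "0 \<le> a \<Longrightarrow> 0 \<le> b \<Longrightarrow> 0 \<le> c \<Longrightarrow> 0 \<le> d \<Longrightarrow> ennreal (a * b + c * d) = ennreal a * ennreal b + ennreal c * ennreal d"
  by (simp add: ennreal_plus ennreal_mult)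

text \<open>Either \<open>c * b \<le> t / 2\<close>, and the first term dominates, or
  \<open>t\<close> is below \<open>2 * c * b\<close> and is replaced by it. In the application
  \<open>t\<close> is the norm of the gradient of \<phi> and \<open>b\<close> that of the gradient
  of \<open>\<rho>0\<close> divided by \<open>\<rho>0\<close>.\<close>

lemma young_absorb:
  fixes c t b p :: real
  assumes "0 \<le> c" "0 < t" "0 \<le> b" "0 < p"
  shows "c * t powr p * b \<le> t powr (p + 1) / 2 + c * (2 * c) powr p * b powr (p + 1)"
proof (cases "c * b \<le> t / 2")
  case True
  have "c * t powr p * b = t powr p * (c * b)" by simp
  also have "\<dots> \<le> t powr p * (t / 2)" using True by (intro mult_left_mono) auto
  also have "\<dots> = t powr (p + 1) / 2" using assms by (simp add: powr_add)
  also have "\<dots> \<le> t powr (p + 1) / 2 + c * (2 * c) powr p * b powr (p + 1)" using assms by simp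
  finally show ?thesis .
next
  case False
  then have t: "t \<le> 2 * c * b" by simp
  have b: "0 < b" using False assms by (metis less_eq_real_def linorder_not_le mult_zero_right zero_less_divide_iff zero_less_numeral order.strict_implies_order)
  have "c * t powr p * b \<le> c * (2 * c * b) powr p * b"
    using assms t by (intro mult_left_mono mult_right_mono powr_mono2) auto
  also have "\<dots> = c * (2 * c) powr p * b powr (p + 1)" using assms b by (simp add: powr_mult powr_add)
  also have "\<dots> \<le> t powr (p + 1) / 2 + c * (2 * c) powr p * b powr (p + 1)" by simp
  finally show ?thesis .
qed


section \<open>Curvature of the boundary\<close>

context radial_target_transport
begin

text \<open>Any outer normal at \<open>x\<close> attains the support function of \<open>A\<close>
  there, so \<open>x\<close> is its contact point, and injectivity of \<open>X R\<close> determines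
  it.\<close>

lemma outer_unit_normal_frontier:
  assumes x: "x \<in> frontier A"
  shows "outer_unit_normal A x = \<nu> x"
  unfolding outer_unit_normal_def
proof (rule the_equality)
  have x': "X R (\<nu> x) = x" "\<nu> x \<in> sphere 0 1" using \<nu>_frontier[OF x] by auto
  show "is_outer_unit_normal A x (\<nu> x)"
    unfolding is_outer_unit_normal_def
  proof (intro conjI ballI)
    fix y assume "y \<in> A"
    then have "\<nu> x \<bullet> y \<le> H R (\<nu> x)" using inner_le_H[of y R] by (simp add: sublevel_R)
    then show "\<nu> x \<bullet> (y - x) \<le> 0" using X_in(2)[OF R_in x'(2)] x'(1) by (simp add: inner_diff_right)
  qed (use x' in simp)
  fix n assume n: "is_outer_unit_normal A x n"
  then have n1: "n \<in> sphere 0 1" by (simp add: is_outer_unit_normal_def)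
  have "x = X R n"
  proof (rule X_unique[OF R_in n1])
    show "x \<in> sublevel A \<phi> R" using frontier_sub x by (auto simp: sublevel_R)
    show "H R n \<le> n \<bullet> x"
      using n R_pos by (intro H_le) (auto simp: is_outer_unit_normal_def inner_diff_right sublevel_R)
  qed
  then show "n = \<nu> x" using \<nu>_X[OF n1] by simp
qed

text \<open>The cone map \<open>z \<mapsto> |z| X R (z / |z|)\<close> is injective because the support function is positive; it extends \<open>X R\<close> to an open set,
  so that the differentiability of \<open>\<nu>\<close> along the frontier reduces to that of an inverse map.\<close>

definition cone_map :: "real^'n \<Rightarrow> real^'n" where "cone_map z = norm z *\<^sub>R X R (sgn z)"

text \<open>Pairing \<open>cone_map z\<close> with \<open>sgn z\<close> gives
  \<open>norm z * H R (sgn z)\<close>, while the pairing of \<open>cone_map w\<close> with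
  \<open>sgn z\<close> is at most \<open>norm w * H R (sgn z)\<close>. Equal images thus have equal
  norms, and injectivity of \<open>X R\<close> finishes.\<close>

lemma cone_map_inj: "inj_on cone_map (- {0})"
proof -
  have *: "norm z \<le> norm w" if zw: "z \<noteq> 0" "w \<noteq> 0" "cone_map z = cone_map w" for z w
  proof -
    have s: "sgn z \<in> sphere 0 1" "sgn w \<in> sphere 0 1" using zw by (simp_all add: norm_sgn)
    have "norm z * H R (sgn z) = sgn z \<bullet> cone_map z" using X_in(2)[OF R_in s(1)] by (simp add: cone_map_def)
    also have "\<dots> = norm w * (sgn z \<bullet> X R (sgn w))" unfolding zw(3) by (simp add: cone_map_def)
    also have "\<dots> \<le> norm w * H R (sgn z)"
      using X_in(1)[OF R_in s(2)] by (intro mult_left_mono inner_le_H) auto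
    finally show ?thesis using H_pos[OF R_in s(1)] by simp
  qed
  show ?thesis
  proof (rule inj_onI)
    fix z w assume zw: "z \<in> - {0}" "w \<in> - {0}" "cone_map z = cone_map w"
    then have n: "norm z = norm w" using *[of z w] *[of w z] by simp
    have s: "sgn z \<in> sphere 0 1" "sgn w \<in> sphere 0 1" using zw by (simp_all add: norm_sgn)
    have "X R (sgn z) = X R (sgn w)" using zw n by (simp add: cone_map_def)
    then have "sgn z = sgn w" using inj_X_R s by (auto dest: inj_onD)
    then have "norm z *\<^sub>R sgn z = norm w *\<^sub>R sgn w" using n by simp
    then show "z = w" using zw by (simp add: sgn_div_norm)
  qed
qed

lemma normal_differentiable:
  assumes x: "x \<in> frontier A"
  shows "outer_unit_normal A differentiable (at x within frontier A)"
proof -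
  define \<theta> where "\<theta> = \<nu> x"
  have \<theta>: "\<theta> \<in> sphere 0 1" "X R \<theta> = x" using \<nu>_frontier[OF x] by (auto simp: \<theta>_def)
  have n: "norm \<theta> = 1" "\<theta> \<noteq> 0" and s: "sgn \<theta> = \<theta>" using \<theta> by (auto simp: sgn_div_norm)
  \<comment> \<open>The radial direction is sent to \<open>x\<close>, whose component along \<theta>
    is the positive number \<open>H R \<theta>\<close>; tangent vectors are treated by
    \<open>L\<close>. Hence \<open>M\<close> is injective.\<close>
  define M where "M v = L R \<theta> v + (\<theta> \<bullet> v) *\<^sub>R x" for v
  have nd: "(norm has_derivative (\<lambda>v. \<theta> \<bullet> v)) (at \<theta>)"
    using has_derivative_norm[OF n(2)] unfolding s by (simp only: inner_commute)
  have "(cone_map has_derivative (\<lambda>v. norm \<theta> *\<^sub>R L R \<theta> v + (\<theta> \<bullet> v) *\<^sub>R X R (sgn \<theta>))) (at \<theta>)"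
    unfolding cone_map_def[abs_def] by (rule has_derivative_scaleR[OF nd X_has_derivative[OF R_in \<theta>(1)]])
  then have dM: "(cone_map has_derivative M) (at \<theta>)"
    unfolding M_def[abs_def] n(1) s \<theta>(2) scaleR_one .
  have linM: "linear M" using dM by (rule has_derivative_linear)
  have "v = 0" if "M v = 0" for v
  proof -
    have "\<theta> \<bullet> M v = (\<theta> \<bullet> v) * H R \<theta>"
      using inner_L[OF R_in \<theta>(1)] X_in(2)[OF R_in \<theta>(1)] \<theta>(2) by (simp add: M_def inner_add_right)
    then have 0: "\<theta> \<bullet> v = 0" using that H_pos[OF R_in \<theta>(1)] by simp
    then have "L R \<theta> v = 0" using that by (simp add: M_def)
    then have "tangential \<theta> v = 0" by (rule L_eq_0[OF R_in \<theta>(1)])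
    then show "v = 0" using 0 by (simp add: tangential_def)
  qed
  then have "inj M" using linM by (simp add: linear_injective_0)
  then obtain g' where g': "linear g'" "g' \<circ> M = id" using linear_injective_left_inverse[OF linM] by blast
  have inv: "M \<circ> g' = id" using g' linM linear_inverse_left by blast
  have "(the_inv_into (- {0}) cone_map has_derivative g') (at (cone_map \<theta>))"
  proof (rule has_derivative_inverse_strong[where S = "- {0}" and x = \<theta> and f = cone_map and f' = M])
    show "continuous_on (- {0}) cone_map"
      unfolding cone_map_def[abs_def] by (intro continuous_on_scaleR continuous_on_norm continuous_on_id continuous_X_R)
    show "the_inv_into (- {0}) cone_map (cone_map y) = y" if "y \<in> - {0}" for y
      by (rule the_inv_into_f_f[OF cone_map_inj that])
  qed (use n dM inv in auto)
  moreover have "cone_map \<theta> = x" using n s \<theta> by (simp add: cone_map_def)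
  ultimately have d: "(the_inv_into (- {0}) cone_map has_derivative g') (at x within frontier A)"
    using has_derivative_at_withinI by metis
  have "(outer_unit_normal A has_derivative g') (at x within frontier A)"
  proof (rule has_derivative_transform[OF x _ d])
    fix y assume y: "y \<in> frontier A"
    note \<nu>y = \<nu>_frontier[OF y]
    have sy: "sgn (\<nu> y) = \<nu> y" using \<nu>y(1) by (simp add: sgn_div_norm)
    have "cone_map (\<nu> y) = y" using \<nu>y sy by (simp add: cone_map_def)
    moreover have "\<nu> y \<in> - {0}" using \<nu>y(1) by auto
    ultimately have "the_inv_into (- {0}) cone_map y = \<nu> y" using the_inv_into_f_f[OF cone_map_inj] by metis
    then show "outer_unit_normal A y = the_inv_into (- {0}) cone_map y" using outer_unit_normal_frontier[OF y] by simp
  qed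
  then show ?thesis unfolding differentiable_def by blast
qed

text \<open>Differentiating \<open>\<nu> (X R \<theta>) = \<theta>\<close> shows that the
  differential of the Gauss map inverts \<open>L\<close> on the tangent space. The curvature is
  therefore the reciprocal of the determinant in the Monge-Ampere equation.\<close>

lemma gauss_curvature_eq:
  assumes x: "x \<in> frontier A"
  shows "gauss_curvature A x = \<rho>0 x * h R (\<nu> x) / C"
proof -
  define \<theta> where "\<theta> = \<nu> x"
  have \<theta>: "\<theta> \<in> sphere 0 1" "X R \<theta> = x" using \<nu>_frontier[OF x] by (auto simp: \<theta>_def)
  have n: "norm \<theta> = 1" "\<theta> \<noteq> 0" and s: "sgn \<theta> = \<theta>" using \<theta> by (auto simp: sgn_div_norm)
  define D where "D = frechet_derivative (outer_unit_normal A) (at x within frontier A)"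
  have D: "(outer_unit_normal A has_derivative D) (at x within frontier A)"
    using normal_differentiable[OF x] unfolding D_def by (simp only: frechet_derivative_works)
  have Dlin: "linear D" using D by (rule has_derivative_linear)
  have DL: "D (L R \<theta> v) = tangential \<theta> v" for v
  proof -
    have f: "((\<lambda>z. X R (sgn z)) has_derivative L R \<theta>) (at \<theta> within - {0})"
      by (rule has_derivative_at_withinI[OF X_has_derivative[OF R_in \<theta>(1)]])
    have img: "(\<lambda>z. X R (sgn z)) ` (- {0}) \<subseteq> frontier A"
    proof
      fix y assume "y \<in> (\<lambda>z. X R (sgn z)) ` (- {0})"
      then obtain z where z: "z \<in> - {0}" "y = X R (sgn z)" by blast
      then have "sgn z \<in> sphere 0 1" by (simp add: norm_sgn)
      then show "y \<in> frontier A" unfolding z(2) by (rule X_frontier)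
    qed
    have xs: "X R (sgn \<theta>) = x" using s \<theta> by simp
    have "((\<lambda>z. outer_unit_normal A (X R (sgn z))) has_derivative (\<lambda>v. D (L R \<theta> v))) (at \<theta> within - {0})"
      by (rule has_derivative_in_compose[OF f]) (unfold xs, rule has_derivative_subset[OF D img])
    moreover have "((\<lambda>z. outer_unit_normal A (X R (sgn z))) has_derivative (\<lambda>v. tangential (sgn \<theta>) v /\<^sub>R norm \<theta>)) (at \<theta> within - {0})"
    proof (rule has_derivative_transform[OF _ _ has_derivative_at_withinI[OF has_derivative_sgn[OF n(2)]]])
      fix z :: "real^'n" assume "z \<in> - {0}"
      then have "sgn z \<in> sphere 0 1" by (simp add: norm_sgn)
      then show "outer_unit_normal A (X R (sgn z)) = sgn z"
        using outer_unit_normal_frontier[OF X_frontier] \<nu>_X by simp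
    qed (use n in auto)
    moreover have "at \<theta> within - {0} = at \<theta>" using n by (intro at_within_open) auto
    ultimately have "(\<lambda>v. D (L R \<theta> v)) = (\<lambda>v. tangential (sgn \<theta>) v /\<^sub>R norm \<theta>)"
      using has_derivative_unique by metis
    then show ?thesis using n s by (metis inverse_1 scaleR_one)
  qed
  define P where "P v = D (tangential \<theta> v) + (\<theta> \<bullet> v) *\<^sub>R \<theta>" for v
  define M where "M v = (H R \<theta> *\<^sub>R tangential \<theta> v + Q R \<theta> (tangential \<theta> v)) + (\<theta> \<bullet> v) *\<^sub>R \<theta>" for v
  have M_eq: "M v = L R \<theta> v + (\<theta> \<bullet> v) *\<^sub>R \<theta>" for v
    using sphere_hess_works(2)[OF H_\<theta>\<theta>_exists[OF R_in] \<theta>(1)] by (simp add: M_def L_def)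
  have linP: "linear P" unfolding P_def
    by (rule linearI) (simp_all add: linear_add[OF Dlin] linear_cmul[OF Dlin] algebra_simps inner_simps)
  have linM: "linear M" unfolding M_eq
    by (rule linearI) (simp_all add: linear_add[OF linear_L[OF R_in \<theta>(1)]] linear_cmul[OF linear_L[OF R_in \<theta>(1)]] algebra_simps inner_simps)
  have "P (M v) = v" for v
  proof -
    have nn: "\<theta> \<bullet> \<theta> = 1" using n by (simp add: dot_square_norm)
    have i: "\<theta> \<bullet> M v = \<theta> \<bullet> v" using inner_L[OF R_in \<theta>(1)] nn by (simp add: M_eq inner_add_right)
    then have "tangential \<theta> (M v) = L R \<theta> v" by (simp add: tangential_def M_eq)
    then show ?thesis using i by (simp add: P_def DL tangential_def)
  qed
  then have "P \<circ> M = id" by auto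
  then have "matrix P ** matrix M = mat 1" using matrix_compose[OF linM linP] matrix_id_mat_1 by metis
  then have "det (matrix P) * det (matrix M) = 1" by (metis det_I det_mul)
  moreover have "gauss_curvature A x = det (matrix P)"
    unfolding gauss_curvature_def tangent_det_def outer_unit_normal_frontier[OF x] \<theta>_def[symmetric] D_def[symmetric] P_def[abs_def] ..
  moreover have "C = \<rho>0 x * h R \<theta> * det (matrix M)"
    using cov[OF R_in \<theta>(1)] \<theta>(2) unfolding tangent_det_def M_def[abs_def] by simp
  ultimately have "gauss_curvature A x * C = \<rho>0 x * h R \<theta>" by (metis mult.assoc mult.commute mult.right_neutral)
  then show ?thesis using C_pos unfolding \<theta>_def by (simp add: field_simps)
qed

lemma grad_\<phi>_frontier:
  assumes x: "x \<in> frontier A"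
  shows "norm (grad_on \<phi> A x) = 1 / h R (\<nu> x)"
  using H_r_eq[OF R_in \<nu>_frontier(1)[OF x]] \<nu>_frontier(2)[OF x] by simp

lemma frontier_integrands:
  assumes x: "x \<in> frontier A"
  shows "norm (grad_on \<phi> A x) powr p * \<rho>0 x = h R (\<nu> x) powr (-p) * \<rho>0 x"
    "gauss_curvature A x powr (-p) * \<rho>0 x powr (p + 1) = C powr p * (h R (\<nu> x) powr (-p) * \<rho>0 x)"
proof -
  have h: "0 < h R (\<nu> x)" and r: "0 < \<rho>0 x"
    using positivity(1,2)[OF R_in \<nu>_frontier(1)[OF x]] \<nu>_frontier(2)[OF x] by auto
  show "norm (grad_on \<phi> A x) powr p * \<rho>0 x = h R (\<nu> x) powr (-p) * \<rho>0 x"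
    using h unfolding grad_\<phi>_frontier[OF x] by (simp add: powr_divide powr_minus_divide)
  show "gauss_curvature A x powr (-p) * \<rho>0 x powr (p + 1) = C powr p * (h R (\<nu> x) powr (-p) * \<rho>0 x)"
    unfolding gauss_curvature_eq[OF x] using h r C_pos
    by (simp add: powr_divide powr_mult powr_minus_divide powr_add)
qed

end


section \<open>The two estimates\<close>

context radial_target_transport
begin

lemma mem_annulus_image:
  assumes "x \<in> \<Omega>" "0 < a" "b < R"
  shows "x \<in> annulus_image a b \<longleftrightarrow> a \<le> rN x \<and> rN x \<le> b"
proof
  assume "x \<in> annulus_image a b"
  then obtain y where y: "y \<in> cball 0 b - ball 0 a" "x = Xy y" unfolding annulus_image_def by blast
  then have "y \<in> B0" using annulus_sub[OF assms(2,3)] by blast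
  then have "y \<in> PB" by auto
  then have "N x = y" using N_Xy y(2) by simp
  then show "a \<le> rN x \<and> rN x \<le> b" using y(1) by auto
next
  assume "a \<le> rN x \<and> rN x \<le> b"
  then show "x \<in> annulus_image a b" using annulus_image(3)[OF assms(2,3,1)] by force
qed

text \<open>Replacing \<open>\<psi>'\<close> by \<open>w\<close> costs the strip integral with
  factor \<open>2 * R / \<delta>\<close>. The gradient term is controlled through
  \<open>\<psi> \<le> R * w\<close> and \<open>young_absorb\<close> with
  \<open>c = (p + 1) * R\<close>, which returns half of \<open>f1\<close>; moving this half to the
  left doubles both constants. All integrals are finite by compact support, so the subtraction is
  legitimate.\<close>

lemma absorbed_inequality:
  fixes p \<epsilon> \<delta> :: real and \<psi> \<psi>' w :: "real \<Rightarrow> real"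
  assumes p: "0 < p" and \<epsilon>: "0 < \<epsilon>" and \<delta>: "0 < \<delta>" "\<delta> < R"
    and cut: "cutoff \<psi> \<psi>' \<epsilon> (R - \<delta>)" and wc: "continuous_on UNIV w"
    and w0: "\<And>r. r < \<epsilon> \<or> R - \<delta> < r \<Longrightarrow> w r = 0" and w: "\<And>r. 0 \<le> w r"
    and \<psi>w: "\<And>r. r \<le> R \<Longrightarrow> \<psi> r \<le> R * w r"
    and \<psi>'w: "\<And>r. r \<le> R \<Longrightarrow> w r - \<psi>' r \<le> (if R - 2 * \<delta> \<le> r \<and> r \<le> R - \<delta> \<and> \<epsilon> \<le> r then 2 * R / \<delta> else 0)"
  defines "c \<equiv> (p + 1) * R"
  defines "f1 \<equiv> \<lambda>x. if x \<in> \<Omega> then \<rho>0 x * (w (rN x) * hN x powr (-p-1)) else 0"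
    and "f2 \<equiv> \<lambda>x. if x \<in> \<Omega> then \<rho>0 x * (hN x powr (-p-1) * indicator (annulus_image (max \<epsilon> (R - 2 * \<delta>)) (R - \<delta>)) x) else 0"
    and "f3 \<equiv> \<lambda>x. if x \<in> \<Omega> then \<rho>0 x * (w (rN x) * (norm (grad\<rho> x) / \<rho>0 x) powr (p + 1)) else 0"
  shows "integrable lborel f1" "integrable lborel f2" "integrable lborel f3"
    "integral\<^sup>L lborel f1 \<le> 4 * R / \<delta> * integral\<^sup>L lborel f2 + 2 * (c * (2 * c) powr p) * integral\<^sup>L lborel f3"
proof -
  interpret cutoff \<psi> \<psi>' \<epsilon> "R - \<delta>" by fact
  have R': "R - \<delta> < R" using \<delta> by simp
  have c: "0 \<le> c" using p R_pos by (simp add: c_def)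
  note ann = annulus_image[OF \<epsilon> R']
  define K where "K = annulus_image \<epsilon> (R - \<delta>)"
  have K: "compact K" "K \<subseteq> \<Omega>" using ann by (auto simp: K_def)
  have outw: "w (rN x) = 0" if "x \<in> \<Omega> - K" for x
    using that ann(3)[of x] w0[of "rN x"] by (auto simp: K_def)
  have out: "\<psi> (rN x) = 0" "\<psi>' (rN x) = 0" if "x \<in> \<Omega> - K" for x
    using that ann(3)[of x] \<psi>_outside[of "rN x"] \<psi>'_outside[of "rN x"] by (auto simp: K_def)
  have \<rho>pos: "0 < \<rho>0 x" if "x \<in> \<Omega>" for x
    using positivity(2)[OF polar_N(2,3)[OF that]] \<Omega>_N(3)[OF that] by (simp add: Xy_def)
  have contw: "continuous_on \<Omega> (\<lambda>x. w (rN x))" "continuous_on \<Omega> (\<lambda>x. \<psi> (rN x))" "continuous_on \<Omega> (\<lambda>x. \<psi>' (rN x))"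
    by (rule continuous_on_compose2[OF wc continuous_on_\<Omega>(3)], simp)
       (rule continuous_on_compose2[OF \<psi>_cont continuous_on_\<Omega>(3)], simp,
        rule continuous_on_compose2[OF \<psi>'_cont continuous_on_\<Omega>(3)], simp)
  have contb: "continuous_on \<Omega> (\<lambda>x. (norm (grad\<rho> x) / \<rho>0 x) powr (p + 1))"
  proof (rule continuous_on_powr')
    show "continuous_on \<Omega> (\<lambda>x. norm (grad\<rho> x) / \<rho>0 x)"
      using \<rho>pos by (intro continuous_on_divide continuous_on_norm continuous_on_\<Omega>) force
    show "\<forall>x\<in>\<Omega>. 0 \<le> norm (grad\<rho> x) / \<rho>0 x \<and> (norm (grad\<rho> x) / \<rho>0 x = 0 \<longrightarrow> 0 < p + 1)"
      using \<rho>pos p by (auto simp: less_imp_le)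
  qed (rule continuous_on_const)
  show int1: "integrable lborel f1"
    unfolding f1_def
  proof (rule integrable_compact_support[OF _ K])
    show "continuous_on \<Omega> (\<lambda>x. \<rho>0 x * (w (rN x) * hN x powr (-p-1)))"
      by (intro continuous_on_mult contw continuous_on_\<Omega>)
  qed (use outw in simp)
  show int3: "integrable lborel f3"
    unfolding f3_def
  proof (rule integrable_compact_support[OF _ K])
    show "continuous_on \<Omega> (\<lambda>x. \<rho>0 x * (w (rN x) * (norm (grad\<rho> x) / \<rho>0 x) powr (p + 1)))"
      by (intro continuous_on_mult contw contb continuous_on_\<Omega>)
  qed (use outw in simp)
  define a where "a = max \<epsilon> (R - 2 * \<delta>)"
  have a: "0 < a" using \<epsilon> by (simp add: a_def)
  note ann2 = annulus_image[OF a R']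
  define S where "S = annulus_image a (R - \<delta>)"
  show int2: "integrable lborel f2"
  proof -
    have "integrable lborel (\<lambda>x. indicator S x *\<^sub>R (\<rho>0 x * hN x powr (-p-1)))"
    proof (rule borel_integrable_compact)
      show "compact S" using ann2(1) by (simp add: S_def)
      have "continuous_on \<Omega> (\<lambda>x. \<rho>0 x * hN x powr (-p-1))" by (intro continuous_on_mult continuous_on_\<Omega>)
      then show "continuous_on S (\<lambda>x. \<rho>0 x * hN x powr (-p-1))"
        using ann2(2) unfolding S_def by (rule continuous_on_subset)
    qed
    also have "(\<lambda>x. indicator S x *\<^sub>R (\<rho>0 x * hN x powr (-p-1))) = f2"
    proof
      fix x show "indicator S x *\<^sub>R (\<rho>0 x * hN x powr (-p-1)) = f2 x"
        using ann2(2) unfolding f2_def a_def[symmetric] S_def[symmetric] by (cases "x \<in> S"; cases "x \<in> \<Omega>") auto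
    qed
    finally show ?thesis .
  qed
  define g1 where "g1 x = (if x \<in> \<Omega> then \<rho>0 x * (\<psi>' (rN x) * hN x powr (-p-1)) else 0)" for x
  define g2 where "g2 x = (if x \<in> \<Omega> then \<psi> (rN x) * hN x powr (-p) * norm (grad\<rho> x) else 0)" for x
  have intg1: "integrable lborel g1"
    unfolding g1_def
  proof (rule integrable_compact_support[OF _ K])
    show "continuous_on \<Omega> (\<lambda>x. \<rho>0 x * (\<psi>' (rN x) * hN x powr (-p-1)))"
      by (intro continuous_on_mult contw continuous_on_\<Omega>)
  qed (use out in simp)
  have intg2: "integrable lborel g2"
    unfolding g2_def
  proof (rule integrable_compact_support[OF _ K])
    show "continuous_on \<Omega> (\<lambda>x. \<psi> (rN x) * hN x powr (-p) * norm (grad\<rho> x))"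
      by (intro continuous_on_mult continuous_on_norm contw continuous_on_\<Omega>)
  qed (use out in simp)
  have main: "integral\<^sup>L lborel g1 \<le> (p + 1) * integral\<^sup>L lborel g2"
    unfolding g1_def g2_def by (rule interior_inequality[OF cut R' p])
  have "integral\<^sup>L lborel f1 - 2 * R / \<delta> * integral\<^sup>L lborel f2 = (\<integral>x. f1 x - 2 * R / \<delta> * f2 x \<partial>lborel)"
    using int1 int2 by simp
  also have "\<dots> \<le> integral\<^sup>L lborel g1"
  proof (rule integral_mono)
    show "integrable lborel (\<lambda>x. f1 x - 2 * R / \<delta> * f2 x)" using int1 int2 by simp
    fix x
    show "f1 x - 2 * R / \<delta> * f2 x \<le> g1 x"
    proof (cases "x \<in> \<Omega>")
      case True
      have rR: "rN x \<le> R" using polar_N(1)[OF True] by simp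
      have ind: "(if R - 2 * \<delta> \<le> rN x \<and> rN x \<le> R - \<delta> \<and> \<epsilon> \<le> rN x then 2 * R / \<delta> else 0) = 2 * R / \<delta> * indicator S x"
        using mem_annulus_image[OF True a R'] by (auto simp: S_def a_def indicator_def)
      have pos: "0 \<le> \<rho>0 x * hN x powr (-p-1)" using \<rho>pos[OF True] by simp
      have "(\<rho>0 x * hN x powr (-p-1)) * (w (rN x) - \<psi>' (rN x)) \<le> (\<rho>0 x * hN x powr (-p-1)) * (2 * R / \<delta> * indicator S x)"
        using \<psi>'w[OF rR] pos unfolding ind by (rule mult_left_mono)
      then show ?thesis using True unfolding f1_def f2_def g1_def a_def[symmetric] S_def[symmetric]
        by (simp add: algebra_simps)
    qed (simp add: f1_def f2_def g1_def)
  qed (rule intg1)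
  also note main
  also have "(p + 1) * integral\<^sup>L lborel g2 = (\<integral>x. (p + 1) * g2 x \<partial>lborel)" by simp
  also have "\<dots> \<le> (\<integral>x. 1 / 2 * f1 x + (c * (2 * c) powr p) * f3 x \<partial>lborel)"
  proof (rule integral_mono)
    show "integrable lborel (\<lambda>x. (p + 1) * g2 x)" using intg2 by simp
    show "integrable lborel (\<lambda>x. 1 / 2 * f1 x + (c * (2 * c) powr p) * f3 x)" using int1 int3 by simp
    fix x
    show "(p + 1) * g2 x \<le> 1 / 2 * f1 x + (c * (2 * c) powr p) * f3 x"
    proof (cases "x \<in> \<Omega>")
      case True
      have rR: "rN x \<le> R" using polar_N(1)[OF True] by simp
      note h = polar_N(7)[OF True] and r = \<rho>pos[OF True]
      define b where "b = norm (grad\<rho> x) / \<rho>0 x"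
      have b: "0 \<le> b" "norm (grad\<rho> x) = \<rho>0 x * b" using r by (auto simp: b_def)
      have e: "(1 / hN x) powr p = hN x powr (-p)" "(1 / hN x) powr (p + 1) = hN x powr (-p-1)"
      proof -
        show "(1 / hN x) powr p = hN x powr (-p)" by (rule powr_one_divide[OF h])
        show "(1 / hN x) powr (p + 1) = hN x powr (-p-1)" using powr_one_divide[OF h, of "p + 1"] by simp
      qed
      have "(p + 1) * g2 x = \<psi> (rN x) * ((p + 1) * (hN x powr (-p) * (\<rho>0 x * b)))" using True b(2) by (simp add: g2_def mult_ac)
      also have "\<dots> \<le> (R * w (rN x)) * ((p + 1) * (hN x powr (-p) * (\<rho>0 x * b)))"
        using \<psi>w[OF rR] p r b(1) by (intro mult_right_mono) auto
      also have "\<dots> = (\<rho>0 x * w (rN x)) * (c * (1 / hN x) powr p * b)" unfolding e c_def by (simp add: mult_ac)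
      also have "\<dots> \<le> (\<rho>0 x * w (rN x)) * ((1 / hN x) powr (p + 1) / 2 + c * (2 * c) powr p * b powr (p + 1))"
        using h r w[of "rN x"] by (intro mult_left_mono young_absorb c b(1) p) auto
      also have "\<dots> = 1 / 2 * f1 x + (c * (2 * c) powr p) * f3 x"
        using True unfolding e f1_def f3_def b_def by (simp add: algebra_simps)
      finally show ?thesis .
    qed (simp add: f1_def f3_def g2_def)
  qed
  also have "\<dots> = 1 / 2 * integral\<^sup>L lborel f1 + (c * (2 * c) powr p) * integral\<^sup>L lborel f3"
    using int1 int3 by simp
  finally show "integral\<^sup>L lborel f1 \<le> 4 * R / \<delta> * integral\<^sup>L lborel f2 + 2 * (c * (2 * c) powr p) * integral\<^sup>L lborel f3"
    by simp
qed

text \<open>Both cutoff parameters are the same \<epsilon>. The factor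
  \<open>4 * R / \<epsilon>\<close> meets a strip of mass of order \<epsilon>, so the bound is
  independent of \<epsilon>, and monotone convergence removes the cutoff.\<close>

lemma main_bound:
  fixes p :: real
  assumes p: "0 < p"
  defines "c \<equiv> (p + 1) * R"
  shows "(\<integral>\<^sup>+x\<in>\<Omega>. ennreal (\<rho>0 x * hN x powr (-p-1)) \<partial>lborel)
    \<le> ennreal (4 * R * boundary_factor CARD('n)) * (\<integral>\<^sup>+x\<in>frontier A. ennreal (h R (\<nu> x) powr (-p) * \<rho>0 x) \<partial>hausdorff_measure (CARD('n) - 1))
      + ennreal (2 * (c * (2 * c) powr p)) * (\<integral>\<^sup>+x\<in>\<Omega>. ennreal (\<rho>0 x * (norm (grad\<rho> x) / \<rho>0 x) powr (p + 1)) \<partial>lborel)"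
    (is "_ \<le> ennreal ?a * ?J + ennreal ?c1 * ?G")
proof -
  have c: "0 \<le> c" using p R_pos by (simp add: c_def)
  have \<rho>pos: "0 < \<rho>0 x" if "x \<in> \<Omega>" for x
    using positivity(2)[OF polar_N(2,3)[OF that]] \<Omega>_N(3)[OF that] by (simp add: Xy_def)
  have \<Omega>m: "\<Omega> \<in> sets borel" using open_\<Omega> by auto
  obtain \<delta>1 where \<delta>1: "\<delta>1 > 0" "\<delta>1 \<le> R / 4" and strip: "\<And>\<delta>. 0 < \<delta> \<Longrightarrow> \<delta> \<le> \<delta>1 \<Longrightarrow>
     (\<integral>\<^sup>+x\<in>\<Omega>. ennreal (\<rho>0 x) * (ennreal (hN x powr (-p-1)) * indicator {R - 2 * \<delta>..} (rN x)) \<partial>lborel)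
      \<le> ennreal (boundary_factor CARD('n) * \<delta>) * ?J"
    using boundary_strip_le[of p] by blast
  have bound: "(\<integral>\<^sup>+x. ennreal (indicator \<Omega> x *\<^sub>R (\<rho>0 x * hN x powr (-p-1))) * indicator {x \<in> \<Omega>. 2 * \<epsilon> \<le> rN x \<and> rN x \<le> R - 2 * \<epsilon>} x \<partial>lborel)
      \<le> ennreal ?a * ?J + ennreal ?c1 * ?G" if \<epsilon>: "0 < \<epsilon>" "\<epsilon> \<le> \<delta>1" for \<epsilon>
  proof -
    obtain \<psi> \<psi>' w where cut: "cutoff \<psi> \<psi>' \<epsilon> (R - \<epsilon>)" "continuous_on UNIV w"
      "\<And>r. r < \<epsilon> \<or> R - \<epsilon> < r \<Longrightarrow> w r = 0" "\<And>r. 0 \<le> w r" 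
      "\<And>r. r \<le> R \<Longrightarrow> \<psi> r \<le> R * w r"
      "\<And>r. r \<le> R \<Longrightarrow> w r - \<psi>' r \<le> (if R - 2 * \<epsilon> \<le> r \<and> r \<le> R - \<epsilon> \<and> \<epsilon> \<le> r then 2 * R / \<epsilon> else 0)"
      and w1: "\<And>r. w r \<le> 1" "\<And>r. 2 * \<epsilon> \<le> r \<Longrightarrow> r \<le> R - 2 * \<epsilon> \<Longrightarrow> w r = 1"
      by (rule cutoff_exists[OF \<epsilon>(1) \<epsilon>(1) R_pos], rule that; assumption)
    define f1 where "f1 = (\<lambda>x. if x \<in> \<Omega> then \<rho>0 x * (w (rN x) * hN x powr (-p-1)) else 0)"
    define f2 where "f2 = (\<lambda>x. if x \<in> \<Omega> then \<rho>0 x * (hN x powr (-p-1) * indicator (annulus_image (max \<epsilon> (R - 2 * \<epsilon>)) (R - \<epsilon>)) x) else 0)"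
    define f3 where "f3 = (\<lambda>x. if x \<in> \<Omega> then \<rho>0 x * (w (rN x) * (norm (grad\<rho> x) / \<rho>0 x) powr (p + 1)) else 0)"
    have \<epsilon>R: "\<epsilon> < R" using \<epsilon> \<delta>1 R_pos by simp
    note abs = absorbed_inequality[OF p \<epsilon>(1) \<epsilon>(1) \<epsilon>R cut, folded f1_def f2_def f3_def c_def]
    have nn: "0 \<le> f1 x" "0 \<le> f2 x" "0 \<le> f3 x" for x
      using \<rho>pos[of x] cut(4)[of "rN x"] by (auto simp: f1_def f2_def f3_def less_imp_le)
    have "(\<integral>\<^sup>+x. ennreal (indicator \<Omega> x *\<^sub>R (\<rho>0 x * hN x powr (-p-1))) * indicator {x \<in> \<Omega>. 2 * \<epsilon> \<le> rN x \<and> rN x \<le> R - 2 * \<epsilon>} x \<partial>lborel)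
       \<le> (\<integral>\<^sup>+x. ennreal (f1 x) \<partial>lborel)"
      by (rule nn_integral_mono) (auto simp: f1_def indicator_def w1(2))
    also have "\<dots> = ennreal (integral\<^sup>L lborel f1)" using abs(1) nn(1) by (intro nn_integral_eq_integral) auto
    also have "\<dots> \<le> ennreal (4 * R / \<epsilon> * integral\<^sup>L lborel f2 + ?c1 * integral\<^sup>L lborel f3)" by (rule ennreal_leI[OF abs(4)])
    also have "\<dots> = ennreal (4 * R / \<epsilon>) * ennreal (integral\<^sup>L lborel f2) + ennreal ?c1 * ennreal (integral\<^sup>L lborel f3)"
    proof -
      have "0 \<le> 4 * R / \<epsilon>" "0 \<le> ?c1" "0 \<le> integral\<^sup>L lborel f2" "0 \<le> integral\<^sup>L lborel f3"
        using R_pos \<epsilon> c nn by (auto intro: integral_nonneg)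
      then show ?thesis by (intro ennreal_lincomb)
    qed
    also have "ennreal (integral\<^sup>L lborel f2) = (\<integral>\<^sup>+x. ennreal (f2 x) \<partial>lborel)"
      using abs(2) nn(2) by (intro nn_integral_eq_integral[symmetric]) auto
    also have "ennreal (integral\<^sup>L lborel f3) = (\<integral>\<^sup>+x. ennreal (f3 x) \<partial>lborel)"
      using abs(3) nn(3) by (intro nn_integral_eq_integral[symmetric]) auto
    also have "ennreal (4 * R / \<epsilon>) * (\<integral>\<^sup>+x. ennreal (f2 x) \<partial>lborel) + ennreal ?c1 * (\<integral>\<^sup>+x. ennreal (f3 x) \<partial>lborel)
       \<le> ennreal (4 * R / \<epsilon>) * (ennreal (boundary_factor CARD('n) * \<epsilon>) * ?J) + ennreal ?c1 * ?G"
    proof (intro add_mono mult_left_mono)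
      have "(\<integral>\<^sup>+x. ennreal (f2 x) \<partial>lborel) \<le> (\<integral>\<^sup>+x\<in>\<Omega>. ennreal (\<rho>0 x) * (ennreal (hN x powr (-p-1)) * indicator {R - 2 * \<epsilon>..} (rN x)) \<partial>lborel)"
      proof (rule nn_integral_mono)
        fix x
        show "ennreal (f2 x) \<le> ennreal (\<rho>0 x) * (ennreal (hN x powr (-p-1)) * indicator {R - 2 * \<epsilon>..} (rN x)) * indicator \<Omega> x"
        proof (cases "x \<in> \<Omega> \<and> x \<in> annulus_image (max \<epsilon> (R - 2 * \<epsilon>)) (R - \<epsilon>)")
          case True
          then have "max \<epsilon> (R - 2 * \<epsilon>) \<le> rN x" using mem_annulus_image[of x "max \<epsilon> (R - 2 * \<epsilon>)" "R - \<epsilon>"] \<epsilon> by auto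
          then show ?thesis using True \<rho>pos[of x] by (simp add: f2_def ennreal_mult'[symmetric] less_imp_le)
        next
          case False
          then show ?thesis by (auto simp: f2_def)
        qed
      qed
      also have "\<dots> \<le> ennreal (boundary_factor CARD('n) * \<epsilon>) * ?J" by (rule strip[OF \<epsilon>])
      finally show "(\<integral>\<^sup>+x. ennreal (f2 x) \<partial>lborel) \<le> ennreal (boundary_factor CARD('n) * \<epsilon>) * ?J" .
      show "(\<integral>\<^sup>+x. ennreal (f3 x) \<partial>lborel) \<le> ?G"
      proof (rule nn_integral_mono)
        fix x
        show "ennreal (f3 x) \<le> ennreal (\<rho>0 x * (norm (grad\<rho> x) / \<rho>0 x) powr (p + 1)) * indicator \<Omega> x"
        proof (cases "x \<in> \<Omega>")
          case True
          have "w (rN x) * (norm (grad\<rho> x) / \<rho>0 x) powr (p + 1) \<le> 1 * (norm (grad\<rho> x) / \<rho>0 x) powr (p + 1)"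
            using w1(1) by (intro mult_right_mono) auto
          then have "f3 x \<le> \<rho>0 x * (norm (grad\<rho> x) / \<rho>0 x) powr (p + 1)"
            using True \<rho>pos[OF True] by (simp add: f3_def)
          then show ?thesis using True by (simp add: ennreal_leI)
        qed (simp add: f3_def)
      qed
    qed auto
    also have "ennreal (4 * R / \<epsilon>) * (ennreal (boundary_factor CARD('n) * \<epsilon>) * ?J) = ennreal ?a * ?J"
    proof -
      have "ennreal (4 * R / \<epsilon> * (boundary_factor CARD('n) * \<epsilon>)) = ennreal (4 * R / \<epsilon>) * ennreal (boundary_factor CARD('n) * \<epsilon>)"
        by (rule ennreal_mult') (use R_pos \<epsilon> in simp)
      moreover have "4 * R / \<epsilon> * (boundary_factor CARD('n) * \<epsilon>) = ?a" using \<epsilon> by simp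
      ultimately show ?thesis by (simp only: mult.assoc)
    qed
    finally show ?thesis .
  qed
  define e where "e n = \<delta>1 / real (Suc n)" for n
  have e: "0 < e n" "e n \<le> \<delta>1" "e (Suc n) \<le> e n" for n using \<delta>1(1) by (auto simp: e_def field_simps)
  \<comment> \<open>Points of \<Omega> have radius strictly between 0 and \<open>R\<close>, so these
    sets exhaust \<Omega>.\<close>
  define U where "U n = {x \<in> \<Omega>. 2 * e n \<le> rN x \<and> rN x \<le> R - 2 * e n}" for n
  define F where "F x = ennreal (indicator \<Omega> x *\<^sub>R (\<rho>0 x * hN x powr (-p-1)))" for x
  have Fm: "F \<in> borel_measurable borel"
  proof -
    have "(\<lambda>x. indicator \<Omega> x *\<^sub>R (\<rho>0 x * hN x powr (-p-1))) \<in> borel_measurable borel"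
      by (intro borel_measurable_continuous_on_indicator[OF \<Omega>m] continuous_on_mult continuous_on_\<Omega>)
    then show ?thesis unfolding F_def by measurable
  qed
  have Um: "U n \<in> sets borel" for n
  proof -
    have "U n = annulus_image (2 * e n) (R - 2 * e n)"
    proof
      show "annulus_image (2 * e n) (R - 2 * e n) \<subseteq> U n"
        using annulus_image(2)[of "2 * e n" "R - 2 * e n"] mem_annulus_image[of _ "2 * e n" "R - 2 * e n"] e[of n] by (auto simp: U_def)
      show "U n \<subseteq> annulus_image (2 * e n) (R - 2 * e n)"
        using mem_annulus_image[of _ "2 * e n" "R - 2 * e n"] e[of n] by (auto simp: U_def)
    qed
    then show ?thesis using annulus_image(1)[of "2 * e n" "R - 2 * e n"] e[of n] by (auto intro: borel_closed compact_imp_closed)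
  qed
  have inc: "incseq (\<lambda>n x. F x * indicator (U n) x)"
  proof (rule incseq_SucI, rule le_funI)
    fix n x
    have "U n \<subseteq> U (Suc n)" using e(3)[of n] by (auto simp: U_def)
    then show "F x * indicator (U n) x \<le> F x * indicator (U (Suc n)) x" by (auto simp: indicator_def)
  qed
  have "(\<integral>\<^sup>+x\<in>\<Omega>. ennreal (\<rho>0 x * hN x powr (-p-1)) \<partial>lborel) \<le> (\<integral>\<^sup>+x. (SUP n. F x * indicator (U n) x) \<partial>lborel)"
  proof (rule nn_integral_mono)
    fix x
    show "ennreal (\<rho>0 x * hN x powr (-p-1)) * indicator \<Omega> x \<le> (SUP n. F x * indicator (U n) x)"
    proof (cases "x \<in> \<Omega>")
      case True
      have r: "0 < rN x" "rN x < R" using polar_N(1)[OF True] by auto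
      have "(\<lambda>n. \<delta>1 / real (Suc n)) \<longlonglongrightarrow> 0" by (rule LIMSEQ_Suc[OF lim_const_over_n])
      then have "eventually (\<lambda>n. e n < min (rN x / 2) ((R - rN x) / 2)) sequentially"
        unfolding e_def by (rule order_tendstoD) (use r in auto)
      then obtain n where "e n < min (rN x / 2) ((R - rN x) / 2)" by (auto simp: eventually_sequentially)
      then have "x \<in> U n" using True by (auto simp: U_def)
      then have "ennreal (\<rho>0 x * hN x powr (-p-1)) * indicator \<Omega> x = F x * indicator (U n) x" using True by (simp add: F_def)
      also have "\<dots> \<le> (SUP n. F x * indicator (U n) x)" by (rule SUP_upper) simp
      finally show ?thesis .
    qed simp
  qed
  also have "\<dots> = (SUP n. \<integral>\<^sup>+x. F x * indicator (U n) x \<partial>lborel)"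
    by (rule nn_integral_monotone_convergence_SUP[OF inc]) (use Fm Um in measurable)
  also have "\<dots> \<le> ennreal ?a * ?J + ennreal ?c1 * ?G"
    unfolding F_def U_def by (rule SUP_least) (rule bound[OF e(1,2)])
  finally show ?thesis .
qed

lemma AE_density_in_\<Omega>: "AE x in density_measure A \<rho>0. x \<in> \<Omega>"
proof -
  have m: "A \<inter> space lborel \<in> sets lborel" using A_borel by simp
  have "borel_measurable (restrict_space lborel A) = (borel_measurable (restrict_space borel A) :: (real^'n \<Rightarrow> real) set)"
    by (intro measurable_cong_sets) (auto simp: sets_restrict_space)
  then have "\<rho>0 \<in> borel_measurable (restrict_space lborel A)"
    using density0 by (simp add: probability_density_on_def)
  then have "(\<lambda>x. ennreal (\<rho>0 x)) \<in> borel_measurable (restrict_space lborel A)" by (rule measurable_compose[OF _ measurable_ennreal])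
  then show ?thesis
    unfolding density_measure_def
    by (subst AE_density) (use AE_in_\<Omega> in \<open>simp_all add: AE_restrict_space_iff[OF m]\<close>)
qed

text \<open>The gradients are controlled on \<Omega> only. Its complement is null for the source
  measure, so the values of \<open>f\<close> there may be arbitrary.\<close>

lemma nn_integral_density_\<Omega>:
  assumes f: "\<And>x. x \<in> \<Omega> \<Longrightarrow> f x = ennreal (g x)" "\<And>x. x \<in> \<Omega> \<Longrightarrow> 0 \<le> g x" and g: "continuous_on \<Omega> g"
  shows "(\<integral>\<^sup>+x. f x \<partial>density_measure A \<rho>0) = (\<integral>\<^sup>+x\<in>\<Omega>. ennreal (\<rho>0 x * g x) \<partial>lborel)"
proof -
  have \<Omega>m: "\<Omega> \<in> sets borel" using open_\<Omega> by auto
  have \<rho>: "\<rho>0 \<in> borel_measurable (restrict_space borel A)" "\<And>x. x \<in> A \<Longrightarrow> 0 \<le> \<rho>0 x"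
    using density0 by (auto simp: probability_density_on_def)
  have gm: "(\<lambda>x. indicator \<Omega> x *\<^sub>R g x) \<in> borel_measurable borel"
    by (rule borel_measurable_continuous_on_indicator[OF \<Omega>m g])
  have "(\<integral>\<^sup>+x. f x \<partial>density_measure A \<rho>0) = (\<integral>\<^sup>+x. ennreal (indicator \<Omega> x *\<^sub>R g x) \<partial>density_measure A \<rho>0)"
    by (rule nn_integral_cong_AE) (use AE_density_in_\<Omega> in \<open>eventually_elim; simp add: f\<close>)
  also have "\<dots> = (\<integral>\<^sup>+x\<in>A. ennreal (\<rho>0 x) * ennreal (indicator \<Omega> x *\<^sub>R g x) \<partial>lborel)"
    by (rule nn_integral_density_measure[OF A_borel \<rho>(1)])
       (intro measurable_restrict_space1 measurable_compose[OF gm measurable_ennreal])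
  also have "\<dots> = (\<integral>\<^sup>+x\<in>\<Omega>. ennreal (\<rho>0 x * g x) \<partial>lborel)"
  proof (rule nn_integral_cong)
    fix x
    show "ennreal (\<rho>0 x) * ennreal (indicator \<Omega> x *\<^sub>R g x) * indicator A x = ennreal (\<rho>0 x * g x) * indicator \<Omega> x"
    proof (cases "x \<in> \<Omega>")
      case True
      then have "x \<in> A" using \<Omega>_sub_A by blast
      then show ?thesis using True \<rho>(2) by (simp add: ennreal_mult')
    qed simp
  qed
  finally show ?thesis .
qed

text \<open>\<open>k0\<close> is built from \<open>p\<close>, \<open>R\<close> and the dimension
  alone. The ratio of the two boundary integrals is exact, but still contains the constant
  \<open>C\<close> of the given transport.\<close>

lemma boundary_estimates:
  fixes p :: real
  assumes p: "0 < p"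
  defines "c \<equiv> (p + 1) * R"
  defines "k0 \<equiv> max (4 * R * boundary_factor CARD('n)) (2 * (c * (2 * c) powr p))"
  shows "(\<integral>\<^sup>+x. ennreal (norm (grad_on \<phi> A x) powr (p + 1)) \<partial>density_measure A \<rho>0)
      \<le> ennreal k0 * ((\<integral>\<^sup>+x. ennreal (norm (grad_on \<rho>0 A x /\<^sub>R \<rho>0 x) powr (p + 1)) \<partial>density_measure A \<rho>0)
          + (\<integral>\<^sup>+x\<in>frontier A. ennreal (norm (grad_on \<phi> A x) powr p * \<rho>0 x) \<partial>hausdorff_measure (CARD('n) - 1)))"
    and "(\<integral>\<^sup>+x\<in>frontier A. ennreal (gauss_curvature A x powr (- p) * \<rho>0 x powr (p + 1)) \<partial>hausdorff_measure (CARD('n) - 1))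
      = ennreal (C powr p) * (\<integral>\<^sup>+x\<in>frontier A. ennreal (norm (grad_on \<phi> A x) powr p * \<rho>0 x) \<partial>hausdorff_measure (CARD('n) - 1))"
proof -
  define J where "J = (\<integral>\<^sup>+x\<in>frontier A. ennreal (h R (\<nu> x) powr (-p) * \<rho>0 x) \<partial>hausdorff_measure (CARD('n) - 1))"
  have J1: "(\<integral>\<^sup>+x\<in>frontier A. ennreal (norm (grad_on \<phi> A x) powr p * \<rho>0 x) \<partial>hausdorff_measure (CARD('n) - 1)) = J"
    unfolding J_def by (rule nn_integral_cong) (simp add: indicator_def frontier_integrands(1))
  have \<rho>pos: "0 < \<rho>0 x" if "x \<in> \<Omega>" for x
    using positivity(2)[OF polar_N(2,3)[OF that]] \<Omega>_N(3)[OF that] by (simp add: Xy_def)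
  have "(\<integral>\<^sup>+x. ennreal (norm (grad_on \<phi> A x) powr (p + 1)) \<partial>density_measure A \<rho>0) = (\<integral>\<^sup>+x\<in>\<Omega>. ennreal (\<rho>0 x * hN x powr (-p-1)) \<partial>lborel)"
  proof (rule nn_integral_density_\<Omega>)
    fix x assume x: "x \<in> \<Omega>"
    have "hN x = 1 / norm (grad_on \<phi> A x)"
      using H_r_eq[OF polar_N(2,3)[OF x]] \<Omega>_N(3)[OF x] by (simp add: Xy_def)
    then have "norm (grad_on \<phi> A x) = 1 / hN x" by simp
    then show "ennreal (norm (grad_on \<phi> A x) powr (p + 1)) = ennreal (hN x powr (-p-1))"
      using powr_one_divide[OF polar_N(7)[OF x], of "p + 1"] by simp
  qed (use continuous_on_\<Omega> in auto)
  also have "\<dots> \<le> ennreal (4 * R * boundary_factor CARD('n)) * J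
      + ennreal (2 * (c * (2 * c) powr p)) * (\<integral>\<^sup>+x\<in>\<Omega>. ennreal (\<rho>0 x * (norm (grad\<rho> x) / \<rho>0 x) powr (p + 1)) \<partial>lborel)"
    unfolding J_def c_def by (rule main_bound[OF p])
  also have "(\<integral>\<^sup>+x\<in>\<Omega>. ennreal (\<rho>0 x * (norm (grad\<rho> x) / \<rho>0 x) powr (p + 1)) \<partial>lborel)
     = (\<integral>\<^sup>+x. ennreal (norm (grad_on \<rho>0 A x /\<^sub>R \<rho>0 x) powr (p + 1)) \<partial>density_measure A \<rho>0)"
  proof (rule nn_integral_density_\<Omega>[symmetric])
    fix x assume x: "x \<in> \<Omega>"
    have "norm (grad_on \<rho>0 A x /\<^sub>R \<rho>0 x) = norm (grad\<rho> x) / \<rho>0 x"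
      using \<rho>pos[OF x] by (simp add: divide_inverse mult.commute)
    then show "ennreal (norm (grad_on \<rho>0 A x /\<^sub>R \<rho>0 x) powr (p + 1)) = ennreal ((norm (grad\<rho> x) / \<rho>0 x) powr (p + 1))" by simp
  next
    show "continuous_on \<Omega> (\<lambda>x. (norm (grad\<rho> x) / \<rho>0 x) powr (p + 1))"
    proof (rule continuous_on_powr')
      show "continuous_on \<Omega> (\<lambda>x. norm (grad\<rho> x) / \<rho>0 x)"
        using \<rho>pos by (intro continuous_on_divide continuous_on_norm continuous_on_\<Omega>) force
      show "\<forall>x\<in>\<Omega>. 0 \<le> norm (grad\<rho> x) / \<rho>0 x \<and> (norm (grad\<rho> x) / \<rho>0 x = 0 \<longrightarrow> 0 < p + 1)"
        using \<rho>pos p by (auto simp: less_imp_le)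
    qed (rule continuous_on_const)
  qed auto
  finally have main: "(\<integral>\<^sup>+x. ennreal (norm (grad_on \<phi> A x) powr (p + 1)) \<partial>density_measure A \<rho>0)
    \<le> ennreal (4 * R * boundary_factor CARD('n)) * J + ennreal (2 * (c * (2 * c) powr p)) * (\<integral>\<^sup>+x. ennreal (norm (grad_on \<rho>0 A x /\<^sub>R \<rho>0 x) powr (p + 1)) \<partial>density_measure A \<rho>0)" .
  also have "\<dots> \<le> ennreal k0 * J + ennreal k0 * (\<integral>\<^sup>+x. ennreal (norm (grad_on \<rho>0 A x /\<^sub>R \<rho>0 x) powr (p + 1)) \<partial>density_measure A \<rho>0)"
    unfolding k0_def by (intro add_mono mult_right_mono ennreal_leI) auto
  finally show "(\<integral>\<^sup>+x. ennreal (norm (grad_on \<phi> A x) powr (p + 1)) \<partial>density_measure A \<rho>0)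
      \<le> ennreal k0 * ((\<integral>\<^sup>+x. ennreal (norm (grad_on \<rho>0 A x /\<^sub>R \<rho>0 x) powr (p + 1)) \<partial>density_measure A \<rho>0)
          + (\<integral>\<^sup>+x\<in>frontier A. ennreal (norm (grad_on \<phi> A x) powr p * \<rho>0 x) \<partial>hausdorff_measure (CARD('n) - 1)))"
    unfolding J1 by (simp add: distrib_left add.commute)
  have Fm: "frontier A \<in> sets borel" using compact_frontier[OF compact_A] by (intro borel_closed compact_imp_closed)
  have "(\<integral>\<^sup>+x\<in>frontier A. ennreal (gauss_curvature A x powr (- p) * \<rho>0 x powr (p + 1)) \<partial>hausdorff_measure (CARD('n) - 1))
    = (\<integral>\<^sup>+x. ennreal (C powr p) * (ennreal (h R (\<nu> x) powr (-p) * \<rho>0 x) * indicator (frontier A) x) \<partial>hausdorff_measure (CARD('n) - 1))"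
  proof (rule nn_integral_cong)
    fix x
    show "ennreal (gauss_curvature A x powr (- p) * \<rho>0 x powr (p + 1)) * indicator (frontier A) x
      = ennreal (C powr p) * (ennreal (h R (\<nu> x) powr (-p) * \<rho>0 x) * indicator (frontier A) x)"
    proof (cases "x \<in> frontier A")
      case True
      have "ennreal (C powr p * (h R (\<nu> x) powr (-p) * \<rho>0 x)) = ennreal (C powr p) * ennreal (h R (\<nu> x) powr (-p) * \<rho>0 x)"
        by (rule ennreal_mult') simp
      then show ?thesis unfolding frontier_integrands(2)[OF True] by (simp only: mult.assoc)
    qed simp
  qed
  also have "\<dots> = ennreal (C powr p) * J"
    unfolding J_def
  proof (rule nn_integral_cmult)
    have hpos: "0 < h R (\<nu> x)" if "x \<in> frontier A" for x using positivity(1)[OF R_in \<nu>_frontier(1)[OF that]] .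
    have "(\<lambda>x. indicator (frontier A) x *\<^sub>R (h R (\<nu> x) powr (-p) * \<rho>0 x)) \<in> borel_measurable borel"
      by (rule borel_measurable_continuous_on_indicator[OF Fm])
       (use hpos continuous_on_subset[OF \<rho>0_continuous frontier_sub] in
        \<open>intro continuous_on_mult continuous_on_powr continuous_on_const continuous_h_frontier; force\<close>)
    then have "(\<lambda>x. ennreal (indicator (frontier A) x *\<^sub>R (h R (\<nu> x) powr (-p) * \<rho>0 x))) \<in> borel_measurable borel" by measurable
    moreover have "ennreal (indicator (frontier A) x *\<^sub>R (h R (\<nu> x) powr (-p) * \<rho>0 x)) = ennreal (h R (\<nu> x) powr (-p) * \<rho>0 x) * indicator (frontier A) x" for x
      by (simp add: indicator_def)
    ultimately show "(\<lambda>x. ennreal (h R (\<nu> x) powr (-p) * \<rho>0 x) * indicator (frontier A) x) \<in> borel_measurable (hausdorff_measure (CARD('n) - 1))"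
      by (simp add: measurable_cong_sets[OF sets_hausdorff refl])
  qed
  finally show "(\<integral>\<^sup>+x\<in>frontier A. ennreal (gauss_curvature A x powr (- p) * \<rho>0 x powr (p + 1)) \<partial>hausdorff_measure (CARD('n) - 1))
      = ennreal (C powr p) * (\<integral>\<^sup>+x\<in>frontier A. ennreal (norm (grad_on \<phi> A x) powr p * \<rho>0 x) \<partial>hausdorff_measure (CARD('n) - 1))"
    unfolding J1 .
qed

text \<open>The target measure has mass one, which makes \<open>C\<close> the reciprocal of a ball
  integral that is the same for all transports with this radius and dimension.\<close>

lemma total_mass:
  "ennreal C * (\<integral>\<^sup>+y\<in>cball (0::real^'n) R. ennreal (1 / norm y ^ (CARD('n) - 1)) \<partial>lborel) = 1"
proof -
  have ps: "prob_space (density_measure (cball 0 R) \<rho>1)" and m: "\<rho>1 \<in> borel_measurable (restrict_space borel (cball 0 R))"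
    using density1 by (auto simp: probability_density_on_def)
  have "1 = emeasure (density_measure (cball 0 R) \<rho>1) (space (density_measure (cball 0 R) \<rho>1))"
    using ps by (simp add: prob_space.emeasure_space_1)
  also have "\<dots> = (\<integral>\<^sup>+x. 1 \<partial>density_measure (cball 0 R) \<rho>1)" by simp
  also have "\<dots> = (\<integral>\<^sup>+x\<in>cball 0 R. ennreal (\<rho>1 x) * 1 \<partial>lborel)"
    by (rule nn_integral_density_measure) (use m in auto)
  also have "\<dots> = (\<integral>\<^sup>+y. ennreal C * (ennreal (1 / norm y ^ (CARD('n) - 1)) * indicator (cball (0::real^'n) R) y) \<partial>lborel)"
  proof (rule nn_integral_cong_AE)
    have "AE x in lborel. x \<noteq> (0::real^'n)" by (rule AE_lborel_singleton)
    then show "AE x in lborel. ennreal (\<rho>1 x) * 1 * indicator (cball 0 R) x = ennreal C * (ennreal (1 / norm x ^ (CARD('n) - 1)) * indicator (cball 0 R) x)"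
    proof eventually_elim
      fix x :: "real^'n" assume "x \<noteq> 0"
      then show "ennreal (\<rho>1 x) * 1 * indicator (cball 0 R) x = ennreal C * (ennreal (1 / norm x ^ (CARD('n) - 1)) * indicator (cball 0 R) x)"
        using target_density[of x] C_pos by (auto simp: indicator_def ennreal_mult'[symmetric])
    qed
  qed
  also have "\<dots> = ennreal C * (\<integral>\<^sup>+y\<in>cball (0::real^'n) R. ennreal (1 / norm y ^ (CARD('n) - 1)) \<partial>lborel)"
  proof (intro nn_integral_cmult borel_measurable_times_ennreal borel_measurable_indicator)
    have "(\<lambda>y::real^'n. ennreal (1 / norm y ^ (CARD('n) - 1))) \<in> borel_measurable borel" by measurable
    then show "(\<lambda>y::real^'n. ennreal (1 / norm y ^ (CARD('n) - 1))) \<in> borel_measurable lborel" by simp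
  qed simp
  finally show ?thesis by simp
qed

end

theorem theorem4p5:
  fixes p R :: real
  assumes "p > 0" and "R > 0"
  shows "\<exists>c>0. \<forall>(A :: (real^'n) set) \<rho>0 \<rho>1 T \<phi> (C :: real).
    regular_gauss_mass_transport A R \<rho>0 \<rho>1 T \<phi> \<longrightarrow>
    (\<forall>x\<in>cball 0 R - {0}. \<rho>1 x = C / norm x ^ (CARD('n) - 1)) \<longrightarrow>
      ennreal c * (\<integral>\<^sup>+x. ennreal (norm (grad_on \<phi> A x) powr (p + 1)) \<partial>density_measure A \<rho>0)
        \<le> (\<integral>\<^sup>+x. ennreal (norm (grad_on \<rho>0 A x /\<^sub>R \<rho>0 x) powr (p + 1)) \<partial>density_measure A \<rho>0)
          + (\<integral>\<^sup>+x\<in>frontier A. ennreal (norm (grad_on \<phi> A x) powr p * \<rho>0 x)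
              \<partial>hausdorff_measure (CARD('n) - 1))
    \<and> ennreal c * (\<integral>\<^sup>+x. ennreal (norm (grad_on \<phi> A x) powr (p + 1)) \<partial>density_measure A \<rho>0)
        \<le> (\<integral>\<^sup>+x. ennreal (norm (grad_on \<rho>0 A x /\<^sub>R \<rho>0 x) powr (p + 1)) \<partial>density_measure A \<rho>0)
          + (\<integral>\<^sup>+x\<in>frontier A. ennreal (gauss_curvature A x powr (- p) * \<rho>0 x powr (p + 1))
              \<partial>hausdorff_measure (CARD('n) - 1))"
proof (cases "\<exists>(A :: (real^'n) set) \<rho>0 \<rho>1 T \<phi> C. radial_target_transport A R \<rho>0 \<rho>1 T \<phi> C")
  \<comment> \<open>No transport with this radius exists, so the claim is vacuous and any positive
    constant serves.\<close>
  case False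
  have no: False if "regular_gauss_mass_transport A R \<rho>0 \<rho>1 T \<phi>" "\<forall>x\<in>cball 0 R - {0}. \<rho>1 x = C / norm x ^ (CARD('n) - 1)"
    for A :: "(real^'n) set" and \<rho>0 \<rho>1 T \<phi> C
  proof -
    have "radial_target_transport A R \<rho>0 \<rho>1 T \<phi> C"
      using that unfolding radial_target_transport_def radial_target_transport_axioms_def by blast
    then show False using False by blast
  qed
  show ?thesis
    by (rule exI[of _ 1], intro conjI allI impI) (rule zero_less_one, (rule FalseE, erule (1) no)+)
next
  \<comment> \<open>One transport is fixed before the constant is chosen. It shows that the ball
    integral \<open>I\<close> is finite and supplies \<open>C0\<close>; by \<open>total_mass\<close>
    every other transport has the same constant, so no evaluation of \<open>I\<close> is
    required.\<close>
  case True
  then obtain A' :: "(real^'n) set" and \<rho>0' \<rho>1' T' \<phi>' C0 where tr: "radial_target_transport A' R \<rho>0' \<rho>1' T' \<phi>' C0" by blast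
  define I where "I = (\<integral>\<^sup>+y\<in>cball (0::real^'n) R. ennreal (1 / norm y ^ (CARD('n) - 1)) \<partial>lborel)"
  have C0: "0 < C0" "ennreal C0 * I = 1"
    using radial_target_transport.C_pos[OF tr] radial_target_transport.total_mass[OF tr] by (auto simp: I_def)
  have "I \<noteq> top"
  proof
    assume "I = top"
    then show False using C0 by (simp add: ennreal_mult_top)
  qed
  then obtain i where i: "I = ennreal i" "0 \<le> i" by (cases I) auto
  define k0 where "k0 = max (4 * R * boundary_factor CARD('n)) (2 * (((p + 1) * R) * (2 * ((p + 1) * R)) powr p))"
  \<comment> \<open>\<open>C0 powr (-p)\<close> turns the curvature integral back into the gradient
    integral over the frontier; the maximum with 1 lets the same constant multiply the density
    term.\<close>
  define m where "m = max 1 (C0 powr (-p))"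
  have k0: "0 < k0" and m: "1 \<le> m" "C0 powr (-p) \<le> m"
    using \<open>0 < R\<close> boundary_factor_pos[of "CARD('n)"] by (auto simp: k0_def m_def less_max_iff_disj)
  have scale: "ennreal (1 / (k0 * m)) * L \<le> Z" if "L \<le> ennreal (k0 * m) * Z" for L Z
  proof -
    have "ennreal (1 / (k0 * m)) * L \<le> ennreal (1 / (k0 * m)) * (ennreal (k0 * m) * Z)"
      using that by (rule mult_left_mono) simp
    also have "\<dots> = ennreal (1 / (k0 * m) * (k0 * m)) * Z"
      using k0 m by (subst ennreal_mult) (auto simp: mult.assoc)
    also have "\<dots> = Z" using k0 m by simp
    finally show ?thesis .
  qed
  show ?thesis
  proof (intro exI[of _ "1 / (k0 * m)"] conjI allI impI)
    show "0 < 1 / (k0 * m)" using k0 m by simp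
    fix A :: "(real^'n) set" and \<rho>0 \<rho>1 T \<phi> C
    assume reg: "regular_gauss_mass_transport A R \<rho>0 \<rho>1 T \<phi>"
      and target: "\<forall>x\<in>cball 0 R - {0}. \<rho>1 x = C / norm x ^ (CARD('n) - 1)"
    interpret radial_target_transport A R \<rho>0 \<rho>1 T \<phi> C
      using reg target unfolding radial_target_transport_def radial_target_transport_axioms_def by blast
    have "C * i = 1"
    proof -
      have "ennreal (C * i) = 1" using total_mass C_pos i unfolding I_def[symmetric] by (simp add: ennreal_mult)
      then show ?thesis by simp
    qed
    moreover have "C0 * i = 1"
    proof -
      have "ennreal (C0 * i) = 1" using C0 i by (simp add: ennreal_mult)
      then show ?thesis by simp
    qed
    ultimately have CC: "C = C0" by (metis mult_cancel_right zero_neq_one mult_zero_right)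
    define LHS where "LHS = (\<integral>\<^sup>+x. ennreal (norm (grad_on \<phi> A x) powr (p + 1)) \<partial>density_measure A \<rho>0)"
    define G where "G = (\<integral>\<^sup>+x. ennreal (norm (grad_on \<rho>0 A x /\<^sub>R \<rho>0 x) powr (p + 1)) \<partial>density_measure A \<rho>0)"
    define J where "J = (\<integral>\<^sup>+x\<in>frontier A. ennreal (norm (grad_on \<phi> A x) powr p * \<rho>0 x) \<partial>hausdorff_measure (CARD('n) - 1))"
    define J2 where "J2 = (\<integral>\<^sup>+x\<in>frontier A. ennreal (gauss_curvature A x powr (- p) * \<rho>0 x powr (p + 1)) \<partial>hausdorff_measure (CARD('n) - 1))"
    have est: "LHS \<le> ennreal k0 * (G + J)" "J2 = ennreal (C powr p) * J"
      unfolding LHS_def G_def J_def J2_def k0_def by (rule boundary_estimates[OF \<open>p > 0\<close>])+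
    have km: "ennreal k0 * (ennreal m * Z) = ennreal (k0 * m) * Z" for Z
      using k0 m by (simp add: ennreal_mult mult.assoc)
    have "G + J \<le> ennreal m * (G + J)"
      using mult_right_mono[of 1 "ennreal m" "G + J"] m(1) by simp
    then have "LHS \<le> ennreal (k0 * m) * (G + J)"
      unfolding km[symmetric] using est(1) by (meson mult_left_mono order_trans zero_le)
    from scale[OF this]
    show "ennreal (1 / (k0 * m)) * (\<integral>\<^sup>+x. ennreal (norm (grad_on \<phi> A x) powr (p + 1)) \<partial>density_measure A \<rho>0)
        \<le> (\<integral>\<^sup>+x. ennreal (norm (grad_on \<rho>0 A x /\<^sub>R \<rho>0 x) powr (p + 1)) \<partial>density_measure A \<rho>0)
          + (\<integral>\<^sup>+x\<in>frontier A. ennreal (norm (grad_on \<phi> A x) powr p * \<rho>0 x)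
              \<partial>hausdorff_measure (CARD('n) - 1))"
      unfolding LHS_def G_def J_def .
    have "J = ennreal (C powr (-p)) * J2"
    proof -
      have "ennreal (C powr (-p)) * J2 = ennreal (C powr (-p) * C powr p) * J"
        unfolding est(2) by (subst ennreal_mult) (auto simp: mult.assoc)
      also have "C powr (-p) * C powr p = 1" using C_pos by (simp add: powr_add[symmetric])
      finally show ?thesis by simp
    qed
    also have "\<dots> \<le> ennreal m * J2" using m(2) CC by (intro mult_right_mono ennreal_leI) auto
    finally have "J \<le> ennreal m * J2" .
    moreover have "G \<le> ennreal m * G"
      using mult_right_mono[of 1 "ennreal m" G] m(1) by simp
    ultimately have "G + J \<le> ennreal m * (G + J2)" by (simp add: distrib_left add_mono)
    then have "LHS \<le> ennreal (k0 * m) * (G + J2)"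
      unfolding km[symmetric] using est(1) by (meson mult_left_mono order_trans zero_le)
    from scale[OF this]
    show "ennreal (1 / (k0 * m)) * (\<integral>\<^sup>+x. ennreal (norm (grad_on \<phi> A x) powr (p + 1)) \<partial>density_measure A \<rho>0)
        \<le> (\<integral>\<^sup>+x. ennreal (norm (grad_on \<rho>0 A x /\<^sub>R \<rho>0 x) powr (p + 1)) \<partial>density_measure A \<rho>0)
          + (\<integral>\<^sup>+x\<in>frontier A. ennreal (gauss_curvature A x powr (- p) * \<rho>0 x powr (p + 1))
              \<partial>hausdorff_measure (CARD('n) - 1))"
      unfolding LHS_def G_def J2_def .
  qed
qed

end
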